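(* Let $\mathcal{M}$ be a separable factor with identity $I$ and let $\mathcal{A}$ be a maximal abelian self-adjoint subalgebra of $\mathcal{M}$. Suppose that one of the following conditions holds: (1) $\mathcal{M}$ is of type $\mathrm{I}_n$ (with $n$ finite) or of type $\mathrm{III}$; (2) $\mathcal{M}$ is of type $\mathrm{II}_1$ and $\mathcal{G}(\mathcal{M})=0$; (3) $\mathcal{M}$ is of type $\mathrm{I}_\infty$ or type $\mathrm{II}_\infty$, and $I=\bigvee\{Q\in\mathcal{A}: Q \text{ is a finite projection in } \mathcal{M}\}$. Then for every nonzero projection $P$ in $\mathcal{A}$ with $P\precsim I-P$ in $\mathcal{M}$, there exists a unitary operator $U$ in $\mathcal{M}$ such that $\mathcal{M}=W^*(U^*PU,\mathcal{A}(I-P))$.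
   Context: A separable factor is a von Neumann algebra with trivial center and separable predual. For a subset $\mathcal{S}\subseteq\mathcal{M}$, $W^*(\mathcal{S})$ is the smallest von Neumann subalgebra of $\mathcal{M}$ (containing the identity $I$ of $\mathcal{M}$) that contains $\mathcal{S}$; $W^*(U^*PU,\mathcal{A}(I-P))$ means $W^*(\{U^*PU\}\cup\{A(I-P):A\in\mathcal{A}\})$. For projections $P,Q\in\mathcal{M}$: $P\sim Q$ means $V^*V=P$, $VV^*=Q$ for some partial isometry $V\in\mathcal{M}$ (Murray–von Neumann equivalence); $P\precsim Q$ means $P\sim Q_0\leqslant Q$ for some projection $Q_0\in\mathcal{M}$. Shen's invariant $\mathcal{G}$: let $\mathcal{M}$ be a separable type $\mathrm{II}_1$ factor with its tracial state $\tau$. For a finite family $\mathcal{P}=\{p_1,\dots,p_k\}$ of mutually orthogonal projections in $\mathcal{M}$ with $\sum_i p_i=I$ and $\tau(p_i)=1/k$ for all $i$, and a finite subset $X\subset\mathcal{M}$, put $\mathcal{I}(X;\mathcal{P})=\sum_{x\in X}\frac{1}{k^2}\,|\{(i,j): p_ixp_j\neq 0\}|$. Then $\mathcal{G}(\mathcal{M})$ is the infimum of $\mathcal{I}(X;\mathcal{P})$ over all such $\mathcal{P}$ (all $k\geqslant 1$) and all finite $X$ with $W^*(X)=\mathcal{M}$ ($\mathcal{G}(\mathcal{M})=\infty$ if $\mathcal{M}$ is not finitely generated). *)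

theory Defs
  imports "HOL-Analysis.Analysis"
begin

section \<open>Complex Hilbert spaces and their bounded operators\<close>

text \<open>The inner product is linear in its first argument.  Positive definiteness is contained
  in \<open>cinner_self\<close>, since the norm is positive definite.\<close>

class complex_hilbert = banach +
  fixes scaleC :: "complex \<Rightarrow> 'a \<Rightarrow> 'a"  (infixr \<open>*\<^sub>C\<close> 75)
    and cinner :: "'a \<Rightarrow> 'a \<Rightarrow> complex"
  assumes scaleC_add_right: "c *\<^sub>C (x + y) = c *\<^sub>C x + c *\<^sub>C y"
    and scaleC_add_left: "(c + d) *\<^sub>C x = c *\<^sub>C x + d *\<^sub>C x"
    and scaleC_scaleC: "c *\<^sub>C (d *\<^sub>C x) = (c * d) *\<^sub>C x"
    and scaleC_of_real: "(of_real r :: complex) *\<^sub>C x = r *\<^sub>R x"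
    and cinner_commute: "cinner x y = cnj (cinner y x)"
    and cinner_add_left: "cinner (x + y) z = cinner x z + cinner y z"
    and cinner_scaleC_left: "cinner (c *\<^sub>C x) y = c * cinner x y"
    and cinner_self: "cinner x x = of_real ((norm x)\<^sup>2)"

lemma norm_scaleC: "norm (c *\<^sub>C x) = cmod c * norm (x :: 'h::complex_hilbert)"
proof -
  have "cinner x (c *\<^sub>C x) = cnj c * cinner x x"
    by (metis cinner_commute cinner_scaleC_left complex_cnj_mult)
  then have "cinner (c *\<^sub>C x) (c *\<^sub>C x) = (c * cnj c) * cinner x x"
    by (simp add: cinner_scaleC_left mult.assoc)
  also have "\<dots> = of_real ((cmod c * norm x)\<^sup>2)"
    by (simp only: cinner_self complex_norm_square[symmetric] of_real_mult[symmetric] power_mult_distrib)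
  finally have "(norm (c *\<^sub>C x))\<^sup>2 = (cmod c * norm x)\<^sup>2"
    by (simp only: cinner_self of_real_eq_iff)
  then show ?thesis
    by (simp add: power2_eq_iff_nonneg)
qed

lift_definition scalar_op :: "complex \<Rightarrow> ('h::complex_hilbert \<Rightarrow>\<^sub>L 'h)" is "\<lambda>c x. c *\<^sub>C x"
proof (rule bounded_linear_intro)
  fix c :: complex and x y :: 'h and r :: real
  show "c *\<^sub>C (x + y) = c *\<^sub>C x + c *\<^sub>C y"
    by (rule scaleC_add_right)
  show "c *\<^sub>C (r *\<^sub>R x) = r *\<^sub>R (c *\<^sub>C x)"
    by (simp only: scaleC_of_real[symmetric] scaleC_scaleC mult.commute)
  show "norm (c *\<^sub>C x) \<le> norm x * cmod c"
    by (simp add: norm_scaleC mult.commute)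
qed

text \<open>The type \<open>'h \<Rightarrow>\<^sub>L 'h\<close> consists of the bounded real-linear operators; the following set is
  \<open>B(H)\<close>.  Its operator norm is that of \<open>'h \<Rightarrow>\<^sub>L 'h\<close>.\<close>

definition bounded_operators :: "('h::complex_hilbert \<Rightarrow>\<^sub>L 'h) set" where
  "bounded_operators = {T. \<forall>c x. blinfun_apply T (c *\<^sub>C x) = c *\<^sub>C blinfun_apply T x}"

definition adj :: "('h::complex_hilbert \<Rightarrow>\<^sub>L 'h) \<Rightarrow> ('h \<Rightarrow>\<^sub>L 'h)" where
  "adj T = (THE S. \<forall>x y. cinner (blinfun_apply T x) y = cinner x (blinfun_apply S y))"


section \<open>Von Neumann algebras\<close>

definition star_subalgebra :: "('h::complex_hilbert \<Rightarrow>\<^sub>L 'h) set \<Rightarrow> bool" where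
  "star_subalgebra M \<longleftrightarrow>
     M \<subseteq> bounded_operators \<and> 0 \<in> M \<and>
     (\<forall>S\<in>M. \<forall>T\<in>M. S + T \<in> M \<and> S o\<^sub>L T \<in> M) \<and>
     (\<forall>c. \<forall>T\<in>M. scalar_op c o\<^sub>L T \<in> M) \<and>
     (\<forall>T\<in>M. adj T \<in> M)"

definition von_neumann_algebra :: "('h::complex_hilbert \<Rightarrow>\<^sub>L 'h) set \<Rightarrow> bool" where
  "von_neumann_algebra M \<longleftrightarrow>
     star_subalgebra M \<and> id_blinfun \<in> M \<and> closedin strong_operator_topology M"

definition center :: "('h::complex_hilbert \<Rightarrow>\<^sub>L 'h) set \<Rightarrow> ('h \<Rightarrow>\<^sub>L 'h) set" where
  "center M = {T\<in>M. \<forall>S\<in>M. T o\<^sub>L S = S o\<^sub>L T}"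

definition factor :: "('h::complex_hilbert \<Rightarrow>\<^sub>L 'h) set \<Rightarrow> bool" where
  "factor M \<longleftrightarrow> von_neumann_algebra M \<and> center M = range scalar_op"

definition W_star :: "('h::complex_hilbert \<Rightarrow>\<^sub>L 'h) set \<Rightarrow> ('h \<Rightarrow>\<^sub>L 'h) set \<Rightarrow> ('h \<Rightarrow>\<^sub>L 'h) set" where
  "W_star M S = (\<lambda>N. von_neumann_algebra N \<and> N \<subseteq> M) hull S"

definition abelian :: "('h::complex_hilbert \<Rightarrow>\<^sub>L 'h) set \<Rightarrow> bool" where
  "abelian A \<longleftrightarrow> (\<forall>S\<in>A. \<forall>T\<in>A. S o\<^sub>L T = T o\<^sub>L S)"

definition masa :: "('h::complex_hilbert \<Rightarrow>\<^sub>L 'h) set \<Rightarrow> ('h \<Rightarrow>\<^sub>L 'h) set \<Rightarrow> bool" where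
  "masa M A \<longleftrightarrow>
     A \<subseteq> M \<and> star_subalgebra A \<and> abelian A \<and>
     (\<forall>B. B \<subseteq> M \<and> star_subalgebra B \<and> abelian B \<and> A \<subseteq> B \<longrightarrow> B = A)"


section \<open>The predual\<close>

definition square_summable :: "(nat \<Rightarrow> 'h::complex_hilbert) \<Rightarrow> bool" where
  "square_summable xs \<longleftrightarrow> summable (\<lambda>n. (norm (xs n))\<^sup>2)"

definition ultraweak_topology :: "('h::complex_hilbert \<Rightarrow>\<^sub>L 'h) topology" where
  "ultraweak_topology =
     (let I = {(xs, ys). square_summable xs \<and> square_summable ys}
      in pullback_topology UNIV
           (\<lambda>T. \<lambda>(xs, ys)\<in>I. \<Sum>n. cinner (blinfun_apply T (xs n)) (ys n))
           (product_topology (\<lambda>_. euclidean) I))"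

text \<open>Functionals on \<open>M\<close> are made to be \<open>undefined\<close> outside \<open>M\<close>, so that two of them are equal
  when they agree on \<open>M\<close>.\<close>

definition linear_functional ::
    "('h::complex_hilbert \<Rightarrow>\<^sub>L 'h) set \<Rightarrow> (('h \<Rightarrow>\<^sub>L 'h) \<Rightarrow> complex) \<Rightarrow> bool" where
  "linear_functional M \<phi> \<longleftrightarrow>
     \<phi> \<in> extensional M \<and>
     (\<forall>S\<in>M. \<forall>T\<in>M. \<phi> (S + T) = \<phi> S + \<phi> T) \<and>
     (\<forall>c. \<forall>T\<in>M. \<phi> (scalar_op c o\<^sub>L T) = c * \<phi> T)"

definition predual :: "('h::complex_hilbert \<Rightarrow>\<^sub>L 'h) set \<Rightarrow> (('h \<Rightarrow>\<^sub>L 'h) \<Rightarrow> complex) set" where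
  "predual M = {\<phi>. linear_functional M \<phi> \<and>
     continuous_map (subtopology ultraweak_topology M) euclidean \<phi>}"

text \<open>The innermost condition says that the functional \<open>\<phi> - \<psi>\<close> has norm at most \<open>\<epsilon>\<close>.\<close>

definition separable_predual :: "('h::complex_hilbert \<Rightarrow>\<^sub>L 'h) set \<Rightarrow> bool" where
  "separable_predual M \<longleftrightarrow>
     (\<exists>D. countable D \<and> D \<subseteq> predual M \<and>
        (\<forall>\<phi>\<in>predual M. \<forall>\<epsilon>>0. \<exists>\<psi>\<in>D. \<forall>T\<in>M. cmod (\<phi> T - \<psi> T) \<le> \<epsilon> * norm T))"


section \<open>Projections and the type of a factor\<close>

definition projections :: "('h::complex_hilbert \<Rightarrow>\<^sub>L 'h) set \<Rightarrow> ('h \<Rightarrow>\<^sub>L 'h) set" where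
  "projections M = {P\<in>M. adj P = P \<and> P o\<^sub>L P = P}"

definition proj_le :: "('h::complex_hilbert \<Rightarrow>\<^sub>L 'h) \<Rightarrow> ('h \<Rightarrow>\<^sub>L 'h) \<Rightarrow> bool" where
  "proj_le P Q \<longleftrightarrow> range (blinfun_apply P) \<subseteq> range (blinfun_apply Q)"

definition is_proj_join ::
    "('h::complex_hilbert \<Rightarrow>\<^sub>L 'h) set \<Rightarrow> ('h \<Rightarrow>\<^sub>L 'h) set \<Rightarrow> ('h \<Rightarrow>\<^sub>L 'h) \<Rightarrow> bool" where
  "is_proj_join M F R \<longleftrightarrow>
     R \<in> projections M \<and> (\<forall>Q\<in>F. proj_le Q R) \<and>
     (\<forall>R'\<in>projections M. (\<forall>Q\<in>F. proj_le Q R') \<longrightarrow> proj_le R R')"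

definition partial_isometry :: "('h::complex_hilbert \<Rightarrow>\<^sub>L 'h) \<Rightarrow> bool" where
  "partial_isometry V \<longleftrightarrow> V o\<^sub>L adj V o\<^sub>L V = V"

definition mvn_equiv ::
    "('h::complex_hilbert \<Rightarrow>\<^sub>L 'h) set \<Rightarrow> ('h \<Rightarrow>\<^sub>L 'h) \<Rightarrow> ('h \<Rightarrow>\<^sub>L 'h) \<Rightarrow> bool" where
  "mvn_equiv M P Q \<longleftrightarrow>
     (\<exists>V\<in>M. partial_isometry V \<and> adj V o\<^sub>L V = P \<and> V o\<^sub>L adj V = Q)"

definition mvn_le ::
    "('h::complex_hilbert \<Rightarrow>\<^sub>L 'h) set \<Rightarrow> ('h \<Rightarrow>\<^sub>L 'h) \<Rightarrow> ('h \<Rightarrow>\<^sub>L 'h) \<Rightarrow> bool" where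
  "mvn_le M P Q \<longleftrightarrow> (\<exists>Q0\<in>projections M. mvn_equiv M P Q0 \<and> proj_le Q0 Q)"

definition finite_projection ::
    "('h::complex_hilbert \<Rightarrow>\<^sub>L 'h) set \<Rightarrow> ('h \<Rightarrow>\<^sub>L 'h) \<Rightarrow> bool" where
  "finite_projection M P \<longleftrightarrow>
     P \<in> projections M \<and>
     (\<forall>Q\<in>projections M. mvn_equiv M P Q \<and> proj_le Q P \<longrightarrow> Q = P)"

definition abelian_projection ::
    "('h::complex_hilbert \<Rightarrow>\<^sub>L 'h) set \<Rightarrow> ('h \<Rightarrow>\<^sub>L 'h) \<Rightarrow> bool" where
  "abelian_projection M P \<longleftrightarrow> P \<in> projections M \<and> abelian ((\<lambda>T. P o\<^sub>L T o\<^sub>L P) ` M)"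

text \<open>The type definitions below are for factors: central supports of nonzero projections are
  then the identity, and an infinite projection is properly infinite.\<close>

definition type_I_fin :: "('h::complex_hilbert \<Rightarrow>\<^sub>L 'h) set \<Rightarrow> nat \<Rightarrow> bool" where
  "type_I_fin M n \<longleftrightarrow>
     n \<ge> 1 \<and>
     (\<exists>p. (\<forall>i<n. abelian_projection M (p i) \<and> p i \<noteq> 0) \<and>
          (\<forall>i<n. \<forall>j<n. mvn_equiv M (p i) (p j) \<and> (i \<noteq> j \<longrightarrow> p i o\<^sub>L p j = 0)) \<and>
          (\<Sum>i<n. p i) = id_blinfun)"

definition type_I_inf :: "('h::complex_hilbert \<Rightarrow>\<^sub>L 'h) set \<Rightarrow> bool" where
  "type_I_inf M \<longleftrightarrow>
     (\<exists>P. abelian_projection M P \<and> P \<noteq> 0) \<and> \<not> finite_projection M id_blinfun"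

definition type_II :: "('h::complex_hilbert \<Rightarrow>\<^sub>L 'h) set \<Rightarrow> bool" where
  "type_II M \<longleftrightarrow>
     (\<nexists>P. abelian_projection M P \<and> P \<noteq> 0) \<and> (\<exists>P. finite_projection M P \<and> P \<noteq> 0)"

definition type_II_1 :: "('h::complex_hilbert \<Rightarrow>\<^sub>L 'h) set \<Rightarrow> bool" where
  "type_II_1 M \<longleftrightarrow> type_II M \<and> finite_projection M id_blinfun"

definition type_II_inf :: "('h::complex_hilbert \<Rightarrow>\<^sub>L 'h) set \<Rightarrow> bool" where
  "type_II_inf M \<longleftrightarrow> type_II M \<and> \<not> finite_projection M id_blinfun"

definition type_III :: "('h::complex_hilbert \<Rightarrow>\<^sub>L 'h) set \<Rightarrow> bool" where
  "type_III M \<longleftrightarrow> (\<nexists>P. finite_projection M P \<and> P \<noteq> 0)"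

definition unitary :: "('h::complex_hilbert \<Rightarrow>\<^sub>L 'h) \<Rightarrow> bool" where
  "unitary U \<longleftrightarrow> adj U o\<^sub>L U = id_blinfun \<and> U o\<^sub>L adj U = id_blinfun"


section \<open>Shen's invariant\<close>

definition tracial_state ::
    "('h::complex_hilbert \<Rightarrow>\<^sub>L 'h) set \<Rightarrow> (('h \<Rightarrow>\<^sub>L 'h) \<Rightarrow> complex) \<Rightarrow> bool" where
  "tracial_state M \<tau> \<longleftrightarrow>
     linear_functional M \<tau> \<and> (\<forall>T\<in>M. \<tau> (adj T o\<^sub>L T) \<in> \<real>\<^sub>\<ge>\<^sub>0) \<and> \<tau> id_blinfun = 1 \<and>
     (\<forall>S\<in>M. \<forall>T\<in>M. \<tau> (S o\<^sub>L T) = \<tau> (T o\<^sub>L S))"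

text \<open>A type \<open>II\<^sub>1\<close> factor has exactly one tracial state; it is automatically normal and faithful.\<close>

definition trace_of :: "('h::complex_hilbert \<Rightarrow>\<^sub>L 'h) set \<Rightarrow> ('h \<Rightarrow>\<^sub>L 'h) \<Rightarrow> complex" where
  "trace_of M = (THE \<tau>. tracial_state M \<tau>)"

definition equal_trace_partition ::
    "('h::complex_hilbert \<Rightarrow>\<^sub>L 'h) set \<Rightarrow> nat \<Rightarrow> (nat \<Rightarrow> 'h \<Rightarrow>\<^sub>L 'h) \<Rightarrow> bool" where
  "equal_trace_partition M k p \<longleftrightarrow>
     (\<forall>i<k. p i \<in> projections M \<and> trace_of M (p i) = 1 / of_nat k) \<and>
     (\<forall>i<k. \<forall>j<k. i \<noteq> j \<longrightarrow> p i o\<^sub>L p j = 0) \<and>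
     (\<Sum>i<k. p i) = id_blinfun"

definition shen_I ::
    "('h::complex_hilbert \<Rightarrow>\<^sub>L 'h) set \<Rightarrow> nat \<Rightarrow> (nat \<Rightarrow> 'h \<Rightarrow>\<^sub>L 'h) \<Rightarrow> real" where
  "shen_I X k p =
     (\<Sum>x\<in>X. real (card {(i, j). i < k \<and> j < k \<and> p i o\<^sub>L x o\<^sub>L p j \<noteq> 0}) / (real k)\<^sup>2)"

text \<open>The infimum is taken in \<open>ereal\<close>, where the infimum of the empty set is \<open>\<infinity>\<close>.\<close>

definition shen_G :: "('h::complex_hilbert \<Rightarrow>\<^sub>L 'h) set \<Rightarrow> ereal" where
  "shen_G M = Inf {ereal (shen_I X k p) | X k p.
     k \<ge> 1 \<and> equal_trace_partition M k p \<and> finite X \<and> X \<subseteq> M \<and> W_star M X = M}"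

end

theory Submission
  imports Defs
begin

text \<open>If \<open>T\<close> is a small operator from the range of \<open>P\<close> to that of \<open>I - P\<close>, some unitary \<open>U\<close> conjugates
  \<open>P\<close> in such a way that \<open>P\<close> and \<open>U\<^sup>*PU\<close> together generate \<open>T\<close>.  Since \<open>A(I - P)\<close> contains \<open>I - P\<close>, it is
  enough to choose \<open>T\<close> such that \<open>T\<close> and \<open>A(I - P)\<close> generate \<open>M\<close>.  Cutting \<open>T\<close> by orthogonal projections in
  \<open>A(I - P)\<close> yields a whole sequence of operators on \<open>PH\<close>.  Some of them are partial isometries that connect \<open>P\<close>
  with small pieces filling up \<open>I - P\<close>, so that only \<open>PMP\<close> has to be generated by the others.  In the infinite
  cases \<open>PMP\<close> is generated by countably many projections, finite ones unless \<open>M\<close> is of type III, and each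
  of them has its own equivalent copy in \<open>A(I - P)\<close>.  In the finite cases there is only room for one copy \<open>E\<close>
  of \<open>P\<close>, and \<open>EME\<close> has to be generated by \<open>AE\<close> and one self-adjoint \<open>K\<close>; such a \<open>K\<close> is a matrix over
  equivalent projections \<open>b\<close> in \<open>AE\<close> that stores generators of \<open>bMb\<close> above the diagonal.  None are
  needed if \<open>b\<close> is minimal, and in type \<open>II\<^sub>1\<close> their number is controlled by Shen's invariant.\<close>

section \<open>Hilbert space geometry\<close>

text \<open>Generation means that an arbitrary von Neumann algebra \<open>N\<close> containing the
  given data contains \<open>M\<close>, so every operator has to be recovered inside an unknown
  \<open>N\<close>. Spectral projections, roots and inverses are therefore built as limits of
  sequences of polynomials in one operator and recorded by \<open>gens\<close>, which applies to
  \<open>M\<close>, the masa, \<open>N\<close> and commutants alike. The obstacle on the side of the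
  masa is that comparison of projections yields subprojections somewhere in \<open>M\<close>, not in
  \<open>A\<close>. The property \<open>small_pieces\<close> bridges this gap: with an exhaustion
  argument it turns a comparison with a projection of \<open>A\<close> into an exact copy inside
  \<open>A\<close>. In the finite types \<open>P\<close> may be equivalent to \<open>1 - P\<close>,
  so one operator from \<open>P\<close> to its copy has to carry everything. A self-adjoint matrix
  with \<open>k\<close> full blocks has about \<open>k^2 / 2\<close> free places, while
  \<open>shen_G M = 0\<close> allows generators whose nonzero blocks number a small fraction of
  \<open>k^2\<close>; both sides grow quadratically, so a fine partition suffices. Additivity of
  finiteness and the trace itself come from vector functionals that are tracial up to a factor on a
  small corner.\<close>

lemma cinner_add_right: "cinner x (y + z) = cinner x y + cinner x (z :: 'h::complex_hilbert)"
  by (metis cinner_commute cinner_add_left complex_cnj_add)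

lemma cinner_scaleC_right: "cinner x (c *\<^sub>C y) = cnj c * cinner x (y :: 'h::complex_hilbert)"
  by (metis cinner_commute cinner_scaleC_left complex_cnj_mult)

lemma cinner_scaleR_left: "cinner (r *\<^sub>R x) y = of_real r * cinner x (y :: 'h::complex_hilbert)"
  by (metis cinner_scaleC_left scaleC_of_real)

lemma cinner_scaleR_right: "cinner x (r *\<^sub>R y) = of_real r * cinner x (y :: 'h::complex_hilbert)"
  by (metis cinner_scaleC_right scaleC_of_real complex_cnj_complex_of_real)

lemma cinner_minus_left [simp]: "cinner (- x) y = - cinner x (y :: 'h::complex_hilbert)"
  using cinner_scaleR_left[of "-1" x y] by simp

lemma cinner_minus_right [simp]: "cinner x (- y) = - cinner x (y :: 'h::complex_hilbert)"
  using cinner_scaleR_right[of x "-1" y] by simp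

lemma cinner_diff_left: "cinner (x - y) z = cinner x z - cinner y (z :: 'h::complex_hilbert)"
  using cinner_add_left[of x "-y" z] by simp

lemma cinner_diff_right: "cinner x (y - z) = cinner x y - cinner x (z :: 'h::complex_hilbert)"
  using cinner_add_right[of x y "-z"] by simp

lemma cinner_zero_left [simp]: "cinner 0 (x :: 'h::complex_hilbert) = 0"
  using cinner_scaleR_left[of 0 x x] by simp

lemma cinner_zero_right [simp]: "cinner (x :: 'h::complex_hilbert) 0 = 0"
  using cinner_scaleR_right[of x 0 x] by simp

lemma scaleC_zero_right [simp]: "c *\<^sub>C (0 :: 'h::complex_hilbert) = 0"
  using norm_scaleC[of c 0] by simp

lemma scaleC_zero_left [simp]: "0 *\<^sub>C (x :: 'h::complex_hilbert) = 0"
  using norm_scaleC[of 0 x] by simp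

lemma scaleC_one [simp]: "1 *\<^sub>C (x :: 'h::complex_hilbert) = x"
  using scaleC_of_real[of 1 x] by simp

lemma norm_add_square:
  "(norm (x + y))\<^sup>2 = (norm x)\<^sup>2 + 2 * Re (cinner x y) + (norm (y :: 'h::complex_hilbert))\<^sup>2"
proof -
  have "complex_of_real ((norm (x + y))\<^sup>2) = cinner (x + y) (x + y)" by (simp only: cinner_self)
  also have "\<dots> = cinner x x + (cinner x y + cinner y x) + cinner y y"
    by (simp add: cinner_add_left cinner_add_right)
  also have "cinner x y + cinner y x = of_real (2 * Re (cinner x y))"
    by (metis cinner_commute complex_add_cnj)
  finally show ?thesis
    by (simp only: cinner_self of_real_add[symmetric] of_real_eq_iff)
qed

lemma norm_diff_square:
  "(norm (x - y))\<^sup>2 = (norm x)\<^sup>2 - 2 * Re (cinner x y) + (norm (y :: 'h::complex_hilbert))\<^sup>2"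
  using norm_add_square[of x "-y"] by simp

lemma Re_cinner_self: "Re (cinner x x) = (norm (x :: 'h::complex_hilbert))\<^sup>2"
  by (simp add: cinner_self)

lemma Cauchy_Schwarz: "cmod (cinner x y) \<le> norm x * norm (y :: 'h::complex_hilbert)"
proof (cases "y = 0")
  case False
  define c where "c = cinner x y / (norm y)\<^sup>2"
  have ny: "(norm y)\<^sup>2 > 0" using False by simp
  have "0 \<le> (norm (x - c *\<^sub>C y))\<^sup>2" by simp
  also have "\<dots> = (norm x)\<^sup>2 - 2 * Re (cnj c * cinner x y) + (cmod c)\<^sup>2 * (norm y)\<^sup>2"
    by (simp add: norm_diff_square cinner_scaleC_right norm_scaleC power_mult_distrib)
  also have "cnj c * cinner x y = of_real ((cmod (cinner x y))\<^sup>2 / (norm y)\<^sup>2)"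
    unfolding c_def complex_norm_square by (simp add: complex_norm_square[symmetric] mult.commute)
  also have "(cmod c)\<^sup>2 * (norm y)\<^sup>2 = (cmod (cinner x y))\<^sup>2 / (norm y)\<^sup>2"
  proof -
    have "cmod c = cmod (cinner x y) / (norm y)\<^sup>2" by (simp add: c_def norm_divide norm_power)
    then have "(cmod c)\<^sup>2 * (norm y)\<^sup>2 = (cmod (cinner x y))\<^sup>2 / ((norm y)\<^sup>2 * (norm y)\<^sup>2) * (norm y)\<^sup>2"
      by (simp only: power_divide power2_eq_square[of "(norm y)\<^sup>2"])
    moreover have "a / (b * b) * b = a / b" if "b > 0" for a b :: real using that by simp
    ultimately show ?thesis using ny by metis
  qed
  finally have "(cmod (cinner x y))\<^sup>2 / (norm y)\<^sup>2 \<le> (norm x)\<^sup>2"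
    by simp
  then have "(cmod (cinner x y))\<^sup>2 \<le> (norm x * norm y)\<^sup>2"
    using ny by (simp add: divide_le_eq power_mult_distrib)
  then show ?thesis
    by (rule power2_le_imp_le) simp
qed simp

lemma bounded_bilinear_cinner: "bounded_bilinear (cinner :: 'h::complex_hilbert \<Rightarrow> _)"
proof
  show "\<exists>K. \<forall>a b :: 'h. norm (cinner a b) \<le> norm a * norm b * K"
    by (rule exI[of _ 1]) (simp add: Cauchy_Schwarz)
qed (simp_all add: cinner_add_left cinner_add_right cinner_scaleR_left cinner_scaleR_right scaleR_conv_of_real)

lemmas tendsto_cinner = bounded_bilinear.tendsto[OF bounded_bilinear_cinner]

lemma cinner_sum_left: "cinner (\<Sum>i\<in>I. f i) y = (\<Sum>i\<in>I. cinner (f i) (y :: 'h::complex_hilbert))"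
  by (induct I rule: infinite_finite_induct) (simp_all add: cinner_add_left)

lemma cinner_ext:
  assumes "\<And>z. cinner x z = cinner y (z :: 'h::complex_hilbert)" shows "x = y"
proof -
  have "cinner (x - y) (x - y) = 0" using assms by (simp add: cinner_diff_left)
  then show ?thesis by (simp add: cinner_self)
qed

text \<open>For small \<open>t\<close> the linear term decides the sign, so a nonzero
  \<open>r\<close> is refuted by a small step against its sign.\<close>

lemma orthogonal_of_minimal:
  fixes n v :: real
  assumes "\<And>t::real. 0 \<le> 2 * t * r + t\<^sup>2 * v"
  shows "r = 0"
proof (rule ccontr)
  assume r: "r \<noteq> 0"
  \<comment> \<open>\<open>\<bar>v\<bar> + 1\<close> dominates \<open>v\<close> and is never zero,
    which covers \<open>v \<le> 0\<close> as well.\<close>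
  define t where "t = - r / (\<bar>v\<bar> + 1)"
  have "0 \<le> 2 * t * r + t\<^sup>2 * v" by (rule assms)
  also have "\<dots> \<le> 2 * t * r + t\<^sup>2 * (\<bar>v\<bar> + 1)" by (intro add_left_mono mult_left_mono) auto
  also have "\<dots> = - r\<^sup>2 / (\<bar>v\<bar> + 1)"
  proof -
    define w where "w = \<bar>v\<bar> + 1"
    have "w \<noteq> 0" unfolding w_def by linarith
    then show ?thesis unfolding t_def w_def[symmetric] power2_eq_square by (simp add: field_simps)
  qed
  also have "\<dots> < 0" using r by (simp add: divide_neg_pos)
  finally show False by simp
qed

text \<open>Elements of the direct sum of \<open>n\<close> copies of the Hilbert space are encoded as the first \<open>n\<close>
  entries of a sequence.\<close>

lemma projection_tuple:
  fixes V :: "(nat \<Rightarrow> 'h::complex_hilbert) set" and y :: "nat \<Rightarrow> 'h"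
  assumes ne: "v0 \<in> V"
    and add: "\<And>v w. v \<in> V \<Longrightarrow> w \<in> V \<Longrightarrow> (\<lambda>i. v i + w i) \<in> V"
    and scale: "\<And>c v. v \<in> V \<Longrightarrow> (\<lambda>i. c *\<^sub>C v i) \<in> V"
  shows "\<exists>z s. (\<forall>k. s k \<in> V) \<and> (\<forall>i<n. (\<lambda>k. s k i) \<longlonglongrightarrow> z i) \<and>
    (\<forall>v\<in>V. (\<Sum>i<n. cinner (v i) (y i - z i)) = 0)"
proof -
  define q where "q = (\<lambda>v. \<Sum>i<n. (norm (y i - v i))\<^sup>2)"
  define d where "d = Inf (q ` V)"
  have q0: "q v \<ge> 0" for v unfolding q_def by (rule sum_nonneg) simp
  have bdd: "bdd_below (q ` V)" using q0 by (intro bdd_belowI[of _ 0]) auto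
  have dle: "d \<le> q v" if "v \<in> V" for v
    unfolding d_def using that bdd by (intro cInf_lower) auto
  have "\<exists>v\<in>V. q v < d + 1 / Suc k" for k
  proof -
    have "Inf (q ` V) < d + 1 / Suc k" unfolding d_def by simp
    then show ?thesis using ne bdd by (subst (asm) cInf_less_iff) auto
  qed
  then obtain s where sV: "\<And>k. s k \<in> V" and sq: "\<And>k. q (s k) < d + 1 / Suc k" by metis
  \<comment> \<open>Parallelogram law: midpoints of members of \<open>V\<close> stay in
    \<open>V\<close> and cannot beat the infimum \<open>d\<close>, so a minimizing sequence is
    Cauchy in each coordinate.\<close>
  have par: "(\<Sum>i<n. (norm (s k i - s l i))\<^sup>2) \<le> 2 / Suc k + 2 / Suc l" for k l
  proof -
    define m where "m = (\<lambda>i. (1/2) *\<^sub>C (s k i + s l i))"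
    have mV: "m \<in> V" unfolding m_def by (intro scale add sV)
    have m: "m i = (1/2) *\<^sub>R (s k i + s l i)" for i
      unfolding m_def using scaleC_of_real[of "1/2"] by simp
    have pl: "(norm (s k i - s l i))\<^sup>2 = 2 * (norm (y i - s k i))\<^sup>2 + 2 * (norm (y i - s l i))\<^sup>2 - 4 * (norm (y i - m i))\<^sup>2" for i
    proof -
      define a b where "a = y i - s k i" and "b = y i - s l i"
      have "s k i - s l i = b - a" by (simp add: a_def b_def)
      moreover have "y i - m i = (1/2) *\<^sub>R (a + b)"
        unfolding m a_def b_def by (simp add: algebra_simps scaleR_2[symmetric])
      ultimately show ?thesis
        unfolding a_def[symmetric] b_def[symmetric]
        by (simp add: power_mult_distrib power_divide)
          (simp add: norm_diff_square norm_add_square cinner_commute[of b a])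
    qed
    have "(\<Sum>i<n. (norm (s k i - s l i))\<^sup>2) = 2 * q (s k) + 2 * q (s l) - 4 * q m"
      unfolding pl q_def by (simp add: sum.distrib sum_subtractf sum_distrib_left)
    also have "\<dots> \<le> 2 * (d + 1 / Suc k) + 2 * (d + 1 / Suc l) - 4 * d"
    proof -
      have *: "2 * X + 2 * Y - 4 * Z \<le> 2 * A + 2 * B - 4 * D" if "X < A" "Y < B" "D \<le> Z" for X Y Z A B D :: real
        using that by linarith
      show ?thesis by (rule *[OF sq sq dle[OF mV]])
    qed
    finally show ?thesis by (simp add: algebra_simps)
  qed
  have "convergent (\<lambda>k. s k i)" if "i < n" for i
  proof -
    have "Cauchy (\<lambda>k. s k i)"
    proof (rule metric_CauchyI)
      fix e :: real assume e: "e > 0"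
      obtain K :: nat where K: "4 / e\<^sup>2 < real K" using reals_Archimedean2 by blast
      show "\<exists>M. \<forall>k\<ge>M. \<forall>l\<ge>M. dist (s k i) (s l i) < e"
      proof (intro exI[of _ K] allI impI)
        fix k l assume kl: "k \<ge> K" "l \<ge> K"
        have K0: "real K > 0" using K e by (meson less_trans zero_less_divide_iff zero_less_numeral zero_less_power)
        have "(norm (s k i - s l i))\<^sup>2 \<le> (\<Sum>i<n. (norm (s k i - s l i))\<^sup>2)"
          using that by (intro member_le_sum) auto
        also have "\<dots> \<le> 2 / Suc k + 2 / Suc l" by (rule par)
        also have "\<dots> \<le> 2 / K + 2 / K" using kl K0 by (intro add_mono divide_left_mono) auto
        also have "\<dots> = 4 / K" by simp
        also have "\<dots> < e\<^sup>2" using K e K0 by (simp add: field_simps)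
        finally show "dist (s k i) (s l i) < e"
          using e by (simp add: dist_norm power_less_imp_less_base)
      qed
    qed
    then show ?thesis by (rule Cauchy_convergent)
  qed
  then obtain z where z: "\<And>i. i < n \<Longrightarrow> (\<lambda>k. s k i) \<longlonglongrightarrow> z i"
    unfolding convergent_def by metis
  \<comment> \<open>\<open>V\<close> need not be closed, so \<open>z\<close> may lie outside it; its
    minimality is inherited from the tuples \<open>s k + v\<close>, which do lie in
    \<open>V\<close>.\<close>
  have zmin: "d \<le> q (\<lambda>i. z i + v i)" if v: "v \<in> V" for v
  proof (rule LIMSEQ_le_const)
    show "(\<lambda>k. q (\<lambda>i. s k i + v i)) \<longlonglongrightarrow> q (\<lambda>i. z i + v i)"
      unfolding q_def by (intro tendsto_sum tendsto_power tendsto_norm tendsto_diff tendsto_add tendsto_const z) simp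
    show "\<exists>N. \<forall>k\<ge>N. d \<le> q (\<lambda>i. s k i + v i)"
      using dle add sV v by blast
  qed
  have "q z = d"
  proof (rule LIMSEQ_unique)
    show "(\<lambda>k. q (s k)) \<longlonglongrightarrow> q z"
      unfolding q_def by (intro tendsto_sum tendsto_power tendsto_norm tendsto_diff tendsto_const z) simp
    have "(\<lambda>k. d + 1 / Suc k) \<longlonglongrightarrow> d + 0"
      by (intro tendsto_add tendsto_const LIMSEQ_Suc[OF lim_1_over_n])
    then have lim: "(\<lambda>k. d + 1 / Suc k) \<longlonglongrightarrow> d" by simp
    show "(\<lambda>k. q (s k)) \<longlonglongrightarrow> d"
    proof (rule tendsto_sandwich[OF _ _ tendsto_const lim])
      show "\<forall>\<^sub>F k in sequentially. d \<le> q (s k)"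
        by (rule always_eventually) (rule allI, rule dle[OF sV])
      show "\<forall>\<^sub>F k in sequentially. q (s k) \<le> d + 1 / Suc k"
        by (rule always_eventually) (rule allI, rule less_imp_le[OF sq])
    qed
  qed
  have Re0: "(\<Sum>i<n. Re (cinner (v i) (y i - z i))) = 0" if v: "v \<in> V" for v
  proof (rule orthogonal_of_minimal)
    fix t :: real
    have "(\<lambda>i. of_real (-t) *\<^sub>C v i) \<in> V" by (rule scale[OF v])
    then have "d \<le> q (\<lambda>i. z i + (-t) *\<^sub>R v i)" using zmin unfolding scaleC_of_real by blast
    moreover have "q (\<lambda>i. z i + (-t) *\<^sub>R v i) = q z + 2 * t * (\<Sum>i<n. Re (cinner (v i) (y i - z i))) + t\<^sup>2 * (\<Sum>i<n. (norm (v i))\<^sup>2)"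
    proof -
      have "(norm (y i - (z i + (-t) *\<^sub>R v i)))\<^sup>2 = (norm (y i - z i))\<^sup>2 + 2 * t * Re (cinner (v i) (y i - z i)) + t\<^sup>2 * (norm (v i))\<^sup>2" for i
        using norm_add_square[of "t *\<^sub>R v i" "y i - z i"]
        by (simp add: algebra_simps cinner_scaleR_left power_mult_distrib)
      then show ?thesis unfolding q_def by (simp add: sum.distrib sum_distrib_left)
    qed
    ultimately show "0 \<le> 2 * t * (\<Sum>i<n. Re (cinner (v i) (y i - z i))) + t\<^sup>2 * (\<Sum>i<n. (norm (v i))\<^sup>2)"
      using \<open>q z = d\<close> by simp
  qed
  have "(\<Sum>i<n. cinner (v i) (y i - z i)) = 0" if v: "v \<in> V" for v
  proof (rule complex_eqI)
    show "Re (\<Sum>i<n. cinner (v i) (y i - z i)) = Re 0" using Re0[OF v] by simp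
    have "(\<Sum>i<n. Re (cinner (\<i> *\<^sub>C v i) (y i - z i))) = 0" by (rule Re0[OF scale[OF v]])
    then show "Im (\<Sum>i<n. cinner (v i) (y i - z i)) = Im 0"
      by (simp add: cinner_scaleC_left sum_negf)
  qed
  then show ?thesis using z sV by blast
qed

text \<open>The representing vector is a multiple of the part of \<open>y\<close> orthogonal to the
  kernel of \<open>f\<close>, found with the one-coordinate case of \<open>projection_tuple\<close>.
  Boundedness of \<open>f\<close> puts the limit \<open>z 0\<close> of kernel vectors back into the
  kernel.\<close>

lemma riesz:
  fixes f :: "'h::complex_hilbert \<Rightarrow> complex"
  assumes add: "\<And>x y. f (x + y) = f x + f y" and scale: "\<And>c x. f (c *\<^sub>C x) = c * f x"
    and bound: "\<And>x. cmod (f x) \<le> norm x * K"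
  shows "\<exists>u. \<forall>x. f x = cinner x u"
proof (cases "\<forall>x. f x = 0")
  case True
  then show ?thesis by (intro exI[of _ 0]) simp
next
  case False
  then obtain y where y: "f y \<noteq> 0" by blast
  have f0: "f 0 = 0" using scale[of 0 0] by simp
  have lin: "bounded_linear f"
    by (rule bounded_linear_intro[where K=K])
      (use add scale bound in \<open>simp_all add: scaleC_of_real[symmetric] scaleR_conv_of_real\<close>)
  obtain z s where s: "\<And>k::nat. f (s k (0::nat)) = 0" and z: "(\<lambda>k. s k 0) \<longlonglongrightarrow> z (0::nat)"
    and orth: "\<And>v. f v = 0 \<Longrightarrow> cinner v (y - z 0) = 0"
  proof -
    have "\<exists>z s. (\<forall>k. s k \<in> {v. f (v (0::nat)) = 0}) \<and> (\<forall>i<1::nat. (\<lambda>k. s k i) \<longlonglongrightarrow> z i) \<and>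
      (\<forall>v\<in>{v. f (v (0::nat)) = 0}. (\<Sum>i<1. cinner (v i) (y - z i)) = 0)"
      by (rule projection_tuple[of "\<lambda>_. 0"]) (simp_all add: add scale f0)
    then obtain z s where zs: "(\<forall>k::nat. s k \<in> {v. f (v (0::nat)) = 0}) \<and> (\<forall>i<1::nat. (\<lambda>k. s k i) \<longlonglongrightarrow> z i) \<and>
      (\<forall>v\<in>{v. f (v (0::nat)) = 0}. (\<Sum>i<1. cinner (v i) (y - z i)) = 0)" by (elim exE)
    have *: "f (s k (0::nat)) = 0" for k using zs by blast
    have **: "(\<lambda>k. s k 0) \<longlonglongrightarrow> z 0" using zs by blast
    have ***: "cinner (v 0) (y - z 0) = 0" if "f (v (0::nat)) = 0" for v
      using zs[THEN conjunct2, THEN conjunct2] that by fastforce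
    show ?thesis
    proof (rule that[where s=s and z=z])
      show "cinner v (y - z 0) = 0" if "f v = 0" for v using ***[of "\<lambda>_. v"] that by simp
    qed (use * ** in blast)+
  qed
  have "(\<lambda>k. f (s k 0)) \<longlonglongrightarrow> f (z 0)"
    by (rule bounded_linear.tendsto[OF lin z])
  then have fz: "f (z 0) = 0" using s by (simp add: LIMSEQ_const_iff)
  define u where "u = y - z 0"
  have fu: "f u = f y" using add[of u "z 0"] fz by (simp add: u_def)
  have u0: "u \<noteq> 0" using fu y f0 by auto
  have "f x = cinner x ((cnj (f u) / (norm u)\<^sup>2) *\<^sub>C u)" for x
  proof -
    have "f (x + (- (f x / f u)) *\<^sub>C u) = 0" using fu y by (simp add: add scale)
    then have "cinner (x + (- (f x / f u)) *\<^sub>C u) u = 0" using orth unfolding u_def by blast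
    then have "cinner x u = f x / f u * of_real ((norm u)\<^sup>2)"
      by (simp add: cinner_add_left cinner_scaleC_left cinner_self)
    then show ?thesis using u0 fu y by (simp add: cinner_scaleC_right)
  qed
  then show ?thesis by blast
qed

text \<open>\<open>adj\<close> is a definite description, so existence precedes every use of it.
  Riesz gives the values; the bound follows because the squared norm of \<open>g x\<close> is the
  inner product of \<open>T (g x)\<close> with \<open>x\<close>.\<close>

lemma adj_exists:
  assumes "T \<in> bounded_operators"
  shows "\<exists>S\<in>bounded_operators. \<forall>x y. cinner (blinfun_apply T x) y = cinner x (blinfun_apply S (y :: 'h::complex_hilbert))"
proof -
  have lin: "blinfun_apply T (c *\<^sub>C x) = c *\<^sub>C blinfun_apply T x" for c x
    using assms by (simp add: bounded_operators_def)
  have "\<exists>u. \<forall>x. cinner (blinfun_apply T x) y = cinner x u" for y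
  proof (rule riesz[where K="norm T * norm y"])
    fix x
    have "cmod (cinner (blinfun_apply T x) y) \<le> norm (blinfun_apply T x) * norm y" by (rule Cauchy_Schwarz)
    also have "\<dots> \<le> (norm T * norm x) * norm y" by (intro mult_right_mono norm_blinfun) simp
    finally show "cmod (cinner (blinfun_apply T x) y) \<le> norm x * (norm T * norm y)" by (simp add: algebra_simps)
  qed (simp_all add: lin blinfun.add_right cinner_add_left cinner_scaleC_left)
  then obtain g where g: "\<And>x y. cinner (blinfun_apply T x) y = cinner x (g y)" by metis
  have g': "cinner (g y) x = cinner y (blinfun_apply T x)" for x y
    by (metis g cinner_commute)
  have gC: "g (c *\<^sub>C x) = c *\<^sub>C g x" for c x
    by (rule cinner_ext) (simp add: g' cinner_scaleC_left)
  have bl: "bounded_linear g"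
  proof (rule bounded_linear_intro[where K="norm T"])
    show "g (x + y) = g x + g y" for x y
      by (rule cinner_ext) (simp add: g' cinner_add_left)
    show "g (r *\<^sub>R x) = r *\<^sub>R g x" for r x
      using gC[of "of_real r" x] by (simp add: scaleC_of_real)
    show "norm (g x) \<le> norm x * norm T" for x
    proof -
      have "(norm (g x))\<^sup>2 = cmod (cinner (g x) (g x))" by (simp add: cinner_self norm_power)
      also have "\<dots> = cmod (cinner (blinfun_apply T (g x)) x)" by (simp add: g)
      also have "\<dots> \<le> norm (blinfun_apply T (g x)) * norm x" by (rule Cauchy_Schwarz)
      also have "\<dots> \<le> (norm T * norm (g x)) * norm x" by (intro mult_right_mono norm_blinfun) simp
      finally have "norm (g x) * norm (g x) \<le> norm (g x) * (norm x * norm T)"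
        by (simp add: power2_eq_square algebra_simps)
      then show ?thesis
        by (cases "g x = 0") (simp_all add: mult_le_cancel_left)
    qed
  qed
  show ?thesis
  proof (intro bexI[of _ "Blinfun g"] allI)
    show "Blinfun g \<in> bounded_operators"
      using bl gC by (simp add: bounded_operators_def bounded_linear_Blinfun_apply)
  qed (simp add: bl bounded_linear_Blinfun_apply g)
qed

lemma
  assumes "T \<in> bounded_operators"
  shows adj_cinner: "cinner (blinfun_apply T x) y = cinner x (blinfun_apply (adj T) (y :: 'h::complex_hilbert))"
    and adj_bounded_operators: "adj T \<in> bounded_operators"
proof -
  obtain S where S: "S \<in> bounded_operators"
    "\<And>x y. cinner (blinfun_apply T x) y = cinner x (blinfun_apply S (y :: 'h))"
    using adj_exists[OF assms] by blast
  have "adj T = S" unfolding adj_def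
  proof (rule the_equality)
    fix S' assume S': "\<forall>x y. cinner (blinfun_apply T x) y = cinner x (blinfun_apply S' (y :: 'h))"
    show "S' = S"
      by (rule blinfun_eqI, rule cinner_ext) (metis S' S(2) cinner_commute)
  qed (simp add: S)
  with S show "cinner (blinfun_apply T x) y = cinner x (blinfun_apply (adj T) (y :: 'h::complex_hilbert))"
    "adj T \<in> bounded_operators" by auto
qed

section \<open>The algebra of bounded operators\<close>

text \<open>\<open>B(H)\<close> is made a type, so that the algebraic type classes apply to it.\<close>

typedef (overloaded) 'h cop = "bounded_operators :: ('h::complex_hilbert \<Rightarrow>\<^sub>L 'h) set"
  by (rule exI[of _ 0]) (simp add: bounded_operators_def)

setup_lifting type_definition_cop

lift_definition ap :: "'h::complex_hilbert cop \<Rightarrow> 'h \<Rightarrow> 'h" (infixr "\<cdot>" 75) is blinfun_apply .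

lemma cop_eqI: "(\<And>v. x \<cdot> v = y \<cdot> v) \<Longrightarrow> x = y"
  by transfer (rule blinfun_eqI)

lemma scaleC_scaleR: "c *\<^sub>C (r *\<^sub>R x) = r *\<^sub>R (c *\<^sub>C (x :: 'h::complex_hilbert))"
  by (simp only: scaleC_of_real[symmetric] scaleC_scaleC mult.commute)

lemma scaleC_minus_right: "c *\<^sub>C (- x) = - (c *\<^sub>C (x :: 'h::complex_hilbert))"
  using scaleC_scaleR[of c "-1" x] by simp

lemma scaleC_diff_right: "c *\<^sub>C (x - y) = c *\<^sub>C x - c *\<^sub>C (y :: 'h::complex_hilbert)"
  using scaleC_add_right[of c x "-y"] by (simp add: scaleC_minus_right)

instantiation cop :: (complex_hilbert) real_normed_algebra
begin

lift_definition zero_cop :: "'a cop" is 0 by (simp add: bounded_operators_def)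
lift_definition plus_cop :: "'a cop \<Rightarrow> 'a cop \<Rightarrow> 'a cop" is "(+)"
  by (simp add: bounded_operators_def blinfun.add_left scaleC_add_right)
lift_definition minus_cop :: "'a cop \<Rightarrow> 'a cop \<Rightarrow> 'a cop" is "(-)"
  by (simp add: bounded_operators_def blinfun.diff_left scaleC_diff_right)
lift_definition uminus_cop :: "'a cop \<Rightarrow> 'a cop" is "uminus"
  by (simp add: bounded_operators_def blinfun.minus_left scaleC_minus_right)
lift_definition times_cop :: "'a cop \<Rightarrow> 'a cop \<Rightarrow> 'a cop" is "(o\<^sub>L)"
  by (simp add: bounded_operators_def)
lift_definition scaleR_cop :: "real \<Rightarrow> 'a cop \<Rightarrow> 'a cop" is "(*\<^sub>R)"
  by (simp add: bounded_operators_def blinfun.scaleR_left scaleC_scaleR)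
lift_definition norm_cop :: "'a cop \<Rightarrow> real" is norm .
lift_definition dist_cop :: "'a cop \<Rightarrow> 'a cop \<Rightarrow> real" is dist .
definition sgn_cop :: "'a cop \<Rightarrow> 'a cop" where "sgn_cop x = inverse (norm x) *\<^sub>R x"
definition uniformity_cop :: "('a cop \<times> 'a cop) filter" where
  "uniformity_cop = (INF e\<in>{0 <..}. principal {(x, y). dist x y < e})"
definition open_cop :: "'a cop set \<Rightarrow> bool" where
  "open_cop U = (\<forall>x\<in>U. \<forall>\<^sub>F (x', y) in uniformity. x' = x \<longrightarrow> y \<in> U)"

instance
proof
  fix a b c :: "'a cop" and r s :: real and U :: "'a cop set"
  show "a + b + c = a + (b + c)" "a + b = b + a" "0 + a = a" "- a + a = 0" "a - b = a + - b"
    "r *\<^sub>R (a + b) = r *\<^sub>R a + r *\<^sub>R b" "(r + s) *\<^sub>R a = r *\<^sub>R a + s *\<^sub>R a"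
    "r *\<^sub>R s *\<^sub>R a = (r * s) *\<^sub>R a" "1 *\<^sub>R a = a" "norm (a + b) \<le> norm a + norm b"
    "norm (r *\<^sub>R a) = \<bar>r\<bar> * norm a" "(norm a = 0) = (a = 0)"
    by (transfer, simp add: algebra_simps norm_triangle_ineq)+
  show "a * b * c = a * (b * c)" "(a + b) * c = a * c + b * c" "a * (b + c) = a * b + a * c"
    "r *\<^sub>R a * b = r *\<^sub>R (a * b)" "a * r *\<^sub>R b = r *\<^sub>R (a * b)"
    by (transfer, rule blinfun_eqI, simp add: blinfun.bilinear_simps)+
  show "norm (a * b) \<le> norm a * norm b" by transfer (rule norm_blinfun_compose)
  show "dist a b = norm (a - b)" by transfer (rule dist_norm)
qed (simp_all only: sgn_cop_def uniformity_cop_def open_cop_def)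

end

text \<open>The Hilbert space may be zero, and then \<open>1 = 0\<close> and
  \<open>norm 1 = 0\<close>. The unit therefore enters through \<open>monoid_mult\<close>, and
  estimates use \<open>norm 1 \<le> 1\<close>.\<close>

instantiation cop :: (complex_hilbert) monoid_mult
begin
lift_definition one_cop :: "'a cop" is id_blinfun by (simp add: bounded_operators_def)
instance
  by standard (transfer, rule blinfun_eqI, simp)+
end

lemma ap_simps [simp]:
  shows "0 \<cdot> v = 0" "1 \<cdot> v = v" "(x + y) \<cdot> v = x \<cdot> v + y \<cdot> v" "(x - y) \<cdot> v = x \<cdot> v - y \<cdot> v"
    "(- x) \<cdot> v = - (x \<cdot> v)" "(x * y) \<cdot> v = x \<cdot> (y \<cdot> v)" "(r *\<^sub>R x) \<cdot> v = r *\<^sub>R (x \<cdot> v)"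
  by (transfer, simp add: blinfun.bilinear_simps)+

lemma ap_linear [simp]:
  shows "x \<cdot> 0 = 0" "x \<cdot> (v + w) = x \<cdot> v + x \<cdot> w" "x \<cdot> (v - w) = x \<cdot> v - x \<cdot> w"
    "x \<cdot> (- v) = - (x \<cdot> v)" "x \<cdot> (r *\<^sub>R v) = r *\<^sub>R (x \<cdot> v)"
  by (transfer, simp add: blinfun.bilinear_simps)+

lemma ap_scaleC [simp]: "x \<cdot> (c *\<^sub>C v) = c *\<^sub>C (x \<cdot> v)"
  by transfer (simp add: bounded_operators_def)

lemma ap_sum: "(\<Sum>i\<in>I. f i) \<cdot> v = (\<Sum>i\<in>I. f i \<cdot> v)"
  by (induct I rule: infinite_finite_induct) simp_all

lemma norm_ap: "norm (x \<cdot> v) \<le> norm x * norm v"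
  by transfer (rule norm_blinfun)

lemma norm_cop_bound: "0 \<le> b \<Longrightarrow> (\<And>v. norm (x \<cdot> v) \<le> b * norm v) \<Longrightarrow> norm x \<le> b"
  by transfer (rule norm_blinfun_bound)

lemma bounded_linear_ap: "bounded_linear (\<lambda>v. x \<cdot> v)"
  by transfer (rule blinfun.bounded_linear_right)

lemmas tendsto_ap = bounded_linear.tendsto[OF bounded_linear_ap]

lemma norm_one_le: "norm (1 :: 'h::complex_hilbert cop) \<le> 1"
  by (rule norm_cop_bound) auto

lift_definition sc :: "complex \<Rightarrow> 'h::complex_hilbert cop" is scalar_op
  by (simp add: bounded_operators_def scalar_op.rep_eq scaleC_scaleC mult.commute)

lemma ap_sc [simp]: "sc c \<cdot> v = c *\<^sub>C v"
  by transfer (simp add: scalar_op.rep_eq)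

lemma sc_commute: "x * sc c = sc c * x"
  by (rule cop_eqI) simp

lemma sc_mult: "sc a * sc b = sc (a * b)"
  by (rule cop_eqI) (simp add: scaleC_scaleC mult.commute)

lemma sc_add: "sc a + sc b = sc (a + b)"
  by (rule cop_eqI) (simp add: scaleC_add_left)

lemma sc_of_real: "sc (of_real r) = r *\<^sub>R 1"
  by (rule cop_eqI) (simp add: scaleC_of_real)

lemma sc_one [simp]: "sc 1 = 1" and sc_zero [simp]: "sc 0 = 0"
  by (rule cop_eqI, simp)+

lift_definition star :: "'h::complex_hilbert cop \<Rightarrow> 'h cop" is adj
  by (rule adj_bounded_operators)

lemma cinner_star: "cinner (x \<cdot> v) w = cinner v (star x \<cdot> w)"
  by transfer (rule adj_cinner)

lemma cinner_star': "cinner (star x \<cdot> v) w = cinner v (x \<cdot> w)"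
proof -
  have "cinner (star x \<cdot> v) w = cnj (cinner w (star x \<cdot> v))" by (rule cinner_commute)
  also have "\<dots> = cnj (cinner (x \<cdot> w) v)" by (simp only: cinner_star)
  finally show ?thesis by (simp only: cinner_commute[symmetric])
qed

lemma star_eqI:
  assumes "\<And>v w. cinner (x \<cdot> v) w = cinner v (y \<cdot> w)"
  shows "star x = y"
proof (rule cop_eqI, rule cinner_ext)
  fix v w
  have "cinner (star x \<cdot> v) w = cnj (cinner (x \<cdot> w) v)"
    unfolding cinner_star' by (rule cinner_commute)
  also have "\<dots> = cinner (y \<cdot> v) w" unfolding assms by (rule cinner_commute[symmetric])
  finally show "cinner (star x \<cdot> v) w = cinner (y \<cdot> v) w" .
qed

lemma star_star [simp]: "star (star x) = x"
  by (rule star_eqI) (rule cinner_star')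

lemma star_mult: "star (x * y) = star y * star x"
  by (rule star_eqI) (simp add: cinner_star)

lemma star_simps [simp]:
  shows "star 0 = 0" "star 1 = 1" "star (x + y) = star x + star y" "star (x - y) = star x - star y"
    "star (- x) = - star x" "star (r *\<^sub>R x) = r *\<^sub>R star x" "star (sc c) = sc (cnj c)"
  by (rule star_eqI, simp add: cinner_star cinner_add_left cinner_add_right cinner_diff_left
      cinner_diff_right cinner_scaleR_left cinner_scaleR_right cinner_scaleC_left cinner_scaleC_right)+

lemma star_sum: "star (\<Sum>i\<in>I. f i) = (\<Sum>i\<in>I. star (f i))"
  by (induct I rule: infinite_finite_induct) simp_all

lemma star_power: "star (x ^ n) = star x ^ n"
  by (induct n) (simp_all add: star_mult power_commutes)

lemma star_eq_0 [simp]: "star x = 0 \<longleftrightarrow> x = 0"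
  by (metis star_simps(1) star_star)

lemma norm_ap_square: "(norm (x \<cdot> v))\<^sup>2 = Re (cinner ((star x * x) \<cdot> v) v)"
  by (simp add: cinner_star' Re_cinner_self)

lemma star_self_eq_0: "star x * x = 0 \<longleftrightarrow> x = 0"
proof
  assume "star x * x = 0"
  then have "norm (x \<cdot> v) ^ 2 = 0" for v by (simp only: norm_ap_square) simp
  then show "x = 0" by (intro cop_eqI) simp
qed simp

lemma norm_star_le: "norm (star x) \<le> norm x"
proof (rule norm_cop_bound)
  fix v
  have "(norm (star x \<cdot> v))\<^sup>2 = cmod (cinner (star x \<cdot> v) (star x \<cdot> v))" by (simp add: cinner_self norm_power)
  also have "\<dots> = cmod (cinner v (x \<cdot> (star x \<cdot> v)))" by (simp add: cinner_star')
  also have "\<dots> \<le> norm v * norm (x \<cdot> (star x \<cdot> v))" by (rule Cauchy_Schwarz)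
  also have "\<dots> \<le> norm v * (norm x * norm (star x \<cdot> v))" by (intro mult_left_mono norm_ap) simp
  finally have "norm (star x \<cdot> v) * norm (star x \<cdot> v) \<le> norm (star x \<cdot> v) * (norm x * norm v)"
    by (simp add: power2_eq_square algebra_simps)
  then show "norm (star x \<cdot> v) \<le> norm x * norm v"
    by (cases "star x \<cdot> v = 0") (simp_all add: mult_le_cancel_left)
qed simp

lemma norm_star [simp]: "norm (star x) = norm x"
  using norm_star_le[of x] norm_star_le[of "star x"] by simp

lemma bounded_linear_star: "bounded_linear (star :: 'h::complex_hilbert cop \<Rightarrow> 'h cop)"
  by (rule bounded_linear_intro[where K=1]) simp_all

text \<open>By polarization.\<close>

lemma norm_selfadjoint_le:
  assumes sa: "star a = a" and c: "0 \<le> c" and q: "\<And>v. \<bar>Re (cinner (a \<cdot> v) v)\<bar> \<le> c * (norm v)\<^sup>2"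
  shows "norm a \<le> c"
proof (rule norm_cop_bound[OF c])
  fix v
  show "norm (a \<cdot> v) \<le> c * norm v"
  proof (cases "a \<cdot> v = 0 \<or> v = 0")
    case True then show ?thesis using c by auto
  next
    case False
    \<comment> \<open>Scaling \<open>a \<cdot> v\<close> to the length of \<open>v\<close> makes the
      parallelogram sum equal to four times the squared norm of \<open>v\<close>, which gives the
      sharp constant \<open>c\<close>.\<close>
    define w where "w = (norm v / norm (a \<cdot> v)) *\<^sub>R (a \<cdot> v)"
    have nw: "norm w = norm v" using False by (simp add: w_def)
    have "cinner (a \<cdot> w) v = cinner w (a \<cdot> v)" by (metis cinner_star sa)
    then have sym: "Re (cinner (a \<cdot> w) v) = Re (cinner (a \<cdot> v) w)"
      by (metis cinner_commute complex_cnj(1) complex.sel(1) cnj.simps(1))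
    have "Re (cinner (a \<cdot> (v + w)) (v + w)) - Re (cinner (a \<cdot> (v - w)) (v - w)) = 4 * Re (cinner (a \<cdot> v) w)"
      by (simp add: cinner_add_left cinner_add_right cinner_diff_left cinner_diff_right sym)
    moreover have "Re (cinner (a \<cdot> (v + w)) (v + w)) - Re (cinner (a \<cdot> (v - w)) (v - w))
        \<le> c * (norm (v + w))\<^sup>2 + c * (norm (v - w))\<^sup>2"
      using q[of "v + w"] q[of "v - w"] by linarith
    moreover have "c * (norm (v + w))\<^sup>2 + c * (norm (v - w))\<^sup>2 = 4 * (c * (norm v)\<^sup>2)"
      by (simp add: norm_add_square norm_diff_square nw algebra_simps)
    ultimately have "Re (cinner (a \<cdot> v) w) \<le> c * (norm v)\<^sup>2" by linarith
    moreover have "Re (cinner (a \<cdot> v) w) = norm v * norm (a \<cdot> v)"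
      using False by (simp add: w_def cinner_scaleR_right Re_cinner_self power2_eq_square)
    ultimately have "norm v * norm (a \<cdot> v) \<le> norm v * (c * norm v)" by (simp add: power2_eq_square algebra_simps)
    then show ?thesis using False by (simp add: mult_le_cancel_left)
  qed
qed

subsection \<open>Strong limits of sequences\<close>

definition sconv :: "(nat \<Rightarrow> 'h::complex_hilbert cop) \<Rightarrow> 'h cop \<Rightarrow> bool" where
  "sconv f x \<longleftrightarrow> (\<forall>v. (\<lambda>n. f n \<cdot> v) \<longlonglongrightarrow> x \<cdot> v)"

lemma sconvD: "sconv f x \<Longrightarrow> (\<lambda>n. f n \<cdot> v) \<longlonglongrightarrow> x \<cdot> v"
  by (simp add: sconv_def)

lemma sconv_unique: "sconv f x \<Longrightarrow> sconv f y \<Longrightarrow> x = y"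
  by (meson sconvD cop_eqI LIMSEQ_unique)

lemma sconv_const: "sconv (\<lambda>_. x) x"
  by (simp add: sconv_def)

lemma sconv_add: "sconv f x \<Longrightarrow> sconv g y \<Longrightarrow> sconv (\<lambda>n. f n + g n) (x + y)"
  by (simp add: sconv_def tendsto_add)

lemma sconv_diff: "sconv f x \<Longrightarrow> sconv g y \<Longrightarrow> sconv (\<lambda>n. f n - g n) (x - y)"
  by (simp add: sconv_def tendsto_diff)

lemma sconv_mult_left: "sconv f x \<Longrightarrow> sconv (\<lambda>n. y * f n) (y * x)"
  by (simp add: sconv_def tendsto_ap)

lemma sconv_mult_right: "sconv f x \<Longrightarrow> sconv (\<lambda>n. f n * y) (x * y)"
  by (simp add: sconv_def)

text \<open>Multiplication is not jointly strongly continuous; the uniform bound on the left factors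
  controls the term \<open>f n * (g n - y)\<close>.\<close>

lemma sconv_mult:
  assumes f: "sconv f x" and b: "\<And>n. norm (f n) \<le> C" and g: "sconv g y"
  shows "sconv (\<lambda>n. f n * g n) (x * y)"
  unfolding sconv_def
proof
  fix v
  have "(\<lambda>n. C * norm ((g n - y) \<cdot> v)) \<longlonglongrightarrow> C * norm (y \<cdot> v - y \<cdot> v)"
    using sconvD[OF g, of v] by (simp only: ap_simps) (intro tendsto_intros)
  then have null: "(\<lambda>n. C * norm ((g n - y) \<cdot> v)) \<longlonglongrightarrow> 0" by (simp only: diff_self norm_zero mult_zero_right)
  have "(\<lambda>n. f n \<cdot> ((g n - y) \<cdot> v)) \<longlonglongrightarrow> 0"
  proof (rule Lim_null_comparison[OF _ null], rule always_eventually, rule allI)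
    fix n show "norm (f n \<cdot> (g n - y) \<cdot> v) \<le> C * norm ((g n - y) \<cdot> v)"
      by (rule order_trans[OF norm_ap]) (intro mult_right_mono b norm_ge_zero)
  qed
  from tendsto_add[OF this sconvD[OF f, of "y \<cdot> v"]]
  show "(\<lambda>n. (f n * g n) \<cdot> v) \<longlonglongrightarrow> (x * y) \<cdot> v" by simp
qed

lemma tendsto_sconv:
  fixes f :: "nat \<Rightarrow> 'h::complex_hilbert cop"
  assumes "f \<longlonglongrightarrow> x" shows "sconv f x"
  unfolding sconv_def
proof
  fix v :: 'h
  have "bounded_linear (\<lambda>x :: 'h cop. x \<cdot> v)"
    by (rule bounded_linear_intro[where K="norm v"]) (simp_all add: norm_ap)
  then show "(\<lambda>n. f n \<cdot> v) \<longlonglongrightarrow> x \<cdot> v"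
    using assms by (rule bounded_linear.tendsto)
qed

lemma sconv_Suc: assumes "sconv f x" shows "sconv (\<lambda>n. f (Suc n)) x"
  unfolding sconv_def
proof
  fix v show "(\<lambda>n. f (Suc n) \<cdot> v) \<longlonglongrightarrow> x \<cdot> v"
    using LIMSEQ_Suc[OF sconvD[OF assms, of v]] .
qed

text \<open>The adjoint is not strongly continuous, so convergence of the adjoints is a hypothesis;
  the two limits are matched through inner products.\<close>

lemma sconv_star:
  assumes "sconv f x" "sconv (\<lambda>n. star (f n)) y"
  shows "y = star x"
proof (rule star_eqI[symmetric])
  fix v w
  have "(\<lambda>n. cinner (f n \<cdot> v) w) \<longlonglongrightarrow> cinner (x \<cdot> v) w"
    by (intro tendsto_cinner tendsto_const sconvD assms)
  moreover have "(\<lambda>n. cinner (f n \<cdot> v) w) \<longlonglongrightarrow> cinner v (y \<cdot> w)"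
    unfolding cinner_star by (intro tendsto_cinner tendsto_const sconvD assms)
  ultimately show "cinner (x \<cdot> v) w = cinner v (y \<cdot> w)" by (rule LIMSEQ_unique)
qed

lemma sconv_exists:
  assumes c: "\<And>v. convergent (\<lambda>n. f n \<cdot> v)" and b: "\<And>n. norm (f n) \<le> C"
  shows "\<exists>x. sconv f x"
proof -
  obtain g where g: "\<And>v. (\<lambda>n. f n \<cdot> v) \<longlonglongrightarrow> g v" using c unfolding convergent_def by metis
  have gC: "g (c *\<^sub>C v) = c *\<^sub>C g v" for c v
  proof (rule LIMSEQ_unique[OF g])
    have "(\<lambda>n. sc c \<cdot> (f n \<cdot> v)) \<longlonglongrightarrow> sc c \<cdot> g v" by (intro tendsto_ap g)
    then show "(\<lambda>n. f n \<cdot> (c *\<^sub>C v)) \<longlonglongrightarrow> c *\<^sub>C g v" by simp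
  qed
  have bl: "bounded_linear g"
  proof (rule bounded_linear_intro[where K=C])
    show "g (v + w) = g v + g w" for v w
      by (rule LIMSEQ_unique[OF g]) (simp add: tendsto_add g)
    show "g (r *\<^sub>R v) = r *\<^sub>R g v" for r v
      by (rule LIMSEQ_unique[OF g]) (simp add: tendsto_scaleR g)
    show "norm (g v) \<le> norm v * C" for v
    proof (rule LIMSEQ_le_const2[OF tendsto_norm[OF g]], intro exI allI impI)
      fix n show "norm (f n \<cdot> v) \<le> norm v * C"
        using order_trans[OF norm_ap mult_right_mono[OF b norm_ge_zero]] by (simp add: mult.commute)
    qed
  qed
  have "Blinfun g \<in> bounded_operators"
    using bl gC by (simp add: bounded_operators_def bounded_linear_Blinfun_apply)
  then have "Abs_cop (Blinfun g) \<cdot> v = g v" for v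
    by (simp add: ap.rep_eq Abs_cop_inverse bounded_linear_Blinfun_apply[OF bl])
  then show ?thesis using g by (intro exI[of _ "Abs_cop (Blinfun g)"]) (simp add: sconv_def)
qed

lemma sconv_norm_le:
  assumes "sconv f x" "\<And>n. norm (f n) \<le> C"
  shows "norm x \<le> C"
proof (rule norm_cop_bound)
  show "0 \<le> C" using assms(2)[of 0] norm_ge_zero order_trans by blast
  fix v show "norm (x \<cdot> v) \<le> C * norm v"
    by (rule LIMSEQ_le_const2[OF tendsto_norm[OF sconvD[OF assms(1)]]], intro exI allI impI)
      (rule order_trans[OF norm_ap mult_right_mono[OF assms(2) norm_ge_zero]])
qed

instance cop :: (complex_hilbert) banach
proof
  fix f :: "nat \<Rightarrow> 'a cop" assume C: "Cauchy f"
  have "Cauchy (\<lambda>n. f n \<cdot> v)" for v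
  proof (rule metric_CauchyI)
    fix e :: real assume e: "e > 0"
    have "e / (norm v + 1) > 0" using e by (simp add: add_nonneg_pos)
    then obtain N where N: "\<And>m n. m \<ge> N \<Longrightarrow> n \<ge> N \<Longrightarrow> dist (f m) (f n) < e / (norm v + 1)"
      using metric_CauchyD[OF C \<open>e / (norm v + 1) > 0\<close>] by blast
    show "\<exists>M. \<forall>m\<ge>M. \<forall>n\<ge>M. dist (f m \<cdot> v) (f n \<cdot> v) < e"
    proof (intro exI[of _ N] allI impI)
      fix m n assume "m \<ge> N" "n \<ge> N"
      have "norm ((f m - f n) \<cdot> v) \<le> norm (f m - f n) * norm v" by (rule norm_ap)
      also have "\<dots> \<le> norm (f m - f n) * (norm v + 1)" by (intro mult_left_mono) auto
      also have "\<dots> < e / (norm v + 1) * (norm v + 1)"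
        using N[OF \<open>m \<ge> N\<close> \<open>n \<ge> N\<close>] by (intro mult_strict_right_mono) (auto simp: dist_norm add_nonneg_pos)
      also have "\<dots> = e" using norm_ge_zero[of v] by (simp add: add_nonneg_eq_0_iff)
      finally show "dist (f m \<cdot> v) (f n \<cdot> v) < e" by (simp add: dist_norm)
    qed
  qed
  then have cv: "\<And>v. convergent (\<lambda>n. f n \<cdot> v)" by (simp add: Cauchy_convergent)
  obtain K where K: "\<And>n. norm (f n) \<le> K" using Cauchy_Bseq[OF C] unfolding Bseq_def by blast
  obtain x where x: "sconv f x" using sconv_exists[OF cv K] by blast
  \<comment> \<open>The Cauchy estimate for \<open>f n - f m\<close> survives the strong limit in
    \<open>m\<close>, so the strong limit is also the norm limit.\<close>
  have "f \<longlonglongrightarrow> x"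
  proof (rule LIMSEQ_I)
    fix r :: real assume r: "r > 0"
    then obtain N where N: "\<And>m n. m \<ge> N \<Longrightarrow> n \<ge> N \<Longrightarrow> dist (f m) (f n) < r / 2"
      using metric_CauchyD[OF C half_gt_zero[OF r]] by blast
    have "norm (f n - x) \<le> r / 2" if "n \<ge> N" for n
    proof (rule sconv_norm_le)
      have "sconv (\<lambda>m. f (m + N)) x"
        unfolding sconv_def by (intro allI LIMSEQ_ignore_initial_segment[where f="\<lambda>n. f n \<cdot> _"] sconvD[OF x])
      then show "sconv (\<lambda>m. f n - f (m + N)) (f n - x)" by (intro sconv_diff sconv_const)
      show "norm (f n - f (m + N)) \<le> r / 2" for m
        using N[OF that, of "m + N"] by (simp add: dist_norm less_imp_le)
    qed
    then have "norm (f n - x) < r" if "n \<ge> N" for n using r that by fastforce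
    then show "\<exists>no. \<forall>n\<ge>no. norm (f n - x) < r" by blast
  qed
  then show "convergent f" by (rule convergentI)
qed

subsection \<open>Strongly closed algebras\<close>

text \<open>Closed under real polynomials and sequential strong limits, hence norm limits. Adjoints
  are left out so that the commutant of a single operator qualifies, which yields
  \<open>gens_commute\<close>.\<close>

definition salg :: "'h::complex_hilbert cop set \<Rightarrow> bool" where
  "salg N \<longleftrightarrow> 1 \<in> N \<and> (\<forall>x\<in>N. \<forall>y\<in>N. x + y \<in> N \<and> x * y \<in> N) \<and> (\<forall>r. \<forall>x\<in>N. r *\<^sub>R x \<in> N) \<and>
     (\<forall>f x. (\<forall>n. f n \<in> N) \<longrightarrow> sconv f x \<longrightarrow> x \<in> N)"

text \<open>The last clause is closedness in the strong operator topology, phrased with basic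
  neighbourhoods: finitely many vectors and a tolerance.\<close>

definition vna :: "'h::complex_hilbert cop set \<Rightarrow> bool" where
  "vna N \<longleftrightarrow> 1 \<in> N \<and> (\<forall>x\<in>N. \<forall>y\<in>N. x + y \<in> N \<and> x * y \<in> N) \<and> (\<forall>c. \<forall>x\<in>N. sc c * x \<in> N) \<and>
     (\<forall>x\<in>N. star x \<in> N) \<and>
     (\<forall>x. (\<forall>F e. finite F \<longrightarrow> e > 0 \<longrightarrow> (\<exists>y\<in>N. \<forall>v\<in>F. norm (x \<cdot> v - y \<cdot> v) < e)) \<longrightarrow> x \<in> N)"

lemma salgD:
  assumes "salg N"
  shows "1 \<in> N" "x \<in> N \<Longrightarrow> y \<in> N \<Longrightarrow> x + y \<in> N" "x \<in> N \<Longrightarrow> y \<in> N \<Longrightarrow> x * y \<in> N"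
    "x \<in> N \<Longrightarrow> r *\<^sub>R x \<in> N" "(\<And>n. f n \<in> N) \<Longrightarrow> sconv f x \<Longrightarrow> x \<in> N"
  using assms unfolding salg_def by blast+

lemma salg_closed:
  assumes "salg N"
  shows "x \<in> N \<Longrightarrow> - x \<in> N" "x \<in> N \<Longrightarrow> y \<in> N \<Longrightarrow> x - y \<in> N" "0 \<in> N" "x \<in> N \<Longrightarrow> x ^ n \<in> N"
proof -
  show m: "- x \<in> N" if "x \<in> N" for x using salgD(4)[OF assms that, of "-1"] by simp
  show "x - y \<in> N" if "x \<in> N" "y \<in> N" using salgD(2)[OF assms that(1) m[OF that(2)]] by simp
  show "0 \<in> N" using salgD(4)[OF assms salgD(1)[OF assms], of 0] by simp
  show "x ^ n \<in> N" if "x \<in> N" by (induct n) (use that salgD[OF assms] in auto)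
qed

lemma salg_sum: "salg N \<Longrightarrow> (\<And>i. i \<in> I \<Longrightarrow> f i \<in> N) \<Longrightarrow> (\<Sum>i\<in>I. f i) \<in> N"
  by (induct I rule: infinite_finite_induct) (auto intro: salgD(2) salg_closed(3))

lemma salg_limit: "salg N \<Longrightarrow> (\<And>n. f n \<in> N) \<Longrightarrow> f \<longlonglongrightarrow> x \<Longrightarrow> x \<in> N"
  using salgD(5) tendsto_sconv by blast

lemma salg_commutant: "salg {x. x * t = t * x}"
proof -
  have "x * y * t = t * (x * y)" if "x * t = t * x" "y * t = t * y" for x y
    by (metis that mult.assoc)
  moreover have "x * t = t * x" if *: "\<forall>n. f n * t = t * f n" and f: "sconv f x" for f x
  proof -
    have "sconv (\<lambda>n. t * f n) (x * t)" using sconv_mult_right[OF f, of t] * by simp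
    then show "x * t = t * x" using sconv_mult_left[OF f] sconv_unique by blast
  qed
  ultimately show ?thesis
    unfolding salg_def by (simp add: distrib_left distrib_right)
qed

lemma vnaD:
  assumes "vna N"
  shows "1 \<in> N" "x \<in> N \<Longrightarrow> y \<in> N \<Longrightarrow> x + y \<in> N" "x \<in> N \<Longrightarrow> y \<in> N \<Longrightarrow> x * y \<in> N"
    "x \<in> N \<Longrightarrow> sc c * x \<in> N" "x \<in> N \<Longrightarrow> star x \<in> N"
    "(\<And>F e. finite F \<Longrightarrow> e > 0 \<Longrightarrow> \<exists>y\<in>N. \<forall>v\<in>F. norm (x \<cdot> v - y \<cdot> v) < e) \<Longrightarrow> x \<in> N"
  using assms unfolding vna_def by blast+

lemma vna_salg: assumes "vna N" shows "salg N"
  unfolding salg_def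
proof (intro conjI ballI allI impI)
  fix r x assume "x \<in> N"
  then have "sc (of_real r) * x \<in> N" by (rule vnaD[OF assms])
  then show "r *\<^sub>R x \<in> N" by (simp add: sc_of_real)
next
  fix f x assume f: "\<forall>n. f n \<in> N" and x: "sconv f x"
  show "x \<in> N"
  proof (rule vnaD(6)[OF assms])
    fix F :: "'a set" and e :: real assume F: "finite F" and e: "e > 0"
    have "\<forall>\<^sub>F n in sequentially. \<forall>v\<in>F. norm (f n \<cdot> v - x \<cdot> v) < e"
      using F e tendstoD[OF sconvD[OF x]] by (intro eventually_ball_finite) (auto simp: dist_norm)
    then obtain n where "\<forall>v\<in>F. norm (f n \<cdot> v - x \<cdot> v) < e" by (auto simp: eventually_sequentially)
    then show "\<exists>y\<in>N. \<forall>v\<in>F. norm (x \<cdot> v - y \<cdot> v) < e"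
      using f by (intro bexI[of _ "f n"]) (auto simp: norm_minus_commute)
  qed
qed (use vnaD[OF assms] in auto)

text \<open>A Hahn--Banach separation for strongly closed subspaces: the functional is read off the
  orthogonal complement in a finite direct sum of copies of the Hilbert space.\<close>

lemma vna_separation:
  assumes N: "vna N" and x: "x \<notin> N"
  shows "\<exists>n xs us. (\<forall>y\<in>N. (\<Sum>i<n. cinner (y \<cdot> xs i) (us i)) = 0) \<and> (\<Sum>i<(n::nat). cinner (x \<cdot> xs i) (us i)) \<noteq> 0"
proof -
  obtain F e where F: "finite F" and e: "e > 0" and ne: "\<not> (\<exists>y\<in>N. \<forall>v\<in>F. norm (x \<cdot> v - y \<cdot> v) < e)"
    using vnaD(6)[OF N] x by blast
  obtain n xs where xs: "F = xs ` {i. i < (n::nat)}" using finite_imp_nat_seg_image_inj_on[OF F] by auto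
  define V where "V = {\<lambda>i. y \<cdot> xs i | y. y \<in> N}"
  have "\<exists>z s. (\<forall>k. s k \<in> V) \<and> (\<forall>i<n. (\<lambda>k. s k i) \<longlonglongrightarrow> z i) \<and>
    (\<forall>v\<in>V. (\<Sum>i<n. cinner (v i) (x \<cdot> xs i - z i)) = 0)"
  proof (rule projection_tuple)
    show "(\<lambda>i. 1 \<cdot> xs i) \<in> V" unfolding V_def using vnaD(1)[OF N] by blast
    show "(\<lambda>i. v i + w i) \<in> V" if "v \<in> V" "w \<in> V" for v w
    proof -
      obtain y y' where y: "y \<in> N" "v = (\<lambda>i. y \<cdot> xs i)" "y' \<in> N" "w = (\<lambda>i. y' \<cdot> xs i)"
        using \<open>v \<in> V\<close> \<open>w \<in> V\<close> unfolding V_def by auto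
      have "(\<lambda>i. (y + y') \<cdot> xs i) \<in> V" unfolding V_def using vnaD(2)[OF N y(1,3)] by blast
      then show ?thesis using y(2,4) by simp
    qed
    show "(\<lambda>i. c *\<^sub>C v i) \<in> V" if "v \<in> V" for c v
    proof -
      obtain y where y: "y \<in> N" "v = (\<lambda>i. y \<cdot> xs i)" using \<open>v \<in> V\<close> unfolding V_def by auto
      have "(\<lambda>i. (sc c * y) \<cdot> xs i) \<in> V" unfolding V_def using vnaD(4)[OF N y(1)] by blast
      then show ?thesis using y(2) by simp
    qed
  qed
  then obtain z s where s: "\<And>k. s k \<in> V" and z: "\<And>i. i < n \<Longrightarrow> (\<lambda>k. s k i) \<longlonglongrightarrow> z i"
    and orth: "\<And>v. v \<in> V \<Longrightarrow> (\<Sum>i<n. cinner (v i) (x \<cdot> xs i - z i)) = 0" by blast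
  define us where "us = (\<lambda>i. x \<cdot> xs i - z i)"
  have 1: "(\<Sum>i<n. cinner (y \<cdot> xs i) (us i)) = 0" if "y \<in> N" for y
    unfolding us_def by (rule orth[of "\<lambda>i. y \<cdot> xs i"]) (use that in \<open>auto simp: V_def\<close>)
  have 2: "(\<Sum>i<n. cinner (z i) (us i)) = 0"
  proof -
    have "(\<lambda>k. \<Sum>i<n. cinner (s k i) (us i)) \<longlonglongrightarrow> (\<Sum>i<n. cinner (z i) (us i))"
      by (intro tendsto_sum tendsto_cinner z tendsto_const) simp
    then show ?thesis using orth[OF s] unfolding us_def by (simp add: LIMSEQ_const_iff)
  qed
  \<comment> \<open>If this vanished, all \<open>us i\<close> would be 0, and tuples from the orbit
    under \<open>N\<close> would approach the tuple of the \<open>x \<cdot> xs i\<close>, against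
    the choice of \<open>F\<close> and \<open>e\<close>.\<close>
  have "(\<Sum>i<n. cinner (x \<cdot> xs i) (us i)) \<noteq> 0"
  proof
    assume "(\<Sum>i<n. cinner (x \<cdot> xs i) (us i)) = 0"
    then have "(\<Sum>i<n. cinner (us i) (us i)) = 0"
      using 2 unfolding us_def by (simp add: cinner_diff_left sum_subtractf)
    then have "complex_of_real (\<Sum>i<n. (norm (us i))\<^sup>2) = 0" by (simp add: cinner_self)
    then have "(\<Sum>i<n. (norm (us i))\<^sup>2) = 0" by (simp only: of_real_eq_0_iff)
    then have us0: "us i = 0" if "i < n" for i using that by (simp add: sum_nonneg_eq_0_iff)
    have "\<forall>\<^sub>F k in sequentially. \<forall>i\<in>{..<n}. norm (s k i - x \<cdot> xs i) < e"
    proof (intro eventually_ball_finite ballI)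
      fix i assume "i \<in> {..<n}"
      then show "\<forall>\<^sub>F k in sequentially. norm (s k i - x \<cdot> xs i) < e"
        using tendstoD[OF z e, of i] us0[of i] by (simp add: us_def dist_norm)
    qed simp
    then obtain k where k: "\<And>i. i < n \<Longrightarrow> norm (s k i - x \<cdot> xs i) < e"
      by (auto simp: eventually_sequentially)
    have "\<exists>y. s k = (\<lambda>i. y \<cdot> xs i) \<and> y \<in> N" using s[of k] unfolding V_def by (rule CollectD)
    then obtain y where y: "y \<in> N" "s k = (\<lambda>i. y \<cdot> xs i)" by (elim exE conjE)
    have "norm (x \<cdot> v - y \<cdot> v) < e" if "v \<in> F" for v
    proof -
      have "v \<in> xs ` {i. i < n}" using that xs by simp
      then obtain i where "i < n" "v = xs i" by auto
      then show ?thesis using k[of i] y(2) by (simp add: norm_minus_commute)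
    qed
    then show False using ne y(1) by blast
  qed
  then have "(\<forall>y\<in>N. (\<Sum>i<n. cinner (y \<cdot> xs i) (us i)) = 0) \<and> (\<Sum>i<n. cinner (x \<cdot> xs i) (us i)) \<noteq> 0"
    using 1 by simp
  then show ?thesis
    apply -
    apply (rule exI[where x=n])
    apply (rule exI[where x=xs])
    apply (rule exI[where x=us])
    apply assumption
    done
qed

section \<open>Functional calculus\<close>

text \<open>Quantifying over all such algebras lets one construction be used in \<open>M\<close>, in
  the masa, in a commutant and in the unknown \<open>N\<close> of a generation argument.\<close>

definition gens :: "'h::complex_hilbert cop \<Rightarrow> 'h cop \<Rightarrow> bool" where
  "gens a x \<longleftrightarrow> (\<forall>N. salg N \<longrightarrow> a \<in> N \<longrightarrow> x \<in> N)"

definition proj :: "'h::complex_hilbert cop \<Rightarrow> bool" where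
  "proj e \<longleftrightarrow> star e = e \<and> e * e = e"

lemma sconv_const_iff: "sconv (\<lambda>_. x) y \<longleftrightarrow> y = x"
  using sconv_const sconv_unique by blast

lemma gensD: "gens a x \<Longrightarrow> salg N \<Longrightarrow> a \<in> N \<Longrightarrow> x \<in> N"
  by (simp add: gens_def)

lemma gens_trans: "gens a b \<Longrightarrow> gens b c \<Longrightarrow> gens a c"
  by (simp add: gens_def)

lemma gens_commute: "gens a x \<Longrightarrow> t * a = a * t \<Longrightarrow> t * x = x * t"
  using gensD[OF _ salg_commutant[of t], of a x] by simp

lemma projD: "proj e \<Longrightarrow> star e = e" "proj e \<Longrightarrow> e * e = e"
  by (simp_all add: proj_def)

lemma proj_complement: "proj e \<Longrightarrow> proj (1 - e)"
  by (simp add: proj_def algebra_simps)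

lemma proj_cinner: "proj e \<Longrightarrow> Re (cinner (e \<cdot> v) v) = (norm (e \<cdot> v))\<^sup>2"
  by (metis cinner_star projD(1) ap_simps(6) projD(2) Re_cinner_self)

lemma norm_proj_ap: "proj e \<Longrightarrow> norm (e \<cdot> v) \<le> norm v"
proof -
  assume e: "proj e"
  have "(norm (e \<cdot> v))\<^sup>2 = Re (cinner (e \<cdot> v) v)" by (simp add: proj_cinner e)
  also have "\<dots> \<le> norm (e \<cdot> v) * norm v" using Cauchy_Schwarz complex_Re_le_cmod order_trans by blast
  finally show ?thesis
    by (cases "e \<cdot> v = 0") (simp_all add: power2_eq_square mult_le_cancel_left)
qed

lemma proj_compress: "proj e \<Longrightarrow> cinner ((e * x * e) \<cdot> v) v = cinner (x \<cdot> (e \<cdot> v)) (e \<cdot> v)"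
  by (simp add: cinner_star[of e] projD)

text \<open>The fixed point equation \<open>r = (x + r * r) / 2\<close> says that
  \<open>1 - r\<close> is a square root of \<open>1 - x\<close>. The iterates of 0 are polynomials
  in \<open>x\<close>, and they are dominated by the scalar iteration for \<open>x = 1\<close>,
  which increases and stays below 1; this includes the boundary case
  \<open>norm x = 1\<close>.\<close>

lemma sqrt_one_minus:
  fixes x :: "'h::complex_hilbert cop"
  assumes x: "norm x \<le> 1"
  shows "\<exists>r. gens x r \<and> norm r \<le> 1 \<and> (1 - r) * (1 - r) = 1 - x \<and> (star x = x \<longrightarrow> star r = r)"
proof -
  define R where "R = rec_nat 0 (\<lambda>_ r. (1/2) *\<^sub>R (x + r * r))"
  define s where "s = rec_nat 0 (\<lambda>_ r. (1/2) * (1 + r * r :: real))"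
  have R0: "R 0 = 0" and RS: "\<And>n. R (Suc n) = (1/2) *\<^sub>R (x + R n * R n)" by (simp_all add: R_def)
  have s0: "s 0 = 0" and sS: "\<And>n. s (Suc n) = (1/2) * (1 + s n * s n)" by (simp_all add: s_def)
  have s01: "0 \<le> s n \<and> s n \<le> 1" for n
  proof (induct n)
    case (Suc n)
    then have "s n * s n \<le> 1 * 1" by (intro mult_mono) auto
    then show ?case using Suc by (simp add: sS)
  qed (simp add: s0)
  have Rs: "norm (R n) \<le> s n" for n
  proof (induct n)
    case (Suc n)
    have "norm (R n * R n) \<le> s n * s n"
      by (rule order_trans[OF norm_mult_ineq mult_mono[OF Suc Suc]]) (use s01 in auto)
    then have "norm (x + R n * R n) \<le> 1 + s n * s n"
      using x by (intro order_trans[OF norm_triangle_ineq] add_mono)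
    then show ?case by (simp add: RS sS)
  qed (simp add: R0 s0)
  \<comment> \<open>An increment of \<open>R\<close> is half of
    \<open>R (Suc n) * d + d * R n\<close>, with \<open>d\<close> the previous increment. The scalar
    recursion has the same shape, so the bound propagates.\<close>
  have step: "norm (R (Suc n) - R n) \<le> s (Suc n) - s n" for n
  proof (induct n)
    case 0 then show ?case using x by (simp add: RS sS R0 s0)
  next
    case (Suc n)
    have "norm (R (Suc n) * (R (Suc n) - R n) + (R (Suc n) - R n) * R n)
      \<le> s (Suc n) * (s (Suc n) - s n) + (s (Suc n) - s n) * s n"
    proof (rule order_trans[OF norm_triangle_ineq add_mono])
      show "norm (R (Suc n) * (R (Suc n) - R n)) \<le> s (Suc n) * (s (Suc n) - s n)"
        by (rule order_trans[OF norm_mult_ineq mult_mono[OF Rs Suc]]) (use s01 in auto)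
      show "norm ((R (Suc n) - R n) * R n) \<le> (s (Suc n) - s n) * s n"
        by (rule order_trans[OF norm_mult_ineq mult_mono[OF Suc Rs]]) (use s01 order_trans[OF norm_ge_zero Suc] in auto)
    qed
    moreover have "R (Suc (Suc n)) - R (Suc n) = (1/2) *\<^sub>R (R (Suc n) * (R (Suc n) - R n) + (R (Suc n) - R n) * R n)"
      unfolding RS[of "Suc n"] by (subst (3) RS) (simp add: algebra_simps)
    moreover have "s (Suc (Suc n)) - s (Suc n) = (1/2) * (s (Suc n) * (s (Suc n) - s n) + (s (Suc n) - s n) * s n)"
      unfolding sS[of "Suc n"] by (subst (3) sS) (simp add: algebra_simps)
    ultimately show ?case by simp
  qed
  have dist: "norm (R (n + k) - R n) \<le> s (n + k) - s n" for n k
  proof (induct k)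
    case (Suc k)
    have "norm (R (n + Suc k) - R n) \<le> norm (R (Suc (n + k)) - R (n + k)) + norm (R (n + k) - R n)"
      using norm_triangle_ineq[of "R (Suc (n + k)) - R (n + k)" "R (n + k) - R n"] by simp
    also have "\<dots> \<le> s (n + Suc k) - s n" using step[of "n + k"] Suc by simp
    finally show ?case .
  qed simp
  have "incseq s"
    by (rule incseq_SucI) (use order_trans[OF norm_ge_zero step] in simp)
  then have "convergent s" using s01 by (intro Bseq_mono_convergent BseqI') (auto simp: incseq_def)
  then have "Cauchy s" by (rule convergent_Cauchy)
  have "Cauchy R"
  proof (rule CauchyI')
    fix e :: real assume "e > 0"
    then obtain K where K: "\<And>m n. m \<ge> K \<Longrightarrow> n \<ge> K \<Longrightarrow> norm (s m - s n) < e"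
      using CauchyD[OF \<open>Cauchy s\<close>] by blast
    have "norm (R m - R n) < e" if "m \<ge> K" "n > m" for m n
    proof -
      have "norm (R n - R m) \<le> s n - s m" using dist[of m "n - m"] that by simp
      also have "\<dots> < e" using K[of n m] that by simp
      finally show ?thesis by (simp add: norm_minus_commute)
    qed
    then show "\<exists>M. \<forall>m\<ge>M. \<forall>n>m. dist (R m) (R n) < e" unfolding dist_norm by blast
  qed
  then obtain r where r: "R \<longlonglongrightarrow> r" using Cauchy_convergent convergent_def by blast
  have "(\<lambda>n. R (Suc n)) \<longlonglongrightarrow> (1/2) *\<^sub>R (x + r * r)"
    unfolding RS by (intro tendsto_scaleR tendsto_add tendsto_mult tendsto_const r)
  then have rr: "r = (1/2) *\<^sub>R (x + r * r)" using LIMSEQ_unique LIMSEQ_Suc[OF r] by blast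
  have "2 *\<^sub>R r = 2 *\<^sub>R ((1/2) *\<^sub>R (x + r * r))" using rr by simp
  then have "r + r = x + r * r" by (simp add: scaleR_2[symmetric])
  then have eq: "(1 - r) * (1 - r) = 1 - x" by (simp add: algebra_simps)
  have "gens x r" unfolding gens_def
  proof (intro allI impI)
    fix N assume N: "salg N" "x \<in> N"
    have "R n \<in> N" for n by (induct n) (use N in \<open>auto simp: R0 RS intro: salgD(2-4) salg_closed(3)\<close>)
    then show "r \<in> N" using salg_limit[OF N(1) _ r] by blast
  qed
  moreover have "norm r \<le> 1"
    by (rule LIMSEQ_le_const2[OF tendsto_norm[OF r]]) (use order_trans[OF Rs] s01 in blast)
  moreover have "star r = r" if "star x = x"
  proof -
    have "star (R n) = R n" for n by (induct n) (simp_all add: R0 RS star_mult that)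
    then have "R \<longlonglongrightarrow> star r" using bounded_linear.tendsto[OF bounded_linear_star r] by simp
    then show ?thesis using r LIMSEQ_unique by blast
  qed
  ultimately show ?thesis using eq by blast
qed

lemma norm_power_le: "norm ((x :: 'h::complex_hilbert cop) ^ n) \<le> norm x ^ n"
proof (induct n)
  case (Suc n)
  show ?case using order_trans[OF norm_mult_ineq mult_left_mono[OF Suc norm_ge_zero]] by simp
qed (simp add: norm_one_le)

lemma neumann_inverse:
  fixes b :: "'h::complex_hilbert cop"
  assumes b: "norm (1 - b) < 1"
  shows "\<exists>g. gens b g \<and> g * b = 1 \<and> b * g = 1 \<and> (star b = b \<longrightarrow> star g = g)"
proof -
  define x where "x = 1 - b"
  have sm: "summable (\<lambda>n. x ^ n)"
  proof (rule summable_comparison_test'[where N=0])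
    show "summable (\<lambda>n. norm x ^ n)" using b by (simp add: x_def summable_geometric)
  qed (rule norm_power_le)
  define g where "g = (\<Sum>n. x ^ n)"
  have "g = (\<Sum>n. x ^ Suc n) + x ^ 0" unfolding g_def by (rule suminf_split_head[OF sm, THEN eq_diff_eq[THEN iffD1], symmetric])
  then have g1: "g = (\<Sum>n. x ^ Suc n) + 1" by simp
  have "(\<Sum>n. x ^ Suc n) = x * g" unfolding g_def using suminf_mult[OF sm, of x] by simp
  with g1 have bg: "b * g = 1" by (simp add: x_def algebra_simps)
  have "(\<Sum>n. x ^ Suc n) = g * x" unfolding g_def power_Suc2 using suminf_mult2[OF sm, of x] by simp
  with g1 have gb: "g * b = 1" by (simp add: x_def algebra_simps)
  have "gens b g" unfolding gens_def
  proof (intro allI impI)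
    fix N assume N: "salg N" "b \<in> N"
    have "x ^ n \<in> N" for n unfolding x_def using N by (intro salg_closed(4) salg_closed(2) salgD(1))
    then have "(\<Sum>i<n. x ^ i) \<in> N" for n by (intro salg_sum N)
    then show "g \<in> N" using salg_limit[OF N(1) _ summable_LIMSEQ[OF sm]] unfolding g_def by blast
  qed
  moreover have "star g = g" if "star b = b"
  proof -
    have "star g * b = 1" using bg that by (metis star_mult star_simps(2))
    then show ?thesis by (metis bg mult.assoc mult_1_left mult_1_right)
  qed
  ultimately show ?thesis using bg gb by blast
qed

text \<open>\<open>q * q\<close> is a positive contraction, and its powers converge strongly to the
  projection onto its fixed vectors; convergence comes from the monotonicity of the norms of
  \<open>q ^ k \<cdot> v\<close>.\<close>

lemma power_limit_proj:
  fixes q :: "'h::complex_hilbert cop"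
  assumes sa: "star q = q" and q: "norm q \<le> 1"
  shows "\<exists>f. sconv (\<lambda>n. (q * q) ^ n) f \<and> proj f \<and> q * q * f = f"
proof -
  define c where "c = q * q"
  have cq: "c ^ n = q ^ (2 * n)" for n by (simp add: c_def power_mult power2_eq_square)
  have sq: "star (q ^ n) = q ^ n" for n by (simp add: star_power sa)
  have nc: "norm (c ^ n) \<le> 1" for n
    unfolding cq by (rule order_trans[OF norm_power_le]) (simp add: q power_le_one)
  have "convergent (\<lambda>n. c ^ n \<cdot> v)" for v
  proof -
    define t where "t = (\<lambda>k. (norm (q ^ k \<cdot> v))\<^sup>2)"
    have "t (Suc k) \<le> t k" for k
    proof -
      have "norm (q \<cdot> (q ^ k \<cdot> v)) \<le> 1 * norm (q ^ k \<cdot> v)"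
        using order_trans[OF norm_ap mult_right_mono[OF q norm_ge_zero]] .
      then show ?thesis unfolding t_def by (intro power_mono) auto
    qed
    then have "decseq t" by (rule decseq_SucI)
    then have "Bseq t" unfolding t_def by (intro decseq_bounded[of _ 0]) auto
    then have "convergent t" using decseq_imp_monoseq[OF \<open>decseq t\<close>] by (rule Bseq_monoseq_convergent)
    then have Ct: "Cauchy t" by (rule convergent_Cauchy)
    \<comment> \<open>As \<open>q\<close> is self-adjoint, a mixed inner product depends only on the
      sum of the exponents, so distances are expressed by the decreasing sequence
      \<open>t\<close>.\<close>
    have eq: "(norm (c ^ n \<cdot> v - c ^ m \<cdot> v))\<^sup>2 = t (2 * n) - 2 * t (n + m) + t (2 * m)" for n m
    proof -
      have "cinner (c ^ n \<cdot> v) (c ^ m \<cdot> v) = cinner (q ^ m \<cdot> q ^ m \<cdot> q ^ n \<cdot> q ^ n \<cdot> v) v"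
        unfolding cq mult_2 power_add by (simp add: cinner_star sq)
      also have "\<dots> = cinner (q ^ (n + m) \<cdot> v) (q ^ (n + m) \<cdot> v)"
      proof -
        have "q ^ m * (q ^ m * (q ^ n * q ^ n)) = q ^ (n + m) * q ^ (n + m)"
          by (simp only: power_add[symmetric]) (simp add: ac_simps)
        then have "q ^ m \<cdot> q ^ m \<cdot> q ^ n \<cdot> q ^ n \<cdot> v = q ^ (n + m) \<cdot> q ^ (n + m) \<cdot> v"
          by (metis ap_simps(6))
        then show ?thesis by (simp add: cinner_star sq)
      qed
      finally show ?thesis unfolding norm_diff_square by (simp add: t_def cq Re_cinner_self)
    qed
    have "Cauchy (\<lambda>n. c ^ n \<cdot> v)"
    proof (rule CauchyI)
      fix e :: real assume e: "e > 0"
      then have "e\<^sup>2 / 2 > 0" by simp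
      then obtain K where K: "\<And>m n. m \<ge> K \<Longrightarrow> n \<ge> K \<Longrightarrow> norm (t m - t n) < e\<^sup>2 / 2"
        using CauchyD[OF Ct] by blast
      have "norm (c ^ m \<cdot> v - c ^ n \<cdot> v) < e" if "m \<ge> K" "n \<ge> K" for m n
      proof -
        have "\<bar>t (2 * m) - t (m + n)\<bar> < e\<^sup>2 / 2" "\<bar>t (2 * n) - t (m + n)\<bar> < e\<^sup>2 / 2"
          using K[of "2 * m" "m + n"] K[of "2 * n" "m + n"] that by auto
        then have "(norm (c ^ m \<cdot> v - c ^ n \<cdot> v))\<^sup>2 < e\<^sup>2" unfolding eq by linarith
        then show ?thesis using e by (simp add: power_less_imp_less_base)
      qed
      then show "\<exists>M. \<forall>m\<ge>M. \<forall>n\<ge>M. norm (c ^ m \<cdot> v - c ^ n \<cdot> v) < e" by blast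
    qed
    then show ?thesis by (rule Cauchy_convergent)
  qed
  then obtain f where f: "sconv (\<lambda>n. c ^ n) f" using sconv_exists nc by blast
  have "star c = c" by (simp add: c_def star_mult sa)
  then have sf: "star f = f" using sconv_star[OF f] f by (simp add: star_power)
  have cf: "c * f = f"
    using sconv_unique[OF sconv_mult_left[OF f, of c] sconv_Suc[OF f, unfolded power_Suc]] .
  have "c ^ n * f = f" for n by (induct n) (simp_all add: cf mult.assoc)
  then have "f * f = f" using sconv_mult_right[OF f, of f] by (simp add: sconv_const_iff)
  then show ?thesis using f sf cf unfolding c_def proj_def by blast
qed

lemma ap_eq_0_of_square: "star p = p \<Longrightarrow> (p * p) * f = 0 \<Longrightarrow> p * f = (0 :: 'h::complex_hilbert cop)"
  by (metis star_mult mult.assoc mult_zero_right star_self_eq_0)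

text \<open>\<open>e\<close> is the range projection of the positive part of \<open>a - l\<close>,
  that is, the spectral projection of \<open>a\<close> for values above \<open>l\<close>. Roots and
  strong limits of powers are enough to produce it, so it is generated by \<open>a\<close> in the
  sense of \<open>gens\<close>.\<close>

lemma spectral_projection:
  fixes a :: "'h::complex_hilbert cop"
  assumes sa: "star a = a"
  shows "\<exists>e. gens a e \<and> proj e \<and> (\<forall>v. l * Re (cinner (e \<cdot> v) v) \<le> Re (cinner ((a * e) \<cdot> v) v)) \<and>
    (\<forall>v. Re (cinner ((a * (1 - e)) \<cdot> v) v) \<le> l * Re (cinner ((1 - e) \<cdot> v) v))"
proof -
  define c where "c = norm a + \<bar>l\<bar> + 1"
  have c: "c > 0" unfolding c_def by (simp add: add_nonneg_pos)
  define b where "b = (1/c) *\<^sub>R (a - l *\<^sub>R 1)"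
  have sb: "star b = b" by (simp add: b_def sa)
  have "norm (a - l *\<^sub>R 1) \<le> norm a + norm (l *\<^sub>R (1 :: 'h cop))" by (rule norm_triangle_ineq4)
  also have "\<dots> \<le> c" using mult_left_mono[OF norm_one_le[where 'h='h] abs_ge_zero, of l] unfolding c_def norm_scaleR by linarith
  finally have nb: "norm b \<le> 1" using c by (simp add: b_def)
  have contr: "norm (1 - y * y) \<le> 1" if "star y = y" "norm y \<le> 1" for y :: "'h cop"
  proof (rule norm_selfadjoint_le)
    fix v
    have "Re (cinner ((1 - y * y) \<cdot> v) v) = (norm v)\<^sup>2 - (norm (y \<cdot> v))\<^sup>2"
      using norm_ap_square[of y v] by (simp add: that(1) cinner_diff_left Re_cinner_self)
    moreover have "norm (y \<cdot> v) \<le> 1 * norm v" using order_trans[OF norm_ap mult_right_mono[OF that(2) norm_ge_zero]] .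
    then have "(norm (y \<cdot> v))\<^sup>2 \<le> (norm v)\<^sup>2" by (intro power_mono) auto
    ultimately show "\<bar>Re (cinner ((1 - y * y) \<cdot> v) v)\<bar> \<le> 1 * (norm v)\<^sup>2" by simp
  qed (simp_all add: star_mult that)
  obtain r where r: "gens (1 - b * b) r" "norm r \<le> 1" "(1 - r) * (1 - r) = b * b" "star r = r"
    using sqrt_one_minus[OF contr[OF sb nb]] by (auto simp: star_mult sb)
  define m where "m = 1 - r"
  have mm: "m * m = b * b" and sm: "star m = m" using r by (simp_all add: m_def)
  have mpos: "0 \<le> Re (cinner (m \<cdot> v) v)" for v
  proof -
    have "Re (cinner (r \<cdot> v) v) \<le> norm (r \<cdot> v) * norm v" using Cauchy_Schwarz complex_Re_le_cmod order_trans by blast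
    also have "\<dots> \<le> (1 * norm v) * norm v"
      by (intro mult_right_mono order_trans[OF norm_ap mult_right_mono[OF r(2) norm_ge_zero]]) simp
    finally show ?thesis by (simp add: m_def cinner_diff_left Re_cinner_self power2_eq_square)
  qed
  have "b * r = r * b" by (rule gens_commute[OF r(1)]) (simp add: algebra_simps)
  then have bm: "b * m = m * b" by (simp add: m_def algebra_simps)
  \<comment> \<open>\<open>m\<close> is the absolute value of \<open>b\<close>, so these are the
    positive and negative parts of \<open>b\<close>.\<close>
  define p n where "p = (1/2) *\<^sub>R (m + b)" and "n = (1/2) *\<^sub>R (m - b)"
  have sp: "star p = p" and sn: "star n = n" by (simp_all add: p_def n_def sm sb)
  have pn: "p * n = 0" by (simp add: p_def n_def algebra_simps mm bm)
  then have np: "n * p = 0" by (metis sn sp star_mult star_simps(1))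
  have m_eq: "m = p + n" by (simp add: p_def n_def algebra_simps flip: scaleR_2 scaleR_left.add)
  have b_eq: "b = p - n" by (simp add: p_def n_def algebra_simps flip: scaleR_2 scaleR_left.add)
  have "norm m \<le> 1"
  proof (rule norm_selfadjoint_le[OF sm])
    fix v
    have "(norm (m \<cdot> v))\<^sup>2 = (norm (b \<cdot> v))\<^sup>2" unfolding norm_ap_square by (simp only: sm sb mm)
    then have "norm (m \<cdot> v) = norm (b \<cdot> v)" by simp
    also have "\<dots> \<le> 1 * norm v" using order_trans[OF norm_ap mult_right_mono[OF nb norm_ge_zero]] .
    finally have "norm (m \<cdot> v) * norm v \<le> 1 * (norm v)\<^sup>2" by (simp add: power2_eq_square mult_right_mono)
    then show "\<bar>Re (cinner (m \<cdot> v) v)\<bar> \<le> 1 * (norm v)\<^sup>2"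
      using Cauchy_Schwarz[of "m \<cdot> v" v] abs_Re_le_cmod[of "cinner (m \<cdot> v) v"] by linarith
  qed simp
  then have "norm p \<le> 1" using nb norm_triangle_ineq[of m b] by (simp add: p_def)
  \<comment> \<open>The fixed vectors of \<open>1 - p * p\<close> form the kernel of
    \<open>p\<close>, and the limit of the even powers projects onto it.\<close>
  define q where "q = 1 - p * p"
  have sq: "star q = q" by (simp add: q_def star_mult sp)
  obtain f where f: "sconv (\<lambda>n. (q * q) ^ n) f" "proj f" "q * q * f = f"
    using power_limit_proj[OF sq] contr[OF sp \<open>norm p \<le> 1\<close>] unfolding q_def by blast
  have "2 *\<^sub>R (p * p * f) = p * p * (p * p * f)"
    using f(3) by (simp add: q_def algebra_simps scaleR_2)
  \<comment> \<open>On the range of \<open>p * p * f\<close> the operator \<open>p * p\<close> would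
    act as multiplication by 2, which \<open>norm p \<le> 1\<close> forbids.\<close>
  have "(p * p) * f = 0"
  proof (rule cop_eqI)
    fix v
    have "2 *\<^sub>R ((p * p * f) \<cdot> v) = (p * p) \<cdot> ((p * p * f) \<cdot> v)"
      using \<open>2 *\<^sub>R (p * p * f) = p * p * (p * p * f)\<close> by (metis ap_simps(6) ap_simps(7))
    then have "2 * norm ((p * p * f) \<cdot> v) = norm ((p * p) \<cdot> ((p * p * f) \<cdot> v))"
      by (metis norm_scaleR abs_numeral)
    also have "\<dots> \<le> norm (p * p) * norm ((p * p * f) \<cdot> v)" by (rule norm_ap)
    also have "\<dots> \<le> 1 * norm ((p * p * f) \<cdot> v)"
      by (intro mult_right_mono order_trans[OF norm_mult_ineq mult_le_one]) (auto simp: \<open>norm p \<le> 1\<close>)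
    finally show "((p * p) * f) \<cdot> v = 0 \<cdot> v" by simp
  qed
  then have pf: "p * f = 0" by (rule ap_eq_0_of_square[OF sp])
  have sf: "star f = f" "f * f = f" using f(2) by (simp_all add: proj_def)
  have fp: "f * p = 0" using pf by (metis sf(1) sp star_mult star_simps(1))
  have "q * n = n" by (simp add: q_def algebra_simps pn)
  then have "(q * q) ^ k * n = n" for k by (induct k) (simp_all add: mult.assoc)
  then have fn: "f * n = n" using sconv_mult_right[OF f(1), of n] by (simp add: sconv_const_iff)
  have nf: "n * f = n" by (metis fn sf(1) sn star_mult)
  define e where "e = 1 - f"
  have "gens b e" unfolding gens_def
  proof (intro allI impI)
    fix N assume N: "salg N" "b \<in> N"
    have "r \<in> N" using gensD[OF r(1) N(1)] N by (simp add: salgD(3) salgD(1) salg_closed(2))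
    then have "p \<in> N" unfolding p_def m_def using N by (intro salgD(2,4) salg_closed(2) salgD(1))
    then have "(q * q) ^ k \<in> N" for k
      unfolding q_def using N(1) by (intro salg_closed(4) salgD(3) salg_closed(2) salgD(1))
    then have "f \<in> N" using salgD(5)[OF N(1) _ f(1)] by blast
    then show "e \<in> N" unfolding e_def using N(1) by (intro salg_closed(2) salgD(1))
  qed
  moreover have "gens a b" unfolding gens_def b_def
    by (intro allI impI salgD(4) salg_closed(2) salgD(1))
  ultimately have ge: "gens a e" using gens_trans by blast
  have pe: "proj e" unfolding e_def by (rule proj_complement[OF f(2)])
  have se: "star e = e" using pe by (simp add: proj_def)
  have be: "b * e = e * m * e" and bf: "b * f = - (f * m * f)"
    by (simp_all add: e_def b_eq m_eq algebra_simps pf fp fn nf)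
  have a_eq: "a = l *\<^sub>R 1 + c *\<^sub>R b" using c by (simp add: b_def)
  have ae: "a * e = l *\<^sub>R e + c *\<^sub>R (e * m * e)" unfolding a_eq by (simp add: distrib_right be)
  have af: "a * f = l *\<^sub>R f - c *\<^sub>R (f * m * f)" unfolding a_eq by (simp add: distrib_right bf)
  have fe: "1 - e = f" by (simp add: e_def)
  have "l * Re (cinner (e \<cdot> v) v) \<le> Re (cinner ((a * e) \<cdot> v) v)" for v
    unfolding ae using mpos[of "e \<cdot> v"] c
    by (simp add: cinner_add_left cinner_scaleR_left cinner_star[of e] se)
  moreover have "Re (cinner ((a * (1 - e)) \<cdot> v) v) \<le> l * Re (cinner ((1 - e) \<cdot> v) v)" for v
    unfolding fe af using mpos[of "f \<cdot> v"] c
    by (simp add: cinner_diff_left cinner_scaleR_left cinner_star[of f] sf)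
  ultimately show ?thesis using ge pe by blast
qed

text \<open>Binary expansion of an operator between 0 and 1: the spectral projection at 1/2 is the
  next digit, and the doubled remainder \<open>2 *\<^sub>R x - e\<close> lies between 0 and 1
  again.\<close>

lemma dyadic_projections:
  fixes a :: "'h::complex_hilbert cop"
  assumes sa: "star a = a" and a: "\<And>v. 0 \<le> Re (cinner (a \<cdot> v) v)" "\<And>v. Re (cinner (a \<cdot> v) v) \<le> (norm v)\<^sup>2"
  shows "\<exists>e. (\<forall>j. gens a (e j) \<and> proj (e j)) \<and>
    (\<forall>n. norm (a - (\<Sum>j<n. (1/2) ^ Suc j *\<^sub>R e j)) \<le> (1/2) ^ n)"
proof -
  define ok where "ok = (\<lambda>x :: 'h cop. star x = x \<and> (\<forall>v. 0 \<le> Re (cinner (x \<cdot> v) v) \<and> Re (cinner (x \<cdot> v) v) \<le> (norm v)\<^sup>2))"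
  have "\<exists>e. gens x e \<and> proj e \<and> ok (2 *\<^sub>R x - e)" if x: "ok x" for x
  proof -
    have sx: "star x = x" using x by (simp add: ok_def)
    obtain e where e: "gens x e" "proj e"
      "\<And>v. 1/2 * Re (cinner (e \<cdot> v) v) \<le> Re (cinner ((x * e) \<cdot> v) v)"
      "\<And>v. Re (cinner ((x * (1 - e)) \<cdot> v) v) \<le> 1/2 * Re (cinner ((1 - e) \<cdot> v) v)"
      using spectral_projection[OF sx, of "1/2"] by blast
    have ex: "x * e = e * x" by (rule gens_commute[OF e(1)]) simp
    have ee: "star e = e" "e * e = e" using e(2) by (simp_all add: proj_def)
    have x1: "x * e = e * x * e" by (metis ex ee(2) mult.assoc)
    have x2: "x * (1 - e) = (1 - e) * x * (1 - e)" by (simp add: algebra_simps ex ee) (metis ex ee(2) mult.assoc)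
    have q1: "Re (cinner ((x * e) \<cdot> v) v) \<le> (norm (e \<cdot> v))\<^sup>2" "0 \<le> Re (cinner ((x * e) \<cdot> v) v)" for v
      unfolding x1 using x by (simp_all add: ok_def cinner_star[of e] ee)
    have q2: "0 \<le> Re (cinner ((x * (1 - e)) \<cdot> v) v)" for v
      unfolding x2 proj_compress[OF proj_complement[OF e(2)]] using x unfolding ok_def by blast
    have n: "(norm v)\<^sup>2 = (norm (e \<cdot> v))\<^sup>2 + (norm ((1 - e) \<cdot> v))\<^sup>2" for v
      using proj_cinner[OF e(2), of v] proj_cinner[OF proj_complement[OF e(2)], of v]
      by (simp add: cinner_diff_left Re_cinner_self)
    have split: "Re (cinner ((2 *\<^sub>R x - e) \<cdot> v) v) =
      2 * Re (cinner ((x * e) \<cdot> v) v) + 2 * Re (cinner ((x * (1 - e)) \<cdot> v) v) - (norm (e \<cdot> v))\<^sup>2" for v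
      using proj_cinner[OF e(2), of v]
      by (simp add: cinner_diff_left cinner_scaleR_left algebra_simps)
    have "0 \<le> Re (cinner ((2 *\<^sub>R x - e) \<cdot> v) v) \<and> Re (cinner ((2 *\<^sub>R x - e) \<cdot> v) v) \<le> (norm v)\<^sup>2" for v
      unfolding split using q1[of v] q2[of v] e(3)[of v] e(4)[of v] n[of v]
        proj_cinner[OF e(2), of v] proj_cinner[OF proj_complement[OF e(2)], of v] by linarith
    then have "ok (2 *\<^sub>R x - e)" unfolding ok_def by (simp add: sx ee)
    then show ?thesis using e by blast
  qed
  then obtain E where E: "\<And>x. ok x \<Longrightarrow> gens x (E x) \<and> proj (E x) \<and> ok (2 *\<^sub>R x - E x)" by metis
  define A where "A = rec_nat a (\<lambda>_ x. 2 *\<^sub>R x - E x)"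
  have A0: "A 0 = a" and AS: "\<And>n. A (Suc n) = 2 *\<^sub>R A n - E (A n)" by (simp_all add: A_def)
  have okA: "ok (A n)" for n by (induct n) (use sa a E in \<open>auto simp: A0 AS ok_def\<close>)
  have gA: "gens a (A n)" for n
  proof (induct n)
    case (Suc n)
    have "gens (A n) (A (Suc n))" unfolding gens_def AS
      using E[OF okA] by (auto intro!: salg_closed(2) salgD(4) simp: gens_def)
    with Suc show ?case by (rule gens_trans)
  qed (simp add: A0 gens_def)
  have rem: "a - (\<Sum>j<n. (1/2) ^ Suc j *\<^sub>R E (A j)) = (1/2) ^ n *\<^sub>R A n" for n
  proof (induct n)
    case (Suc n)
    have "a - (\<Sum>j<Suc n. (1/2) ^ Suc j *\<^sub>R E (A j)) = (1/2) ^ n *\<^sub>R A n - (1/2) ^ Suc n *\<^sub>R E (A n)"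
      using Suc by (simp add: algebra_simps)
    also have "\<dots> = (1/2) ^ Suc n *\<^sub>R A (Suc n)" by (simp add: AS scaleR_diff_right)
    finally show ?case .
  qed (simp add: A0)
  have "norm (A n) \<le> 1" for n
    by (rule norm_selfadjoint_le) (use okA[of n] in \<open>auto simp: ok_def\<close>)
  then have "norm (a - (\<Sum>j<n. (1/2) ^ Suc j *\<^sub>R E (A j))) \<le> (1/2) ^ n" for n
    unfolding rem by (simp add: mult_left_le)
  moreover have "gens a (E (A j)) \<and> proj (E (A j))" for j using E[OF okA] gA gens_trans by blast
  ultimately show ?thesis by (intro exI[of _ "\<lambda>j. E (A j)"]) blast
qed

text \<open>A polar decomposition away from the kernel: \<open>y * g\<close> is a partial isometry whose initial
  projection is a spectral projection of \<open>star y * y\<close>.\<close>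

lemma partial_polar:
  fixes y :: "'h::complex_hilbert cop"
  assumes d: "d > 0"
  shows "\<exists>e g. gens (star y * y) e \<and> gens (star y * y) g \<and> proj e \<and> star g = g \<and>
    g * (star y * y) * g = e \<and> (\<forall>v. Re (cinner ((star y * y * (1 - e)) \<cdot> v) v) \<le> d * (norm v)\<^sup>2)"
proof -
  define a where "a = star y * y"
  have sa: "star a = a" by (simp add: a_def star_mult)
  have apos: "0 \<le> Re (cinner (a \<cdot> v) v)" for v unfolding a_def norm_ap_square[symmetric] by simp
  obtain e where e: "gens a e" "proj e" "\<And>v. d * Re (cinner (e \<cdot> v) v) \<le> Re (cinner ((a * e) \<cdot> v) v)"
      "\<And>v. Re (cinner ((a * (1 - e)) \<cdot> v) v) \<le> d * Re (cinner ((1 - e) \<cdot> v) v)"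
    using spectral_projection[OF sa, of d] by blast
  have ea: "a * e = e * a" by (rule gens_commute[OF e(1)]) simp
  have ee: "star e = e" "e * e = e" using e(2) by (simp_all add: proj_def)
  have aee: "a * e = e * a * e" by (metis ea ee(2) mult.assoc)
  define K where "K = norm a + d + 1"
  have K: "K > 0" "d < K" "norm a \<le> K" using d norm_ge_zero[of a] unfolding K_def by linarith+
  \<comment> \<open>\<open>b\<close> is \<open>a / K\<close> on the range of \<open>e\<close> and
    the identity on its complement; the lower bound \<open>d\<close> for \<open>a\<close> on the
    range of \<open>e\<close> brings \<open>b\<close> within distance less than 1 of the
    identity.\<close>
  define b where "b = (1/K) *\<^sub>R (a * e) + (1 - e)"
  have sb: "star b = b" by (simp add: b_def star_mult sa ee ea)
  have n: "(norm v)\<^sup>2 = (norm (e \<cdot> v))\<^sup>2 + (norm ((1 - e) \<cdot> v))\<^sup>2" for v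
    using proj_cinner[OF e(2), of v] proj_cinner[OF proj_complement[OF e(2)], of v]
    by (simp add: cinner_diff_left Re_cinner_self)
  have "norm (1 - b) \<le> 1 - d / K"
  proof (rule norm_selfadjoint_le)
    fix v
    have q: "Re (cinner ((1 - b) \<cdot> v) v) = (norm (e \<cdot> v))\<^sup>2 - Re (cinner ((a * e) \<cdot> v) v) / K"
      using proj_cinner[OF e(2), of v] by (simp add: b_def cinner_diff_left cinner_scaleR_left Re_cinner_self)
    have "Re (cinner ((a * e) \<cdot> v) v) = Re (cinner (a \<cdot> (e \<cdot> v)) (e \<cdot> v))"
      unfolding aee by (simp add: cinner_star[of e] ee)
    also have "\<dots> \<le> norm (a \<cdot> (e \<cdot> v)) * norm (e \<cdot> v)" using Cauchy_Schwarz complex_Re_le_cmod order_trans by blast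
    also have "\<dots> \<le> (K * norm (e \<cdot> v)) * norm (e \<cdot> v)"
      by (intro mult_right_mono order_trans[OF norm_ap mult_right_mono[OF K(3)]]) auto
    finally have "Re (cinner ((a * e) \<cdot> v) v) / K \<le> (norm (e \<cdot> v))\<^sup>2"
      using K by (simp add: divide_le_eq power2_eq_square ac_simps)
    moreover have "d / K * (norm (e \<cdot> v))\<^sup>2 \<le> Re (cinner ((a * e) \<cdot> v) v) / K"
      using e(3)[of v] K proj_cinner[OF e(2), of v] by (simp add: divide_right_mono)
    moreover have "(1 - d / K) * (norm (e \<cdot> v))\<^sup>2 \<le> (1 - d / K) * (norm v)\<^sup>2"
      using n[of v] K by (intro mult_left_mono) auto
    ultimately show "\<bar>Re (cinner ((1 - b) \<cdot> v) v)\<bar> \<le> (1 - d / K) * (norm v)\<^sup>2"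
      unfolding q by (simp add: left_diff_distrib)
  qed (use K sb in simp_all)
  then have nb: "norm (1 - b) < 1" using d K by (smt (verit) divide_pos_pos)
  obtain h where h: "gens b h" "h * b = 1" "b * h = 1" "star h = h" using neumann_inverse[OF nb] sb by blast
  obtain r where r: "gens (1 - b) r" "(1 - r) * (1 - r) = b" "star r = r"
    using sqrt_one_minus[of "1 - b"] nb sb by auto
  define s where "s = 1 - r"
  have s: "s * s = b" "star s = s" using r by (simp_all add: s_def)
  have gb: "gens a b" unfolding gens_def b_def using e(1)
    by (auto intro!: salgD(2-4) salg_closed(2) salgD(1) simp: gens_def)
  have "gens b (1 - b)" unfolding gens_def by (auto intro!: salg_closed(2) salgD(1))
  then have "gens b r" using r(1) gens_trans by blast
  then have gs: "gens b s" unfolding gens_def s_def by (auto intro!: salg_closed(2) salgD(1))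
  have sh: "s * h = h * s" by (rule gens_commute[OF h(1)]) (metis s(1) mult.assoc)
  have es: "e * s = s * e" and eh: "e * h = h * e"
    using gens_commute[OF gens_trans[OF gb gs], of e] gens_commute[OF gens_trans[OF gb h(1)], of e] ea by simp_all
  \<comment> \<open>\<open>s\<close> is the root and \<open>h\<close> the inverse of
    \<open>b\<close>, so \<open>s * h\<close> is the inverse root of \<open>b\<close>;
    \<open>1 / sqrt K\<close> undoes the scaling, and \<open>e\<close> cuts off the
    complement.\<close>
  define g where "g = (1 / sqrt K) *\<^sub>R (s * h * e)"
  have gg: "gens a g" unfolding gens_def g_def
    using e(1) gens_trans[OF gb gs] gens_trans[OF gb h(1)] by (auto intro!: salgD(2-4) simp: gens_def)
  have sg: "star g = g" by (simp add: g_def star_mult s h ee) (metis es eh sh mult.assoc)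
  have abe: "(1/K) *\<^sub>R (e * a * e) = b * e"
    by (simp add: b_def algebra_simps ee ea)
  have "g * a * g = (1/K) *\<^sub>R (s * h * e * a * (s * h * e))"
    using K by (simp add: g_def mult.assoc)
  also have "s * h * e * a * (s * h * e) = s * h * (e * a * e) * (s * h)"
  proof -
    have "z * e * a * (z * e) = z * (e * a * e) * z" if "e * z = z * e" for z
      by (simp only: that mult.assoc)
    moreover have "e * (s * h) = s * h * e" by (metis es eh mult.assoc)
    ultimately show ?thesis by blast
  qed
  also have "(1/K) *\<^sub>R \<dots> = s * h * ((1/K) *\<^sub>R (e * a * e)) * (s * h)" by simp
  also have "\<dots> = s * h * (b * e) * (s * h)" unfolding abe ..
  also have "\<dots> = s * (h * b) * (e * (s * h))" by (simp add: mult.assoc)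
  also have "\<dots> = s * (s * h) * e"
  proof -
    have "e * (s * h) = s * h * e" by (metis es eh mult.assoc)
    then show ?thesis by (simp add: h(2) mult.assoc)
  qed
  also have "\<dots> = (s * s) * h * e" by (simp add: mult.assoc)
  also have "\<dots> = e" unfolding s(1) h(3) by simp
  finally have gag: "g * a * g = e" .
  have "Re (cinner ((a * (1 - e)) \<cdot> v) v) \<le> d * (norm v)\<^sup>2" for v
    using e(4)[of v] n[of v] d proj_cinner[OF proj_complement[OF e(2)], of v]
    by (smt (verit) mult_left_mono zero_le_power2)
  then show ?thesis using e(1,2) gg sg gag unfolding a_def by blast
qed

section \<open>Projections and partial isometries\<close>

definition ple :: "'h::complex_hilbert cop \<Rightarrow> 'h cop \<Rightarrow> bool" where
  "ple e f \<longleftrightarrow> f * e = e"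

definition pis :: "'h::complex_hilbert cop \<Rightarrow> bool" where
  "pis v \<longleftrightarrow> proj (star v * v)"

lemma proj_0 [simp]: "proj 0" and proj_1 [simp]: "proj 1"
  by (simp_all add: proj_def)

lemma ple_refl: "proj e \<Longrightarrow> ple e e"
  by (simp add: ple_def projD)

lemma ple_0 [simp]: "ple 0 f" and ple_1 [simp]: "ple e 1"
  by (simp_all add: ple_def)

lemma ple_trans: "ple e f \<Longrightarrow> ple f g \<Longrightarrow> ple e g"
  unfolding ple_def by (metis mult.assoc)

lemma ple_right: "proj e \<Longrightarrow> proj f \<Longrightarrow> ple e f \<Longrightarrow> e * f = e"
  unfolding ple_def proj_def by (metis star_mult)

lemma ple_antisym: "proj e \<Longrightarrow> proj f \<Longrightarrow> ple e f \<Longrightarrow> ple f e \<Longrightarrow> e = f"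
  using ple_right unfolding ple_def by metis

lemma proj_diff: "proj e \<Longrightarrow> proj f \<Longrightarrow> ple e f \<Longrightarrow> proj (f - e)"
  using ple_right[of e f] by (simp add: proj_def ple_def algebra_simps)

lemma ple_diff: "proj e \<Longrightarrow> proj f \<Longrightarrow> ple e f \<Longrightarrow> ple (f - e) f"
  by (simp add: proj_def ple_def algebra_simps)

lemma orth_sym: "proj e \<Longrightarrow> proj f \<Longrightarrow> e * f = 0 \<Longrightarrow> f * e = 0"
  unfolding proj_def by (metis star_mult star_simps(1))

lemma proj_add: "proj e \<Longrightarrow> proj f \<Longrightarrow> e * f = 0 \<Longrightarrow> proj (e + f)"
  using orth_sym[of e f] by (simp add: proj_def algebra_simps)

lemma ple_add: "ple e g \<Longrightarrow> ple f g \<Longrightarrow> ple (e + f) g"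
  by (simp add: ple_def algebra_simps)

lemma ple_orth: "proj e \<Longrightarrow> proj f \<Longrightarrow> proj g \<Longrightarrow> ple e (g - f) \<Longrightarrow> ple f g \<Longrightarrow> f * e = 0 \<and> ple e g"
proof -
  assume *: "proj e" "proj f" "proj g" "ple e (g - f)" "ple f g"
  have e: "(g - f) * e = e" using *(4) by (simp add: ple_def)
  have "f * g = f" "f * f = f" using ple_right *(2,3,5) by (auto simp: proj_def)
  then have "f * ((g - f) * e) = 0" by (simp add: mult.assoc[symmetric] algebra_simps)
  then have "f * e = 0" by (simp add: e)
  then show ?thesis using e by (simp add: ple_def algebra_simps)
qed

lemma pisD:
  assumes "pis v"
  shows "v * (star v * v) = v" "proj (star v * v)" "proj (v * star v)" "pis (star v)" "star v * (v * star v) = star v"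
proof -
  define e where "e = star v * v"
  have e: "star e = e" "e * e = e" using assms by (simp_all add: pis_def e_def proj_def)
  have sv: "star v * v = e" "star v * (v * x) = e * x" "e * (e * x) = e * x" for x
    by (simp_all add: e_def[symmetric] mult.assoc[symmetric] e)
  have "star (v - v * e) * (v - v * e) = 0"
    by (simp add: star_mult algebra_simps sv e)
  then show 1: "v * (star v * v) = v" by (simp only: star_self_eq_0 e_def eq_iff_diff_eq_0[symmetric])
  then show 2: "proj (v * star v)" by (simp add: proj_def star_mult mult.assoc) (metis mult.assoc)
  then show "pis (star v)" by (simp add: pis_def)
  show "proj (star v * v)" using assms by (simp add: pis_def)
  show "star v * (v * star v) = star v" using arg_cong[OF 1, of star] by (simp add: star_mult mult.assoc)
qed

lemma proj_pis: "proj e \<Longrightarrow> pis e" "proj e \<Longrightarrow> star e * e = e" "proj e \<Longrightarrow> e * star e = e"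
  by (simp_all add: pis_def proj_def)

lemma sconv_eventually_const:
  assumes "sconv f x" "\<And>n. n > k \<Longrightarrow> f n = c"
  shows "x = c"
proof (rule cop_eqI)
  fix v
  have "\<forall>\<^sub>F n in sequentially. f n \<cdot> v = c \<cdot> v"
    using assms(2) by (auto simp: eventually_sequentially intro: exI[of _ "Suc k"])
  then have "(\<lambda>n. f n \<cdot> v) \<longlonglongrightarrow> c \<cdot> v" by (rule tendsto_eventually)
  then show "x \<cdot> v = c \<cdot> v" using sconvD[OF assms(1)] LIMSEQ_unique by blast
qed

lemma pis_0 [simp]: "pis 0" by (simp add: pis_def)

lemma eq_0_iff_initial: "x * (star v * v) = 0 \<Longrightarrow> x * star v = (0 :: 'h::complex_hilbert cop)"
proof -
  assume "x * (star v * v) = 0"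
  then have "x * star v * star (x * star v) = 0" by (simp add: star_mult) (metis mult.assoc mult_zero_left)
  then show ?thesis by (metis star_self_eq_0 star_star star_eq_0)
qed

text \<open>For partial isometries the two vanishing products mean that the final projections,
  respectively the initial ones, are pairwise orthogonal.\<close>

definition orth_seq :: "(nat \<Rightarrow> 'h::complex_hilbert cop) \<Rightarrow> bool" where
  "orth_seq v \<longleftrightarrow> (\<forall>n. pis (v n)) \<and> (\<forall>m n. m \<noteq> n \<longrightarrow> star (v m) * v n = 0 \<and> v m * star (v n) = 0)"

lemma orth_seq_star: "orth_seq v \<Longrightarrow> orth_seq (\<lambda>n. star (v n))"
  by (simp add: orth_seq_def pisD)

text \<open>Pythagoras: a partial sum has the same effect on norms as the sum \<open>E n\<close> of
  the initial projections, and these sums form an increasing sequence of projections.\<close>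

lemma orth_seq_convergent:
  assumes v: "orth_seq v"
  shows "convergent (\<lambda>n. (\<Sum>i<n. v i) \<cdot> w)" and "norm (\<Sum>i<n. v i) \<le> 1"
    and "star (\<Sum>i<n. v i) * (\<Sum>i<n. v i) = (\<Sum>i<n. star (v i) * v i)"
    and "proj (\<Sum>i<n. star (v i) * v i)"
proof -
  define S E where "S = (\<lambda>n. \<Sum>i<n. v i)" and "E = (\<lambda>n. \<Sum>i<n. star (v i) * v i)"
  have o: "star (v m) * v n = 0" "v m * star (v n) = 0" if "m \<noteq> n" for m n
    using v that by (auto simp: orth_seq_def)
  have pv: "proj (star (v n) * v n)" for n using v by (auto simp: orth_seq_def pis_def)
  have Sv: "star (v n) * S m = 0" if "m \<le> n" for n m
    unfolding S_def sum_distrib_left using that by (intro sum.neutral) (auto simp: o)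
  have SS: "star (S (m + k)) * S m = E m" for m k
  proof (induct m arbitrary: k)
    case 0 then show ?case by (simp add: S_def E_def)
  next
    case (Suc m)
    have "star (S (m + n)) * v m = star (v m) * v m" if "n > 0" for n
    proof -
      have "star (S (m + n)) * v m = (\<Sum>i<m + n. star (v i) * v m)"
        by (simp add: S_def star_sum sum_distrib_right)
      also have "\<dots> = (\<Sum>i\<in>{m}. star (v i) * v m)"
        by (rule sum.mono_neutral_right) (use that o in auto)
      finally show ?thesis by simp
    qed
    from this[of "Suc k"] have "star (S (Suc m + k)) * S (Suc m) = star (S (m + Suc k)) * S m + star (v m) * v m"
      by (simp add: S_def distrib_left)
    then show ?case unfolding Suc by (simp add: E_def)
  qed
  have EE: "E n * E n = E n" "star (E n) = E n" for n
  proof -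
    have "(star (v i) * v i) * (star (v j) * v j) = (if i = j then star (v i) * v i else 0)" for i j
      using pv[of i] o(2)[of i j] by (simp add: proj_def) (metis mult.assoc mult_zero_left mult_zero_right)
    then show "E n * E n = E n" unfolding E_def by (simp add: sum_product)
    show "star (E n) = E n" by (simp add: E_def star_sum star_mult)
  qed
  have pE: "proj (E n)" for n by (simp add: proj_def EE)
  then show "proj (\<Sum>i<n. star (v i) * v i)" by (simp add: E_def)
  show "star (\<Sum>i<n. v i) * (\<Sum>i<n. v i) = (\<Sum>i<n. star (v i) * v i)"
    using SS[of n 0] by (simp add: S_def E_def)
  have nS: "(norm (S n \<cdot> x))\<^sup>2 = (norm (E n \<cdot> x))\<^sup>2" for n x
    unfolding norm_ap_square[of "S n"] using SS[of n 0] by (simp add: proj_cinner[OF pE])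
  have "norm (S n) \<le> 1" for n
  proof (rule norm_cop_bound)
    fix x
    have "norm (S n \<cdot> x) = norm (E n \<cdot> x)" using nS[of n x] by simp
    then show "norm (S n \<cdot> x) \<le> 1 * norm x" using norm_proj_ap[OF pE, of n x] by simp
  qed simp
  then show "norm (\<Sum>i<n. v i) \<le> 1" by (simp add: S_def)
  define t where "t = (\<lambda>n. (norm (E n \<cdot> w))\<^sup>2)"
  have d: "(norm (S (m + k) \<cdot> w - S m \<cdot> w))\<^sup>2 = t (m + k) - t m" for m k
  proof -
    have "star (S m) * S (m + k) = E m" using arg_cong[OF SS[of m k], of star] EE by (simp add: star_mult)
    then have "star (S (m + k) - S m) * (S (m + k) - S m) = E (m + k) - E m"
      using SS[of m k] SS[of "m + k" 0] SS[of m 0] by (simp add: algebra_simps)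
    then show ?thesis
      using norm_ap_square[of "S (m + k) - S m" w] by (simp add: cinner_diff_left proj_cinner[OF pE] t_def)
  qed
  have tmono: "t m \<le> t (m + k)" for m k using d[of m k] zero_le_power2[of "norm (S (m + k) \<cdot> w - S m \<cdot> w)"] by linarith
  have "incseq t" by (rule incseq_SucI) (use tmono[of _ 1] in simp)
  moreover have "t n \<le> (norm w)\<^sup>2" for n unfolding t_def by (intro power_mono norm_proj_ap pE) simp
  then have "Bseq t" by (intro BseqI'[of _ "(norm w)\<^sup>2"]) (simp add: t_def)
  ultimately have "convergent t" using incseq_imp_monoseq Bseq_monoseq_convergent by blast
  then have Ct: "Cauchy t" by (rule convergent_Cauchy)
  have "Cauchy (\<lambda>n. S n \<cdot> w)"
  proof (rule CauchyI')
    fix e :: real assume e: "e > 0"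
    then have "e\<^sup>2 > 0" by simp
    then obtain K where K: "\<And>m n. m \<ge> K \<Longrightarrow> n \<ge> K \<Longrightarrow> norm (t m - t n) < e\<^sup>2"
      using CauchyD[OF Ct] by blast
    have "dist (S m \<cdot> w) (S n \<cdot> w) < e" if mn: "m \<ge> K" "n > m" for m n
    proof -
      have "(norm (S n \<cdot> w - S m \<cdot> w))\<^sup>2 = t n - t m" using d[of m "n - m"] mn by simp
      also have "\<dots> < e\<^sup>2" using K[of n m] mn by auto
      finally show ?thesis using e by (simp add: dist_norm norm_minus_commute power_less_imp_less_base)
    qed
    then show "\<exists>M. \<forall>m\<ge>M. \<forall>n>m. dist (S m \<cdot> w) (S n \<cdot> w) < e" by blast
  qed
  then show "convergent (\<lambda>n. (\<Sum>i<n. v i) \<cdot> w)" unfolding S_def by (rule Cauchy_convergent)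
qed

text \<open>The adjoints form a sequence of the same kind, so their sums converge strongly too,
  necessarily to \<open>star V\<close>; with uniform bounds both products of the sums then
  converge.\<close>

lemma orth_sum:
  assumes v: "orth_seq v"
  shows "\<exists>V. sconv (\<lambda>n. \<Sum>i<n. v i) V \<and> pis V \<and>
    sconv (\<lambda>n. \<Sum>i<n. star (v i) * v i) (star V * V) \<and> sconv (\<lambda>n. \<Sum>i<n. v i * star (v i)) (V * star V) \<and>
    (\<forall>i. ple (star (v i) * v i) (star V * V) \<and> ple (v i * star (v i)) (V * star V) \<and> V * (star (v i) * v i) = v i)"
proof -
  let ?S = "\<lambda>n. \<Sum>i<n. v i"
  have v': "orth_seq (\<lambda>n. star (v n))" by (rule orth_seq_star[OF v])
  obtain V where V: "sconv ?S V" using sconv_exists[OF orth_seq_convergent(1)[OF v] orth_seq_convergent(2)[OF v]] by blast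
  obtain V' where "sconv (\<lambda>n. \<Sum>i<n. star (v i)) V'" using sconv_exists[OF orth_seq_convergent(1)[OF v'] orth_seq_convergent(2)[OF v']] by blast
  moreover have "V' = star V" using sconv_star[OF V] calculation by (simp add: star_sum)
  ultimately have V': "sconv (\<lambda>n. \<Sum>i<n. star (v i)) (star V)" by simp
  have E: "sconv (\<lambda>n. \<Sum>i<n. star (v i) * v i) (star V * V)"
    using sconv_mult[OF V' orth_seq_convergent(2)[OF v'] V] orth_seq_convergent(3)[OF v] by (simp add: star_sum)
  have F: "sconv (\<lambda>n. \<Sum>i<n. v i * star (v i)) (V * star V)"
    using sconv_mult[OF V orth_seq_convergent(2)[OF v] V'] orth_seq_convergent(3)[OF v'] by (simp add: star_sum)
  have "sconv (\<lambda>n. (\<Sum>i<n. star (v i) * v i) * (\<Sum>i<n. star (v i) * v i)) ((star V * V) * (star V * V))"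
  proof (rule sconv_mult[OF E _ E])
    show "norm (\<Sum>i<n. star (v i) * v i) \<le> 1" for n
      by (rule norm_cop_bound) (simp_all add: norm_proj_ap[OF orth_seq_convergent(4)[OF v]])
  qed
  then have "sconv (\<lambda>n. \<Sum>i<n. star (v i) * v i) ((star V * V) * (star V * V))"
    using projD(2)[OF orth_seq_convergent(4)[OF v]] by simp
  then have "(star V * V) * (star V * V) = star V * V" using E sconv_unique by blast
  then have pV: "pis V" by (simp add: pis_def proj_def star_mult)
  have Vv: "V * (star (v i) * v i) = v i" for i
  proof -
    have "(\<Sum>j<n. v j) * (star (v i) * v i) = v i" if "i < n" for n
    proof -
      have "v j * (star (v i) * v i) = 0" if "j \<noteq> i" for j
        using v that unfolding orth_seq_def by (metis mult.assoc mult_zero_left)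
      then have "(\<Sum>j<n. v j * (star (v i) * v i)) = (\<Sum>j\<in>{i}. v j * (star (v i) * v i))"
        using \<open>i < n\<close> by (intro sum.mono_neutral_right) auto
      then show ?thesis using v unfolding orth_seq_def by (simp add: sum_distrib_right pisD(1))
    qed
    then show ?thesis by (rule sconv_eventually_const[OF sconv_mult_right[OF V]])
  qed
  have "ple (star (v i) * v i) (star V * V)" for i
  proof -
    have "star (v i) * V = star (v i) * v i"
    proof -
      have "star (v i) * (\<Sum>j<n. v j) = star (v i) * v i" if "i < n" for n
      proof -
        have "(\<Sum>j<n. star (v i) * v j) = (\<Sum>j\<in>{i}. star (v i) * v j)"
          using that v by (intro sum.mono_neutral_right) (auto simp: orth_seq_def)
        then show ?thesis by (simp add: sum_distrib_left)
      qed
      then show ?thesis by (rule sconv_eventually_const[OF sconv_mult_left[OF V]])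
    qed
    then have "star V * v i = star (v i) * v i" by (metis star_mult star_star)
    then show ?thesis by (simp add: ple_def mult.assoc Vv)
  qed
  moreover have "ple (v i * star (v i)) (V * star V)" for i
  proof -
    have "v i = V * star V * v i" using pisD(1)[OF pV] Vv[of i] by (metis mult.assoc)
    then show ?thesis unfolding ple_def by (metis mult.assoc)
  qed
  ultimately show ?thesis using V E F pV Vv by blast
qed

section \<open>Comparison of projections in a factor\<close>

text \<open>The last two assumptions are the consequences of a separable predual that are needed:
  countable decomposability, and a countable subset that is dense in the unit ball for the weak
  operator topology.\<close>

locale separable_factor =
  fixes M :: "'h::complex_hilbert cop set"
  assumes vna: "vna M"
    and center: "x \<in> M \<Longrightarrow> (\<And>y. y \<in> M \<Longrightarrow> x * y = y * x) \<Longrightarrow> \<exists>c. x = sc c"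
    and sigma_finite: "F \<subseteq> M \<Longrightarrow> (\<And>e. e \<in> F \<Longrightarrow> proj e \<and> e \<noteq> 0) \<Longrightarrow>
      (\<And>e f. e \<in> F \<Longrightarrow> f \<in> F \<Longrightarrow> e \<noteq> f \<Longrightarrow> e * f = 0) \<Longrightarrow> countable F"
    and countably_dense: "\<exists>S. countable S \<and> S \<subseteq> M \<and>
      (\<forall>x\<in>M. norm x \<le> 1 \<longrightarrow> (\<forall>(n::nat) xs us. \<forall>\<epsilon>>0. \<exists>s\<in>S.
        cmod ((\<Sum>i<n. cinner (s \<cdot> xs i) (us i)) - (\<Sum>i<n. cinner (x \<cdot> xs i) (us i))) < \<epsilon>))"
begin

definition pm :: "'h cop \<Rightarrow> bool" where "pm e \<longleftrightarrow> e \<in> M \<and> proj e"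

definition meq :: "'h cop \<Rightarrow> 'h cop \<Rightarrow> bool" where
  "meq p q \<longleftrightarrow> (\<exists>v\<in>M. star v * v = p \<and> v * star v = q)"

definition mle :: "'h cop \<Rightarrow> 'h cop \<Rightarrow> bool" where
  "mle p q \<longleftrightarrow> (\<exists>v\<in>M. star v * v = p \<and> ple (v * star v) q)"

definition fin :: "'h cop \<Rightarrow> bool" where
  "fin p \<longleftrightarrow> pm p \<and> (\<forall>q. pm q \<longrightarrow> meq p q \<longrightarrow> ple q p \<longrightarrow> q = p)"

lemmas M_salg = vna_salg[OF vna]
lemmas M_closed = vnaD(1-5)[OF vna] salg_closed[OF M_salg] salgD(4)[OF M_salg] salg_sum[OF M_salg]

lemma pmD: "pm e \<Longrightarrow> e \<in> M" "pm e \<Longrightarrow> proj e" "pm e \<Longrightarrow> star e = e" "pm e \<Longrightarrow> e * e = e"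
  by (simp_all add: pm_def proj_def)

lemma pm_1 [simp]: "pm 1" and pm_0 [simp]: "pm 0"
  by (simp_all add: pm_def M_closed)

lemma pm_diff: "pm e \<Longrightarrow> pm f \<Longrightarrow> ple e f \<Longrightarrow> pm (f - e)"
  by (simp add: pm_def proj_diff M_closed)

lemma pm_add: "pm e \<Longrightarrow> pm f \<Longrightarrow> e * f = 0 \<Longrightarrow> pm (e + f)"
  by (simp add: pm_def proj_add M_closed)

lemma pis_pm: "v \<in> M \<Longrightarrow> pis v \<Longrightarrow> pm (star v * v) \<and> pm (v * star v)"
  by (simp add: pm_def pisD M_closed)

text \<open>\<open>v\<close> lists a maximal orthogonal family from \<open>W\<close>, padded with 0
  because the family may be finite, and \<open>V\<close> is its strong sum. The last clause is the
  maximality: no member of \<open>W\<close> fits into what is left of \<open>p\<close> and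
  \<open>q\<close>.\<close>

definition maximal_sum ::
    "'h cop set \<Rightarrow> 'h cop \<Rightarrow> 'h cop \<Rightarrow> (nat \<Rightarrow> 'h cop) \<Rightarrow> 'h cop \<Rightarrow> bool" where
  "maximal_sum W p q v V \<longleftrightarrow> (\<forall>n. v n \<in> insert 0 W) \<and> orth_seq v \<and> V \<in> M \<and> pis V \<and>
    sconv (\<lambda>n. \<Sum>i<n. v i) V \<and>
    sconv (\<lambda>n. \<Sum>i<n. star (v i) * v i) (star V * V) \<and> sconv (\<lambda>n. \<Sum>i<n. v i * star (v i)) (V * star V) \<and>
    (\<forall>i. ple (star (v i) * v i) (star V * V)) \<and> (\<forall>i. ple (v i * star (v i)) (V * star V)) \<and>
    (\<forall>i. V * (star (v i) * v i) = v i) \<and> ple (star V * V) p \<and> ple (V * star V) q \<and>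
    (\<forall>w\<in>W. \<not> (ple (star w * w) (p - star V * V) \<and> ple (w * star w) (q - V * star V)))"

lemma maximal_sumD:
  assumes "maximal_sum W p q v V"
  shows "v n \<in> insert 0 W" "orth_seq v" "V \<in> M" "pis V" "sconv (\<lambda>n. \<Sum>i<n. v i) V"
    "sconv (\<lambda>n. \<Sum>i<n. star (v i) * v i) (star V * V)" "sconv (\<lambda>n. \<Sum>i<n. v i * star (v i)) (V * star V)"
    "ple (star (v n) * v n) (star V * V)" "ple (v n * star (v n)) (V * star V)"
    "V * (star (v n) * v n) = v n" "ple (star V * V) p" "ple (V * star V) q"
    "w \<in> W \<Longrightarrow> ple (star w * w) (p - star V * V) \<Longrightarrow> ple (w * star w) (q - V * star V) \<Longrightarrow> False"
  using assms by (simp_all add: maximal_sum_def)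

text \<open>Zorn's lemma provides a maximal family, and countable decomposability turns it into a
  sequence, so that sequential limits suffice from here on.\<close>

lemma exhaustion:
  assumes W: "W \<subseteq> M" "\<And>w. w \<in> W \<Longrightarrow> pis w \<and> w \<noteq> 0" and p: "pm p" and q: "pm q"
  shows "\<exists>v V. maximal_sum W p q v V"
proof -
  define ok where "ok = (\<lambda>X. X \<subseteq> W \<and> (\<forall>w\<in>X. ple (star w * w) p \<and> ple (w * star w) q) \<and>
    (\<forall>w\<in>X. \<forall>u\<in>X. w \<noteq> u \<longrightarrow> star w * u = 0 \<and> w * star u = 0))"
  have okD: "w \<in> W" "ple (star w * w) p" "ple (w * star w) q" if "ok X" "w \<in> X" for X w
    using that by (simp_all add: ok_def subset_iff)
  have okO: "star w * u = 0" "w * star u = 0" if "ok X" "w \<in> X" "u \<in> X" "w \<noteq> u" for X w u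
    using that by (simp_all add: ok_def)
  have "\<exists>X\<in>{X. ok X}. \<forall>Y\<in>{X. ok X}. X \<subseteq> Y \<longrightarrow> Y = X"
  proof (rule subset_Zorn_nonempty)
    show "{X. ok X} \<noteq> {}" by (auto simp: ok_def)
  next
    fix C assume C: "C \<noteq> {}" "subset.chain {X. ok X} C"
    have okC: "ok X" if "X \<in> C" for X using C that by (auto simp: subset_chain_def)
    have chain: "X \<subseteq> Y \<or> Y \<subseteq> X" if "X \<in> C" "Y \<in> C" for X Y
      using C that by (simp add: subset_chain_def)
    have pair: "\<exists>X\<in>C. w \<in> X \<and> u \<in> X" if wu: "w \<in> \<Union>C" "u \<in> \<Union>C" for w u
    proof -
      obtain X Y where XY: "X \<in> C" "w \<in> X" "Y \<in> C" "u \<in> Y" using wu by blast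
      then show ?thesis using chain[OF XY(1,3)] by blast
    qed
    have "ok (\<Union>C)" unfolding ok_def
    proof (intro conjI ballI impI)
      show "\<Union>C \<subseteq> W" using okC okD(1) by blast
    next
      fix w assume "w \<in> \<Union>C"
      then show "ple (star w * w) p" "ple (w * star w) q" using okC okD(2,3) by blast+
    next
      fix w u assume wu: "w \<in> \<Union>C" "u \<in> \<Union>C" "w \<noteq> u"
      obtain X where "X \<in> C" "w \<in> X" "u \<in> X" using pair[OF wu(1,2)] by blast
      then show "star w * u = 0" "w * star u = 0" using okC[of X] wu(3) okO by blast+
    qed
    then show "\<Union>C \<in> {X. ok X}" by simp
  qed
  then obtain X where X: "ok X" and max: "\<And>Y. ok Y \<Longrightarrow> X \<subseteq> Y \<Longrightarrow> Y = X" by blast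
  \<comment> \<open>Distinct members have orthogonal nonzero initial projections, so countability of
    these projections carries over to \<open>X\<close>.\<close>
  have inj: "w = u" if "w \<in> X" "u \<in> X" "star w * w = star u * u" for w u
  proof (rule ccontr)
    assume "w \<noteq> u"
    then have "w * star u = 0" using X that okO by blast
    then have "star w * w * (star w * w) = 0" unfolding that(3) using that(3) by (metis mult.assoc mult_zero_left mult_zero_right)
    moreover have "pis w" "w \<noteq> 0" using that W(2) okD(1)[OF X] by blast+
    ultimately show False by (metis pisD(1) mult.assoc mult_zero_right)
  qed
  have "countable ((\<lambda>w. star w * w) ` X)"
  proof (rule sigma_finite)
    show "(\<lambda>w. star w * w) ` X \<subseteq> M"
      by (intro image_subsetI M_closed(3) M_closed(5)) (use okD(1)[OF X] W(1) in blast)+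
    show "proj e \<and> e \<noteq> 0" if "e \<in> (\<lambda>w. star w * w) ` X" for e
      using that okD(1)[OF X] W(2) by (auto simp: star_self_eq_0 pis_def)
    fix e f assume "e \<in> (\<lambda>w. star w * w) ` X" "f \<in> (\<lambda>w. star w * w) ` X" "e \<noteq> f"
    then obtain w u where "w \<in> X" "u \<in> X" "e = star w * w" "f = star u * u" "w \<noteq> u" by blast
    then show "e * f = 0" using okO(2)[OF X, of w u] by (simp add: mult.assoc) (metis mult.assoc mult_zero_left mult_zero_right)
  qed
  then have cX: "countable X" by (rule countable_image_inj_on) (use inj in \<open>auto simp: inj_on_def\<close>)
  define v where "v = (\<lambda>n. if n \<in> to_nat_on X ` X then from_nat_into X n else 0)"
  have vX: "v n \<in> insert 0 X" for n using cX by (auto simp: v_def)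
  have Xv: "\<exists>n. v n = w" if "w \<in> X" for w
    using cX that by (intro exI[of _ "to_nat_on X w"]) (auto simp: v_def)
  have vne: "v m \<noteq> v n \<or> v m = 0" if "m \<noteq> n" for m n
    using that cX by (auto simp: v_def)
  have vO: "orth_seq v" unfolding orth_seq_def
  proof (intro conjI allI impI)
    fix n show "pis (v n)" using vX[of n] okD(1)[OF X, of "v n"] W(2)[of "v n"] by auto
  next
    fix m n :: nat assume "m \<noteq> n"
    then have "v m = 0 \<or> v n = 0 \<or> v m \<in> X \<and> v n \<in> X \<and> v m \<noteq> v n"
      using vne[of m n] vX[of m] vX[of n] by blast
    then show "star (v m) * v n = 0" "v m * star (v n) = 0"
      using okO[OF X, of "v m" "v n"] by auto
  qed
  obtain V where V: "sconv (\<lambda>n. \<Sum>i<n. v i) V" "pis V"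
    "sconv (\<lambda>n. \<Sum>i<n. star (v i) * v i) (star V * V)" "sconv (\<lambda>n. \<Sum>i<n. v i * star (v i)) (V * star V)"
    "\<And>i. ple (star (v i) * v i) (star V * V)" "\<And>i. ple (v i * star (v i)) (V * star V)"
    "\<And>i. V * (star (v i) * v i) = v i"
    using orth_sum[OF vO] by blast
  have vM: "v n \<in> M" for n using vX[of n] okD(1)[OF X, of "v n"] W(1) M_closed(8) by auto
  have VM: "V \<in> M" by (rule salgD(5)[OF M_salg _ V(1)]) (rule salg_sum[OF M_salg vM])
  have vple: "p * (star (v i) * v i) = star (v i) * v i" "q * (v i * star (v i)) = v i * star (v i)" for i
    using vX[of i] okD(2,3)[OF X, of "v i"] by (auto simp: ple_def)
  have "sconv (\<lambda>n. p * (\<Sum>i<n. star (v i) * v i)) (p * (star V * V))" by (rule sconv_mult_left[OF V(3)])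
  then have Vp: "ple (star V * V) p"
    unfolding ple_def sum_distrib_left vple using V(3) sconv_unique by blast
  have "sconv (\<lambda>n. q * (\<Sum>i<n. v i * star (v i))) (q * (V * star V))" by (rule sconv_mult_left[OF V(4)])
  then have Vq: "ple (V * star V) q"
    unfolding ple_def sum_distrib_left vple using V(4) sconv_unique by blast
  \<comment> \<open>A member of \<open>W\<close> fitting into the remainders is orthogonal to all of
    \<open>X\<close>; by maximality it belongs to \<open>X\<close>, hence is orthogonal to
    itself.\<close>
  have "False" if w: "w \<in> W" "ple (star w * w) (p - star V * V)" "ple (w * star w) (q - V * star V)" for w
  proof -
    have pw: "pis w" "w \<noteq> 0" using W(2)[OF w(1)] by auto
    have 1: "star V * V * (star w * w) = 0" "ple (star w * w) p"
      using ple_orth[OF pisD(2)[OF pw(1)] pisD(2)[OF V(2)] pmD(2)[OF p] w(2) Vp] by auto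
    have 2: "V * star V * (w * star w) = 0" "ple (w * star w) q"
      using ple_orth[OF pisD(3)[OF pw(1)] pisD(3)[OF V(2)] pmD(2)[OF q] w(3) Vq] by auto
    have o: "star w * u = 0 \<and> w * star u = 0 \<and> star u * w = 0 \<and> u * star w = 0" if u: "u \<in> X" for u
    proof -
      obtain n where n: "v n = u" using Xv[OF u] by blast
      have pu: "pis u" using okD(1)[OF X u] W(2) by blast
      have "star u * u * (star w * w) = star u * u * (star V * V) * (star w * w)"
        using ple_right[OF pisD(2)[OF pu] pisD(2)[OF V(2)]] V(5)[of n] n by simp
      also have "\<dots> = 0" using 1 by (simp add: mult.assoc)
      finally have "star u * u * star w = 0" by (rule eq_0_iff_initial)
      then have "u * star w = 0" by (metis pisD(1)[OF pu] mult.assoc mult_zero_right)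
      have "u * star u * (w * star w) = u * star u * (V * star V) * (w * star w)"
        using ple_right[OF pisD(3)[OF pu] pisD(3)[OF V(2)]] V(6)[of n] n by simp
      also have "\<dots> = 0" using 2 by (simp add: mult.assoc)
      finally have "u * star u * w = 0" using eq_0_iff_initial[of "u * star u" "star w"] by simp
      then have "star u * w = 0" by (metis pisD(5)[OF pu] mult.assoc mult_zero_right)
      with \<open>u * star w = 0\<close> show ?thesis by (metis star_mult star_star star_simps(1))
    qed
    have "ok (insert w X)" unfolding ok_def
    proof (intro conjI ballI impI)
      show "insert w X \<subseteq> W" using w(1) okD(1)[OF X] by blast
    next
      fix u assume "u \<in> insert w X"
      then show "ple (star u * u) p" "ple (u * star u) q" using 1 2 okD(2,3)[OF X] by blast+
    next
      fix u u' assume "u \<in> insert w X" "u' \<in> insert w X" "u \<noteq> u'"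
      then show "star u * u' = 0" "u * star u' = 0" using o okO[OF X] by blast+
    qed
    then have "w \<in> X" using max by blast
    then have "w * star w = 0" using o by blast
    then show False using pw(2) by (metis star_self_eq_0 star_star star_eq_0)
  qed
  moreover have "v n \<in> insert 0 W" for n using vX[of n] okD(1)[OF X, of "v n"] by auto
  ultimately have "maximal_sum W p q v V"
    unfolding maximal_sum_def using vO VM V Vp Vq by (intro conjI allI ballI notI) auto
  then show ?thesis by blast
qed

text \<open>Polar decomposition above a cut-off: \<open>y * g\<close> has the spectral projection
  \<open>e\<close> of \<open>star y * y\<close> as its initial projection. Cutting at half the norm
  of \<open>star y * y\<close> keeps \<open>e\<close> nonzero.\<close>

lemma nonzero_partial_isometry:
  assumes y: "y \<in> M" "y \<noteq> 0" and p: "pm p" "y * p = y" and q: "q * y = y"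
  obtains g where "g \<in> M" "pis (y * g)" "y * g \<noteq> 0" "ple (star (y * g) * (y * g)) p" "ple (y * g * star (y * g)) q"
    "star (y * g) * (y * g) = g * g * (star y * y)"
proof -
  define a where "a = star y * y"
  have sa: "star a = a" by (simp add: a_def star_mult)
  have "a \<noteq> 0" using y by (simp add: a_def star_self_eq_0)
  define d where "d = norm a / 2"
  have d: "d > 0" using \<open>a \<noteq> 0\<close> by (simp add: d_def)
  obtain e g where eg: "gens a e" "gens a g" "proj e" "star g = g" "g * a * g = e"
    "\<And>v. Re (cinner ((a * (1 - e)) \<cdot> v) v) \<le> d * (norm v)\<^sup>2"
    using partial_polar[OF d, of y] unfolding a_def by blast
  have aM: "a \<in> M" using y by (simp add: a_def M_closed)
  have gM: "g \<in> M" using gensD[OF eg(2) M_salg aM] .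
  have vv: "star (y * g) * (y * g) = e" using eg(5) by (simp add: star_mult eg(4) a_def mult.assoc)
  have "e \<noteq> 0"
  proof
    assume "e = 0"
    have "norm a \<le> d"
    proof (rule norm_selfadjoint_le[OF sa less_imp_le[OF d]])
      fix v
      have "0 \<le> Re (cinner (a \<cdot> v) v)" unfolding a_def norm_ap_square[symmetric] by simp
      then show "\<bar>Re (cinner (a \<cdot> v) v)\<bar> \<le> d * (norm v)\<^sup>2" using eg(6)[of v] \<open>e = 0\<close> by simp
    qed
    then show False using d by (simp add: d_def)
  qed
  have "a * p = a" by (simp add: a_def mult.assoc p)
  then have "p * a = a" using sa pmD(3)[OF p(1)] by (metis star_mult)
  then have "p * g = g * p" using gens_commute[OF eg(2)] \<open>a * p = a\<close> by simp
  then have "y * g * p = y * g" using p(2) by (metis mult.assoc)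
  then have "ple (star (y * g) * (y * g)) p" unfolding ple_def using pmD(3)[OF p(1)] by (metis mult.assoc star_mult)
  moreover have "ple (y * g * star (y * g)) q" unfolding ple_def using q by (metis mult.assoc)
  moreover have "y * g \<noteq> 0" using vv \<open>e \<noteq> 0\<close> by auto
  moreover have "pis (y * g)" using vv eg(3) by (simp add: pis_def)
  \<comment> \<open>With \<open>star y * y\<close> moved to the right, the initial projection
    visibly kills every vector that \<open>y\<close> kills; \<open>near_trace_faithful\<close>
    relies on this form.\<close>
  moreover have "a * g = g * a" by (rule gens_commute[OF eg(2)]) simp
  then have "star (y * g) * (y * g) = g * g * (star y * y)"
    unfolding vv eg(5)[symmetric] a_def by (simp add: mult.assoc)
  ultimately show ?thesis using gM that by blast
qed

text \<open>The supremum \<open>z\<close> of the projections \<open>f\<close> with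
  \<open>f M p = 0\<close> is central, hence a scalar. If \<open>q\<close> were among them,
  \<open>z\<close> would be 1 and \<open>p\<close> would vanish.\<close>

lemma full_corner:
  assumes p: "pm p" "p \<noteq> 0" and q: "pm q" "q \<noteq> 0"
  shows "\<exists>x\<in>M. q * x * p \<noteq> 0"
proof (rule ccontr)
  assume "\<not> ?thesis"
  then have qp: "\<And>x. x \<in> M \<Longrightarrow> q * x * p = 0" by blast
  define W where "W = {f. pm f \<and> f \<noteq> 0 \<and> (\<forall>x\<in>M. f * x * p = 0)}"
  have W: "W \<subseteq> M" "\<And>w. w \<in> W \<Longrightarrow> pis w \<and> w \<noteq> 0" by (auto simp: W_def pm_def proj_pis)
  obtain v V where ms: "maximal_sum W 1 1 v V" using exhaustion[OF W pm_1 pm_1] by blast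
  note v = maximal_sumD(1)[OF ms] and VM = maximal_sumD(3)[OF ms] and pV = maximal_sumD(4)[OF ms]
    and E = maximal_sumD(6)[OF ms] and F = maximal_sumD(7)[OF ms] and max = maximal_sumD(13)[OF ms]
  have vp: "star (v i) = v i" for i using v[of i] by (auto simp: W_def pm_def proj_def)
  define z where "z = star V * V"
  have "V * star V = z" using sconv_unique[OF F] E by (simp add: vp z_def)
  have z: "pm z" using pis_pm[OF VM pV] by (simp add: z_def)
  have zp: "z * x * p = 0" if "x \<in> M" for x
  proof -
    have "v i * x * p = 0" for i using v[of i] that by (auto simp: W_def)
    then have "star (v i) * v i * (x * p) = 0" for i by (simp add: mult.assoc)
    then have "sconv (\<lambda>n. 0) (z * (x * p))"
      using sconv_mult_right[OF E, of "x * p"] unfolding sum_distrib_right z_def by simp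
    then show ?thesis by (simp add: sconv_const_iff mult.assoc)
  qed
  \<comment> \<open>Otherwise a partial isometry obtained from \<open>(1 - z) * x * z\<close> has a
    final projection that lies below \<open>1 - z\<close> and again annihilates \<open>M p\<close>,
    against maximality.\<close>
  have zc: "(1 - z) * x * z = 0" if x: "x \<in> M" for x
  proof (rule ccontr)
    assume ne: "(1 - z) * x * z \<noteq> 0"
    define y where "y = (1 - z) * x * z"
    have zz: "z * z = z" using z by (simp add: pmD)
    have yM: "y \<in> M" using x z by (simp add: y_def M_closed pmD)
    have "y * z = y" "(1 - z) * y = y" by (simp_all add: y_def mult.assoc zz) (simp add: algebra_simps, metis mult.assoc zz)
    then obtain g where g: "g \<in> M" "pis (y * g)" "y * g \<noteq> 0" "ple (y * g * star (y * g)) (1 - z)"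
      using nonzero_partial_isometry[OF yM ne[folded y_def] z] by metis
    define f where "f = y * g * star (y * g)"
    have f: "pm f" using pis_pm[OF _ g(2)] yM g(1) by (simp add: f_def M_closed)
    have "f * x' * p = 0" if "x' \<in> M" for x'
    proof -
      have "g * star (y * g) * x' \<in> M" using g(1) yM that by (simp add: M_closed)
      then have "z * (g * star (y * g) * x') * p = 0" by (rule zp)
      then have "y * (z * (g * star (y * g) * x') * p) = 0" by simp
      then show ?thesis unfolding f_def by (metis \<open>y * z = y\<close> mult.assoc)
    qed
    moreover have "f \<noteq> 0" using g(3) unfolding f_def by (metis star_self_eq_0 star_star star_eq_0)
    ultimately have "f \<in> W" using f by (simp add: W_def)
    then show False using max[of f] g(4) f \<open>V * star V = z\<close>
      by (simp add: f_def[symmetric] z_def[symmetric] pmD)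
  qed
  have comm: "z * x = x * z" if x: "x \<in> M" for x
  proof -
    have 1: "x * z = z * x * z" using zc[OF x] by (simp add: algebra_simps)
    have "star ((1 - z) * star x * z) = 0" using zc[of "star x"] x by (simp add: M_closed)
    then have "z * x * (1 - z) = 0" using z by (simp add: star_mult pmD mult.assoc)
    with 1 show ?thesis by (simp add: algebra_simps)
  qed
  obtain c where c: "z = sc c" using center[OF pmD(1)[OF z] comm] by blast
  have "z \<noteq> 0"
  proof
    assume "z = 0"
    then show False using max[of q] q qp \<open>V * star V = z\<close> by (auto simp: W_def z_def[symmetric])
  qed
  then have "c \<noteq> 0" using c by auto
  have "sc (c * c) = (sc c :: 'h cop)" using pmD(4)[OF z] by (simp add: c sc_mult)
  then have "sc (inverse c) * sc (c * c) = sc (inverse c) * (sc c :: 'h cop)" by simp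
  then have "sc c = (1 :: 'h cop)" using \<open>c \<noteq> 0\<close> by (simp add: sc_mult mult.assoc[symmetric])
  then have "p = 0" using zp[of 1] c by (simp add: M_closed)
  then show False using p by simp
qed

lemma comparison_nonzero:
  assumes p: "pm p" "p \<noteq> 0" and q: "pm q" "q \<noteq> 0"
  obtains v where "v \<in> M" "pis v" "v \<noteq> 0" "ple (star v * v) p" "ple (v * star v) q"
proof -
  obtain x where x: "x \<in> M" "q * x * p \<noteq> 0" using full_corner[OF p q] by blast
  have "q * x * p \<in> M" using p q x by (simp add: M_closed pmD)
  moreover have "q * x * p * p = q * x * p" "q * (q * x * p) = q * x * p"
    using pmD(4)[OF p(1)] pmD(4)[OF q(1)] by (simp_all add: mult.assoc) (metis mult.assoc)
  ultimately obtain g where "g \<in> M" "pis (q * x * p * g)" "q * x * p * g \<noteq> 0"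
    "ple (star (q * x * p * g) * (q * x * p * g)) p" "ple (q * x * p * g * star (q * x * p * g)) q"
    using nonzero_partial_isometry[OF _ x(2) p(1)] by metis
  then show ?thesis using that[of "q * x * p * g"] \<open>q * x * p \<in> M\<close> by (simp add: M_closed)
qed

text \<open>A maximal orthogonal family of partial isometries from \<open>p\<close> to
  \<open>q\<close> must exhaust one side, since \<open>comparison_nonzero\<close> links any two
  nonzero remainders.\<close>

theorem comparison:
  assumes p: "pm p" and q: "pm q"
  shows "mle p q \<or> mle q p"
proof -
  define W where "W = {w \<in> M. pis w \<and> w \<noteq> 0}"
  have W: "W \<subseteq> M" "\<And>w. w \<in> W \<Longrightarrow> pis w \<and> w \<noteq> 0" by (auto simp: W_def)
  obtain v V where ms: "maximal_sum W p q v V" using exhaustion[OF W p q] by blast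
  note V = maximal_sumD(3,4,11,12)[OF ms] and max = maximal_sumD(13)[OF ms]
  have VV: "pm (star V * V)" "pm (V * star V)" using pis_pm[OF V(1,2)] by auto
  have "p - star V * V = 0 \<or> q - V * star V = 0"
  proof (rule ccontr)
    assume ne: "\<not> ?thesis"
    obtain w where "w \<in> M" "pis w" "w \<noteq> 0" "ple (star w * w) (p - star V * V)" "ple (w * star w) (q - V * star V)"
      using comparison_nonzero[OF pm_diff[OF VV(1) p V(3)] _ pm_diff[OF VV(2) q V(4)]] ne by metis
    then show False using max[of w] by (simp add: W_def)
  qed
  then show ?thesis
  proof
    assume "p - star V * V = 0"
    then show ?thesis unfolding mle_def using V by auto
  next
    assume "q - V * star V = 0"
    then have "mle q p" unfolding mle_def using V by (intro bexI[of _ "star V"]) (auto simp: M_closed)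
    then show ?thesis ..
  qed
qed

end

section \<open>Equivalence and finiteness of projections\<close>

context separable_factor begin

lemma pis_left: "pis v \<Longrightarrow> ple (v * star v) q \<Longrightarrow> q * v = v"
  unfolding ple_def by (metis pisD(1) mult.assoc)

lemma pis_right: "pis v \<Longrightarrow> proj p \<Longrightarrow> ple (star v * v) p \<Longrightarrow> v * p = v"
  using pis_left[of "star v" p] pisD(4)[of v] projD(1)[of p] by (metis star_mult star_star)

lemma pis_of_initial: "pm p \<Longrightarrow> star v * v = p \<Longrightarrow> pis v"
  by (simp add: pis_def pm_def)

lemma meq_refl: "pm p \<Longrightarrow> meq p p"
  unfolding meq_def by (intro bexI[of _ p]) (simp_all add: pmD)

lemma meq_sym: "meq p q \<Longrightarrow> meq q p"
  unfolding meq_def by (metis M_closed(5) star_star)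

lemma meq_pm: "pm p \<Longrightarrow> meq p q \<Longrightarrow> pm q"
  unfolding meq_def using pis_of_initial pis_pm by blast

lemma meq_trans: assumes "pm p" "meq p q" "meq q r" shows "meq p r"
proof -
  obtain v u where v: "v \<in> M" "star v * v = p" "v * star v = q" and u: "u \<in> M" "star u * u = q" "u * star u = r"
    using assms unfolding meq_def by blast
  have "pis v" using pis_of_initial assms(1) v by blast
  have "pis u" using pis_of_initial meq_pm[OF assms(1,2)] u by blast
  have qv: "q * v = v" using pisD(1)[OF \<open>pis v\<close>] v(3) by (simp add: mult.assoc[symmetric])
  have uq: "u * q = u" using pisD(1)[OF \<open>pis u\<close>] u(2) by simp
  have "star (u * v) * (u * v) = star v * (star u * u) * v" by (simp add: star_mult mult.assoc)
  then have "star (u * v) * (u * v) = p" by (simp add: u(2) v(2) qv mult.assoc)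
  moreover have "u * v * star (u * v) = u * (v * star v) * star u" by (simp add: star_mult mult.assoc)
  then have "u * v * star (u * v) = r" by (simp add: v(3) u(3) uq)
  ultimately show ?thesis unfolding meq_def using v u by (intro bexI[of _ "u * v"]) (auto simp: M_closed)
qed

lemma mle_iff: "pm p \<Longrightarrow> mle p q \<longleftrightarrow> (\<exists>r. pm r \<and> meq p r \<and> ple r q)"
  unfolding mle_def meq_def by (metis pis_of_initial pis_pm)

lemma mle_0: "mle 0 q"
  unfolding mle_def by (intro bexI[of _ 0]) (simp_all add: M_closed)

lemma conj_pm:
  assumes v: "v \<in> M" "pis v" and f: "pm f" "ple f (star v * v)"
  shows "pm (v * f * star v)" "meq f (v * f * star v)" "ple (v * f * star v) (v * star v)"
proof -
  have e: "star v * v * f = f" using f(2) by (simp add: ple_def)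
  have "star (v * f) * (v * f) = f * (star v * v * f)" by (simp add: star_mult pmD(3)[OF f(1)] mult.assoc)
  then have 1: "star (v * f) * (v * f) = f" by (simp add: e pmD(4)[OF f(1)])
  have 2: "v * f * star (v * f) = v * f * star v"
    by (simp add: star_mult pmD(3)[OF f(1)]) (metis mult.assoc pmD(4)[OF f(1)])
  show 3: "meq f (v * f * star v)" unfolding meq_def
    using 1 2 v f(1) by (intro bexI[of _ "v * f"]) (auto simp: M_closed pmD)
  show "pm (v * f * star v)" using meq_pm[OF f(1) 3] .
  show "ple (v * f * star v) (v * star v)" unfolding ple_def
    using pisD(1)[OF v(2)] by (metis mult.assoc)
qed

lemma mle_trans:
  assumes p: "pm p" and q: "pm q" and "mle p q" "mle q r" and r: "proj r"
  shows "mle p r"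
proof -
  obtain v u where v: "v \<in> M" "star v * v = p" "ple (v * star v) q" and u: "u \<in> M" "star u * u = q" "ple (u * star u) r"
    using assms unfolding mle_def by blast
  have pv: "pis v" and pu: "pis u" using pis_of_initial p q v u by blast+
  have c: "meq (v * star v) (u * (v * star v) * star u)" "ple (u * (v * star v) * star u) (u * star u)"
    using conj_pm[OF u(1) pu, of "v * star v"] pis_pm[OF v(1) pv] v(3) u(2) by auto
  have "meq p (v * star v)" unfolding meq_def using v by blast
  then have "meq p (u * (v * star v) * star u)" using meq_trans[OF p _ c(1)] by blast
  moreover have "ple (u * (v * star v) * star u) r" using c(2) u(3) ple_trans by blast
  ultimately show ?thesis using mle_iff[OF p] meq_pm[OF p] by blast
qed

lemma meq_add:
  assumes p: "pm p" "pm p'" and "meq p q" "meq p' q'" and o: "p * p' = 0" "q * q' = 0"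
  shows "meq (p + p') (q + q')"
proof -
  obtain v u where v: "v \<in> M" "star v * v = p" "v * star v = q" and u: "u \<in> M" "star u * u = p'" "u * star u = q'"
    using assms unfolding meq_def by blast
  have pv: "pis v" and pu: "pis u" using pis_of_initial p v u by blast+
  have "star v * u = star v * q * (q' * u)"
    using pisD(5)[OF pv] pisD(1)[OF pu] v(3) u(3) by (metis mult.assoc)
  then have 1: "star v * u = 0" using o(2) by (metis mult.assoc mult_zero_left mult_zero_right)
  have "v * star u = v * p * (p' * star u)"
    using pisD(1)[OF pv] pisD(5)[OF pu] v(2) u(2) by (metis mult.assoc)
  then have 2: "v * star u = 0" using o(1) by (metis mult.assoc mult_zero_left mult_zero_right)
  have 3: "star u * v = 0" "u * star v = 0" using 1 2 by (metis star_mult star_star star_simps(1))+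
  show ?thesis unfolding meq_def
    using v u 1 2 3 by (intro bexI[of _ "v + u"]) (auto simp: M_closed algebra_simps)
qed

lemma fin_pm: "fin p \<Longrightarrow> pm p"
  by (simp add: fin_def)

text \<open>An equivalence of \<open>q\<close> with a subprojection \<open>r\<close> extends by the
  identity on \<open>p - q\<close> to an equivalence of \<open>p\<close> with a
  subprojection.\<close>

lemma fin_sub:
  assumes p: "fin p" and q: "pm q" "ple q p"
  shows "fin q"
  unfolding fin_def
proof (intro conjI allI impI)
  fix r assume r: "pm r" "meq q r" "ple r q"
  have pp: "pm p" using p by (rule fin_pm)
  have pq: "pm (p - q)" by (rule pm_diff[OF q(1) pp q(2)])
  have o: "(p - q) * q = 0" using q by (simp add: ple_def algebra_simps pmD)
  then have o': "(p - q) * r = 0" using r(3) unfolding ple_def by (metis mult.assoc mult_zero_left)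
  have "meq (p - q + q) (p - q + r)" by (rule meq_add[OF pq q(1) meq_refl[OF pq] r(2) o o'])
  moreover have "pm (p - q + r)" by (rule pm_add[OF pq r(1) o'])
  moreover have "ple (p - q + r) p"
    using ple_add ple_diff[of q p] ple_trans[OF r(3) q(2)] q pp by (simp add: pm_def)
  ultimately have "p - q + r = p" using p unfolding fin_def by simp
  then show "r = q" by (simp add: algebra_simps)
qed (rule q)

lemma fin_meq:
  assumes p: "fin p" and pq: "meq p q"
  shows "fin q"
  unfolding fin_def
proof (intro conjI allI impI)
  have pp: "pm p" using p by (rule fin_pm)
  show qq: "pm q" by (rule meq_pm[OF pp pq])
  fix r assume r: "pm r" "meq q r" "ple r q"
  obtain v where v: "v \<in> M" "star v * v = p" "v * star v = q" using pq unfolding meq_def by blast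
  have pv: "pis v" using pis_of_initial pp v by blast
  have c: "pm (star v * r * v)" "meq r (star v * r * v)" "ple (star v * r * v) p"
    using conj_pm[of "star v" r] v pisD(4)[OF pv] r by (auto simp: M_closed)
  have "meq p (star v * r * v)" using meq_trans[OF pp pq] meq_trans[OF qq r(2) c(2)] by blast
  then have "star v * r * v = p" using p c unfolding fin_def by blast
  then have "v * (star v * r * v) * star v = v * p * star v" by simp
  moreover have "v * (star v * r * v) * star v = q * r * q" by (simp add: v(3)[symmetric] mult.assoc)
  moreover have "q * r * q = r" using r(3) ple_right[of r q] r(1) qq by (simp add: ple_def pm_def)
  moreover have "v * p * star v = q" using pisD(1)[OF pv] v by simp
  ultimately show "r = q" by simp
qed

lemma fin_mle: "fin q \<Longrightarrow> pm p \<Longrightarrow> mle p q \<Longrightarrow> fin p"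
  using mle_iff fin_sub fin_meq meq_sym by metis

text \<open>By way of \<open>E\<close>, the projection \<open>f\<close> embeds into its own
  subprojection \<open>F\<close>, which finiteness allows only for \<open>F = f\<close>.\<close>

lemma fin_squeeze:
  assumes f: "fin f" and E: "pm E" and F: "pm F" and "mle f E" "mle E F" "ple F f"
  shows "F = f"
proof -
  have pf: "pm f" by (rule fin_pm[OF f])
  have "mle f F" using mle_trans[OF pf E assms(4,5) pmD(2)[OF F]] .
  then obtain r where r: "pm r" "meq f r" "ple r F" using mle_iff[OF pf] by blast
  have "ple r f" using ple_trans[OF r(3) assms(6)] .
  then have "r = f" using f r(1,2) unfolding fin_def by blast
  then show ?thesis using ple_antisym[of F f] r(3) assms(6) F pf by (simp add: pm_def)
qed

lemma orth_seq_pm: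
  assumes "\<And>n. pm (r n)" "\<And>m n. m \<noteq> n \<Longrightarrow> r m * r n = 0"
  shows "orth_seq r"
  using assms by (simp add: orth_seq_def proj_pis pmD)

lemma pm_sum_seq:
  assumes r: "\<And>n. pm (r n)" and o: "\<And>m n. m \<noteq> n \<Longrightarrow> r m * r n = 0"
  obtains R where "pm R" "sconv (\<lambda>n. \<Sum>i<n. r i) R" "\<And>n. ple (r n) R"
    "\<And>p. (\<And>n. ple (r n) p) \<Longrightarrow> ple R p" "\<And>x. (\<And>n. x * r n = 0) \<Longrightarrow> x * R = 0"
proof -
  obtain V where V: "sconv (\<lambda>n. \<Sum>i<n. r i) V" "pis V" "sconv (\<lambda>n. \<Sum>i<n. star (r i) * r i) (star V * V)"
    "\<And>i. ple (star (r i) * r i) (star V * V)"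
    using orth_sum[OF orth_seq_pm[of r, OF r o]] by blast
  have rr: "star (r n) * r n = r n" for n using r[of n] by (simp add: pmD)
  have eq: "star V * V = V" using V(1,3) sconv_unique unfolding rr by blast
  have "V \<in> M" using salgD(5)[OF M_salg _ V(1)] r by (simp add: M_closed pmD)
  then have pV: "pm V" using pis_pm[of V] V(2) eq by simp
  show ?thesis
  proof (rule that[OF pV V(1)])
    show "ple (r n) V" for n using V(4)[of n] by (simp add: rr eq)
    show "ple V p" if "\<And>n. ple (r n) p" for p
      using sconv_mult_left[OF V(1), of p] that V(1) sconv_unique unfolding ple_def sum_distrib_left by simp
    show "x * V = 0" if "\<And>n. x * r n = 0" for x
      using sconv_mult_left[OF V(1), of x] that unfolding sum_distrib_left by (simp add: sconv_const_iff)
  qed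
qed

text \<open>Shifting the copies of \<open>g\<close> by one place makes their supremum equivalent to
  itself minus the copy number 0, although a projection below \<open>p\<close> is finite.\<close>

lemma fin_no_infinite_copies:
  fixes r :: "nat \<Rightarrow> 'h cop"
  assumes p: "fin p" and g: "pm g" "g \<noteq> 0"
    and r: "\<And>n. pm (r n)" "\<And>n. ple (r n) p" "\<And>m n. m \<noteq> n \<Longrightarrow> r m * r n = 0" "\<And>n. mle g (r n)"
  shows False
proof -
  have pp: "pm p" by (rule fin_pm[OF p])
  obtain w where w: "\<And>n. w n \<in> M" "\<And>n. star (w n) * w n = g" "\<And>n. ple (w n * star (w n)) (r n)"
    using r(4) unfolding mle_def by metis
  define s where "s = (\<lambda>n. w n * star (w n))"
  have pw: "pis (w n)" for n using pis_of_initial[OF g(1) w(2)] .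
  have s: "pm (s n)" for n unfolding s_def using pis_pm[OF w(1) pw] by blast
  have rw: "r n * w n = w n" for n by (rule pis_left[OF pw w(3)])
  have ww: "star (w m) * w n = 0" if "m \<noteq> n" for m n
  proof -
    have "star (w m) * w n = star (r m * w m) * (r n * w n)" by (simp add: rw)
    also have "\<dots> = star (w m) * (r m * r n) * w n" by (simp add: star_mult pmD(3)[OF r(1)] mult.assoc)
    finally show ?thesis using r(3)[OF that] by simp
  qed
  have so: "s m * s n = 0" if "m \<noteq> n" for m n
  proof -
    have "s m * s n = w m * (star (w m) * w n) * star (w n)" by (simp add: s_def mult.assoc)
    then show ?thesis by (simp add: ww[OF that])
  qed
  have gw: "w n * g = w n" for n using pisD(1)[OF pw[of n]] w(2)[of n] by simp
  \<comment> \<open>\<open>v n\<close> carries copy \<open>n\<close> to copy \<open>n + 1\<close>;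
    the strong sum of the \<open>v n\<close> is the shift.\<close>
  define v where "v = (\<lambda>n. w (Suc n) * star (w n))"
  have vv: "star (v n) * v n = s n" for n
  proof -
    have "star (v n) * v n = w n * (star (w (Suc n)) * w (Suc n)) * star (w n)" by (simp add: v_def star_mult mult.assoc)
    then show ?thesis by (simp add: w(2) gw s_def)
  qed
  have vv': "v n * star (v n) = s (Suc n)" for n
  proof -
    have "v n * star (v n) = w (Suc n) * (star (w n) * w n) * star (w (Suc n))" by (simp add: v_def star_mult mult.assoc)
    then show ?thesis by (simp add: w(2) gw s_def)
  qed
  have vo: "orth_seq v" unfolding orth_seq_def
  proof (intro conjI allI impI)
    show "pis (v n)" for n unfolding pis_def vv using s by (simp add: pmD)
    fix m n :: nat assume "m \<noteq> n"
    have "star (v m) * v n = w m * (star (w (Suc m)) * w (Suc n)) * star (w n)"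
      by (simp add: v_def star_mult mult.assoc)
    then show "star (v m) * v n = 0" using ww \<open>m \<noteq> n\<close> by simp
    have "v m * star (v n) = w (Suc m) * (star (w m) * w n) * star (w (Suc n))"
      by (simp add: v_def star_mult mult.assoc)
    then show "v m * star (v n) = 0" using ww \<open>m \<noteq> n\<close> by simp
  qed
  obtain V where V: "sconv (\<lambda>n. \<Sum>i<n. v i) V" "pis V" "sconv (\<lambda>n. \<Sum>i<n. s i) (star V * V)"
    "sconv (\<lambda>n. \<Sum>i<n. s (Suc i)) (V * star V)"
    using orth_sum[OF vo] unfolding vv vv' by blast
  have VM: "V \<in> M" using salgD(5)[OF M_salg _ V(1)] by (simp add: M_closed w v_def)
  define R R' where "R = star V * V" and "R' = V * star V"
  have RR: "pm R" "pm R'" using pis_pm[OF VM V(2)] by (auto simp: R_def R'_def)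
  obtain R0 where R0: "sconv (\<lambda>n. \<Sum>i<n. s i) R0" "\<And>n. ple (s n) R0" "\<And>q. (\<And>n. ple (s n) q) \<Longrightarrow> ple R0 q"
    using pm_sum_seq[of s, OF s so] by metis
  have "R0 = R" using R0(1) V(3) sconv_unique unfolding R_def by blast
  have "ple (s n) p" for n using ple_trans[OF w(3) r(2)] by (simp add: s_def)
  then have Rp: "ple R p" using R0(3) \<open>R0 = R\<close> by blast
  obtain R1 where R1: "sconv (\<lambda>n. \<Sum>i<n. s (Suc i)) R1" "\<And>q. (\<And>n. ple (s (Suc n)) q) \<Longrightarrow> ple R1 q"
    "\<And>x. (\<And>n. x * s (Suc n) = 0) \<Longrightarrow> x * R1 = 0"
    using pm_sum_seq[of "\<lambda>n. s (Suc n)"] s so by (metis Suc_inject)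
  have "R1 = R'" using R1(1) V(4) sconv_unique unfolding R'_def by blast
  have R'R: "ple R' R" using R1(2) R0(2) \<open>R0 = R\<close> \<open>R1 = R'\<close> by blast
  have s0: "s 0 * R' = 0" using R1(3) so \<open>R1 = R'\<close> by simp
  have meqR: "meq R R'" unfolding meq_def R_def R'_def using VM by blast
  have "R' = R" using fin_sub[OF p RR(1) Rp] RR(2) meqR R'R unfolding fin_def by blast
  then have "s 0 = 0" using s0 R0(2)[of 0] \<open>R0 = R\<close> ple_right[of "s 0" R] s[of 0] RR(1) by (simp add: pm_def)
  then have "w 0 = 0" unfolding s_def by (metis star_self_eq_0 star_star star_eq_0)
  then show False using w(2)[of 0] g(2) by simp
qed

text \<open>Conjugates of \<open>r\<close> by the powers of \<open>x\<close>. When \<open>x\<close>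
  maps \<open>p\<close> isometrically into itself and \<open>r\<close> is orthogonal to the range of
  \<open>x\<close>, these are wandering projections.\<close>

primrec shift_seq :: "'h cop \<Rightarrow> 'h cop \<Rightarrow> nat \<Rightarrow> 'h cop" where
  "shift_seq x r 0 = r"
| "shift_seq x r (Suc n) = x * shift_seq x r n * star x"

lemma shift_seq:
  assumes x: "x \<in> M" "star x * x = p" "ple (x * star x) p" and p: "pm p" and r: "pm r" "ple r p" "r * x = 0"
  shows "pm (shift_seq x r n)" "ple (shift_seq x r n) p" "meq r (shift_seq x r n)"
    "m \<noteq> n \<Longrightarrow> shift_seq x r m * shift_seq x r n = 0"
proof -
  let ?r = "shift_seq x r"
  have px: "pis x" using pis_of_initial p x by blast
  have all: "pm (?r n) \<and> ple (?r n) p \<and> meq r (?r n)" for n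
  proof (induct n)
    case (Suc n)
    have c: "pm (?r (Suc n))" "meq (?r n) (?r (Suc n))" "ple (?r (Suc n)) (x * star x)"
      using conj_pm[OF x(1) px, of "?r n"] Suc x(2) by auto
    then show ?case using Suc meq_trans[OF r(1), of "?r n"] ple_trans[OF c(3) x(3)] by blast
  qed (use r meq_refl in auto)
  then show "pm (?r n)" "ple (?r n) p" "meq r (?r n)" by blast+
  have sx: "star x * r = 0" using r by (metis star_mult star_simps(1) pmD(3))
  have o: "?r m * ?r (m + Suc k) = 0" for m k
  proof (induct m)
    case 0 then show ?case using r(3) by (simp add: mult.assoc[symmetric])
  next
    case (Suc m)
    have "p * ?r (m + Suc k) = ?r (m + Suc k)" using all ple_def by blast
    moreover have "(x * a * star x) * (x * b * star x) = x * (a * (p * b)) * star x" for a b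
      by (simp add: mult.assoc x(2)[symmetric])
    ultimately have "?r (Suc m) * ?r (Suc m + Suc k) = x * (?r m * ?r (m + Suc k)) * star x"
      by (simp only: add_Suc shift_seq.simps(2))
    then show ?case by (simp only: Suc mult_zero_left mult_zero_right)
  qed
  have "?r m * ?r n = 0" if "m < n" for m n using o[of m "n - m - 1"] that by simp
  then show "?r m * ?r n = 0" if "m \<noteq> n"
    using that orth_sym[of "?r n" "?r m"] all by (metis linorder_neqE_nat pm_def)
qed

text \<open>An isometry \<open>x\<close> of \<open>p\<close> onto a proper subprojection
  \<open>q\<close> moves the defect \<open>p - q\<close> through infinitely many mutually orthogonal
  places.\<close>

lemma infinite_copies:
  assumes p: "pm p" "\<not> fin p"
  obtains r :: "nat \<Rightarrow> 'h cop" where "\<And>n. pm (r n)" "\<And>n. ple (r n) p" "\<And>m n. m \<noteq> n \<Longrightarrow> r m * r n = 0"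
    "\<And>n. meq (r 0) (r n)" "r 0 \<noteq> 0"
proof -
  obtain q where q: "pm q" "meq p q" "ple q p" "q \<noteq> p" using p unfolding fin_def by blast
  obtain x where x: "x \<in> M" "star x * x = p" "x * star x = q" using q(2) unfolding meq_def by blast
  have "q * x = x" using pis_left[OF pis_of_initial[OF p(1) x(2)]] x(3) ple_refl q(1) by (auto simp: pm_def)
  moreover have "p * x = x" using \<open>q * x = x\<close> q(3) unfolding ple_def by (metis mult.assoc)
  ultimately have "(p - q) * x = 0" by (simp add: algebra_simps)
  note s = shift_seq[OF x(1,2) _ p(1) pm_diff[OF q(1) p(1) q(3)] _ this]
  show ?thesis
  proof (rule that[of "shift_seq x (p - q)"])
    have "ple (x * star x) p" "ple (p - q) p" using q x p by (auto simp: pm_def intro: ple_diff)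
    note s' = s[OF this]
    show "pm (shift_seq x (p - q) n)" "ple (shift_seq x (p - q) n) p" for n using s' by blast+
    show "m \<noteq> n \<Longrightarrow> shift_seq x (p - q) m * shift_seq x (p - q) n = 0" for m n using s' by blast
    show "meq (shift_seq x (p - q) 0) (shift_seq x (p - q) n)" for n using s'(3) by simp
    show "shift_seq x (p - q) 0 \<noteq> 0" using q(4) by simp
  qed
qed

text \<open>Cantor's argument: \<open>x = w * v\<close> maps \<open>p\<close> into itself, and
  \<open>R\<close> collects the translates of the part \<open>r0\<close> of \<open>p\<close> missed
  by \<open>w\<close>. The equivalence is \<open>v\<close> on \<open>R\<close> and the inverse of
  \<open>w\<close> on \<open>p - R\<close>.\<close>

lemma schroeder_bernstein:
  assumes p: "pm p" and q: "pm q" and "mle p q" "mle q p"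
  shows "meq p q"
proof -
  obtain v w where v: "v \<in> M" "star v * v = p" "ple (v * star v) q" and w: "w \<in> M" "star w * w = q" "ple (w * star w) p"
    using assms unfolding mle_def by blast
  have pv: "pis v" and pw: "pis w" using pis_of_initial p q v w by blast+
  have qv: "q * v = v" by (rule pis_left[OF pv v(3)])
  have pw': "p * w = w" by (rule pis_left[OF pw w(3)])
  have wq: "w * q = w" using pisD(1)[OF pw] w(2) by simp
  have vp: "v * p = v" using pisD(1)[OF pv] v(2) by simp
  have sw: "q * star w = star w" "star w * p = star w" "star v * q = star v" "p * star v = star v"
    using wq pw' qv vp pmD(3)[OF p] pmD(3)[OF q] by (metis star_mult)+
  have pp: "p * p = p" "star p = p" and qq: "q * q = q" using p q by (simp_all add: pmD)
  define x where "x = w * v"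
  have xM: "x \<in> M" using v w by (simp add: x_def M_closed)
  have xx: "star x * x = p"
  proof -
    have "star x * x = star v * (star w * w) * v" by (simp add: x_def star_mult mult.assoc)
    then show ?thesis by (simp add: w(2) mult.assoc qv v(2))
  qed
  have px: "p * x = x" by (simp add: x_def mult.assoc[symmetric] pw')
  have xp: "ple (x * star x) p" unfolding ple_def by (simp add: mult.assoc[symmetric] px)
  define r0 where "r0 = p - w * star w"
  have r0: "pm r0" "ple r0 p" unfolding r0_def
    using pm_diff[OF _ p w(3)] ple_diff[OF _ _ w(3)] pis_pm[OF w(1) pw] p by (auto simp: pm_def)
  have r0w: "r0 * w = 0" using pisD(1)[OF pw] by (simp add: r0_def left_diff_distrib pw' mult.assoc)
  have r0x: "r0 * x = 0" by (simp add: x_def mult.assoc[symmetric] r0w)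
  let ?r = "shift_seq x r0"
  note s = shift_seq[OF xM xx xp p r0 r0x]
  obtain R where R: "pm R" "sconv (\<lambda>n. \<Sum>i<n. ?r i) R" "\<And>n. ple (?r n) R" "\<And>q. (\<And>n. ple (?r n) q) \<Longrightarrow> ple R q"
    "\<And>x. (\<And>n. x * ?r n = 0) \<Longrightarrow> x * R = 0"
    using pm_sum_seq[of ?r, OF s(1) s(4)] by metis
  have Rp: "p * R = R" using R(4)[of p] s(2) by (simp add: ple_def)
  then have Rp': "R * p = R" using ple_right[of R p] R(1) p by (simp add: ple_def pm_def)
  have RR: "R * R = R" "star R = R" using R(1) by (simp_all add: pmD)
  have Rr: "R * ?r n = ?r n" for n using R(3) by (simp add: ple_def)
  have xr: "x * ?r n = ?r (Suc n) * x" for n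
  proof -
    have "?r n * p = ?r n" using ple_right[of "?r n" p] s(1,2)[of n] p by (simp add: pm_def)
    then show ?thesis by (simp add: mult.assoc xx)
  qed
  have "((p - R) * x) * ?r n = 0" for n
  proof -
    have "(p - R) * ?r (Suc n) = 0" using s(2)[of "Suc n"] Rr[of "Suc n"]
      by (simp only: left_diff_distrib ple_def diff_self)
    then have "(p - R) * (?r (Suc n) * x) = 0" by (simp only: mult.assoc[symmetric] mult_zero_left)
    then show ?thesis by (simp only: mult.assoc xr)
  qed
  then have xR: "(p - R) * x * R = 0" by (rule R(5))
  then have xR': "R * star x * (p - R) = 0"
    by (metis (no_types, lifting) RR(2) pp(2) mult.assoc star_mult star_simps(1) star_simps(4))
  have "(p - R) * r0 = 0" using Rr[of 0] r0(2) by (simp add: left_diff_distrib ple_def)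
  \<comment> \<open>As \<open>R\<close> contains everything that \<open>w\<close> misses,
    \<open>p - R\<close> lies in the final projection of \<open>w\<close>.\<close>
  then have Rw: "(p - R) * (w * star w) = p - R"
    by (simp add: r0_def algebra_simps pp Rp')
  define u where "u = v * R + star w * (p - R)"
  have uM: "u \<in> M" using v w R(1) p by (simp add: u_def M_closed pmD)
  have su: "star u = R * star v + (p - R) * w" by (simp add: u_def star_mult RR pp)
  have "star u * u = R * (star v * v) * R + R * (star v * star w) * (p - R) + (p - R) * (w * v) * R + (p - R) * (w * star w) * (p - R)"
    unfolding su by (simp only: u_def distrib_left distrib_right mult.assoc) (simp only: add.commute add.left_commute add.assoc)
  also have "R * (star v * v) * R = R" by (simp add: v(2) Rp' RR)
  also have "R * (star v * star w) * (p - R) = 0" using xR' by (simp add: x_def star_mult)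
  also have "(p - R) * (w * v) * R = 0" using xR by (simp add: x_def)
  also have "(p - R) * (w * star w) * (p - R) = p - R" unfolding Rw by (simp add: algebra_simps pp RR Rp Rp')
  finally have uu: "star u * u = p" by simp
  \<comment> \<open>\<open>star w\<close> kills the translate number 0 and sends translate
    \<open>n + 1\<close> to the image of translate \<open>n\<close> under \<open>v\<close>. Hence
    both halves of \<open>u\<close> fill \<open>q\<close> without overlap.\<close>
  have "sconv (\<lambda>n. star w * (\<Sum>i<Suc n. ?r i) * w) (star w * R * w)"
    using sconv_mult_right[OF sconv_mult_left[OF sconv_Suc[OF R(2)]]] .
  moreover have "star w * (\<Sum>i<Suc n. ?r i) * w = v * (\<Sum>i<n. ?r i) * star v" for n
  proof (induct n)
    case 0 then show ?case by (simp add: mult.assoc r0w)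
  next
    case (Suc n)
    have "star w * ?r (Suc n) * w = (star w * w) * v * ?r n * star v * (star w * w)"
      by (simp add: x_def star_mult mult.assoc)
    also have "\<dots> = v * ?r n * star v" by (simp add: w(2) qv mult.assoc sw)
    finally show ?case using Suc by (simp only: sum.lessThan_Suc distrib_left distrib_right)
  qed
  moreover have "sconv (\<lambda>n. v * (\<Sum>i<n. ?r i) * star v) (v * R * star v)"
    using sconv_mult_right[OF sconv_mult_left[OF R(2)]] .
  ultimately have wR: "star w * R * w = v * R * star v" using sconv_unique by simp
  have "R * (p - R) = 0" "(p - R) * R = 0" "(p - R) * (p - R) = p - R" by (simp_all add: algebra_simps RR Rp Rp' pp)
  then have o: "R * ((p - R) * z) = 0" "(p - R) * (R * z) = 0" "(p - R) * ((p - R) * z) = (p - R) * z" "R * (R * z) = R * z" for z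
    by (simp_all add: mult.assoc[symmetric] RR)
  have "u * star u = v * R * star v + star w * (p - R) * w"
    unfolding su unfolding u_def by (simp add: distrib_left distrib_right mult.assoc o)
  also have "star w * (p - R) * w = q - v * R * star v"
    using wR by (simp add: algebra_simps) (simp add: mult.assoc[symmetric] sw w(2))
  finally have "u * star u = q" by simp
  then show ?thesis unfolding meq_def using uu uM by blast
qed

text \<open>Division with remainder: \<open>p\<close> is split into copies of \<open>b\<close> and a
  rest smaller than \<open>b\<close>, and finiteness bounds the number of copies. \<open>B\<close>
  is the algebra in which the final projections are to lie: \<open>M\<close> itself or the
  masa.\<close>

lemma finite_cover_in:
  assumes p: "fin p" and b: "pm b" "b \<noteq> 0" and B: "salg B" "p \<in> B"
    and fit: "\<And>r. pm r \<Longrightarrow> r \<in> B \<Longrightarrow> mle b r \<Longrightarrow> \<exists>f\<in>B. pm f \<and> meq b f \<and> ple f r"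
  shows "\<exists>k v. (\<forall>i. v i \<in> M \<and> pis (v i)) \<and> (\<forall>i<k. star (v i) * v i = b) \<and> ple (star (v k) * v k) b \<and>
    (\<forall>i\<le>k. \<forall>j\<le>k. i \<noteq> j \<longrightarrow> star (v i) * v j = 0) \<and> (\<Sum>i<Suc k. v i * star (v i)) = p \<and>
    (\<forall>i\<le>k. v i * star (v i) \<in> B)"
proof -
  have pp: "pm p" by (rule fin_pm[OF p])
  define W where "W = {f \<in> B. pm f \<and> f \<noteq> 0 \<and> meq b f}"
  have W: "W \<subseteq> M" "\<And>w. w \<in> W \<Longrightarrow> pis w \<and> w \<noteq> 0" by (auto simp: W_def pm_def proj_pis)
  obtain f V where ms: "maximal_sum W p p f V" using exhaustion[OF W pp pp] by blast
  have f: "f n = 0 \<or> f n \<in> W" for n using maximal_sumD(1)[OF ms, of n] by blast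
  have pf: "pm (f n)" for n using f[of n] by (auto simp: W_def)
  have sf: "star (f n) = f n" "f n * f n = f n" for n using pf[of n] by (simp_all add: pmD)
  have fo: "f m * f n = 0" if "m \<noteq> n" for m n
    using maximal_sumD(2)[OF ms] that unfolding orth_seq_def sf by blast
  have fF: "ple (f n) p" for n
    using ple_trans[OF maximal_sumD(8)[OF ms, of n] maximal_sumD(11)[OF ms]] by (simp add: sf)
  define F where "F = star V * V"
  have F: "sconv (\<lambda>n. \<Sum>i<n. f i) F" "pm F" "ple F p" "ple (V * star V) p"
    using maximal_sumD(6)[OF ms] pis_pm[OF maximal_sumD(3,4)[OF ms]] maximal_sumD(11,12)[OF ms] by (simp_all add: sf F_def)
  have F': "V * star V = F"
    using maximal_sumD(7)[OF ms] F(1) sconv_unique by (simp add: sf) blast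
  have fin: "finite {n. f n \<noteq> 0}"
  proof (rule ccontr)
    assume inf: "infinite {n. f n \<noteq> 0}"
    define g where "g = enumerate {n. f n \<noteq> 0}"
    have g: "f (g n) \<noteq> 0" for n using enumerate_in_set[OF inf, of n] by (simp add: g_def)
    have gi: "g m \<noteq> g n" if "m \<noteq> n" for m n
      using strict_mono_enumerate[OF inf] that unfolding g_def by (simp add: strict_mono_eq)
    have "mle b (f (g n))" for n
    proof -
      have "f (g n) \<in> W" using f g by blast
      then show ?thesis using mle_iff[OF b(1)] pf ple_refl pmD(2)[OF pf] unfolding W_def by blast
    qed
    then show False using fin_no_infinite_copies[OF p b, of "\<lambda>n. f (g n)"] pf fF fo gi by blast
  qed
  obtain e where e: "bij_betw e {..<card {n. f n \<noteq> 0}} {n. f n \<noteq> 0}"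
    using ex_bij_betw_nat_finite[OF fin] by (auto simp: atLeast0LessThan)
  define k where "k = card {n. f n \<noteq> 0}"
  obtain N where N: "\<And>n. f n \<noteq> 0 \<Longrightarrow> n < N" using fin unfolding finite_nat_set_iff_bounded by blast
  have "(\<Sum>i<n. f i) = (\<Sum>i\<in>{n. f n \<noteq> 0}. f i)" if "n > N" for n
    using N that by (intro sum.mono_neutral_right) (auto intro: less_trans)
  then have "F = (\<Sum>i\<in>{n. f n \<noteq> 0}. f i)" by (rule sconv_eventually_const[OF F(1)])
  also have "\<dots> = (\<Sum>i<k. f (e i))" using sum.reindex_bij_betw[OF e, of f] by (simp add: k_def)
  finally have Fe: "F = (\<Sum>i<k. f (e i))" .
  have fe: "f (e i) \<in> W" if "i < k" for i
    using bij_betw_apply[OF e, of i] that f[of "e i"] by (auto simp: k_def)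
  have eo: "e i \<noteq> e j" if "i < k" "j < k" "i \<noteq> j" for i j
    using bij_betw_imp_inj_on[OF e] that by (auto simp: k_def inj_on_def)
  define r where "r = p - F"
  have r: "pm r" unfolding r_def by (rule pm_diff[OF F(2) pp F(3)])
  have fB: "f n \<in> B" for n using f[of n] salg_closed(3)[OF B(1)] by (auto simp: W_def)
  have "F \<in> B" by (rule salgD(5)[OF B(1) _ F(1)]) (rule salg_sum[OF B(1) fB])
  then have rB: "r \<in> B" unfolding r_def by (rule salg_closed(2)[OF B])
  have "\<not> mle b r"
  proof
    assume "mle b r"
    then obtain f' where f': "f' \<in> B" "pm f'" "meq b f'" "ple f' r" using fit[OF r rB] by blast
    have "f' \<noteq> 0"
    proof
      assume "f' = 0"
      then obtain v where "star v * v = b" "v * star v = 0" using f'(3) unfolding meq_def by blast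
      then show False using b(2) by (metis star_self_eq_0 star_star star_eq_0 mult_zero_left mult_zero_right)
    qed
    then show False using maximal_sumD(13)[OF ms, of f'] f' F'
      by (simp add: W_def r_def F_def[symmetric] pmD)
  qed
  then have "mle r b" using comparison[OF b(1) r] by blast
  then obtain u where u: "u \<in> M" "star u * u = r" "ple (u * star u) b" unfolding mle_def by blast
  have "\<forall>i<k. \<exists>v\<in>M. star v * v = b \<and> v * star v = f (e i)" using fe unfolding W_def meq_def by blast
  then obtain v where v: "\<And>i. i < k \<Longrightarrow> v i \<in> M \<and> star (v i) * v i = b \<and> v i * star (v i) = f (e i)" by metis
  \<comment> \<open>Slot \<open>k\<close> holds the remainder; since \<open>u\<close> leads from the
    remainder into \<open>b\<close>, its adjoint has the required direction. Later slots are padded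
    with 0.\<close>
  define z where "z = (\<lambda>i. if i < k then v i else if i = k then star u else 0)"
  have pu: "pis u" using pis_of_initial[OF r u(2)] .
  have pz: "z i \<in> M \<and> pis (z i)" for i
    using v[of i] pis_of_initial[OF b(1)] u(1) pisD(4)[OF pu] by (auto simp: z_def M_closed)
  define h where "h = (\<lambda>i. if i < k then f (e i) else r)"
  have zh: "z i * star (z i) = h i" if "i \<le> k" for i using that v[of i] u(2) by (auto simp: z_def h_def)
  have ho: "h i * h j = 0" if "i \<le> k" "j \<le> k" "i \<noteq> j" for i j
  proof -
    have *: "f n * r = 0" for n
      using fF[of n] ple_right[of "f n" p] ple_right[of "f n" F] maximal_sumD(8)[OF ms, of n] pf[of n] pp F(2)
      by (simp add: r_def right_diff_distrib pm_def F_def[symmetric] sf)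
    then have "r * f n = 0" for n using orth_sym[of "f n" r] pf[of n] r by (simp add: pm_def)
    with * show ?thesis using that fo eo by (auto simp: h_def)
  qed
  have "star (z i) * z j = 0" if "i \<le> k" "j \<le> k" "i \<noteq> j" for i j
  proof -
    have "star (z i) * z j = star (z i) * (h i * h j) * z j"
      using pisD(5)[of "z i"] pisD(1)[of "z j"] pz zh[OF that(1)] zh[OF that(2)] by (metis mult.assoc)
    then show ?thesis by (simp add: ho that)
  qed
  moreover have "(\<Sum>i<Suc k. z i * star (z i)) = p"
  proof -
    have "(\<Sum>i<k. z i * star (z i)) = F" unfolding Fe by (rule sum.cong) (use v in \<open>auto simp: z_def\<close>)
    then show ?thesis by (simp add: z_def u(2) r_def)
  qed
  moreover have "star (z i) * z i = b" if "i < k" for i using v that by (simp add: z_def)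
  moreover have "ple (star (z k) * z k) b" using u(3) by (simp add: z_def)
  moreover have "z i * star (z i) \<in> B" if "i \<le> k" for i using zh[OF that] fB rB by (simp add: h_def)
  ultimately show ?thesis using pz by (intro exI[of _ k] exI[of _ z]) auto
qed

lemma finite_cover:
  assumes p: "fin p" and b: "pm b" "b \<noteq> 0"
  shows "\<exists>k v. (\<forall>i. v i \<in> M \<and> pis (v i)) \<and> (\<forall>i<k. star (v i) * v i = b) \<and> ple (star (v k) * v k) b \<and>
    (\<forall>i\<le>k. \<forall>j\<le>k. i \<noteq> j \<longrightarrow> star (v i) * v j = 0) \<and> (\<Sum>i<Suc k. v i * star (v i)) = p"
proof -
  have *: "\<exists>f\<in>M. pm f \<and> meq b f \<and> ple f r" if "pm r" "r \<in> M" "mle b r" for r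
    using that mle_iff[OF b(1)] pmD(1) by blast
  have "\<exists>k v. (\<forall>i. v i \<in> M \<and> pis (v i)) \<and> (\<forall>i<k. star (v i) * v i = b) \<and> ple (star (v k) * v k) b \<and>
    (\<forall>i\<le>k. \<forall>j\<le>k. i \<noteq> j \<longrightarrow> star (v i) * v j = 0) \<and> (\<Sum>i<Suc k. v i * star (v i)) = p \<and>
    (\<forall>i\<le>k. v i * star (v i) \<in> M)"
    by (rule finite_cover_in[OF p b M_salg pmD(1)[OF fin_pm[OF p]]]) (rule *)
  then show ?thesis by blast
qed

text \<open>A nonzero \<open>p\<close> contains infinitely many orthogonal copies \<open>r n\<close>
  of one projection. By comparison \<open>q\<close> breaks up into countably many pieces smaller
  than \<open>r 0\<close>, and piece \<open>n\<close> is placed into \<open>r n\<close>; symmetry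
  and \<open>schroeder_bernstein\<close> finish.\<close>

lemma type_III_meq:
  assumes III: "\<And>p. fin p \<Longrightarrow> p = 0" and p: "pm p" "p \<noteq> 0" and q: "pm q" "q \<noteq> 0"
  shows "meq p q"
proof -
  have mle: "mle q p" if p: "pm p" "p \<noteq> 0" and q: "pm q" for p q
  proof -
    obtain r :: "nat \<Rightarrow> 'h cop" where r: "\<And>n. pm (r n)" "\<And>n. ple (r n) p" "\<And>m n. m \<noteq> n \<Longrightarrow> r m * r n = 0"
      "\<And>n. meq (r 0) (r n)" "r 0 \<noteq> 0"
      using infinite_copies[OF p(1)] III p(2) by metis
    define W where "W = {f. pm f \<and> f \<noteq> 0 \<and> mle f (r 0)}"
    have W: "W \<subseteq> M" "\<And>w. w \<in> W \<Longrightarrow> pis w \<and> w \<noteq> 0" by (auto simp: W_def pm_def proj_pis)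
    obtain f V where ms: "maximal_sum W q q f V" using exhaustion[OF W q q] by blast
    have f: "f n = 0 \<or> f n \<in> W" for n using maximal_sumD(1)[OF ms, of n] by blast
    have pf: "pm (f n)" for n using f[of n] by (auto simp: W_def)
    have sf: "star (f n) = f n" "f n * f n = f n" for n using pf[of n] by (simp_all add: pmD)
    have fo: "f m * f n = 0" if "m \<noteq> n" for m n
      using maximal_sumD(2)[OF ms] that unfolding orth_seq_def sf by blast
    define F where "F = star V * V"
    have F: "sconv (\<lambda>n. \<Sum>i<n. f i) F" "pm F" "ple F q"
      using maximal_sumD(6)[OF ms] pis_pm[OF maximal_sumD(3,4)[OF ms]] maximal_sumD(11)[OF ms] by (simp_all add: sf F_def)
    have F': "V * star V = F"
      using maximal_sumD(7)[OF ms] F(1) sconv_unique by (simp add: sf) blast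
    have "q - F = 0"
    proof (rule ccontr)
      assume ne: "q - F \<noteq> 0"
      obtain v where v: "v \<in> M" "pis v" "v \<noteq> 0" "ple (star v * v) (q - F)" "ple (v * star v) (r 0)"
        using comparison_nonzero[OF pm_diff[OF F(2) q F(3)] ne r(1)[of 0] r(5)] by blast
      have "star v * v \<in> W" unfolding W_def mle_def using v pis_pm[OF v(1,2)] by (auto simp: star_self_eq_0)
      moreover have "star (star v * v) * (star v * v) = star v * v" "(star v * v) * star (star v * v) = star v * v"
        using pisD(2)[OF v(2)] by (simp_all add: proj_def)
      ultimately show False using maximal_sumD(13)[OF ms, of "star v * v"] v(4) F' by (simp add: F_def[symmetric])
    qed
    then have qF: "q = F" by simp
    have "\<exists>w\<in>M. star w * w = f n \<and> ple (w * star w) (r n)" for n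
    proof -
      have "mle (f n) (r 0)" using f[of n] mle_0 by (auto simp: W_def)
      moreover have "mle (r 0) (r n)" using mle_iff[OF r(1)] r(1,4) ple_refl pmD(2) by blast
      ultimately have "mle (f n) (r n)" using mle_trans pf r(1) pmD(2) by blast
      then show ?thesis unfolding mle_def .
    qed
    then obtain w where w: "\<And>n. w n \<in> M" "\<And>n. star (w n) * w n = f n" "\<And>n. ple (w n * star (w n)) (r n)" by metis
    have pw: "pis (w n)" for n using pis_of_initial[OF pf w(2)] .
    have "orth_seq w" unfolding orth_seq_def
    proof (intro conjI allI impI)
      fix m n :: nat assume mn: "m \<noteq> n"
      have "star (w m) * w n = star (r m * w m) * (r n * w n)" by (simp add: pis_left[OF pw w(3)])
      also have "\<dots> = star (w m) * (r m * r n) * w n" by (simp add: star_mult pmD(3)[OF r(1)] mult.assoc)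
      finally show "star (w m) * w n = 0" using r(3)[OF mn] by simp
      have "w m * star (w n) = w m * (f m * f n) * star (w n)"
        using pisD(1)[OF pw[of m]] pisD(5)[OF pw[of n]] w(2)[of m] w(2)[of n]
        by (metis mult.assoc sf(1) star_mult star_star)
      then show "w m * star (w n) = 0" using fo[OF mn] by simp
    qed (rule pw)
    then obtain X where X: "sconv (\<lambda>n. \<Sum>i<n. w i) X" "sconv (\<lambda>n. \<Sum>i<n. f i) (star X * X)"
      "sconv (\<lambda>n. \<Sum>i<n. w i * star (w i)) (X * star X)"
      using orth_sum[of w] unfolding w(2) by blast
    have "X \<in> M" using salgD(5)[OF M_salg _ X(1)] w(1) by (simp add: M_closed)
    moreover have "star X * X = q" using X(2) F(1) qF sconv_unique by blast
    moreover have "ple (X * star X) p"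
    proof -
      have "p * (w i * star (w i)) = w i * star (w i)" for i using ple_trans[OF w(3) r(2)] by (simp add: ple_def)
      then show ?thesis using sconv_mult_left[OF X(3), of p] X(3) sconv_unique
        unfolding ple_def sum_distrib_left by simp
    qed
    ultimately show ?thesis unfolding mle_def by blast
  qed
  show ?thesis by (rule schroeder_bernstein[OF p(1) q(1) mle[OF q p(1)] mle[OF p q(1)]])
qed

end

section \<open>Traces on finite factors\<close>

definition qf :: "'h::complex_hilbert \<Rightarrow> 'h cop \<Rightarrow> real" where
  "qf \<xi> x = Re (cinner (x \<cdot> \<xi>) \<xi>)"

lemma qf_simps: "qf \<xi> (x + y) = qf \<xi> x + qf \<xi> y" "qf \<xi> (x - y) = qf \<xi> x - qf \<xi> y"
  "qf \<xi> (r *\<^sub>R x) = r * qf \<xi> x" "qf \<xi> 0 = 0"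
  by (simp_all add: qf_def cinner_add_left cinner_diff_left cinner_scaleR_left)

lemma qf_sum: "qf \<xi> (\<Sum>i\<in>I. f i) = (\<Sum>i\<in>I. qf \<xi> (f i))"
  by (simp add: qf_def ap_sum cinner_sum_left)

lemma qf_star: "qf \<xi> (star x * x) = (norm (x \<cdot> \<xi>))\<^sup>2"
  unfolding qf_def by (rule norm_ap_square[symmetric])

lemma qf_star': "qf \<xi> (x * star x) = (norm (star x \<cdot> \<xi>))\<^sup>2"
  using qf_star[of \<xi> "star x"] by simp

lemma qf_proj: "proj e \<Longrightarrow> qf \<xi> e = (norm (e \<cdot> \<xi>))\<^sup>2"
  by (simp add: qf_def proj_cinner)

lemma qf_mono: "proj e \<Longrightarrow> proj f \<Longrightarrow> ple e f \<Longrightarrow> qf \<xi> e \<le> qf \<xi> f"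
  using qf_proj[OF proj_diff[of e f], of \<xi>] zero_le_power2[of "norm ((f - e) \<cdot> \<xi>)"] qf_simps(2)[of \<xi> f e] by linarith

lemma qf_sconv: "sconv f x \<Longrightarrow> (\<lambda>n. qf \<xi> (f n)) \<longlonglongrightarrow> qf \<xi> x"
  unfolding qf_def by (intro tendsto_Re tendsto_cinner tendsto_const sconvD)

text \<open>The sum of the vector functionals of the vectors \<open>v i \<cdot> \<xi>\<close>. If
  \<open>\<xi>\<close> is nearly tracial on a corner \<open>b\<close> and the \<open>v i\<close>
  resolve \<open>e\<close> over \<open>b\<close>, this is nearly a trace on the corner of
  \<open>e\<close>.\<close>

definition qtrace :: "'i set \<Rightarrow> ('i \<Rightarrow> 'h::complex_hilbert cop) \<Rightarrow> 'h \<Rightarrow> 'h cop \<Rightarrow> real" where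
  "qtrace I v \<xi> x = (\<Sum>i\<in>I. qf \<xi> (star (v i) * x * v i))"

lemma qtrace_simps: "qtrace I v \<xi> (x + y) = qtrace I v \<xi> x + qtrace I v \<xi> y"
  "qtrace I v \<xi> (x - y) = qtrace I v \<xi> x - qtrace I v \<xi> y" "qtrace I v \<xi> 0 = 0"
  by (simp_all add: qtrace_def algebra_simps qf_simps sum.distrib sum_subtractf)

lemma qtrace_sum: "qtrace I v \<xi> (\<Sum>j\<in>J. f j) = (\<Sum>j\<in>J. qtrace I v \<xi> (f j))"
  unfolding qtrace_def by (simp add: sum_distrib_left sum_distrib_right qf_sum sum.swap[of _ J I])

lemma qtrace_proj_nonneg: "proj e \<Longrightarrow> 0 \<le> qtrace I v \<xi> e"
  unfolding qtrace_def
proof (rule sum_nonneg)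
  fix i assume "proj e"
  then have "star (v i) * e * v i = star (e * v i) * (e * v i)"
    by (simp add: star_mult proj_def) (metis mult.assoc)
  then show "0 \<le> qf \<xi> (star (v i) * e * v i)" by (simp add: qf_star)
qed

context separable_factor begin

definition max_proj_sum :: "'h cop set \<Rightarrow> 'h cop \<Rightarrow> (nat \<Rightarrow> 'h cop) \<Rightarrow> 'h cop \<Rightarrow> bool" where
  "max_proj_sum W p f F \<longleftrightarrow> (\<forall>n. f n = 0 \<or> f n \<in> W) \<and> (\<forall>n. pm (f n)) \<and> (\<forall>m n. m \<noteq> n \<longrightarrow> f m * f n = 0) \<and>
    pm F \<and> ple F p \<and> sconv (\<lambda>n. \<Sum>i<n. f i) F \<and> (\<forall>n. ple (f n) F) \<and> (\<forall>w\<in>W. \<not> ple w (p - F))"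

lemma max_proj_sumD:
  assumes "max_proj_sum W p f F"
  shows "f n = 0 \<or> f n \<in> W" "pm (f n)" "m \<noteq> n \<Longrightarrow> f m * f n = 0"
    "pm F" "ple F p" "sconv (\<lambda>n. \<Sum>i<n. f i) F" "ple (f n) F"
    "w \<in> W \<Longrightarrow> ple w (p - F) \<Longrightarrow> False"
  using assms by (simp_all add: max_proj_sum_def)

lemma exhaustion_proj:
  assumes W: "\<And>f. f \<in> W \<Longrightarrow> pm f \<and> f \<noteq> 0" and p: "pm p"
  shows "\<exists>f F. max_proj_sum W p f F"
proof -
  have W': "W \<subseteq> M" "\<And>w. w \<in> W \<Longrightarrow> pis w \<and> w \<noteq> 0" using W by (auto simp: pm_def proj_pis)
  obtain f V where ms: "maximal_sum W p p f V" using exhaustion[OF W' p p] by blast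
  have f: "f n = 0 \<or> f n \<in> W" for n using maximal_sumD(1)[OF ms, of n] by blast
  have pf: "pm (f n)" for n using f[of n] W by auto
  have sf: "star (f n) = f n" "f n * f n = f n" for n using pf[of n] by (simp_all add: pmD)
  have fo: "f m * f n = 0" if "m \<noteq> n" for m n
    using maximal_sumD(2)[OF ms] that unfolding orth_seq_def sf by blast
  define F where "F = star V * V"
  have F: "sconv (\<lambda>n. \<Sum>i<n. f i) F" "pm F" "ple F p" "\<And>n. ple (f n) F"
    using maximal_sumD(6)[OF ms] pis_pm[OF maximal_sumD(3,4)[OF ms]] maximal_sumD(8,11)[OF ms] by (simp_all add: sf F_def)
  have F': "V * star V = F"
    using maximal_sumD(7)[OF ms] F(1) sconv_unique by (simp add: sf) blast
  have "False" if "w \<in> W" "ple w (p - F)" for w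
    using maximal_sumD(13)[OF ms that(1)] that(2) W[OF that(1)] by (simp add: F' F_def[symmetric] pmD)
  then have "max_proj_sum W p f F" unfolding max_proj_sum_def using f pf fo F by auto
  then show ?thesis by blast
qed

text \<open>A functional is tracial where the ratio of its values on initial and final projections
  is constant under some fixed transport. The ratio is made bounded, its supremum is almost attained
  at some \<open>u\<close>, and \<open>b\<close> is the part of the initial projection of
  \<open>u\<close> on which all ratios stay close to that supremum.\<close>

lemma near_trace_projections:
  assumes p: "fin p" "p \<noteq> 0" and d: "0 < d" "d < 1"
  obtains b \<xi> where "pm b" "b \<noteq> 0" "ple b p" "\<And>e. pm e \<Longrightarrow> e \<noteq> 0 \<Longrightarrow> ple e b \<Longrightarrow> 0 < qf \<xi> e"
    "\<And>w. w \<in> M \<Longrightarrow> pis w \<Longrightarrow> ple (star w * w) b \<Longrightarrow> ple (w * star w) b \<Longrightarrow>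
      (1 - d) * qf \<xi> (star w * w) \<le> qf \<xi> (w * star w)"
proof -
  have pp: "pm p" by (rule fin_pm[OF p(1)])
  obtain v where "p \<cdot> v \<noteq> 0" using p(2) cop_eqI[of p 0] by auto
  define \<xi> where "\<xi> = p \<cdot> v"
  have p\<xi>: "p \<cdot> \<xi> = \<xi>" unfolding \<xi>_def by (metis ap_simps(6) pmD(4)[OF pp])
  have qp: "qf \<xi> p > 0" using \<open>p \<cdot> v \<noteq> 0\<close> by (simp add: qf_proj pmD[OF pp] p\<xi>) (simp add: \<xi>_def)
  \<comment> \<open>Splitting off a maximal null part makes \<open>qf \<xi>\<close> strictly
    positive on the nonzero subprojections of the rest \<open>p0\<close>.\<close>
  define W0 where "W0 = {f. pm f \<and> f \<noteq> 0 \<and> ple f p \<and> qf \<xi> f = 0}"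
  have W0p: "pm f \<and> f \<noteq> 0" if "f \<in> W0" for f using that by (simp add: W0_def)
  obtain f0 F0 where ms0: "max_proj_sum W0 p f0 F0" using exhaustion_proj[OF W0p pp] by blast
  note F0 = max_proj_sumD(1,4-6)[OF ms0] and max0 = max_proj_sumD(8)[OF ms0]
  have "qf \<xi> (f0 n) = 0" for n using F0(1)[of n] by (auto simp: W0_def qf_simps)
  then have qF0: "qf \<xi> F0 = 0" using qf_sconv[OF F0(4), of \<xi>] by (simp add: qf_sum LIMSEQ_const_iff)
  define p0 where "p0 = p - F0"
  have p0: "pm p0" "ple p0 p" unfolding p0_def
    using pm_diff[OF F0(2) pp F0(3)] ple_diff F0(2,3) pp by (auto simp: pm_def)
  have fp0: "fin p0" using fin_sub[OF p(1) p0] .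
  have qp0: "qf \<xi> p0 > 0" using qp qF0 by (simp add: p0_def qf_simps)
  have pos: "0 < qf \<xi> e" if e: "pm e" "e \<noteq> 0" "ple e p0" for e
  proof (rule ccontr)
    assume "\<not> 0 < qf \<xi> e"
    moreover have "0 \<le> qf \<xi> e" using e by (simp add: qf_proj pmD)
    ultimately have "e \<in> W0" using e ple_trans[OF e(3) p0(2)] by (simp add: W0_def)
    then show False using max0 e(3) p0_def by blast
  qed
  \<comment> \<open>Once a maximal family of partial isometries that lower the value by more than
    the factor 2 is removed, the ratio \<open>rt\<close> is at most 2 on the rest. Any factor above
    1 would serve.\<close>
  define W where "W = {w \<in> M. pis w \<and> w \<noteq> 0 \<and> 2 * qf \<xi> (w * star w) < qf \<xi> (star w * w)}"
  have W: "W \<subseteq> M" "\<And>w. w \<in> W \<Longrightarrow> pis w \<and> w \<noteq> 0" by (auto simp: W_def)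
  obtain v V where ms: "maximal_sum W p0 p0 v V" using exhaustion[OF W p0(1) p0(1)] by blast
  define a c where "a = star V * V" and "c = V * star V"
  have ac: "pm a" "pm c" "ple a p0" "ple c p0" "meq a c"
    using pis_pm[OF maximal_sumD(3,4)[OF ms]] maximal_sumD(11,12)[OF ms] maximal_sumD(3)[OF ms]
    by (auto simp: a_def c_def meq_def)
  have "2 * qf \<xi> c \<le> qf \<xi> a"
  proof (rule LIMSEQ_le)
    show "(\<lambda>n. qf \<xi> (\<Sum>i<n. star (v i) * v i)) \<longlonglongrightarrow> qf \<xi> a"
      unfolding a_def by (rule qf_sconv[OF maximal_sumD(6)[OF ms]])
    show "(\<lambda>n. 2 * qf \<xi> (\<Sum>i<n. v i * star (v i))) \<longlonglongrightarrow> 2 * qf \<xi> c"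
      unfolding c_def by (intro tendsto_mult tendsto_const qf_sconv[OF maximal_sumD(7)[OF ms]])
    have "2 * qf \<xi> (v i * star (v i)) \<le> qf \<xi> (star (v i) * v i)" for i
      using maximal_sumD(1)[OF ms, of i] by (auto simp: W_def qf_simps)
    then have "2 * qf \<xi> (\<Sum>i<n. v i * star (v i)) \<le> qf \<xi> (\<Sum>i<n. star (v i) * v i)" for n
      unfolding qf_sum sum_distrib_left by (intro sum_mono) blast
    then show "\<exists>N. \<forall>n\<ge>N. 2 * qf \<xi> (\<Sum>i<n. v i * star (v i)) \<le> qf \<xi> (\<Sum>i<n. star (v i) * v i)" by blast
  qed
  moreover have qa: "qf \<xi> a \<le> qf \<xi> p0" by (rule qf_mono[OF pmD(2)[OF ac(1)] pmD(2)[OF p0(1)] ac(3)])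
  ultimately have "c \<noteq> p0" using qp0 by auto
  \<comment> \<open>Finiteness enters here: \<open>a = p0\<close> would make \<open>c\<close> an
    equivalent subprojection of \<open>p0\<close>, hence equal to it.\<close>
  moreover have "a \<noteq> p0"
  proof
    assume "a = p0"
    then have "c = p0" using fp0 ac unfolding fin_def by blast
    then show False using \<open>c \<noteq> p0\<close> by blast
  qed
  ultimately obtain u0 where u0: "u0 \<in> M" "pis u0" "u0 \<noteq> 0" "ple (star u0 * u0) (p0 - a)" "ple (u0 * star u0) (p0 - c)"
    using comparison_nonzero[OF pm_diff[OF ac(1) p0(1) ac(3)] _ pm_diff[OF ac(2) p0(1) ac(4)]] by auto
  have sub: "ple (p0 - a) p0" "ple (p0 - c) p0" using ple_diff ac p0 by (auto simp: pm_def)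
  define T where "T = {w \<in> M. pis w \<and> w \<noteq> 0 \<and> ple (star w * w) (p0 - a) \<and> ple (w * star w) (p0 - c)}"
  define rt where "rt = (\<lambda>w. qf \<xi> (star w * w) / qf \<xi> (w * star w))"
  have Tpos: "0 < qf \<xi> (star w * w)" "0 < qf \<xi> (w * star w)" if "w \<in> T" for w
  proof -
    have w: "w \<in> M" "pis w" "w \<noteq> 0" "ple (star w * w) (p0 - a)" "ple (w * star w) (p0 - c)" using that by (auto simp: T_def)
    have "star w * w \<noteq> 0" "w * star w \<noteq> 0" using w(3) by (metis star_self_eq_0 star_star star_eq_0)+
    then show "0 < qf \<xi> (star w * w)" "0 < qf \<xi> (w * star w)"
      using pos pis_pm[OF w(1,2)] ple_trans[OF w(4) sub(1)] ple_trans[OF w(5) sub(2)] by blast+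
  qed
  have rt2: "rt w \<le> 2" if "w \<in> T" for w
  proof -
    have "w \<notin> W" using maximal_sumD(13)[OF ms, of w] that by (auto simp: T_def a_def c_def)
    then have "qf \<xi> (star w * w) \<le> 2 * qf \<xi> (w * star w)" using that by (auto simp: W_def T_def)
    then show ?thesis using Tpos[OF that] by (simp add: rt_def divide_le_eq)
  qed
  have bdd: "bdd_above (rt ` T)" using rt2 by (intro bdd_aboveI[of _ 2]) auto
  have "u0 \<in> T" using u0 by (simp add: T_def)
  \<comment> \<open>The largest ratio on the rest; around an element that almost attains it the
    ratios are squeezed between \<open>K\<close> and \<open>C\<close>.\<close>
  define C where "C = Sup (rt ` T)"
  have rtC: "rt w \<le> C" if "w \<in> T" for w unfolding C_def using that bdd by (intro cSup_upper) auto
  have "0 < rt u0" using Tpos[OF \<open>u0 \<in> T\<close>] by (simp add: rt_def)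
  then have C: "0 < C" using rtC[OF \<open>u0 \<in> T\<close>] by linarith
  have "(1 - d) * C < Sup (rt ` T)" unfolding C_def[symmetric] using C d by (simp add: mult_less_cancel_right1)
  then obtain u where u: "u \<in> T" "(1 - d) * C < rt u" using bdd \<open>u0 \<in> T\<close> by (subst (asm) less_cSup_iff) auto
  have u': "u \<in> M" "pis u" "ple (star u * u) (p0 - a)" "ple (u * star u) (p0 - c)" using u(1) by (auto simp: T_def)
  define K where "K = (1 - d) * C"
  have K: "0 < K" using C d by (simp add: K_def)
  \<comment> \<open>Subprojections on which the ratio along \<open>u\<close> is at most
    \<open>K\<close> are exhausted; they cannot fill \<open>star u * u\<close>, because
    \<open>u\<close> itself has a larger ratio.\<close>
  define W2 where "W2 = {f. pm f \<and> f \<noteq> 0 \<and> ple f (star u * u) \<and> qf \<xi> f \<le> K * qf \<xi> (u * f * star u)}"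
  have puu: "pm (star u * u)" using pis_pm[OF u'(1,2)] by blast
  have W2p: "pm f \<and> f \<noteq> 0" if "f \<in> W2" for f using that by (simp add: W2_def)
  obtain f F where ms2: "max_proj_sum W2 (star u * u) f F" using exhaustion_proj[OF W2p puu] by blast
  note F = max_proj_sumD(1,4-6)[OF ms2] and max2 = max_proj_sumD(8)[OF ms2]
  have "qf \<xi> F \<le> K * qf \<xi> (u * F * star u)"
  proof (rule LIMSEQ_le)
    show "(\<lambda>n. qf \<xi> (\<Sum>i<n. f i)) \<longlonglongrightarrow> qf \<xi> F" by (rule qf_sconv[OF F(4)])
    show "(\<lambda>n. K * qf \<xi> (u * (\<Sum>i<n. f i) * star u)) \<longlonglongrightarrow> K * qf \<xi> (u * F * star u)"
      by (intro tendsto_mult tendsto_const qf_sconv sconv_mult_right sconv_mult_left F(4))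
    have "qf \<xi> (f i) \<le> K * qf \<xi> (u * f i * star u)" for i using F(1)[of i] by (auto simp: W2_def qf_simps)
    then have "qf \<xi> (\<Sum>i<n. f i) \<le> K * qf \<xi> (u * (\<Sum>i<n. f i) * star u)" for n
      unfolding sum_distrib_left sum_distrib_right qf_sum by (intro sum_mono) blast
    then show "\<exists>N. \<forall>n\<ge>N. qf \<xi> (\<Sum>i<n. f i) \<le> K * qf \<xi> (u * (\<Sum>i<n. f i) * star u)" by blast
  qed
  then have "F \<noteq> star u * u"
    using u(2) Tpos[OF u(1)] by (auto simp: rt_def K_def[symmetric] less_divide_eq pisD(1)[OF u'(2)])
  define b where "b = star u * u - F"
  have b: "pm b" "b \<noteq> 0" "ple b (star u * u)" unfolding b_def
    using pm_diff[OF F(2) puu F(3)] ple_diff F(2,3) puu \<open>F \<noteq> star u * u\<close> by (auto simp: pm_def)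
  have bp0: "ple b p0" using ple_trans[OF ple_trans[OF b(3) u'(3)] sub(1)] .
  have main: "(1 - d) * qf \<xi> (star w * w) \<le> qf \<xi> (w * star w)"
    if w: "w \<in> M" "pis w" "ple (star w * w) b" "ple (w * star w) b" for w
  proof (cases "w = 0")
    case False
    have nz: "w * star w \<noteq> 0" using False by (metis star_self_eq_0 star_star star_eq_0)
    define g where "g = w * star w"
    have g: "pm g" "ple g (star u * u)" using pis_pm[OF w(1,2)] ple_trans[OF w(4) b(3)] by (auto simp: g_def)
    have 1: "K * qf \<xi> (u * g * star u) < qf \<xi> g"
      using max2[of g] g nz w(4) unfolding W2_def g_def b_def by force
    \<comment> \<open>\<open>u * w\<close> keeps the initial projection of \<open>w\<close>. The
      supremum \<open>C\<close> compares \<open>star w * w\<close> with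
      \<open>u * g * star u\<close>, and the choice of \<open>b\<close> compares the latter with
      \<open>g\<close>.\<close>
    define t where "t = u * w"
    have uw: "star u * u * w = w" using pis_left[OF w(2), of "star u * u"] g(2) by (simp add: g_def)
    have tt: "star t * t = star w * w" "t * star t = u * g * star u"
      by (simp_all add: t_def g_def star_mult mult.assoc) (metis uw mult.assoc)
    have "ple (u * g * star u) (u * star u)" by (rule conj_pm(3)[OF u'(1,2) g])
    then have "t \<in> T" using w u' False uw tt ple_trans[OF ple_trans[OF w(3) b(3)] u'(3)] ple_trans[OF _ u'(4)]
      by (auto simp: T_def pis_def t_def M_closed mult.assoc)
    then have "qf \<xi> (star w * w) \<le> C * qf \<xi> (u * g * star u)"
      using rtC[of t] Tpos[of t] by (simp add: rt_def tt divide_le_eq)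
    then have "(1 - d) * qf \<xi> (star w * w) \<le> (1 - d) * (C * qf \<xi> (u * g * star u))"
      using d by (intro mult_left_mono) auto
    then show ?thesis using 1 by (simp add: K_def g_def)
  qed (simp add: qf_simps)
  show ?thesis
    using that[OF b(1,2) ple_trans[OF bp0 p0(2)] _ main] pos ple_trans[OF _ bp0] by blast
qed

text \<open>One inequality expresses both directions, since \<open>y\<close> may be replaced by
  \<open>star y\<close>; a trace would satisfy it with \<open>k = 1\<close>.\<close>

definition near_trace :: "'h cop \<Rightarrow> 'h \<Rightarrow> real \<Rightarrow> bool" where
  "near_trace b \<xi> k \<longleftrightarrow> pm b \<and> b \<noteq> 0 \<and> (\<forall>e. pm e \<longrightarrow> e \<noteq> 0 \<longrightarrow> ple e b \<longrightarrow> 0 < qf \<xi> e) \<and>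
    (\<forall>y\<in>M. b * y = y \<longrightarrow> y * b = y \<longrightarrow> k * (norm (y \<cdot> \<xi>))\<^sup>2 \<le> (norm (star y \<cdot> \<xi>))\<^sup>2)"

text \<open>The inequality passes from projections to operators by the dyadic expansion of
  \<open>a = star y * y\<close>: with \<open>v\<close> the polar part of \<open>y\<close> above a
  cut-off \<open>d\<close>, each digit \<open>E j\<close> gives a partial isometry
  \<open>v * E j\<close>, and the inequalities are added with their weights.\<close>

lemma near_trace_exists:
  assumes p: "fin p" "p \<noteq> 0" and k: "0 < k" "k < 1"
  obtains b \<xi> where "ple b p" "near_trace b \<xi> k"
proof -
  obtain b \<xi> where b: "pm b" "b \<noteq> 0" "ple b p" "\<And>e. pm e \<Longrightarrow> e \<noteq> 0 \<Longrightarrow> ple e b \<Longrightarrow> 0 < qf \<xi> e"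
    and nt: "\<And>w. w \<in> M \<Longrightarrow> pis w \<Longrightarrow> ple (star w * w) b \<Longrightarrow> ple (w * star w) b \<Longrightarrow>
      k * qf \<xi> (star w * w) \<le> qf \<xi> (w * star w)"
    using near_trace_projections[OF p, of "1 - k"] k by auto
  have small: "k * qf \<xi> (star y * y) \<le> qf \<xi> (y * star y)"
    if y: "y \<in> M" "b * y = y" "y * b = y" "norm y \<le> 1" for y
  proof -
    define a where "a = star y * y"
    have sa: "star a = a" by (simp add: a_def star_mult)
    have aM: "a \<in> M" using y by (simp add: a_def M_closed)
    have ab: "b * a = a" "a * b = a"
      by (simp_all add: a_def mult.assoc y) (metis mult.assoc star_mult y(3) pmD(3)[OF b(1)])
    have qa: "qf v a = (norm (y \<cdot> v))\<^sup>2" for v unfolding a_def by (rule qf_star)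
    have a1: "Re (cinner (a \<cdot> v) v) \<le> (norm v)\<^sup>2" "0 \<le> Re (cinner (a \<cdot> v) v)" for v
    proof -
      have "norm (y \<cdot> v) \<le> 1 * norm v" by (rule order_trans[OF norm_ap mult_right_mono[OF y(4) norm_ge_zero]])
      then show "Re (cinner (a \<cdot> v) v) \<le> (norm v)\<^sup>2" using qa[of v] by (simp add: qf_def power_mono)
      show "0 \<le> Re (cinner (a \<cdot> v) v)" using qa[of v] by (simp add: qf_def)
    qed
    obtain E where E: "\<And>j::nat. gens a (E j)" "\<And>j. proj (E j)"
      "\<And>n. norm (a - (\<Sum>j<n. (1/2) ^ Suc j *\<^sub>R E j)) \<le> (1/2) ^ n"
      using dyadic_projections[OF sa a1(2,1)] by blast
    define X where "X = (\<lambda>n. \<Sum>j<n. (1/2::real) ^ Suc j *\<^sub>R E j)"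
    have "X \<longlonglongrightarrow> a"
    proof (rule Lim_transform)
      show "(\<lambda>n. a) \<longlonglongrightarrow> a" by simp
      have lim: "(\<lambda>n. (1/2::real) ^ n) \<longlonglongrightarrow> 0" by (rule LIMSEQ_realpow_zero) auto
      show "(\<lambda>n. X n - a) \<longlonglongrightarrow> 0"
        by (rule Lim_null_comparison[OF _ lim], rule always_eventually)
          (use E(3) in \<open>simp add: X_def norm_minus_commute\<close>)
    qed
    then have X: "sconv X a" by (rule tendsto_sconv)
    \<comment> \<open>\<open>a\<close> may fail to be invertible, so the polar part exists only on
      the spectral part above \<open>d\<close>; the loss is at most \<open>d\<close> times the
      squared norm of \<open>\<xi>\<close>, and \<open>d\<close> tends to 0 afterwards.\<close>
    have step: "k * (qf \<xi> a - d * (norm \<xi>)\<^sup>2) \<le> qf \<xi> (y * star y)" if d: "d > 0" for d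
    proof -
      obtain e g where eg: "gens a e" "gens a g" "proj e" "star g = g" "g * a * g = e"
        "\<And>v. Re (cinner ((a * (1 - e)) \<cdot> v) v) \<le> d * (norm v)\<^sup>2"
        using partial_polar[OF d, of y] unfolding a_def by blast
      have eM: "e \<in> M" "g \<in> M" using gensD[OF eg(1) M_salg aM] gensD[OF eg(2) M_salg aM] .
      define v where "v = y * g"
      have vM: "v \<in> M" using y eM by (simp add: v_def M_closed)
      have vv: "star v * v = e" using eg(5) by (simp add: v_def star_mult eg(4) a_def mult.assoc)
      then have pv: "pis v" using eg(3) by (simp add: pis_def)
      have ve: "v * e = v" using pisD(1)[OF pv] vv by simp
      have eb: "b * e = e" "b * g = g * b"
      proof -
        show bg: "b * g = g * b" using gens_commute[OF eg(2), of b] ab by simp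
        have "b * e = b * g * a * g" by (simp add: eg(5)[symmetric] mult.assoc)
        also have "\<dots> = g * (b * a) * g" by (simp add: bg mult.assoc)
        finally show "b * e = e" by (simp add: ab eg(5))
      qed
      have bv: "b * v = v" by (simp add: v_def mult.assoc[symmetric] y)
      have Ej: "k * qf \<xi> (E j * e) \<le> qf \<xi> (v * E j * star v)" for j
      proof -
        have pE: "E j * e = e * E j"
        proof -
          have "e * a = a * e" using gens_commute[OF eg(1), of a] by simp
          then show ?thesis using gens_commute[OF E(1)[of j], of e] by simp
        qed
        have EM: "E j \<in> M" using gensD[OF E(1) M_salg aM] .
        have EE: "E j * E j = E j" "star (E j) = E j" using E(2)[of j] by (simp_all add: proj_def)
        define w where "w = v * E j"
        have "star w * w = E j * (star v * v) * E j" by (simp add: w_def star_mult EE mult.assoc)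
        also have "\<dots> = E j * e" by (simp add: vv mult.assoc pE[symmetric]) (simp add: mult.assoc[symmetric] EE)
        finally have ww: "star w * w = E j * e" .
        have "w * star w = v * (E j * E j) * star v" by (simp add: w_def star_mult EE(2) mult.assoc)
        then have ww': "w * star w = v * E j * star v" by (simp add: EE)
        have "proj (E j * e)" unfolding proj_def
          using eg(3) EE pE by (simp add: star_mult proj_def) (metis mult.assoc)
        then have "pis w" using ww by (simp add: pis_def)
        moreover have "w \<in> M" using vM EM by (simp add: w_def M_closed)
        moreover have "ple (star w * w) b" unfolding ple_def ww pE by (simp add: mult.assoc[symmetric] eb)
        moreover have "ple (w * star w) b" unfolding ple_def ww' by (simp add: mult.assoc[symmetric] bv)
        ultimately show ?thesis using nt[of w] ww ww' by simp
      qed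
      have "k * qf \<xi> (a * e) \<le> qf \<xi> (v * a * star v)"
      proof (rule LIMSEQ_le)
        show "(\<lambda>n. k * qf \<xi> (X n * e)) \<longlonglongrightarrow> k * qf \<xi> (a * e)"
          by (intro tendsto_mult tendsto_const qf_sconv sconv_mult_right X)
        show "(\<lambda>n. qf \<xi> (v * X n * star v)) \<longlonglongrightarrow> qf \<xi> (v * a * star v)"
          by (intro qf_sconv sconv_mult_right sconv_mult_left X)
        have "k * ((1/2) ^ Suc j * qf \<xi> (E j * e)) \<le> (1/2) ^ Suc j * qf \<xi> (v * E j * star v)" for j
          using mult_left_mono[OF Ej, of "(1/2) ^ Suc j" j] by (simp add: mult.left_commute)
        then have "k * qf \<xi> (X n * e) \<le> qf \<xi> (v * X n * star v)" for n
          unfolding X_def sum_distrib_left sum_distrib_right qf_sum mult_scaleR_left mult_scaleR_right qf_simps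
          by (intro sum_mono) blast
        then show "\<exists>N. \<forall>n\<ge>N. k * qf \<xi> (X n * e) \<le> qf \<xi> (v * X n * star v)" by blast
      qed
      moreover have "v * a * star v = y * e * star y"
      proof -
        have "v * a * star v = y * (g * a * g) * star y" by (simp add: v_def star_mult eg(4) mult.assoc)
        then show ?thesis by (simp add: eg(5))
      qed
      moreover have "qf \<xi> (y * e * star y) \<le> qf \<xi> (y * star y)"
      proof -
        have "proj (1 - e)" by (rule proj_complement[OF eg(3)])
        then have "y * (1 - e) * star y = y * (1 - e) * star (y * (1 - e))"
          by (simp add: star_mult proj_def) (metis mult.assoc)
        then have "0 \<le> qf \<xi> (y * (1 - e) * star y)" by (simp add: qf_star')
        then show ?thesis by (simp add: algebra_simps qf_simps)
      qed
      moreover have "qf \<xi> a - d * (norm \<xi>)\<^sup>2 \<le> qf \<xi> (a * e)"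
        using eg(6)[of \<xi>] unfolding qf_def[symmetric] by (simp add: right_diff_distrib qf_simps)
      then have "k * (qf \<xi> a - d * (norm \<xi>)\<^sup>2) \<le> k * qf \<xi> (a * e)" using k by (intro mult_left_mono) auto
      ultimately show ?thesis by simp
    qed
    have "(\<lambda>n. k * (qf \<xi> a - (1 / Suc n) * (norm \<xi>)\<^sup>2)) \<longlonglongrightarrow> k * (qf \<xi> a - 0 * (norm \<xi>)\<^sup>2)"
      by (intro tendsto_mult tendsto_diff tendsto_const LIMSEQ_Suc[OF lim_1_over_n])
    then have "k * (qf \<xi> a - 0 * (norm \<xi>)\<^sup>2) \<le> qf \<xi> (y * star y)"
      by (rule LIMSEQ_le_const2) (intro exI allI impI step, simp)
    then show ?thesis by (simp add: a_def)
  qed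
  have "k * (norm (y \<cdot> \<xi>))\<^sup>2 \<le> (norm (star y \<cdot> \<xi>))\<^sup>2" if y: "y \<in> M" "b * y = y" "y * b = y" for y
  proof (cases "y = 0")
    case False
    define z where "z = (1 / norm y) *\<^sub>R y"
    have "k * qf \<xi> (star z * z) \<le> qf \<xi> (z * star z)"
      by (rule small) (use y False in \<open>simp_all add: z_def M_closed\<close>)
    then show ?thesis using False unfolding qf_star qf_star'
      by (simp add: z_def power_divide divide_right_mono mult.assoc) (simp add: divide_le_cancel)
  qed simp
  then show ?thesis using that[of b \<xi>] b unfolding near_trace_def by blast
qed

text \<open>A nonzero \<open>z\<close> would yield a nonzero projection below \<open>b\<close> of
  the form \<open>g * g * (star z * z)\<close>, which kills \<open>\<xi>\<close> although its value
  must be positive.\<close>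

lemma near_trace_faithful:
  assumes b: "near_trace b \<xi> k" and z: "z \<in> M" "z * b = z" "z \<cdot> \<xi> = 0"
  shows "z = 0"
proof (rule ccontr)
  assume "z \<noteq> 0"
  have pb: "pm b" using b by (simp add: near_trace_def)
  obtain g where g: "g \<in> M" "pis (z * g)" "z * g \<noteq> 0" "ple (star (z * g) * (z * g)) b"
    "star (z * g) * (z * g) = g * g * (star z * z)"
    using nonzero_partial_isometry[OF z(1) \<open>z \<noteq> 0\<close> pb z(2), of 1] by auto
  define e where "e = star (z * g) * (z * g)"
  have "pm e" using pis_pm[OF _ g(2)] g(1) z(1) by (simp add: e_def M_closed)
  moreover have "e \<noteq> 0" using g(3) by (simp add: e_def star_self_eq_0)
  ultimately have "0 < qf \<xi> e" using b g(4) unfolding near_trace_def e_def by blast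
  moreover have "e \<cdot> \<xi> = 0" unfolding e_def g(5) by (simp add: z(3))
  ultimately show False by (simp add: qf_def)
qed

definition cover :: "'i set \<Rightarrow> ('i \<Rightarrow> 'h cop) \<Rightarrow> 'h cop \<Rightarrow> 'h cop \<Rightarrow> bool" where
  "cover I v b e \<longleftrightarrow> finite I \<and> (\<forall>i\<in>I. v i \<in> M \<and> v i * b = v i) \<and> (\<Sum>i\<in>I. v i * star (v i)) = e"

text \<open>Inserting \<open>e\<close> as the sum of the \<open>v j * star (v j)\<close> turns both
  sides into double sums over the matrix entries \<open>star (v j) * x * v i\<close> in the corner
  of \<open>b\<close>, where \<open>near_trace\<close> applies entry by entry.\<close>

lemma qtrace_near:
  assumes b: "near_trace b \<xi> k" and c: "cover I v b e" and x: "x \<in> M" "e * x = x" "x * e = x"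
  shows "k * qtrace I v \<xi> (star x * x) \<le> qtrace I v \<xi> (x * star x)"
proof -
  have pb: "pm b" using b by (simp add: near_trace_def)
  have v: "\<And>i. i \<in> I \<Longrightarrow> v i \<in> M" "\<And>i. i \<in> I \<Longrightarrow> v i * b = v i" and e: "(\<Sum>i\<in>I. v i * star (v i)) = e"
    using c by (auto simp: cover_def)
  have bv: "b * star (v i) = star (v i)" if "i \<in> I" for i
    using v(2)[OF that] pmD(3)[OF pb] by (metis star_mult)
  define y where "y = (\<lambda>j i. star (v j) * x * v i)"
  have "star x * x = star x * e * x" using x(2) by (simp add: mult.assoc)
  then have 1: "qf \<xi> (star (v i) * (star x * x) * v i) = (\<Sum>j\<in>I. (norm (y j i \<cdot> \<xi>))\<^sup>2)" for i
    unfolding e[symmetric] qf_star[symmetric]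
    by (simp add: sum_distrib_left sum_distrib_right qf_sum y_def star_mult mult.assoc)
  have "x * star x = x * e * star x" using x(3) by (simp add: mult.assoc)
  then have 2: "qf \<xi> (star (v j) * (x * star x) * v j) = (\<Sum>i\<in>I. (norm (star (y j i) \<cdot> \<xi>))\<^sup>2)" for j
    unfolding e[symmetric] qf_star'[symmetric]
    by (simp add: sum_distrib_left sum_distrib_right qf_sum y_def star_mult mult.assoc)
  have 3: "k * (norm (y j i \<cdot> \<xi>))\<^sup>2 \<le> (norm (star (y j i) \<cdot> \<xi>))\<^sup>2" if "i \<in> I" "j \<in> I" for i j
  proof -
    have "y j i \<in> M" using v x(1) that by (simp add: y_def M_closed)
    moreover have "b * y j i = y j i" "y j i * b = y j i"
      using bv[OF that(2)] v(2)[OF that(1)] by (simp_all add: y_def mult.assoc) (simp add: mult.assoc[symmetric])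
    ultimately show ?thesis using b unfolding near_trace_def by blast
  qed
  have "k * qtrace I v \<xi> (star x * x) = (\<Sum>j\<in>I. \<Sum>i\<in>I. k * (norm (y j i \<cdot> \<xi>))\<^sup>2)"
    unfolding qtrace_def 1 by (subst sum.swap) (simp add: sum_distrib_left)
  also have "\<dots> \<le> (\<Sum>j\<in>I. \<Sum>i\<in>I. (norm (star (y j i) \<cdot> \<xi>))\<^sup>2)" by (intro sum_mono 3)
  finally show ?thesis unfolding qtrace_def 2 .
qed

text \<open>If \<open>e\<close> were infinite, it would contain arbitrarily many orthogonal
  equivalent projections, each of value at least \<open>k\<close> times that of \<open>r 0\<close>,
  and their sum would exceed the value of \<open>e\<close>.\<close>

lemma fin_of_cover:
  assumes b: "near_trace b \<xi> k" and k: "0 < k" and c: "cover I v b e" and e: "pm e"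
  shows "fin e"
proof (rule ccontr)
  assume "\<not> fin e"
  obtain r where r: "\<And>n::nat. pm (r n)" "\<And>n. ple (r n) e" "\<And>m n. m \<noteq> n \<Longrightarrow> r m * r n = 0"
      "\<And>n. meq (r 0) (r n)" "r 0 \<noteq> 0"
    using infinite_copies[OF e \<open>\<not> fin e\<close>] by metis
  let ?t = "qtrace I v \<xi>"
  have re: "e * r n = r n" "r n * e = r n" for n
    using r(2)[of n] ple_right[of "r n" e] r(1)[of n] e by (simp_all add: ple_def pm_def)
  have "?t (r 0) \<noteq> 0"
  proof
    assume 0: "?t (r 0) = 0"
    have v: "finite I" "\<And>i. i \<in> I \<Longrightarrow> v i \<in> M" "\<And>i. i \<in> I \<Longrightarrow> v i * b = v i" "(\<Sum>i\<in>I. v i * star (v i)) = e"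
      using c by (auto simp: cover_def)
    have "star (v i) * r 0 * v i = star (r 0 * v i) * (r 0 * v i)" for i
      by (simp add: star_mult pmD[OF r(1)]) (metis mult.assoc pmD(4)[OF r(1)])
    then have q: "qf \<xi> (star (v i) * r 0 * v i) = (norm ((r 0 * v i) \<cdot> \<xi>))\<^sup>2" for i
      by (simp only: qf_star)
    have "r 0 * v i = 0" if "i \<in> I" for i
    proof (rule near_trace_faithful[OF b])
      show "r 0 * v i \<in> M" "r 0 * v i * b = r 0 * v i" using v that r(1) by (simp_all add: M_closed pmD mult.assoc)
      have "(norm ((r 0 * v i) \<cdot> \<xi>))\<^sup>2 = 0"
        using 0 that v(1) unfolding qtrace_def q by (subst (asm) sum_nonneg_eq_0_iff) auto
      then show "(r 0 * v i) \<cdot> \<xi> = 0" by simp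
    qed
    then have "r 0 * e = 0" unfolding v(4)[symmetric] sum_distrib_left
      by (intro sum.neutral) (simp add: mult.assoc[symmetric])
    then show False using re(2)[of 0] r(5) by simp
  qed
  then have t0: "?t (r 0) > 0" using qtrace_proj_nonneg[of "r 0" I v \<xi>] r(1)[of 0] by (simp add: pm_def)
  have tn: "k * ?t (r 0) \<le> ?t (r n)" for n
  proof -
    obtain x where x: "x \<in> M" "star x * x = r 0" "x * star x = r n" using r(4)[of n] unfolding meq_def by blast
    have px: "pis x" using pis_of_initial[OF r(1) x(2)] .
    have "e * x = x" using pis_left[OF px] x(3) r(2) by simp
    moreover have "x * e = x" using pis_right[OF px] x(2) r(2) e by (simp add: pm_def)
    ultimately show ?thesis using qtrace_near[OF b c x(1)] x by simp
  qed
  have "real n * (k * ?t (r 0)) \<le> ?t e" for n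
  proof -
    have S: "pm (\<Sum>i<n. r i) \<and> ple (\<Sum>i<n. r i) e" for n
    proof (induct n)
      case (Suc n)
      have "(\<Sum>i<n. r i) * r n = 0" unfolding sum_distrib_right using r(3) by (intro sum.neutral) auto
      then show ?case using Suc r(1)[of n] r(2)[of n] by (simp add: pm_add ple_add)
    qed simp
    have "real n * (k * ?t (r 0)) = (\<Sum>i<n. k * ?t (r 0))" by simp
    also have "\<dots> \<le> (\<Sum>i<n. ?t (r i))" by (intro sum_mono tn)
    also have "\<dots> = ?t (\<Sum>i<n. r i)" by (simp add: qtrace_sum)
    also have "\<dots> \<le> ?t e"
      using qtrace_proj_nonneg[OF proj_diff[of "\<Sum>i<n. r i" e], of I v \<xi>] S[of n] e by (simp add: qtrace_simps pm_def)
    finally show ?thesis .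
  qed
  moreover obtain n where "real n * (k * ?t (r 0)) > ?t e"
    using reals_Archimedean3[of "k * ?t (r 0)"] t0 k by (meson mult_pos_pos)
  ultimately show False by (meson not_le)
qed

lemma cover_exists:
  assumes p: "fin p" and b: "pm b" "b \<noteq> 0"
  obtains n and v :: "nat \<Rightarrow> 'h cop" where "cover {..<n} v b p"
proof -
  obtain n v where v: "\<forall>i. v i \<in> M \<and> pis (v i)" "\<forall>i<n. star (v i) * v i = b" "ple (star (v n) * v n) b"
    "(\<Sum>i<Suc n. v i * star (v i)) = p"
    using finite_cover[OF p b] by metis
  have "v i * b = v i" if "i < Suc n" for i
  proof -
    have "ple (star (v i) * v i) b" using v(2,3) that ple_refl[of b] b by (cases "i = n") (auto simp: pm_def)
    then show ?thesis using pis_right[of "v i" b] v(1) b by (simp add: pm_def)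
  qed
  then have "cover {..<Suc n} v b p" unfolding cover_def using v by auto
  then show ?thesis using that by blast
qed

text \<open>A near trace certifies finiteness: one corner \<open>b\<close> covers both summands, and
  the disjoint union of the two covers covers the sum. The factor 1/2 stands for any number strictly
  between 0 and 1.\<close>

theorem fin_add:
  assumes p: "fin p" and q: "fin q" and o: "p * q = 0"
  shows "fin (p + q)"
proof (cases "p = 0")
  case False
  have h: "0 < (1/2::real)" "(1/2::real) < 1" by simp_all
  obtain b \<xi> where b: "near_trace b \<xi> (1/2)" using near_trace_exists[OF p False h] by blast
  then have pb: "pm b" "b \<noteq> 0" by (auto simp: near_trace_def)
  obtain m v where v: "cover {..<m::nat} v b p" using cover_exists[OF p pb] by blast
  obtain n w where w: "cover {..<n::nat} w b q" using cover_exists[OF q pb] by blast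
  have "cover ({..<m} <+> {..<n}) (case_sum v w) b (p + q)"
    using v w unfolding cover_def by (auto simp: sum.Plus comp_def)
  then show ?thesis using fin_of_cover[OF b] pm_add[OF fin_pm[OF p] fin_pm[OF q] o] by simp
qed (simp add: q)

end

text \<open>Tychonoff's theorem. The domain may be uncountable, so a cluster point takes the place
  of a convergent subsequence; it inherits every closed property that holds from some index
  on.\<close>

lemma function_cluster_point:
  fixes F :: "nat \<Rightarrow> 'a \<Rightarrow> complex" and B :: "'a \<Rightarrow> real"
  assumes bound: "\<And>n x. cmod (F n x) \<le> B x"
  obtains f where "\<And>S N. closed S \<Longrightarrow> (\<And>n. n \<ge> N \<Longrightarrow> F n \<in> S) \<Longrightarrow> f \<in> S"
proof -
  define K where "K = PiE UNIV (\<lambda>x. cball (0::complex) (B x))"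
  have "compact K"
  proof -
    have "compactin (product_topology (\<lambda>_. euclidean) UNIV) K"
      unfolding K_def by (subst compactin_PiE) (simp add: compactin_euclidean_iff)
    then show ?thesis by (simp add: euclidean_product_topology compactin_euclidean_iff)
  qed
  have FK: "F n \<in> K" for n using bound by (auto simp: K_def PiE_def extensional_def)
  have "K \<inter> \<Inter>((\<lambda>n. closure (F ` {n..})) ` UNIV) \<noteq> {}"
  proof (rule compact_imp_fip[OF \<open>compact K\<close>])
    show "closed T" if "T \<in> (\<lambda>n. closure (F ` {n..})) ` UNIV" for T using that by auto
    fix \<T> assume T: "finite \<T>" "\<T> \<subseteq> (\<lambda>n. closure (F ` {n..})) ` UNIV"
    then obtain J where J: "finite J" "\<T> = (\<lambda>n. closure (F ` {n..})) ` J" by (meson finite_subset_image)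
    define m where "m = Max (insert 0 J)"
    have "F m \<in> closure (F ` {n..})" if "n \<in> J" for n
      using that J(1) by (intro subsetD[OF closure_subset]) (auto simp: m_def)
    then have "F m \<in> K \<inter> \<Inter>\<T>" using J FK by auto
    then show "K \<inter> \<Inter>\<T> \<noteq> {}" by blast
  qed
  then obtain f where f: "\<And>n. f \<in> closure (F ` {n..})" by blast
  show ?thesis
  proof (rule that)
    fix S N assume S: "closed S" "\<And>n. n \<ge> N \<Longrightarrow> F n \<in> S"
    have "closure (F ` {N..}) \<subseteq> S" by (rule closure_minimal) (use S in auto)
    then show "f \<in> S" using f by blast
  qed
qed

section \<open>The tracial state of a finite factor\<close>

context separable_factor begin

text \<open>Values outside \<open>M\<close> are unconstrained, in contrast to
  \<open>tracial_state\<close>; uniqueness is accordingly stated on \<open>M\<close>.\<close>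

definition tracial :: "('h cop \<Rightarrow> complex) \<Rightarrow> bool" where
  "tracial \<tau> \<longleftrightarrow> (\<forall>x\<in>M. \<forall>y\<in>M. \<tau> (x + y) = \<tau> x + \<tau> y) \<and> (\<forall>c. \<forall>x\<in>M. \<tau> (sc c * x) = c * \<tau> x) \<and>
     (\<forall>x\<in>M. \<tau> (star x * x) \<in> \<real>\<^sub>\<ge>\<^sub>0) \<and> \<tau> 1 = 1 \<and> (\<forall>x\<in>M. \<forall>y\<in>M. \<tau> (x * y) = \<tau> (y * x))"

text \<open>\<open>qtrace\<close> over a cover of 1, divided by its value at 1, which is positive
  because the near trace is faithful. It is a sum of vector functionals, so the bound by the
  operator norm holds on all of \<open>cop\<close>, as the compactness argument requires.\<close>

lemma approximate_trace:
  assumes f1: "fin 1" and ne: "(1 :: 'h cop) \<noteq> 0" and k: "0 < k" "k < 1"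
  shows "\<exists>f. (\<forall>x y. f (x + y) = f x + f y) \<and> (\<forall>c x. f (sc c * x) = c * f x) \<and> f 1 = 1 \<and>
    (\<forall>x. cmod (f x) \<le> norm x) \<and> (\<forall>x. Im (f (star x * x)) = 0 \<and> 0 \<le> Re (f (star x * x))) \<and>
    (\<forall>x\<in>M. k * Re (f (star x * x)) \<le> Re (f (x * star x)))"
proof -
  obtain b \<xi> where b: "near_trace b \<xi> k" using near_trace_exists[OF f1 ne k] by blast
  then have pb: "pm b" "b \<noteq> 0" by (auto simp: near_trace_def)
  obtain m and v :: "nat \<Rightarrow> 'h cop" where c: "cover {..<m} v b 1" using cover_exists[OF f1 pb] by blast
  define \<eta> where "\<eta> = (\<lambda>i. v i \<cdot> \<xi>)"
  define N where "N = (\<Sum>i<m. (norm (\<eta> i))\<^sup>2)"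
  have "N \<noteq> 0"
  proof
    assume "N = 0"
    then have "\<eta> i = 0" if "i < m" for i using that unfolding N_def by (subst (asm) sum_nonneg_eq_0_iff) auto
    then have "v i = 0" if "i < m" for i
      using near_trace_faithful[OF b, of "v i"] c that unfolding cover_def \<eta>_def by auto
    then show False using c ne by (simp add: cover_def)
  qed
  moreover have "N \<ge> 0" unfolding N_def by (rule sum_nonneg) simp
  ultimately have N: "N > 0" by simp
  define f where "f = (\<lambda>x. (\<Sum>i<m. cinner (x \<cdot> \<eta> i) (\<eta> i)) / of_real N)"
  have Re_f: "Re (f x) = qtrace {..<m} v \<xi> x / N" for x
    using N by (simp add: f_def qtrace_def qf_def \<eta>_def cinner_star')
  have "f (x + y) = f x + f y" for x y by (simp add: f_def cinner_add_left sum.distrib add_divide_distrib)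
  moreover have "f (sc c * x) = c * f x" for c x by (simp add: f_def cinner_scaleC_left sum_distrib_left)
  moreover have "f 1 = 1"
  proof -
    have "(\<Sum>i<m. cinner (\<eta> i) (\<eta> i)) = of_real N" by (simp add: N_def cinner_self)
    then show ?thesis using N by (simp add: f_def)
  qed
  moreover have "cmod (f x) \<le> norm x" for x
  proof -
    have "cmod (\<Sum>i<m. cinner (x \<cdot> \<eta> i) (\<eta> i)) \<le> (\<Sum>i<m. norm x * (norm (\<eta> i))\<^sup>2)"
    proof (rule sum_norm_le)
      fix i
      have "cmod (cinner (x \<cdot> \<eta> i) (\<eta> i)) \<le> norm (x \<cdot> \<eta> i) * norm (\<eta> i)" by (rule Cauchy_Schwarz)
      also have "\<dots> \<le> norm x * norm (\<eta> i) * norm (\<eta> i)" by (intro mult_right_mono norm_ap) simp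
      finally show "cmod (cinner (x \<cdot> \<eta> i) (\<eta> i)) \<le> norm x * (norm (\<eta> i))\<^sup>2" by (simp add: power2_eq_square mult.assoc)
    qed
    also have "\<dots> = norm x * N" by (simp add: N_def sum_distrib_left)
    finally show ?thesis using N by (simp add: f_def norm_divide divide_le_eq)
  qed
  moreover have "Im (f (star x * x)) = 0 \<and> 0 \<le> Re (f (star x * x))" for x
  proof -
    have "f (star x * x) = of_real ((\<Sum>i<m. (norm (x \<cdot> \<eta> i))\<^sup>2) / N)"
      by (simp add: f_def cinner_star' cinner_self)
    then show ?thesis using N by (simp add: sum_nonneg del: of_real_divide of_real_sum)
  qed
  moreover have "k * Re (f (star x * x)) \<le> Re (f (x * star x))" if "x \<in> M" for x
    using qtrace_near[OF b c that] N unfolding Re_f by (simp add: divide_right_mono)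
  ultimately show ?thesis by (intro exI[of _ f]) blast
qed

text \<open>A cluster point of approximate traces with factors \<open>\<kappa> n\<close> tending to
  1. In the limit \<open>star x * x\<close> and \<open>x * star x\<close> have equal values, and
  polarization extends this to all products.\<close>

lemma tracial_exists:
  assumes f1: "fin 1" and ne: "(1 :: 'h cop) \<noteq> 0"
  shows "\<exists>\<tau>. tracial \<tau>"
proof -
  define \<kappa> where "\<kappa> = (\<lambda>n::nat. 1 - 1 / (real n + 2))"
  have k: "0 < \<kappa> n" "\<kappa> n < 1" for n by (simp_all add: \<kappa>_def)
  obtain F where F: "\<And>n x y. F n (x + y) = F n x + F n y" "\<And>n c x. F n (sc c * x) = c * F n x" "\<And>n. F n 1 = 1"
    "\<And>n x. cmod (F n x) \<le> norm x" "\<And>n x. Im (F n (star x * x)) = 0" "\<And>n x. 0 \<le> Re (F n (star x * x))"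
    "\<And>n x. x \<in> M \<Longrightarrow> \<kappa> n * Re (F n (star x * x)) \<le> Re (F n (x * star x))"
    using approximate_trace[OF f1 ne k] by metis
  obtain \<tau> where \<tau>: "\<And>S N. closed S \<Longrightarrow> (\<And>n. n \<ge> N \<Longrightarrow> F n \<in> S) \<Longrightarrow> \<tau> \<in> S"
    using function_cluster_point[of F norm, OF F(4)] by metis
  have cont: "continuous_on UNIV (\<lambda>f :: 'h cop \<Rightarrow> complex. f x)" for x by simp
  have add: "\<tau> (x + y) = \<tau> x + \<tau> y" for x y
  proof -
    have "closed {f :: 'h cop \<Rightarrow> complex. f (x + y) = f x + f y}"
      by (intro closed_Collect_eq continuous_on_add cont)
    then show ?thesis using \<tau>[of "{f. f (x + y) = f x + f y}" 0] F(1) by blast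
  qed
  have scl: "\<tau> (sc c * x) = c * \<tau> x" for c x
  proof -
    have "closed {f :: 'h cop \<Rightarrow> complex. f (sc c * x) = c * f x}"
      by (intro closed_Collect_eq continuous_on_mult continuous_on_const cont)
    then show ?thesis using \<tau>[of "{f. f (sc c * x) = c * f x}" 0] F(2) by blast
  qed
  have one: "\<tau> 1 = 1"
  proof -
    have "closed {f :: 'h cop \<Rightarrow> complex. f 1 = 1}" by (intro closed_Collect_eq continuous_on_const cont)
    then show ?thesis using \<tau>[of "{f. f 1 = 1}" 0] F(3) by blast
  qed
  have im: "Im (\<tau> (star x * x)) = 0" for x
  proof -
    have "closed {f :: 'h cop \<Rightarrow> complex. Im (f (star x * x)) = 0}"
      by (intro closed_Collect_eq continuous_on_Im continuous_on_const cont)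
    then show ?thesis using \<tau>[of "{f. Im (f (star x * x)) = 0}" 0] F(5) by blast
  qed
  have re: "0 \<le> Re (\<tau> (star x * x))" for x
  proof -
    have "closed {f :: 'h cop \<Rightarrow> complex. 0 \<le> Re (f (star x * x))}"
      by (intro closed_Collect_le continuous_on_Re continuous_on_const cont)
    then show ?thesis using \<tau>[of "{f. 0 \<le> Re (f (star x * x))}" 0] F(6) by blast
  qed
  have le: "Re (\<tau> (star x * x)) \<le> Re (\<tau> (x * star x))" if x: "x \<in> M" for x
  proof -
    \<comment> \<open>For fixed \<open>N\<close> this is a closed condition, and it holds for all
      \<open>F n\<close> with \<open>n \<ge> N\<close> because \<open>\<kappa>\<close>
      increases.\<close>
    have "\<kappa> N * Re (\<tau> (star x * x)) \<le> Re (\<tau> (x * star x))" for N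
    proof -
      have "closed {f :: 'h cop \<Rightarrow> complex. \<kappa> N * Re (f (star x * x)) \<le> Re (f (x * star x))}"
        by (intro closed_Collect_le continuous_on_mult continuous_on_Re continuous_on_const cont)
      moreover have "\<kappa> N * Re (F n (star x * x)) \<le> Re (F n (x * star x))" if "n \<ge> N" for n
      proof -
        have "\<kappa> N \<le> \<kappa> n" using that by (simp add: \<kappa>_def frac_le)
        then have "\<kappa> N * Re (F n (star x * x)) \<le> \<kappa> n * Re (F n (star x * x))" by (intro mult_right_mono F(6))
        then show ?thesis using F(7)[OF x, of n] by linarith
      qed
      ultimately show ?thesis
        using \<tau>[of "{f. \<kappa> N * Re (f (star x * x)) \<le> Re (f (x * star x))}" N] by blast
    qed
    moreover have "(\<lambda>N. \<kappa> N * Re (\<tau> (star x * x))) \<longlonglongrightarrow> (1 - 0) * Re (\<tau> (star x * x))"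
    proof (intro tendsto_mult tendsto_const)
      have "(\<lambda>n. 1 / real (n + 2)) \<longlonglongrightarrow> 0" by (rule LIMSEQ_ignore_initial_segment[OF lim_1_over_n])
      then show "\<kappa> \<longlonglongrightarrow> 1 - 0" unfolding \<kappa>_def by (intro tendsto_diff tendsto_const) (simp add: add.commute)
    qed
    ultimately have "(1 - 0) * Re (\<tau> (star x * x)) \<le> Re (\<tau> (x * star x))"
      by (intro LIMSEQ_le_const2) auto
    then show ?thesis by simp
  qed
  have eq: "\<tau> (star x * x) = \<tau> (x * star x)" if x: "x \<in> M" for x
    using le[OF x] le[of "star x"] im[of x] im[of "star x"] x by (intro complex_eqI) (simp_all add: M_closed)
  have sum: "\<tau> (star x * y) + \<tau> (star y * x) = \<tau> (x * star y) + \<tau> (y * star x)" if "x \<in> M" "y \<in> M" for x y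
  proof -
    have "\<tau> (star (x + y) * (x + y)) = \<tau> ((x + y) * star (x + y))" by (rule eq) (use that in \<open>simp add: M_closed\<close>)
    then show ?thesis using eq[OF that(1)] eq[OF that(2)] by (simp add: algebra_simps add)
  qed
  \<comment> \<open>The identity \<open>sum\<close> is applied once more with
    \<open>sc \<i> * y\<close> in place of \<open>y\<close>; together the two equations isolate one
    of the two terms.\<close>
  have tr: "\<tau> (star x * y) = \<tau> (y * star x)" if xy: "x \<in> M" "y \<in> M" for x y
  proof -
    have "\<tau> (star x * (sc \<i> * y)) + \<tau> (star (sc \<i> * y) * x) = \<tau> (x * star (sc \<i> * y)) + \<tau> (sc \<i> * y * star x)"
      by (rule sum) (use xy in \<open>auto simp: M_closed\<close>)
    moreover have "star x * (sc \<i> * y) = sc \<i> * (star x * y)" "star (sc \<i> * y) * x = sc (- \<i>) * (star y * x)"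
      "x * star (sc \<i> * y) = sc (- \<i>) * (x * star y)" "sc \<i> * y * star x = sc \<i> * (y * star x)"
      by (simp_all add: star_mult sc_commute mult.assoc) (simp_all add: mult.assoc[symmetric] sc_commute)
    ultimately have "\<i> * (\<tau> (star x * y) - \<tau> (star y * x)) = \<i> * (\<tau> (y * star x) - \<tau> (x * star y))"
      by (simp only: scl) (simp add: algebra_simps)
    then have "\<tau> (star x * y) - \<tau> (star y * x) = \<tau> (y * star x) - \<tau> (x * star y)" by simp
    moreover have "A = D" if "A - B = D - C" "A + B = C + D" for A B C D :: complex
    proof -
      have "(A - B) + (A + B) = (D - C) + (C + D)" by (simp only: that)
      then show ?thesis by simp
    qed
    ultimately show ?thesis using sum[OF xy] by blast
  qed
  have "\<tau> (x * y) = \<tau> (y * x)" if "x \<in> M" "y \<in> M" for x y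
    using tr[of "star x" y] that by (simp add: M_closed)
  then have "tracial \<tau>" unfolding tracial_def
    using add scl one re im by (auto simp: complex_nonneg_Reals_iff)
  then show ?thesis by blast
qed

lemma tracialD:
  assumes "tracial \<tau>"
  shows "x \<in> M \<Longrightarrow> y \<in> M \<Longrightarrow> \<tau> (x + y) = \<tau> x + \<tau> y" "x \<in> M \<Longrightarrow> \<tau> (sc c * x) = c * \<tau> x"
    "x \<in> M \<Longrightarrow> 0 \<le> Re (\<tau> (star x * x)) \<and> Im (\<tau> (star x * x)) = 0" "\<tau> 1 = 1"
    "x \<in> M \<Longrightarrow> y \<in> M \<Longrightarrow> \<tau> (x * y) = \<tau> (y * x)" "x \<in> M \<Longrightarrow> y \<in> M \<Longrightarrow> \<tau> (x - y) = \<tau> x - \<tau> y"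
    "x \<in> M \<Longrightarrow> \<tau> (r *\<^sub>R x) = of_real r * \<tau> x" "\<tau> 0 = 0"
proof -
  show add: "x \<in> M \<Longrightarrow> y \<in> M \<Longrightarrow> \<tau> (x + y) = \<tau> x + \<tau> y" for x y using assms by (simp add: tracial_def)
  show s: "x \<in> M \<Longrightarrow> \<tau> (sc c * x) = c * \<tau> x" for x c using assms by (simp add: tracial_def)
  show "x \<in> M \<Longrightarrow> 0 \<le> Re (\<tau> (star x * x)) \<and> Im (\<tau> (star x * x)) = 0"
    using assms by (simp add: tracial_def complex_nonneg_Reals_iff)
  show "\<tau> 1 = 1" "x \<in> M \<Longrightarrow> y \<in> M \<Longrightarrow> \<tau> (x * y) = \<tau> (y * x)" using assms by (simp_all add: tracial_def)
  show r: "x \<in> M \<Longrightarrow> \<tau> (r *\<^sub>R x) = of_real r * \<tau> x" for x r using s[of x "of_real r"] by (simp add: sc_of_real)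
  show "x \<in> M \<Longrightarrow> y \<in> M \<Longrightarrow> \<tau> (x - y) = \<tau> x - \<tau> y"
    using add[of x "- y"] r[of y "-1"] by (simp add: M_closed)
  show "\<tau> 0 = 0" using r[of 0 0] by (simp add: M_closed)
qed

lemma tracial_sum: "tracial \<tau> \<Longrightarrow> (\<And>i. i \<in> I \<Longrightarrow> f i \<in> M) \<Longrightarrow> \<tau> (\<Sum>i\<in>I. f i) = (\<Sum>i\<in>I. \<tau> (f i))"
  by (induct I rule: infinite_finite_induct) (auto simp: tracialD(1,8) M_closed)

lemma tracial_pm: "tracial \<tau> \<Longrightarrow> pm e \<Longrightarrow> 0 \<le> Re (\<tau> e) \<and> \<tau> e = of_real (Re (\<tau> e))"
  using tracialD(3)[of \<tau> e] by (simp add: pmD complex_eq_iff)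

lemma tracial_meq: "tracial \<tau> \<Longrightarrow> meq p q \<Longrightarrow> \<tau> p = \<tau> q"
  unfolding meq_def using tracialD(5)[of \<tau>] M_closed(5) by blast

lemma tracial_ple:
  assumes t: "tracial \<tau>" and pq: "pm p" "pm q" "ple p q"
  shows "Re (\<tau> p) \<le> Re (\<tau> q)"
  using tracial_pm[OF t pm_diff[OF pq]] tracialD(6)[OF t, of q p] pq by (simp add: pmD)

lemma tracial_mle: "tracial \<tau> \<Longrightarrow> pm p \<Longrightarrow> pm q \<Longrightarrow> mle p q \<Longrightarrow> Re (\<tau> p) \<le> Re (\<tau> q)"
  using mle_iff tracial_meq tracial_ple by metis

text \<open>The number of copies of \<open>r\<close> that fit into \<open>q\<close> is a matter of
  equivalence alone, so the same \<open>j\<close> serves for every trace. Faithfulness and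
  uniqueness both rest on this.\<close>

lemma tracial_count:
  assumes f1: "fin 1" and q: "pm q" and r: "pm r" "r \<noteq> 0"
  obtains j :: nat where "\<And>\<tau>. tracial \<tau> \<Longrightarrow> real j * Re (\<tau> r) \<le> Re (\<tau> q) \<and> Re (\<tau> q) \<le> (real j + 1) * Re (\<tau> r)"
proof -
  have "fin q" by (rule fin_sub[OF f1 q]) simp
  then obtain j v where v: "\<forall>i. v i \<in> M \<and> pis (v i)" "\<forall>i<j. star (v i) * v i = r" "ple (star (v j) * v j) r"
    "(\<Sum>i<Suc j. v i * star (v i)) = q"
    using finite_cover[OF \<open>fin q\<close> r] by metis
  have "real j * Re (\<tau> r) \<le> Re (\<tau> q) \<and> Re (\<tau> q) \<le> (real j + 1) * Re (\<tau> r)" if t: "tracial \<tau>" for \<tau>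
  proof -
    have "\<tau> q = (\<Sum>i<Suc j. \<tau> (v i * star (v i)))"
      unfolding v(4)[symmetric] using v(1) by (intro tracial_sum[OF t]) (simp add: M_closed)
    also have "\<dots> = (\<Sum>i<Suc j. \<tau> (star (v i) * v i))"
      using v(1) by (intro sum.cong refl tracialD(5)[OF t]) (simp_all add: M_closed)
    also have "\<dots> = of_nat j * \<tau> r + \<tau> (star (v j) * v j)" using v(2) by simp
    finally have "Re (\<tau> q) = real j * Re (\<tau> r) + Re (\<tau> (star (v j) * v j))" by simp
    moreover have pv: "pm (star (v j) * v j)" using pis_pm v(1) by blast
    moreover have "Re (\<tau> (star (v j) * v j)) \<le> Re (\<tau> r)" using tracial_ple[OF t pv r(1) v(3)] .
    moreover have "0 \<le> Re (\<tau> (star (v j) * v j))" using tracial_pm[OF t pv] by blast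
    ultimately show ?thesis by (simp add: distrib_right)
  qed
  then show ?thesis using that by blast
qed

lemma tracial_faithful:
  assumes f1: "fin 1" and t: "tracial \<tau>" and e: "pm e" "e \<noteq> 0"
  shows "0 < Re (\<tau> e)"
proof -
  obtain j :: nat where j: "Re (\<tau> 1) \<le> (real j + 1) * Re (\<tau> e)" using tracial_count[OF f1 pm_1 e] t by metis
  have "Re (\<tau> e) \<noteq> 0" using j tracialD(4)[OF t] by auto
  then show ?thesis using tracial_pm[OF t e(1)] by simp
qed

lemma tracial_eq_meq:
  assumes f1: "fin 1" and t: "tracial \<tau>" and p: "pm p" and q: "pm q" and eq: "\<tau> p = \<tau> q"
  shows "meq p q"
proof -
  have *: "meq p q" if p: "pm p" and q: "pm q" and eq: "\<tau> p = \<tau> q" and m: "mle p q" for p q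
  proof -
    obtain r where r: "pm r" "meq p r" "ple r q" using m mle_iff[OF p] by blast
    have "\<tau> (q - r) = 0" using tracialD(6)[OF t, of q r] tracial_meq[OF t r(2)] eq q r by (simp add: pmD)
    then have "q - r = 0" using tracial_faithful[OF f1 t pm_diff[OF r(1) q r(3)]] by auto
    then show ?thesis using r(2) by simp
  qed
  show ?thesis using comparison[OF p q] *[OF p q eq] *[OF q p eq[symmetric]] meq_sym by blast
qed

lemma tracial_contraction:
  assumes t: "tracial \<tau>" and a: "a \<in> M" "star a = a" "\<And>v. 0 \<le> Re (cinner (a \<cdot> v) v)" "\<And>v. Re (cinner (a \<cdot> v) v) \<le> (norm v)\<^sup>2"
  shows "0 \<le> Re (\<tau> a) \<and> Im (\<tau> a) = 0"
proof -
  have "norm (1 - a) \<le> 1"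
    by (rule norm_selfadjoint_le) (use a in \<open>auto simp: cinner_diff_left Re_cinner_self\<close>)
  then obtain r where r: "gens (1 - a) r" "(1 - r) * (1 - r) = a" "star r = r"
    using sqrt_one_minus[of "1 - a"] a(2) by auto
  have "r \<in> M" using gensD[OF r(1) M_salg] a(1) by (simp add: M_closed)
  then show ?thesis using tracialD(3)[OF t, of "1 - r"] r by (simp add: M_closed)
qed

text \<open>Positivity gives boundedness: \<open>(1 + a / c) / 2\<close> and
  \<open>(1 - a / c) / 2\<close> lie between 0 and 1, and both have nonnegative trace.\<close>

lemma tracial_bound:
  assumes t: "tracial \<tau>" and a: "a \<in> M" "star a = a" and c: "norm a \<le> c" "0 < c"
  shows "cmod (\<tau> a) \<le> c"
proof -
  have q: "\<bar>Re (cinner (a \<cdot> v) v)\<bar> \<le> c * (norm v)\<^sup>2" for v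
  proof -
    have "cmod (cinner (a \<cdot> v) v) \<le> norm (a \<cdot> v) * norm v" by (rule Cauchy_Schwarz)
    also have "\<dots> \<le> (c * norm v) * norm v" by (intro mult_right_mono order_trans[OF norm_ap mult_right_mono[OF c(1)]]) auto
    finally show ?thesis using abs_Re_le_cmod[of "cinner (a \<cdot> v) v"] by (simp add: power2_eq_square mult.assoc)
  qed
  have *: "0 \<le> Re (\<tau> ((1/2) *\<^sub>R (1 + (s / c) *\<^sub>R a))) \<and> Im (\<tau> ((1/2) *\<^sub>R (1 + (s / c) *\<^sub>R a))) = 0"
    if s: "\<bar>s\<bar> = 1" for s
  proof (rule tracial_contraction[OF t])
    fix v
    have "\<bar>s / c * Re (cinner (a \<cdot> v) v)\<bar> \<le> (norm v)\<^sup>2"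
      using q[of v] c s by (simp add: abs_mult divide_le_eq mult.commute)
    moreover have "Re (cinner (((1/2) *\<^sub>R (1 + (s / c) *\<^sub>R a)) \<cdot> v) v) = 1/2 * ((norm v)\<^sup>2 + s / c * Re (cinner (a \<cdot> v) v))"
      by (simp add: cinner_scaleR_left cinner_add_left Re_cinner_self)
    moreover have "0 \<le> 1/2 * (n + r)" "1/2 * (n + r) \<le> n" if "\<bar>r\<bar> \<le> n" for n r :: real
      using that by auto
    ultimately show "0 \<le> Re (cinner (((1/2) *\<^sub>R (1 + (s / c) *\<^sub>R a)) \<cdot> v) v)"
      "Re (cinner (((1/2) *\<^sub>R (1 + (s / c) *\<^sub>R a)) \<cdot> v) v) \<le> (norm v)\<^sup>2"
      by presburger+
  qed (use a in \<open>simp_all add: M_closed\<close>)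
  have v: "\<tau> ((1/2) *\<^sub>R (1 + (s / c) *\<^sub>R a)) = of_real (1/2) * (1 + of_real (s / c) * \<tau> a)" for s
    using a(1) by (simp add: tracialD[OF t] M_closed)
  have "0 \<le> 1 + Re (\<tau> a) / c" "0 \<le> 1 - Re (\<tau> a) / c" "Im (\<tau> a) / c = 0"
    using *[of 1] *[of "-1"] unfolding v by simp_all
  then have "Im (\<tau> a) = 0" "\<bar>Re (\<tau> a)\<bar> \<le> c" using c(2) by (simp_all add: abs_le_iff field_simps)
  then show ?thesis by (simp add: cmod_eq_Re)
qed

text \<open>Dyadic expansions approximate positive contractions in norm by combinations of
  projections, and traces are norm bounded; general elements are combinations of positive
  contractions.\<close>

lemma tracial_eqI:
  assumes s: "tracial \<sigma>" and t: "tracial \<tau>" and eq: "\<And>e. pm e \<Longrightarrow> \<sigma> e = \<tau> e" and x: "x \<in> M"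
  shows "\<sigma> x = \<tau> x"
proof -
  have 1: "\<sigma> a = \<tau> a" if a: "a \<in> M" "star a = a" "\<And>v. 0 \<le> Re (cinner (a \<cdot> v) v)" "\<And>v. Re (cinner (a \<cdot> v) v) \<le> (norm v)\<^sup>2" for a
  proof -
    obtain E where E: "\<And>j::nat. gens a (E j)" "\<And>j. proj (E j)"
      "\<And>n. norm (a - (\<Sum>j<n. (1/2) ^ Suc j *\<^sub>R E j)) \<le> (1/2) ^ n"
      using dyadic_projections[OF a(2,3,4)] by blast
    have pE: "pm (E j)" for j using gensD[OF E(1) M_salg a(1)] E(2) by (simp add: pm_def)
    have "cmod (\<sigma> a - \<tau> a) \<le> 2 * (1/2) ^ n" for n
    proof -
      define X where "X = (\<Sum>j<n. (1/2::real) ^ Suc j *\<^sub>R E j)"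
      have XM: "X \<in> M" unfolding X_def using pE by (intro M_closed(11) M_closed(10)) (simp add: pmD)
      have sX: "star X = X" using E(2) by (simp add: X_def star_sum proj_def)
      have "\<sigma> X = \<tau> X" unfolding X_def
        using pE eq by (simp add: tracial_sum[OF s] tracial_sum[OF t] tracialD(7)[OF s] tracialD(7)[OF t] M_closed pmD)
      then have "\<sigma> a - \<tau> a = \<sigma> (a - X) - \<tau> (a - X)"
        using a(1) XM by (simp add: tracialD(6)[OF s] tracialD(6)[OF t])
      moreover have bd: "cmod (\<rho> (a - X)) \<le> (1/2) ^ n" if "tracial \<rho>" for \<rho>
        by (rule tracial_bound[OF that]) (use a XM sX E(3)[of n] in \<open>simp_all add: M_closed X_def\<close>)
      moreover note bd[OF s] bd[OF t]
      ultimately show ?thesis using norm_triangle_ineq4[of "\<sigma> (a - X)" "\<tau> (a - X)"] by simp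
    qed
    then have "\<exists>N. \<forall>n\<ge>N. cmod (\<sigma> a - \<tau> a) \<le> 2 * (1/2) ^ n" by blast
    moreover have "(\<lambda>n. 2 * (1/2::real) ^ n) \<longlonglongrightarrow> 2 * 0"
      by (intro tendsto_mult tendsto_const LIMSEQ_realpow_zero) auto
    ultimately have "cmod (\<sigma> a - \<tau> a) \<le> 2 * 0" using LIMSEQ_le_const by blast
    then show ?thesis by simp
  qed
  have 2: "\<sigma> a = \<tau> a" if a: "a \<in> M" "star a = a" for a
  proof -
    define c where "c = norm a + 1"
    have c: "0 < c" "norm a \<le> c" by (simp_all add: c_def add_nonneg_pos)
    define b where "b = (1/2) *\<^sub>R (1 + (1 / c) *\<^sub>R a)"
    have bM: "b \<in> M" using a by (simp add: b_def M_closed)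
    have "\<bar>Re (cinner (a \<cdot> v) v)\<bar> \<le> c * (norm v)\<^sup>2" for v
    proof -
      have "cmod (cinner (a \<cdot> v) v) \<le> norm (a \<cdot> v) * norm v" by (rule Cauchy_Schwarz)
      also have "\<dots> \<le> (c * norm v) * norm v" by (intro mult_right_mono order_trans[OF norm_ap mult_right_mono[OF c(2)]]) auto
      finally show ?thesis using abs_Re_le_cmod[of "cinner (a \<cdot> v) v"] by (simp add: power2_eq_square mult.assoc)
    qed
    then have q: "\<bar>Re (cinner (a \<cdot> v) v) / c\<bar> \<le> (norm v)\<^sup>2" for v using c by (simp add: divide_le_eq mult.commute)
    have "\<sigma> b = \<tau> b"
    proof (rule 1[OF bM])
      show "star b = b" using a by (simp add: b_def)
      fix v
      have "Re (cinner (b \<cdot> v) v) = 1/2 * ((norm v)\<^sup>2 + Re (cinner (a \<cdot> v) v) / c)"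
        by (simp add: b_def cinner_scaleR_left cinner_add_left Re_cinner_self)
      moreover have "0 \<le> 1/2 * (n + r)" "1/2 * (n + r) \<le> n" if "\<bar>r\<bar> \<le> n" for n r :: real
        using that by auto
      ultimately show "0 \<le> Re (cinner (b \<cdot> v) v)" "Re (cinner (b \<cdot> v) v) \<le> (norm v)\<^sup>2"
        using q[of v] by presburger+
    qed
    moreover have "a = c *\<^sub>R (2 *\<^sub>R b - 1)" using c by (simp add: b_def)
    ultimately show ?thesis using bM by (simp add: tracialD[OF s] tracialD[OF t] M_closed)
  qed
  define a b where "a = (1/2) *\<^sub>R (x + star x)" and "b = (1/2) *\<^sub>R (sc (- \<i>) * (x - star x))"
  have ab: "a \<in> M" "b \<in> M" using x by (simp_all add: a_def b_def M_closed)
  have "star a = a" by (simp add: a_def add.commute)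
  moreover have "star b = b"
  proof -
    have "sc \<i> * y = - (sc (- \<i>) * y)" for y :: "'h cop"
    proof -
      have "sc \<i> * y + sc (- \<i>) * y = sc (\<i> + - \<i>) * y" unfolding sc_add[symmetric] by (rule distrib_right[symmetric])
      then show ?thesis by (simp add: eq_neg_iff_add_eq_0)
    qed
    then show ?thesis by (simp add: b_def star_mult sc_commute right_diff_distrib)
  qed
  moreover have "x = a + sc \<i> * b"
  proof -
    have "sc \<i> * (sc (- \<i>) * y) = y" for y :: "'h cop" by (simp add: mult.assoc[symmetric] sc_mult)
    then show ?thesis by (simp add: a_def b_def scaleR_right_distrib[symmetric] scaleR_2[symmetric])
  qed
  ultimately show ?thesis using 2 ab by (simp add: tracialD(1,2)[OF s] tracialD(1,2)[OF t] M_closed)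
qed

text \<open>Both \<open>q\<close> and 1 are measured in copies of a projection \<open>r\<close> of
  small trace. The two counts confine every trace of \<open>q\<close> to a short interval; the
  sequence \<open>e\<close> provides arbitrarily small \<open>r\<close>.\<close>

lemma tracial_unique:
  fixes e :: "nat \<Rightarrow> 'h cop"
  assumes f1: "fin 1" and s: "tracial \<sigma>" and t: "tracial \<tau>" and x: "x \<in> M"
    and e: "\<And>n. pm (e n)" "\<And>n. e n \<noteq> 0" "\<And>m n. m \<noteq> n \<Longrightarrow> e m * e n = 0"
  shows "\<sigma> x = \<tau> x"
proof (rule tracial_eqI[OF s t _ x])
  fix q assume q: "pm q"
  \<comment> \<open>Otherwise \<open>m + 1\<close> of the orthogonal projections would together have
    trace above 1.\<close>
  have small: "\<exists>n. Re (\<tau> (e n)) \<le> 1 / real (Suc m)" for m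
  proof (rule ccontr)
    assume "\<not> ?thesis"
    then have *: "1 / real (Suc m) < Re (\<tau> (e n))" for n by (meson not_le)
    have S: "pm (\<Sum>i<n. e i)" for n
    proof (induct n)
      case (Suc n)
      have "(\<Sum>i<n. e i) * e n = 0" unfolding sum_distrib_right using e(3) by (intro sum.neutral) auto
      then show ?case using Suc e(1)[of n] by (simp add: pm_add)
    qed simp
    have "1 = (\<Sum>i<Suc m. 1 / real (Suc m))" by simp
    also have "\<dots> < (\<Sum>i<Suc m. Re (\<tau> (e i)))" by (rule sum_strict_mono) (use * in auto)
    also have "\<dots> = Re (\<tau> (\<Sum>i<Suc m. e i))"
      using e(1) tracial_sum[OF t, of "{..<Suc m}" e] by (simp add: pmD)
    also have "\<dots> \<le> Re (\<tau> 1)" by (rule tracial_ple[OF t S pm_1]) simp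
    finally show False using tracialD(4)[OF t] by simp
  qed
  have bound: "\<bar>Re (\<sigma> q) - Re (\<tau> q)\<bar> \<le> 2 / real (Suc m)" for m
  proof -
    obtain n where n: "Re (\<tau> (e n)) \<le> 1 / real (Suc (Suc m))" using small by blast
    define r where "r = e n"
    have r: "pm r" "r \<noteq> 0" using e by (simp_all add: r_def)
    obtain N where N: "\<And>\<rho>. tracial \<rho> \<Longrightarrow> real N * Re (\<rho> r) \<le> Re (\<rho> 1) \<and> Re (\<rho> 1) \<le> (real N + 1) * Re (\<rho> r)"
      using tracial_count[OF f1 pm_1 r] by metis
    obtain j where j: "\<And>\<rho>. tracial \<rho> \<Longrightarrow> real j * Re (\<rho> r) \<le> Re (\<rho> q) \<and> Re (\<rho> q) \<le> (real j + 1) * Re (\<rho> r)"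
      using tracial_count[OF f1 q r] by metis
    have pos: "0 < Re (\<rho> r)" if "tracial \<rho>" for \<rho> using tracial_faithful[OF f1 that r] .
    have "1 \<le> (real N + 1) * Re (\<tau> r)" using N[OF t] tracialD(4)[OF t] by simp
    also have "\<dots> \<le> (real N + 1) * (1 / real (Suc (Suc m)))" using n unfolding r_def by (intro mult_left_mono) auto
    finally have "real (Suc (Suc m)) \<le> real N + 1" by (simp add: field_simps)
    then have Nm: "real (Suc m) \<le> real N" by simp
    then have N0: "0 < real N" by linarith
    have up: "Re (\<rho> r) \<le> 1 / N" and lo: "1 / (real N + 1) \<le> Re (\<rho> r)" if "tracial \<rho>" for \<rho>
      using N[OF that] tracialD(4)[OF that] N0 by (simp_all add: field_simps)
    have "real j * (1 / (real N + 1)) \<le> 1"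
    proof -
      have "real j * (1 / (real N + 1)) \<le> real j * Re (\<tau> r)" using lo[OF t] by (intro mult_left_mono) auto
      also have "\<dots> \<le> Re (\<tau> q)" using j[OF t] by blast
      also have "\<dots> \<le> Re (\<tau> 1)" by (rule tracial_ple[OF t q pm_1]) simp
      finally show ?thesis using tracialD(4)[OF t] by simp
    qed
    then have jN: "real j \<le> real N + 1" by (simp add: field_simps)
    have rng: "real j / (real N + 1) \<le> Re (\<rho> q) \<and> Re (\<rho> q) \<le> (real j + 1) / N" if "tracial \<rho>" for \<rho>
    proof
      have "real j * (1 / (real N + 1)) \<le> real j * Re (\<rho> r)" using lo[OF that] by (intro mult_left_mono) auto
      then show "real j / (real N + 1) \<le> Re (\<rho> q)" using j[OF that] by simp
      have "(real j + 1) * Re (\<rho> r) \<le> (real j + 1) * (1 / N)" using up[OF that] by (intro mult_left_mono) auto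
      then show "Re (\<rho> q) \<le> (real j + 1) / N" using j[OF that] by simp
    qed
    \<comment> \<open>Both traces lie between these two quotients, and \<open>j \<le> N + 1\<close>
      bounds the gap by \<open>2 / N\<close>.\<close>
    have "(real j + 1) / N - real j / (real N + 1) = (real j + real N + 1) / (N * (real N + 1))"
      using N0 by (simp add: field_simps)
    also have "\<dots> \<le> (2 * (real N + 1)) / (N * (real N + 1))" using jN N0 by (intro divide_right_mono) auto
    also have "\<dots> = 2 / N" by (rule mult_divide_mult_cancel_right) (use N0 in linarith)
    also have "\<dots> \<le> 2 / real (Suc m)" using Nm by (intro divide_left_mono) auto
    finally show ?thesis using rng[OF s] rng[OF t] by (simp add: abs_le_iff)
  qed
  have "Re (\<sigma> q) = Re (\<tau> q)"
  proof (rule ccontr)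
    assume "Re (\<sigma> q) \<noteq> Re (\<tau> q)"
    then have "0 < \<bar>Re (\<sigma> q) - Re (\<tau> q)\<bar> / 2" by simp
    then obtain m where "inverse (real (Suc m)) < \<bar>Re (\<sigma> q) - Re (\<tau> q)\<bar> / 2" using reals_Archimedean by blast
    moreover have "2 * i < X" if "i < X / 2" for i X :: real using that by simp
    ultimately have "2 * inverse (real (Suc m)) < \<bar>Re (\<sigma> q) - Re (\<tau> q)\<bar>" by blast
    then show False using bound[of m] unfolding divide_inverse by (meson not_le)
  qed
  moreover have "\<sigma> q = of_real (Re (\<sigma> q))" "\<tau> q = of_real (Re (\<tau> q))"
    using tracial_pm[OF s q] tracial_pm[OF t q] by blast+
  ultimately show "\<sigma> q = \<tau> q" by simp
qed

end

section \<open>Maximal abelian subalgebras\<close>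

text \<open>Real and imaginary parts are self-adjoint, and a self-adjoint \<open>a\<close> is a
  combination of 1 and the positive contraction \<open>(1 + a / c) / 2\<close> for \<open>c\<close>
  above its norm.\<close>

lemma contraction_induct [consumes 2, case_names contraction add scale]:
  assumes N: "vna N" and x: "x \<in> N"
    and P: "\<And>a. a \<in> N \<Longrightarrow> star a = a \<Longrightarrow> (\<And>v. 0 \<le> Re (cinner (a \<cdot> v) v)) \<Longrightarrow>
      (\<And>v. Re (cinner (a \<cdot> v) v) \<le> (norm v)\<^sup>2) \<Longrightarrow> P a"
    and add: "\<And>a b. a \<in> N \<Longrightarrow> b \<in> N \<Longrightarrow> P a \<Longrightarrow> P b \<Longrightarrow> P (a + b)"
    and scale: "\<And>c a. a \<in> N \<Longrightarrow> P a \<Longrightarrow> P (sc c * a)"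
  shows "P x"
proof -
  note NN = vnaD(1-5)[OF N] salg_closed(1,2)[OF vna_salg[OF N]] salgD(4)[OF vna_salg[OF N]]
  have one: "P 1" by (rule P) (simp_all add: NN Re_cinner_self)
  have scR: "P (r *\<^sub>R a)" if "a \<in> N" "P a" for r a
    using scale[OF that, of "of_real r"] by (simp add: sc_of_real)
  have sa: "P a" if a: "a \<in> N" "star a = a" for a
  proof -
    define c where "c = norm a + 1"
    have c: "0 < c" "norm a \<le> c" by (simp_all add: c_def add_nonneg_pos)
    define b where "b = (1/2) *\<^sub>R (1 + (1 / c) *\<^sub>R a)"
    have bN: "b \<in> N" using a by (simp add: b_def NN)
    have "\<bar>Re (cinner (a \<cdot> v) v)\<bar> \<le> c * (norm v)\<^sup>2" for v
    proof -
      have "cmod (cinner (a \<cdot> v) v) \<le> norm (a \<cdot> v) * norm v" by (rule Cauchy_Schwarz)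
      also have "\<dots> \<le> (c * norm v) * norm v" by (intro mult_right_mono order_trans[OF norm_ap mult_right_mono[OF c(2)]]) auto
      finally show ?thesis using abs_Re_le_cmod[of "cinner (a \<cdot> v) v"] by (simp add: power2_eq_square mult.assoc)
    qed
    then have q: "\<bar>Re (cinner (a \<cdot> v) v) / c\<bar> \<le> (norm v)\<^sup>2" for v using c by (simp add: divide_le_eq mult.commute)
    have "P b"
    proof (rule P[OF bN])
      show "star b = b" using a by (simp add: b_def)
      fix v
      have "Re (cinner (b \<cdot> v) v) = 1/2 * ((norm v)\<^sup>2 + Re (cinner (a \<cdot> v) v) / c)"
        by (simp add: b_def cinner_scaleR_left cinner_add_left Re_cinner_self)
      moreover have "0 \<le> 1/2 * (n + r)" "1/2 * (n + r) \<le> n" if "\<bar>r\<bar> \<le> n" for n r :: real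
        using that by auto
      ultimately show "0 \<le> Re (cinner (b \<cdot> v) v)" "Re (cinner (b \<cdot> v) v) \<le> (norm v)\<^sup>2"
        using q[of v] by presburger+
    qed
    then have "P ((2 * c) *\<^sub>R b + (- c) *\<^sub>R 1)" using bN one by (intro add scR) (simp_all add: NN)
    moreover have "(2 * c) *\<^sub>R b + (- c) *\<^sub>R 1 = a" using c by (simp add: b_def scaleR_add_right)
    ultimately show ?thesis by simp
  qed
  define a b where "a = (1/2) *\<^sub>R (x + star x)" and "b = (1/2) *\<^sub>R (sc (- \<i>) * (x - star x))"
  have ab: "a \<in> N" "b \<in> N" using x by (simp_all add: a_def b_def NN)
  have "star a = a" by (simp add: a_def add.commute)
  moreover have "star b = b"
  proof -
    have "sc \<i> * y = - (sc (- \<i>) * y)" for y :: "'a cop"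
    proof -
      have "sc \<i> * y + sc (- \<i>) * y = sc (\<i> + - \<i>) * y" unfolding sc_add[symmetric] by (rule distrib_right[symmetric])
      then show ?thesis by (simp add: eq_neg_iff_add_eq_0)
    qed
    then show ?thesis by (simp add: b_def star_mult sc_commute right_diff_distrib)
  qed
  ultimately have "P (a + sc \<i> * b)" using ab sa by (intro add scale) (simp_all add: NN)
  moreover have "x = a + sc \<i> * b"
  proof -
    have "sc \<i> * (sc (- \<i>) * y) = y" for y :: "'a cop" by (simp add: mult.assoc[symmetric] sc_mult)
    then show ?thesis by (simp add: a_def b_def scaleR_right_distrib[symmetric] scaleR_2[symmetric])
  qed
  ultimately show ?thesis by simp
qed

lemma salg_Int_INT:
  assumes S: "salg S" and C: "\<And>a. a \<in> I \<Longrightarrow> salg (C a)"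
  shows "salg (S \<inter> (\<Inter>a\<in>I. C a))"
proof -
  have "x \<in> S \<inter> (\<Inter>a\<in>I. C a)" if "\<And>n. f n \<in> S \<inter> (\<Inter>a\<in>I. C a)" "sconv f x" for f x
  proof -
    have "x \<in> S" by (rule salgD(5)[OF S _ that(2)]) (use that(1) in blast)
    moreover have "x \<in> C a" if "a \<in> I" for a
      by (rule salgD(5)[OF C[OF that] _ \<open>sconv f x\<close>]) (use \<open>\<And>n. f n \<in> S \<inter> (\<Inter>a\<in>I. C a)\<close> that in blast)
    ultimately show ?thesis by blast
  qed
  moreover have "1 \<in> S \<inter> (\<Inter>a\<in>I. C a)" using salgD(1)[OF S] salgD(1)[OF C] by simp
  moreover have "x + y \<in> S \<inter> (\<Inter>a\<in>I. C a)" "x * y \<in> S \<inter> (\<Inter>a\<in>I. C a)"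
    if "x \<in> S \<inter> (\<Inter>a\<in>I. C a)" "y \<in> S \<inter> (\<Inter>a\<in>I. C a)" for x y
    using that salgD(2,3)[OF S] salgD(2,3)[OF C] by simp_all
  moreover have "r *\<^sub>R x \<in> S \<inter> (\<Inter>a\<in>I. C a)" if "x \<in> S \<inter> (\<Inter>a\<in>I. C a)" for r x
    using that salgD(4)[OF S] salgD(4)[OF C] by simp
  ultimately show ?thesis unfolding salg_def by (intro conjI ballI allI impI) (assumption | blast)+
qed

lemma dyadic_limit:
  fixes a :: "'h::complex_hilbert cop"
  assumes sa: "star a = a" and a: "\<And>v. 0 \<le> Re (cinner (a \<cdot> v) v)" "\<And>v. Re (cinner (a \<cdot> v) v) \<le> (norm v)\<^sup>2"
  obtains e where "\<And>j. gens a (e j)" "\<And>j. proj (e j)" "(\<lambda>n. \<Sum>j<n. (1/2) ^ Suc j *\<^sub>R e j) \<longlonglongrightarrow> a"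
proof -
  obtain E where E: "\<And>j::nat. gens a (E j)" "\<And>j. proj (E j)"
    "\<And>n. norm (a - (\<Sum>j<n. (1/2) ^ Suc j *\<^sub>R E j)) \<le> (1/2) ^ n"
    using dyadic_projections[OF sa a] by blast
  have "(\<lambda>n. \<Sum>j<n. (1/2) ^ Suc j *\<^sub>R E j) \<longlonglongrightarrow> a"
  proof (rule Lim_transform)
    show "(\<lambda>n. a) \<longlonglongrightarrow> a" by simp
    have lim: "(\<lambda>n. (1/2::real) ^ n) \<longlonglongrightarrow> 0" by (rule LIMSEQ_realpow_zero) auto
    show "(\<lambda>n. (\<Sum>j<n. (1/2) ^ Suc j *\<^sub>R E j) - a) \<longlonglongrightarrow> 0"
      by (rule Lim_null_comparison[OF _ lim], rule always_eventually) (use E(3) in \<open>simp add: norm_minus_commute\<close>)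
  qed
  then show ?thesis using that E by blast
qed

text \<open>Maximality is assumed in the form that the masa is its own relative commutant;
  \<open>masa_max\<close> derives this from maximality with respect to inclusion.\<close>

locale factor_with_masa = separable_factor M for M :: "'h::complex_hilbert cop set" +
  fixes A :: "'h cop set"
  assumes A_sub: "A \<subseteq> M" and A_comm: "a \<in> A \<Longrightarrow> b \<in> A \<Longrightarrow> a * b = b * a"
    and A_star: "a \<in> A \<Longrightarrow> star a \<in> A"
    and A_max: "x \<in> M \<Longrightarrow> (\<And>a. a \<in> A \<Longrightarrow> x * a = a * x) \<Longrightarrow> x \<in> A"
begin

definition pa :: "'h cop \<Rightarrow> bool" where "pa e \<longleftrightarrow> e \<in> A \<and> proj e"

lemma pa_pm: "pa e \<Longrightarrow> pm e"
  using A_sub by (auto simp: pa_def pm_def)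

lemma paD: "pa e \<Longrightarrow> e \<in> A" "pa e \<Longrightarrow> proj e" "pa e \<Longrightarrow> star e = e" "pa e \<Longrightarrow> e * e = e"
  by (simp_all add: pa_def proj_def)

lemma A_eq: "A = M \<inter> (\<Inter>a\<in>A. {x. x * a = a * x})"
proof (intro equalityI subsetI)
  fix x assume "x \<in> A"
  then show "x \<in> M \<inter> (\<Inter>a\<in>A. {x. x * a = a * x})" using A_sub A_comm[of x] by blast
next
  fix x assume "x \<in> M \<inter> (\<Inter>a\<in>A. {x. x * a = a * x})"
  then show "x \<in> A" by (intro A_max) simp_all
qed

lemma A_salg: "salg A"
proof -
  have "salg (M \<inter> (\<Inter>a\<in>A. {x. x * a = a * x}))"
    by (intro salg_Int_INT M_salg salg_commutant)
  then show ?thesis by (simp only: A_eq[symmetric])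
qed

lemma A_sc: "x \<in> A \<Longrightarrow> sc c * x \<in> A"
proof (rule A_max)
  assume x: "x \<in> A"
  then show "sc c * x \<in> M" using A_sub by (auto intro: M_closed)
  fix a assume "a \<in> A"
  then show "sc c * x * a = a * (sc c * x)" using A_comm[OF x, of a] by (metis mult.assoc sc_commute)
qed

lemmas A_closed = salgD(1-4)[OF A_salg] salg_closed[OF A_salg] A_sc A_star salg_sum[OF A_salg]

lemma A_vna: "vna A"
  unfolding vna_def
proof (intro conjI ballI allI impI)
  fix x assume x: "\<forall>F e. finite F \<longrightarrow> 0 < e \<longrightarrow> (\<exists>y\<in>A. \<forall>v\<in>F. norm (x \<cdot> v - y \<cdot> v) < e)"
  show "x \<in> A"
  proof (rule A_max)
    show "x \<in> M" by (rule vnaD(6)[OF vna]) (use x A_sub in blast)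
    fix a assume a: "a \<in> A"
    show "x * a = a * x"
    proof (rule cop_eqI, rule ccontr)
      fix v assume ne: "(x * a) \<cdot> v \<noteq> (a * x) \<cdot> v"
      define d where "d = norm ((x * a) \<cdot> v - (a * x) \<cdot> v)"
      have d: "d > 0" using ne by (simp add: d_def)
      define e where "e = d / (norm a + 2)"
      have e: "e > 0" using d by (simp add: e_def add_nonneg_pos)
      obtain y where y: "y \<in> A" "norm (x \<cdot> v - y \<cdot> v) < e" "norm (x \<cdot> a \<cdot> v - y \<cdot> a \<cdot> v) < e"
        using x[rule_format, of "{v, a \<cdot> v}" e] e by auto
      have ya: "y \<cdot> a \<cdot> v = a \<cdot> y \<cdot> v" using A_comm[OF y(1) a] by (metis ap_simps(6))
      have "d = norm ((x \<cdot> a \<cdot> v - y \<cdot> a \<cdot> v) - a \<cdot> (x \<cdot> v - y \<cdot> v))" by (simp add: d_def ya)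
      also have "\<dots> \<le> norm (x \<cdot> a \<cdot> v - y \<cdot> a \<cdot> v) + norm (a \<cdot> (x \<cdot> v - y \<cdot> v))" by (rule norm_triangle_ineq4)
      also have "\<dots> \<le> e + norm a * e"
        using y by (intro add_mono order_trans[OF norm_ap mult_left_mono]) auto
      also have "\<dots> < e * (norm a + 2)" using e by (simp add: algebra_simps)
      also have "\<dots> = d" using norm_ge_zero[of a] by (simp add: e_def add_nonneg_eq_0_iff)
      finally show False by simp
    qed
  qed
qed (use A_closed in auto)

lemma pa_diff: "pa e \<Longrightarrow> pa f \<Longrightarrow> ple e f \<Longrightarrow> pa (f - e)"
  by (simp add: pa_def proj_diff A_closed)

lemma pa_1 [simp]: "pa 1" and pa_0 [simp]: "pa 0"
  by (simp_all add: pa_def A_closed)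

lemma pa_mult: "pa e \<Longrightarrow> pa f \<Longrightarrow> pa (e * f)"
proof -
  assume *: "pa e" "pa f"
  have "e * f = f * e" using A_comm * by (simp add: pa_def)
  then show ?thesis using * unfolding pa_def proj_def by (simp add: A_closed star_mult) (metis mult.assoc)
qed

definition atom :: "'h cop \<Rightarrow> bool" where
  "atom e \<longleftrightarrow> pa e \<and> e \<noteq> 0 \<and> (\<forall>f. pa f \<longrightarrow> ple f e \<longrightarrow> f = 0 \<or> f = e)"

text \<open>Every dyadic projection of \<open>a\<close>, multiplied by the atom, is 0 or the atom,
  so the partial sums are multiples of \<open>e\<close>, and so is their limit.\<close>

lemma atom_A_scalar:
  assumes e: "atom e" and a: "a \<in> A"
  shows "\<exists>c. a * e = sc c * e"
  using A_vna a
proof (induct rule: contraction_induct)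
  case (contraction a)
  have pe: "pa e" "e \<noteq> 0" using e by (auto simp: atom_def)
  obtain E where E: "\<And>j::nat. gens a (E j)" "\<And>j. proj (E j)" "(\<lambda>n. \<Sum>j<n. (1/2) ^ Suc j *\<^sub>R E j) \<longlonglongrightarrow> a"
    using dyadic_limit[OF contraction(2-4)] by blast
  have pE: "pa (E j)" for j using gensD[OF E(1) A_salg contraction(1)] E(2) by (simp add: pa_def)
  have "\<exists>c. E j * e = c *\<^sub>R e" for j
  proof -
    have "ple (E j * e) e" using A_comm[of "E j" e] pE[of j] pe by (simp add: ple_def pa_def proj_def) (metis mult.assoc)
    then have "E j * e = 0 \<or> E j * e = e" using e pa_mult[OF pE pe(1)] by (simp add: atom_def)
    then show ?thesis by (metis scaleR_one scaleR_zero_left)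
  qed
  then obtain c where c: "\<And>j. E j * e = c j *\<^sub>R e" by metis
  define s where "s = (\<lambda>n. \<Sum>j<n. (1/2) ^ Suc j * c j)"
  have Xs: "(\<Sum>j<n. (1/2) ^ Suc j *\<^sub>R E j) * e = s n *\<^sub>R e" for n
    by (simp add: sum_distrib_right c s_def scaleR_sum_left)
  obtain v where v: "e \<cdot> v \<noteq> 0" using pe(2) cop_eqI[of e 0] by auto
  have lim: "(\<lambda>n. s n *\<^sub>R e) \<longlonglongrightarrow> a * e"
    using tendsto_mult[OF E(3) tendsto_const[of e]] unfolding Xs .
  have lim': "(\<lambda>n. Re (cinner ((s n *\<^sub>R e) \<cdot> v) (e \<cdot> v)) / (norm (e \<cdot> v))\<^sup>2) \<longlonglongrightarrow>
      Re (cinner ((a * e) \<cdot> v) (e \<cdot> v)) / (norm (e \<cdot> v))\<^sup>2"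
    using v by (intro tendsto_divide tendsto_Re tendsto_cinner sconvD[OF tendsto_sconv[OF lim]] tendsto_const) simp
  have "Re (cinner ((s n *\<^sub>R e) \<cdot> v) (e \<cdot> v)) / (norm (e \<cdot> v))\<^sup>2 = s n" for n
    using v by (simp add: cinner_scaleR_left Re_cinner_self)
  then have "s \<longlonglongrightarrow> Re (cinner ((a * e) \<cdot> v) (e \<cdot> v)) / (norm (e \<cdot> v))\<^sup>2" using lim' by simp
  then have "(\<lambda>n. s n *\<^sub>R e) \<longlonglongrightarrow> (Re (cinner ((a * e) \<cdot> v) (e \<cdot> v)) / (norm (e \<cdot> v))\<^sup>2) *\<^sub>R e"
    by (intro tendsto_scaleR tendsto_const)
  then have "\<exists>r. a * e = r *\<^sub>R e" using lim LIMSEQ_unique by blast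
  then obtain r where "a * e = r *\<^sub>R e" by blast
  then have "a * e = sc (of_real r) * e" unfolding sc_of_real by simp
  then show ?case by blast
next
  case (add a b)
  then show ?case by (metis distrib_right sc_add)
next
  case (scale c a)
  then show ?case by (metis mult.assoc sc_mult)
qed

text \<open>Elements of \<open>A\<close> act on \<open>e\<close> as scalars, so
  \<open>e * x * e\<close> commutes with \<open>A\<close> and lies in \<open>A\<close> by
  maximality. Thus minimality in the masa becomes minimality in \<open>M\<close>.\<close>

lemma atom_scalar:
  assumes e: "atom e" and x: "x \<in> M"
  shows "\<exists>c. e * x * e = sc c * e"
proof -
  have pe: "pa e" using e by (simp add: atom_def)
  have "e * x * e \<in> A"
  proof (rule A_max)
    show "e * x * e \<in> M" using x pmD(1)[OF pa_pm[OF pe]] by (simp add: M_closed)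
    fix a assume a: "a \<in> A"
    obtain c where c: "a * e = sc c * e" using atom_A_scalar[OF e a] by blast
    have ea: "e * a = sc c * e" using A_comm[OF paD(1)[OF pe] a] c by simp
    have "e * x * e * a = e * x * (sc c * e)" by (simp add: mult.assoc ea)
    also have "\<dots> = sc c * (e * x * e)" by (metis mult.assoc sc_commute)
    also have "\<dots> = a * (e * x * e)" by (metis mult.assoc c)
    finally show "e * x * e * a = a * (e * x * e)" .
  qed
  from atom_A_scalar[OF e this] show ?thesis by (simp add: mult.assoc paD(4)[OF pe])
qed

lemma sc_idem:
  assumes "proj (sc c * e)" "e * e = e" "sc c * e \<noteq> 0"
  shows "sc c * e = e"
proof -
  have "c \<noteq> 0" using assms(3) by auto
  have "sc c * e * (sc c * e) = sc c * (sc c * (e * e))" by (metis mult.assoc sc_commute)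
  then have "sc c * (sc c * e) = sc c * e" using assms(1,2) by (simp add: proj_def)
  then have "sc (inverse c) * (sc c * (sc c * e)) = sc (inverse c) * (sc c * e)" by simp
  then show ?thesis using \<open>c \<noteq> 0\<close> by (simp add: mult.assoc[symmetric] sc_mult)
qed

lemma atom_sub:
  assumes e: "atom e" and f: "pm f" "ple f e" "f \<noteq> 0"
  shows "f = e"
proof -
  have pe: "pm e" "e * e = e" using e by (auto simp: atom_def pa_pm pmD)
  have "e * f * e = f" using f ple_right[of f e] pe by (simp add: ple_def pm_def)
  then obtain c where "f = sc c * e" using atom_scalar[OF e pmD(1)[OF f(1)]] by metis
  then show ?thesis using sc_idem[of c e] f pe by (simp add: pm_def)
qed

lemma atom_mle:
  assumes e: "atom e" and g: "pm g" "g \<noteq> 0"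
  shows "mle e g"
proof -
  have pe: "pm e" "e \<noteq> 0" using e by (auto simp: atom_def pa_pm)
  obtain v where v: "v \<in> M" "pis v" "v \<noteq> 0" "ple (star v * v) e" "ple (v * star v) g"
    using comparison_nonzero[OF pe g] by blast
  have "star v * v = e" using atom_sub[OF e] pis_pm[OF v(1,2)] v(3,4) by (simp add: star_self_eq_0)
  then show ?thesis unfolding mle_def using v by blast
qed

lemma atom_fin: "atom e \<Longrightarrow> fin e"
  unfolding fin_def
proof (intro conjI allI impI)
  assume e: "atom e"
  then show pe: "pm e" by (simp add: atom_def pa_pm)
  fix q assume q: "pm q" "meq e q" "ple q e"
  have "q \<noteq> 0"
  proof
    assume "q = 0"
    then obtain v where "star v * v = e" "v * star v = 0" using q(2) unfolding meq_def by blast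
    then show False using e by (metis atom_def star_self_eq_0 star_star star_eq_0 mult_zero_left mult_zero_right)
  qed
  then show "q = e" using atom_sub[OF e] q by blast
qed

text \<open>Without atoms one can pass to smaller and smaller nonzero projections of the masa; the
  successive differences form the sequence.\<close>

lemma diffuse_orth_seq:
  assumes E: "pa E" "E \<noteq> 0" and no: "\<And>e. atom e \<Longrightarrow> ple e E \<Longrightarrow> False"
  obtains e :: "nat \<Rightarrow> 'h cop" where "\<And>n. pa (e n)" "\<And>n. e n \<noteq> 0" "\<And>n. ple (e n) E" "\<And>m n. m \<noteq> n \<Longrightarrow> e m * e n = 0"
proof -
  have "\<exists>f'. pa f' \<and> ple f' f \<and> f' \<noteq> 0 \<and> f' \<noteq> f" if "pa f" "f \<noteq> 0" "ple f E" for f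
    using no[of f] that unfolding atom_def by blast
  then obtain h where h: "\<And>f. pa f \<Longrightarrow> f \<noteq> 0 \<Longrightarrow> ple f E \<Longrightarrow> pa (h f) \<and> ple (h f) f \<and> h f \<noteq> 0 \<and> h f \<noteq> f" by metis
  define f where "f = rec_nat E (\<lambda>_. h)"
  have f0: "f 0 = E" and fS: "\<And>n. f (Suc n) = h (f n)" by (simp_all add: f_def)
  have inv: "pa (f n) \<and> f n \<noteq> 0 \<and> ple (f n) E" for n
  proof (induct n)
    case (Suc n)
    then show ?case using h[of "f n"] ple_trans[of "h (f n)" "f n" E] by (simp add: fS)
  qed (use E ple_refl[of E] in \<open>simp add: f0 pa_def\<close>)
  have step: "ple (f (Suc n)) (f n)" "f (Suc n) \<noteq> f n" for n using h[of "f n"] inv[of n] by (auto simp: fS)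
  have dec: "ple (f (m + k)) (f m)" for m k
  proof (induct k)
    case (Suc k)
    then show ?case using step(1)[of "m + k"] ple_trans by fastforce
  qed (use inv[of m] ple_refl[of "f m"] in \<open>simp add: pa_def\<close>)
  define e where "e = (\<lambda>n. f n - f (Suc n))"
  have pe: "pa (e n)" for n unfolding e_def using pa_diff inv step by blast
  have ef: "ple (e n) (f n)" for n unfolding e_def using ple_diff[OF _ _ step(1)[of n]] inv by (simp add: pa_def)
  have lt: "e m * e n = 0" if "m < n" for m n
  proof -
    have "ple (f n) (f (Suc m))" using dec[of "Suc m" "n - Suc m"] that by simp
    then have "f (Suc m) * e n = e n" using ple_trans[OF ef] by (simp add: ple_def)
    then have "e m * e n = e m * f (Suc m) * e n" by (simp add: mult.assoc)
    moreover have "e m * f (Suc m) = 0"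
      using step(1)[of m] inv[of "Suc m"] unfolding e_def ple_def by (simp add: left_diff_distrib pa_def proj_def)
    ultimately show ?thesis by simp
  qed
  show ?thesis
  proof (rule that[of e])
    show "e n \<noteq> 0" for n using step(2)[of n] by (simp add: e_def)
    show "ple (e n) E" for n using ple_trans[OF ef] inv by blast
    show "e m * e n = 0" if "m \<noteq> n" for m n
      using lt[of m n] lt[of n m] that orth_sym[of "e n" "e m"] pe by (metis linorder_neqE_nat paD(2))
  qed (rule pe)
qed

text \<open>This is the form in which the hypotheses on the type of the factor enter the construction.\<close>

definition small_pieces :: bool where
  "small_pieces \<longleftrightarrow> (\<forall>E g. pa E \<longrightarrow> E \<noteq> 0 \<longrightarrow> pm g \<longrightarrow> g \<noteq> 0 \<longrightarrow> (\<exists>e. pa e \<and> e \<noteq> 0 \<and> ple e E \<and> mle e g))"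

lemma small_pieces_III: "(\<And>p. fin p \<Longrightarrow> p = 0) \<Longrightarrow> small_pieces"
  unfolding small_pieces_def
proof (intro allI impI)
  fix E g assume III: "\<And>p. fin p \<Longrightarrow> p = 0" and E: "pa E" "E \<noteq> 0" and g: "pm g" "g \<noteq> 0"
  have "meq E g" using type_III_meq[OF III pa_pm[OF E(1)] E(2) g] .
  then have "mle E g" using mle_iff[OF pa_pm[OF E(1)]] g ple_refl by (auto simp: pm_def)
  then show "\<exists>e. pa e \<and> e \<noteq> 0 \<and> ple e E \<and> mle e g" using E ple_refl paD by blast
qed

text \<open>Inside the finite \<open>E0\<close> there is an atom, which embeds into every nonzero
  projection, or there is an infinite orthogonal sequence in the masa. In a finite projection the
  members of such a sequence cannot all contain a copy of \<open>g\<close>.\<close>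

lemma small_pieces_semifinite:
  assumes "\<And>E. pa E \<Longrightarrow> E \<noteq> 0 \<Longrightarrow> \<exists>E0. pa E0 \<and> E0 \<noteq> 0 \<and> ple E0 E \<and> fin E0"
  shows small_pieces
  unfolding small_pieces_def
proof (intro allI impI)
  fix E g assume E: "pa E" "E \<noteq> 0" and g: "pm g" "g \<noteq> 0"
  obtain E0 where E0: "pa E0" "E0 \<noteq> 0" "ple E0 E" "fin E0" using assms[OF E] by blast
  show "\<exists>e. pa e \<and> e \<noteq> 0 \<and> ple e E \<and> mle e g"
  proof (cases "\<exists>e. atom e \<and> ple e E0")
    case True
    then obtain e where e: "atom e" "ple e E0" by blast
    then show ?thesis using atom_mle[OF e(1) g] ple_trans[OF e(2) E0(3)] by (auto simp: atom_def)
  next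
    case False
    then obtain e :: "nat \<Rightarrow> 'h cop" where e: "\<And>n. pa (e n)" "\<And>n. e n \<noteq> 0" "\<And>n. ple (e n) E0" "\<And>m n. m \<noteq> n \<Longrightarrow> e m * e n = 0"
      using diffuse_orth_seq[OF E0(1,2)] by metis
    have "\<exists>n. \<not> mle g (e n)" using fin_no_infinite_copies[OF E0(4) g, of e] e pa_pm by blast
    then obtain n where n: "\<not> mle g (e n)" by blast
    then have "mle (e n) g" using comparison[OF pa_pm[OF e(1)] g(1)] by blast
    then show ?thesis using e ple_trans[OF e(3) E0(3)] by blast
  qed
qed

text \<open>Pieces of \<open>E\<close> in the masa are matched with pieces of \<open>f\<close> until
  one side is exhausted, since \<open>small_pieces\<close> would otherwise supply a further pair. If
  it is \<open>E\<close> that is used up, \<open>fin_squeeze\<close> shows that \<open>f\<close> is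
  used up too.\<close>

lemma fit:
  assumes sm: small_pieces and E: "pa E" and f: "fin f" and fE: "mle f E"
  obtains e where "pa e" "ple e E" "meq f e"
proof -
  have pf: "pm f" and pE: "pm E" using fin_pm[OF f] pa_pm[OF E] by auto
  define W where "W = {w \<in> M. pis w \<and> w \<noteq> 0 \<and> star w * w \<in> A}"
  have W: "W \<subseteq> M" "\<And>w. w \<in> W \<Longrightarrow> pis w \<and> w \<noteq> 0" by (auto simp: W_def)
  obtain v V where ms: "maximal_sum W E f v V" using exhaustion[OF W pE pf] by blast
  define e F where "e = star V * V" and "F = V * star V"
  have pV: "pm e" "pm F" using pis_pm[OF maximal_sumD(3,4)[OF ms]] by (auto simp: e_def F_def)
  have le: "ple e E" "ple F f" using maximal_sumD(11,12)[OF ms] by (auto simp: e_def F_def)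
  have eF: "meq e F" unfolding meq_def e_def F_def using maximal_sumD(3)[OF ms] by blast
  have "star (v i) * v i \<in> A" for i using maximal_sumD(1)[OF ms, of i] by (auto simp: W_def A_closed)
  then have "(\<Sum>i<n. star (v i) * v i) \<in> A" for n by (intro salg_sum[OF A_salg])
  then have "e \<in> A" using salgD(5)[OF A_salg _ maximal_sumD(6)[OF ms]] by (simp add: e_def)
  then have e: "pa e" using pV by (simp add: pa_def pm_def)
  have "e = E \<or> F = f"
  proof (rule ccontr)
    assume "\<not> ?thesis"
    then have "E - e \<noteq> 0" "f - F \<noteq> 0" by auto
    moreover have "pa (E - e)" "pm (f - F)" using pa_diff[OF e E le(1)] pm_diff[OF pV(2) pf le(2)] .
    ultimately obtain e' where e': "pa e'" "e' \<noteq> 0" "ple e' (E - e)" "mle e' (f - F)"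
      using sm unfolding small_pieces_def by blast
    then obtain w where w: "w \<in> M" "star w * w = e'" "ple (w * star w) (f - F)" unfolding mle_def by blast
    have "w \<in> W" using w e' pis_of_initial[OF pa_pm[OF e'(1)] w(2)] by (auto simp: W_def paD)
    then show False using maximal_sumD(13)[OF ms] w e'(3) unfolding e_def F_def by blast
  qed
  moreover have "F = f" if "e = E"
  proof (rule fin_squeeze[OF f pE pV(2) fE _ le(2)])
    show "mle E F" using eF that mle_iff[OF pE] pV(2) ple_refl pmD(2) by blast
  qed
  ultimately have "F = f" by blast
  then show ?thesis using that[OF e le(1)] meq_sym[OF eF] by simp
qed

text \<open>By \<open>small_pieces\<close>, a maximal family of projections of the masa below
  \<open>E\<close> that embed into \<open>P\<close> leaves no remainder. The \<open>w n\<close> lead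
  from \<open>P\<close> to these pieces, in the shape that \<open>generate_from_corner\<close> asks
  for.\<close>

lemma pieces:
  assumes sm: small_pieces and E: "pa E" and P: "pm P" "P \<noteq> 0"
  obtains w :: "nat \<Rightarrow> 'h cop" where "\<And>n. w n \<in> M \<and> pis (w n)" "\<And>n. pa (w n * star (w n))" "\<And>n. ple (star (w n) * w n) P"
    "\<And>m n. m \<noteq> n \<Longrightarrow> (w m * star (w m)) * (w n * star (w n)) = 0" "\<And>n. ple (w n * star (w n)) E"
    "\<And>R. pm R \<Longrightarrow> (\<And>n. ple (w n * star (w n)) R) \<Longrightarrow> ple E R"
proof -
  define W where "W = {e. pa e \<and> e \<noteq> 0 \<and> mle e P}"
  have W: "pm f \<and> f \<noteq> 0" if "f \<in> W" for f using that by (auto simp: W_def pa_pm)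
  obtain f F where ms: "max_proj_sum W E f F" using exhaustion_proj[OF W pa_pm[OF E]] by blast
  note f = max_proj_sumD[OF ms]
  have pf: "pa (f n)" for n using f(1)[of n] by (auto simp: W_def)
  have "(\<Sum>i<n. f i) \<in> A" for n using pf by (intro salg_sum[OF A_salg]) (simp add: paD)
  then have "F \<in> A" using salgD(5)[OF A_salg _ f(6)] by blast
  then have F: "pa F" using f(4) by (simp add: pa_def pm_def)
  have "E - F = 0"
  proof (rule ccontr)
    assume "E - F \<noteq> 0"
    then obtain e where "pa e" "e \<noteq> 0" "ple e (E - F)" "mle e P"
      using sm pa_diff[OF F E f(5)] P unfolding small_pieces_def by blast
    then show False using f(8)[of e] by (simp add: W_def)
  qed
  then have EF: "E = F" by simp
  have "\<exists>u. u \<in> M \<and> star u * u = f n \<and> ple (u * star u) P" for n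
    using f(1)[of n] mle_0[of P] unfolding W_def mle_def by auto
  then obtain u where u: "\<And>n. u n \<in> M" "\<And>n. star (u n) * u n = f n" "\<And>n. ple (u n * star (u n)) P" by metis
  have pu: "pis (u n)" for n using pis_of_initial[OF f(2) u(2)] .
  show ?thesis
  proof (rule that[of "\<lambda>n. star (u n)"])
    show "star (u n) \<in> M \<and> pis (star (u n))" for n using u(1) pisD(4)[OF pu] by (simp add: M_closed)
    show "ple E R" if R: "pm R" "\<And>n. ple (star (u n) * star (star (u n))) R" for R
    proof -
      have Rf: "R * f n = f n" for n using R(2)[of n] by (simp add: u(2) ple_def)
      have "sconv (\<lambda>n. R * (\<Sum>i<n. f i)) (R * F)" by (rule sconv_mult_left[OF f(6)])
      then show ?thesis using f(6) sconv_unique unfolding EF ple_def sum_distrib_left Rf by blast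
    qed
  qed (use u pf f(3,5,7) EF in \<open>auto simp: u(2)\<close>)
qed

end

section \<open>Generating a factor\<close>

text \<open>Writing \<open>S = 2 * P - 1\<close> and \<open>J = T - star T\<close>, the operators \<open>S\<close> and \<open>J\<close> anticommute, so the unitary
  \<open>u = (1 + J) (1 - J\<^sup>2)\<^sup>-\<^sup>1\<^sup>/\<^sup>2\<close> satisfies \<open>u S u\<^sup>* S = (1 + J) / (1 - J)\<close>, from which \<open>J\<close> is recovered.\<close>

lemma unitary_graph:
  fixes P T :: "'h::complex_hilbert cop"
  assumes P: "proj P" and T: "P * T = 0" "T * P = T" "norm T \<le> 1/8" and M: "vna M" "P \<in> M" "T \<in> M"
  shows "\<exists>U\<in>M. star U * U = 1 \<and> U * star U = 1 \<and>
    (\<forall>N. vna N \<longrightarrow> P \<in> N \<longrightarrow> star U * P * U \<in> N \<longrightarrow> T \<in> N)"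
proof -
  have sP: "star P = P" and PP: "P * P = P" using P by (simp_all add: proj_def)
  have sT: "P * star T = star T" "star T * P = 0" using T(1,2) sP by (metis star_mult star_simps(1))+
  define J where "J = T - star T"
  have sJ: "star J = - J" by (simp add: J_def)
  define S where "S = 2 *\<^sub>R P - 1"
  have SS: "S * S = 1" by (simp add: S_def algebra_simps PP scaleR_2)
  have SJ: "S * J = - (J * S)" by (simp add: S_def J_def algebra_simps scaleR_2 T sT)
  define K where "K = J * J"
  have SK: "S * K = K * S"
  proof -
    have "S * (J * J) = S * J * J" by (simp only: mult.assoc)
    also have "\<dots> = - (J * (S * J))" by (simp only: SJ minus_mult_left[symmetric] mult.assoc)
    also have "\<dots> = J * J * S" by (simp add: SJ mult.assoc)
    finally show ?thesis by (simp add: K_def)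
  qed
  have sK: "star K = K" by (simp add: K_def star_mult sJ)
  have nJ: "norm J \<le> 1/4" using T(3) norm_triangle_ineq4[of T "star T"] by (simp add: J_def)
  have "norm K \<le> 1/4 * (1/4)" unfolding K_def
    by (rule order_trans[OF norm_mult_ineq mult_mono[OF nJ nJ]]) auto
  then have nK: "norm K < 1" by simp
  define D where "D = 1 - K"
  have sD: "star D = D" by (simp add: D_def sK)
  obtain h where h: "gens D h" "h * D = 1" "D * h = 1" "star h = h"
    using neumann_inverse[of D] nK sD by (auto simp: D_def)
  obtain r where r: "gens K r" "(1 - r) * (1 - r) = 1 - K" "star r = r"
    using sqrt_one_minus[of K] nK sK by auto
  define b where "b = 1 - r"
  have bb: "b * b = D" and sb: "star b = b" using r by (simp_all add: b_def D_def)
  have JD: "J * D = D * J" by (simp add: D_def K_def algebra_simps)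
  have SD: "S * D = D * S" by (simp add: D_def algebra_simps SK)
  have bD: "b * D = D * b" by (simp add: bb[symmetric] mult.assoc)
  have Jh: "J * h = h * J" and Sh: "S * h = h * S" and bh: "b * h = h * b"
    using gens_commute[OF h(1)] JD SD bD by blast+
  have "J * r = r * J" "S * r = r * S" using gens_commute[OF r(1), of J] gens_commute[OF r(1), of S] SK
    by (simp_all add: K_def mult.assoc)
  then have Jb: "J * b = b * J" and Sb: "S * b = b * S" by (simp_all add: b_def algebra_simps)
  \<comment> \<open>\<open>b\<close> is the root and \<open>h\<close> the inverse of
    \<open>D = 1 - J * J\<close>, so \<open>b * h\<close> is the inverse root of
    \<open>D\<close>.\<close>
  define u where "u = (1 + J) * b * h"
  have su: "star u = h * b * (1 - J)" by (simp add: u_def star_mult h(4) sb sJ mult.assoc)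
  have JJ: "(1 + J) * (1 - J) = D" "(1 - J) * (1 + J) = D" by (simp_all add: D_def K_def algebra_simps)
  have bhhb: "b * h * (h * b) = h"
  proof -
    have "b * h * (h * b) = h * (b * b) * h" by (metis bh mult.assoc)
    then show ?thesis by (simp add: bb h(2))
  qed
  have chJ: "(1 + J) * h * (1 - J) = 1"
  proof -
    have "h * (1 - J) = (1 - J) * h" by (simp add: algebra_simps Jh)
    then have "(1 + J) * h * (1 - J) = (1 + J) * (1 - J) * h" by (simp add: mult.assoc)
    then show ?thesis by (simp add: JJ h(3))
  qed
  have uu': "u * star u = 1"
  proof -
    have "u * star u = (1 + J) * (b * h * (h * b)) * (1 - J)" unfolding su by (simp add: u_def mult.assoc)
    then show ?thesis by (simp add: bhhb chJ)
  qed
  have uu: "star u * u = 1"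
  proof -
    have "star u * u = h * b * ((1 - J) * (1 + J)) * b * h" unfolding su by (simp add: u_def mult.assoc)
    also have "\<dots> = h * (b * D * b) * h" by (simp add: JJ mult.assoc)
    also have "b * D * b = D * D" by (simp add: bD bb mult.assoc)
    also have "h * (D * D) * h = (h * D) * (D * h)" by (simp add: mult.assoc)
    finally show ?thesis by (simp add: h)
  qed
  \<comment> \<open>\<open>c\<close> is the inverse of \<open>1 - J\<close>, because
    \<open>D\<close> factors as \<open>(1 + J) * (1 - J)\<close>.\<close>
  define c where "c = (1 + J) * h"
  have cJ: "c * (1 - J) = 1" using chJ by (simp add: c_def)
  have w: "u * S * star u * S = 2 *\<^sub>R c - 1"
  proof -
    have "u * S * star u * S = (1 + J) * (b * h * (S * h * b)) * ((1 - J) * S)"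
      unfolding su by (simp add: u_def mult.assoc)
    also have "S * h * b = h * b * S" by (metis Sb Sh mult.assoc)
    also have "b * h * (h * b * S) = h * S" by (metis bhhb mult.assoc)
    also have "(1 + J) * (h * S) * ((1 - J) * S) = (1 + J) * h * (S * (1 - J) * S)" by (simp add: mult.assoc)
    also have "S * (1 - J) * S = 1 + J"
    proof -
      have "S * (1 - J) = (1 + J) * S" by (simp add: algebra_simps SJ)
      then have "S * (1 - J) * S = (1 + J) * (S * S)" by (simp add: mult.assoc)
      then show ?thesis by (simp add: SS)
    qed
    finally have "u * S * star u * S = c * (1 + J)" by (simp add: c_def)
    moreover have "c * (1 + J) + c * (1 - J) = 2 *\<^sub>R c" by (simp add: algebra_simps scaleR_2)
    ultimately show ?thesis unfolding cJ by (simp add: eq_diff_eq)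
  qed
  \<comment> \<open>The bound 1/8 on \<open>T\<close> is spent here: \<open>norm J \<le> 1/4\<close>
    makes \<open>c\<close> so close to 1 that its inverse \<open>1 - J\<close> is a norm limit of
    polynomials in \<open>c\<close>, hence lies in every \<open>N\<close> containing
    \<open>c\<close>.\<close>
  have nc: "norm (1 - c) < 1"
  proof -
    have c1: "c = 1 + c * J" using cJ by (simp add: algebra_simps)
    have "norm (c * J) \<le> norm c * (1/4)" by (rule order_trans[OF norm_mult_ineq mult_left_mono[OF nJ norm_ge_zero]])
    moreover have "norm c \<le> norm (1 :: 'h cop) + norm (c * J)" by (subst c1) (rule norm_triangle_ineq)
    moreover have "norm (1 :: 'h cop) \<le> 1" by (rule norm_one_le)
    ultimately have "norm (c * J) < 1" by linarith
    moreover have "1 - c = - (c * J)" by (subst c1) simp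
    ultimately show ?thesis by simp
  qed
  obtain g where g: "gens c g" "g * c = 1" using neumann_inverse[OF nc] by blast
  have gJ: "g = 1 - J"
  proof -
    have "g * (c * (1 - J)) = 1 - J" by (simp add: mult.assoc[symmetric] g(2))
    then show ?thesis by (simp add: cJ)
  qed
  have JP: "J * P = T" by (simp add: J_def left_diff_distrib T sT)
  note Msa = vna_salg[OF M(1)]
  have JM: "J \<in> M" unfolding J_def using M by (intro salg_closed(2)[OF Msa] vnaD(5)) auto
  have KM: "K \<in> M" unfolding K_def by (intro salgD(3)[OF Msa] JM)
  have DM: "D \<in> M" unfolding D_def by (intro salg_closed(2)[OF Msa] salgD(1)[OF Msa] KM)
  have uM: "u \<in> M" unfolding u_def b_def
    using gensD[OF h(1) Msa DM] gensD[OF r(1) Msa KM] JM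
    by (intro salgD(2,3)[OF Msa] salg_closed(2)[OF Msa] salgD(1)[OF Msa])
  have "T \<in> N" if N: "vna N" "P \<in> N" "star (star u) * P * star u \<in> N" for N
  proof -
    note Nsa = vna_salg[OF N(1)]
    have SN: "S \<in> N" unfolding S_def by (intro salg_closed(2)[OF Nsa] salgD(4)[OF Nsa] salgD(1)[OF Nsa] N(2))
    have "u * S * star u = 2 *\<^sub>R (u * P * star u) - 1"
      by (simp add: S_def algebra_simps uu' scaleR_2)
    then have "u * S * star u \<in> N"
      using N(3) by (simp add: salg_closed(2)[OF Nsa] salgD(4)[OF Nsa] salgD(1)[OF Nsa])
    then have "2 *\<^sub>R c - 1 \<in> N" unfolding w[symmetric] using salgD(3)[OF Nsa _ SN] by blast
    then have "(1/2) *\<^sub>R ((2 *\<^sub>R c - 1) + 1) \<in> N" by (intro salgD(4)[OF Nsa] salgD(2)[OF Nsa] salgD(1)[OF Nsa])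
    then have "c \<in> N" by simp
    then have "g \<in> N" by (rule gensD[OF g(1) Nsa])
    then have "(1 - g) * P \<in> N" by (intro salgD(3)[OF Nsa] salg_closed(2)[OF Nsa] salgD(1)[OF Nsa] N(2))
    then show ?thesis by (simp add: gJ JP)
  qed
  \<comment> \<open>The witness is \<open>star u\<close>, since the claim conjugates
    \<open>P\<close> as \<open>star U * P * U\<close>.\<close>
  then show ?thesis using uM uu uu' by (intro bexI[of _ "star u"]) (auto intro: vnaD(5)[OF M(1)])
qed

section \<open>Generating the factor from one corner, and the corner from projections\<close>

context separable_factor begin

text \<open>\<open>P\<close> and the projections \<open>w n * star (w n)\<close> add up to 1, so
  \<open>x\<close> is the strong limit of its finite block sums. A block is \<open>w i\<close> times
  an element of the corner of \<open>P\<close> times \<open>star (w j)\<close>, and all three lie in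
  \<open>N\<close>.\<close>

lemma generate_from_corner:
  assumes N: "vna N" and P: "pm P" "P \<in> N" and PMP: "\<And>x. x \<in> M \<Longrightarrow> P * x * P \<in> N"
    and w: "\<And>n. w n \<in> M" "\<And>n. w n \<in> N" "\<And>n. w n * P = w n"
    and e: "\<And>n. pm (w n * star (w n))" "\<And>n. ple (w n * star (w n)) (1 - P)"
      "\<And>m n. m \<noteq> n \<Longrightarrow> (w m * star (w m)) * (w n * star (w n)) = 0"
      "\<And>R. pm R \<Longrightarrow> (\<And>n::nat. ple (w n * star (w n)) R) \<Longrightarrow> ple (1 - P) R"
  shows "M \<subseteq> N"
proof
  fix x assume x: "x \<in> M"
  note Nsa = vna_salg[OF N]
  define f where "f = (\<lambda>n. w n * star (w n))"
  note e = e[folded f_def[THEN fun_cong]]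
  obtain R where R: "pm R" "sconv (\<lambda>n. \<Sum>i<n. f i) R" "\<And>n. ple (f n) R" "\<And>p. (\<And>n. ple (f n) p) \<Longrightarrow> ple R p"
    using pm_sum_seq[of f, OF e(1) e(3)] by metis
  have "R = 1 - P"
  proof (rule ple_antisym)
    show "proj R" "proj (1 - P)" using R(1) P(1) proj_complement by (auto simp: pm_def)
    show "ple R (1 - P)" by (rule R(4)[OF e(2)])
    show "ple (1 - P) R" by (rule e(4)[OF R(1,3)])
  qed
  define s where "s = (\<lambda>n. P + (\<Sum>i<n. f i))"
  have s: "sconv s 1"
    using sconv_add[OF sconv_const[of P] R(2)] \<open>R = 1 - P\<close> by (simp add: s_def)
  have ns: "norm (s n * x) \<le> 2 * norm x" for n
  proof -
    have "norm (\<Sum>i<n. f i) \<le> 1" by (rule orth_seq_convergent(2)[OF orth_seq_pm[of f, OF e(1) e(3)]])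
    moreover have "norm P \<le> 1" by (rule norm_cop_bound) (simp_all add: norm_proj_ap pmD(2)[OF P(1)])
    ultimately have "norm (s n) \<le> 2" unfolding s_def by (intro order_trans[OF norm_triangle_ineq]) simp
    then show ?thesis by (intro order_trans[OF norm_mult_ineq] mult_right_mono) auto
  qed
  have "sconv (\<lambda>n. s n * x * s n) (1 * x * 1)"
    by (rule sconv_mult[OF sconv_mult_right[OF s] ns s])
  then have lim: "sconv (\<lambda>n. s n * x * s n) x" by simp
  have "s n * x * s n \<in> N" for n
  proof -
    \<comment> \<open>\<open>P\<close> takes slot 0 and is its own connecting operator, so that all
      blocks are treated alike.\<close>
    define W where "W = (\<lambda>i. case i of 0 \<Rightarrow> P | Suc j \<Rightarrow> w j)"
    have W: "W i \<in> M" "W i \<in> N" "W i * P = W i" for i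
      using w P by (auto simp: W_def pmD split: nat.split)
    have sW: "s n = (\<Sum>i<Suc n. W i * star (W i))"
      by (subst sum.lessThan_Suc_shift) (simp add: s_def f_def W_def pmD[OF P(1)])
    have "W i * star (W i) * x * (W j * star (W j)) \<in> N" for i j
    proof -
      have "star (W i) = P * star (W i)" using W(3)[of i] pmD(3)[OF P(1)] by (metis star_mult)
      then have "star (W i) * x * W j = P * (star (W i) * x * W j) * P"
        using W(3)[of j] by (metis mult.assoc)
      moreover have "P * (star (W i) * x * W j) * P \<in> N" using W x by (intro PMP) (simp add: M_closed)
      ultimately have "star (W i) * x * W j \<in> N" by simp
      then have "W i * (star (W i) * x * W j) * star (W j) \<in> N"
        by (rule salgD(3)[OF Nsa salgD(3)[OF Nsa W(2)] vnaD(5)[OF N W(2)]])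
      then show ?thesis by (simp add: mult.assoc)
    qed
    then show ?thesis unfolding sW sum_distrib_left sum_distrib_right by (intro salg_sum[OF Nsa])
  qed
  then show "x \<in> N" using salgD(5)[OF Nsa _ lim] by blast
qed

text \<open>For a positive contraction \<open>a\<close> the dyadic projections of
  \<open>P * a * P\<close> commute with \<open>P\<close>, so their products with \<open>P\<close>
  are projections below \<open>P\<close> with the same weighted sum.\<close>

lemma element_generated_by_projections:
  assumes P: "pm P" and x: "x \<in> M"
  shows "\<exists>D. countable D \<and> (\<forall>d\<in>D. pm d \<and> ple d P) \<and>
    (\<forall>N. vna N \<longrightarrow> P \<in> N \<longrightarrow> D \<subseteq> N \<longrightarrow> P * x * P \<in> N)"
  using vna x
proof (induct rule: contraction_induct)
  case (contraction a)
  define c where "c = P * a * P"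
  have PP: "P * P = P" "star P = P" using P by (simp_all add: pmD)
  have cM: "c \<in> M" using contraction(1) P by (simp add: c_def M_closed pmD)
  have cP: "P * c = c" "c * P = c" by (simp_all add: c_def mult.assoc PP) (simp add: mult.assoc[symmetric] PP)
  have q: "cinner (c \<cdot> v) v = cinner (a \<cdot> P \<cdot> v) (P \<cdot> v)" for v
    unfolding c_def by (rule proj_compress[OF pmD(2)[OF P]])
  have "star c = c" by (simp add: c_def star_mult PP contraction(2) mult.assoc)
  moreover have "0 \<le> Re (cinner (c \<cdot> v) v)" "Re (cinner (c \<cdot> v) v) \<le> (norm v)\<^sup>2" for v
  proof -
    show "0 \<le> Re (cinner (c \<cdot> v) v)" unfolding q by (rule contraction(3))
    have "Re (cinner (c \<cdot> v) v) \<le> (norm (P \<cdot> v))\<^sup>2" unfolding q by (rule contraction(4))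
    also have "\<dots> \<le> (norm v)\<^sup>2" by (intro power_mono norm_proj_ap pmD(2)[OF P]) simp
    finally show "Re (cinner (c \<cdot> v) v) \<le> (norm v)\<^sup>2" .
  qed
  ultimately obtain E where E: "\<And>j::nat. gens c (E j)" "\<And>j. proj (E j)" "(\<lambda>n. \<Sum>j<n. (1/2) ^ Suc j *\<^sub>R E j) \<longlonglongrightarrow> c"
    using dyadic_limit[of c] by blast
  have EP: "P * E j = E j * P" for j using gens_commute[OF E(1), of P] cP by simp
  have EM: "E j \<in> M" for j using gensD[OF E(1) M_salg cM] .
  have d: "pm (E j * P) \<and> ple (E j * P) P" for j
    using E(2)[of j] EM[of j] P EP[of j] unfolding pm_def proj_def ple_def
    by (simp add: M_closed star_mult) (metis mult.assoc)
  have "P * a * P \<in> N" if N: "vna N" "P \<in> N" "range (\<lambda>j. E j * P) \<subseteq> N" for N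
  proof -
    note Nsa = vna_salg[OF N(1)]
    have "(\<lambda>n. (\<Sum>j<n. (1/2) ^ Suc j *\<^sub>R E j) * P) \<longlonglongrightarrow> c * P" by (intro tendsto_mult E(3) tendsto_const)
    moreover have "(\<Sum>j<n. (1/2) ^ Suc j *\<^sub>R E j) * P \<in> N" for n
    proof -
      have "(\<Sum>j<n. (1/2) ^ Suc j *\<^sub>R (E j * P)) \<in> N"
        using N(3) by (intro salg_sum[OF Nsa] salgD(4)[OF Nsa]) auto
      then show ?thesis by (simp add: sum_distrib_right)
    qed
    ultimately have "c * P \<in> N" by (rule salg_limit[OF Nsa, rotated])
    then show ?thesis by (simp add: cP(2)) (simp add: c_def)
  qed
  then show ?case using d by (intro exI[of _ "range (\<lambda>j. E j * P)"]) auto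
next
  case (add a b)
  then obtain D D' where "countable D" "\<forall>d\<in>D. pm d \<and> ple d P" "\<forall>N. vna N \<longrightarrow> P \<in> N \<longrightarrow> D \<subseteq> N \<longrightarrow> P * a * P \<in> N"
    "countable D'" "\<forall>d\<in>D'. pm d \<and> ple d P" "\<forall>N. vna N \<longrightarrow> P \<in> N \<longrightarrow> D' \<subseteq> N \<longrightarrow> P * b * P \<in> N" by blast
  then show ?case by (intro exI[of _ "D \<union> D'"]) (auto simp: distrib_left distrib_right intro: vnaD(2))
next
  case (scale c a)
  then obtain D where D: "countable D" "\<forall>d\<in>D. pm d \<and> ple d P" "\<forall>N. vna N \<longrightarrow> P \<in> N \<longrightarrow> D \<subseteq> N \<longrightarrow> P * a * P \<in> N" by blast
  have "P * (sc c * a) * P = sc c * (P * a * P)" by (metis mult.assoc sc_commute)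
  then show ?case using D by (intro exI[of _ D]) (auto intro: vnaD(4))
qed

text \<open>Projections for the elements of a weakly dense countable set suffice: if some
  \<open>P * y * P\<close> lay outside \<open>N\<close>, a finite sum of vector functionals
  vanishing on \<open>N\<close> would separate it, against density.\<close>

lemma corner_generated_by_projections:
  assumes P: "pm P"
  obtains D where "countable D" "\<And>d. d \<in> D \<Longrightarrow> pm d \<and> ple d P"
    "\<And>N x. vna N \<Longrightarrow> P \<in> N \<Longrightarrow> D \<subseteq> N \<Longrightarrow> x \<in> M \<Longrightarrow> P * x * P \<in> N"
proof -
  obtain S where S: "countable S" "S \<subseteq> M" and dense: "\<And>x n xs us \<epsilon>. x \<in> M \<Longrightarrow> norm x \<le> 1 \<Longrightarrow> \<epsilon> > 0 \<Longrightarrow>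
      \<exists>s\<in>S. cmod ((\<Sum>i<(n::nat). cinner (s \<cdot> xs i) (us i)) - (\<Sum>i<n. cinner (x \<cdot> xs i) (us i))) < \<epsilon>"
    using countably_dense by metis
  have "\<forall>s\<in>S. \<exists>D. countable D \<and> (\<forall>d\<in>D. pm d \<and> ple d P) \<and>
    (\<forall>N. vna N \<longrightarrow> P \<in> N \<longrightarrow> D \<subseteq> N \<longrightarrow> P * s * P \<in> N)"
    using element_generated_by_projections[OF P] S(2) by blast
  then obtain D where D: "\<And>s. s \<in> S \<Longrightarrow> countable (D s)" "\<And>s d. s \<in> S \<Longrightarrow> d \<in> D s \<Longrightarrow> pm d \<and> ple d P"
    "\<And>s N. s \<in> S \<Longrightarrow> vna N \<Longrightarrow> P \<in> N \<Longrightarrow> D s \<subseteq> N \<Longrightarrow> P * s * P \<in> N" by metis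
  have sP: "star P = P" using P by (simp add: pmD)
  show ?thesis
  proof (rule that[of "\<Union>s\<in>S. D s"])
    show "countable (\<Union>s\<in>S. D s)" using S(1) D(1) by blast
    show "pm d \<and> ple d P" if "d \<in> (\<Union>s\<in>S. D s)" for d using D(2) that by blast
    fix N x assume N: "vna N" "P \<in> N" "(\<Union>s\<in>S. D s) \<subseteq> N" and x: "x \<in> M"
    have unit: "P * y * P \<in> N" if y: "y \<in> M" "norm y \<le> 1" for y
    proof (rule ccontr)
      assume "P * y * P \<notin> N"
      obtain n xs us where 0: "\<And>z. z \<in> N \<Longrightarrow> (\<Sum>i<n. cinner (z \<cdot> xs i) (us i)) = 0"
        and ne: "(\<Sum>i<(n::nat). cinner ((P * y * P) \<cdot> xs i) (us i)) \<noteq> 0"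
        using vna_separation[OF N(1) \<open>P * y * P \<notin> N\<close>] by (elim exE conjE) blast
      have pc: "cinner ((P * z * P) \<cdot> v) u = cinner (z \<cdot> (P \<cdot> v)) (P \<cdot> u)" for z u v
        by (simp add: cinner_star[of P] sP)
      \<comment> \<open>The tolerance is the value that separates: the approximating
        \<open>P * s * P\<close> lies in \<open>N\<close>, has value 0, and so misses by exactly
        this amount.\<close>
      define \<epsilon> where "\<epsilon> = cmod (\<Sum>i<n. cinner ((P * y * P) \<cdot> xs i) (us i))"
      have "\<epsilon> > 0" using ne by (simp add: \<epsilon>_def)
      obtain s where s: "s \<in> S" "cmod ((\<Sum>i<n. cinner (s \<cdot> (P \<cdot> xs i)) (P \<cdot> us i)) - (\<Sum>i<n. cinner (y \<cdot> (P \<cdot> xs i)) (P \<cdot> us i))) < \<epsilon>"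
        using dense[OF y \<open>\<epsilon> > 0\<close>, of "\<lambda>i. P \<cdot> xs i" "\<lambda>i. P \<cdot> us i" n] by blast
      have "P * s * P \<in> N" using D(3)[OF s(1) N(1,2)] N(3) s(1) by blast
      then have "(\<Sum>i<n. cinner (s \<cdot> (P \<cdot> xs i)) (P \<cdot> us i)) = 0" using 0 unfolding pc[symmetric] by blast
      then show False using s(2) unfolding pc[symmetric] \<epsilon>_def by simp
    qed
    define z where "z = (1 / (norm x + 1)) *\<^sub>R x"
    have n1: "norm x + 1 > 0" by (simp add: add_nonneg_pos)
    have "P * z * P \<in> N" using n1 x by (intro unit) (simp_all add: z_def M_closed divide_le_eq)
    then have "(norm x + 1) *\<^sub>R (P * z * P) \<in> N" by (rule salgD(4)[OF vna_salg[OF N(1)]])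
    moreover have "(norm x + 1) *\<^sub>R (P * z * P) = P * x * P" using n1 by (simp add: z_def)
    ultimately show "P * x * P \<in> N" by simp
  qed
qed

lemma fin_0: "fin 0"
  unfolding fin_def by (simp add: ple_def)

text \<open>Every projection is a strong sum of finite ones, because a nonzero remainder would share
  an equivalent part with the finite projection \<open>g\<close>.\<close>

lemma corner_generated_by_finite_projections:
  assumes P: "pm P" and g: "fin g" "g \<noteq> 0"
  obtains D where "countable D" "\<And>d. d \<in> D \<Longrightarrow> fin d \<and> ple d P"
    "\<And>N x. vna N \<Longrightarrow> P \<in> N \<Longrightarrow> D \<subseteq> N \<Longrightarrow> x \<in> M \<Longrightarrow> P * x * P \<in> N"
proof -
  obtain D where D: "countable D" "\<And>d. d \<in> D \<Longrightarrow> pm d \<and> ple d P"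
    "\<And>N x. vna N \<Longrightarrow> P \<in> N \<Longrightarrow> D \<subseteq> N \<Longrightarrow> x \<in> M \<Longrightarrow> P * x * P \<in> N"
    using corner_generated_by_projections[OF P] by blast
  have "\<exists>f. (\<forall>n::nat. fin (f n) \<and> ple (f n) d) \<and> sconv (\<lambda>n. \<Sum>i<n. f i) d" if d: "pm d" for d
  proof -
    define W where "W = {f. fin f \<and> f \<noteq> 0}"
    have W: "pm f \<and> f \<noteq> 0" if "f \<in> W" for f using that by (simp add: W_def fin_pm)
    obtain f F where ms: "max_proj_sum W d f F" using exhaustion_proj[OF W d] by blast
    note f = max_proj_sumD[OF ms]
    have "d - F = 0"
    proof (rule ccontr)
      assume ne: "d - F \<noteq> 0"
      obtain v where v: "v \<in> M" "pis v" "v \<noteq> 0" "ple (star v * v) (d - F)" "ple (v * star v) g"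
        using comparison_nonzero[OF pm_diff[OF f(4) d f(5)] ne fin_pm[OF g(1)] g(2)] by blast
      have "mle (star v * v) g" unfolding mle_def using v by blast
      then have "fin (star v * v)" using fin_mle[OF g(1)] pis_pm[OF v(1,2)] by blast
      then show False using f(8)[of "star v * v"] v by (simp add: W_def star_self_eq_0)
    qed
    moreover have "fin (f n)" for n using f(1)[of n] fin_0 by (auto simp: W_def)
    ultimately show ?thesis using f(6,7) by (intro exI[of _ f]) auto
  qed
  then obtain f where f: "\<And>d n. pm d \<Longrightarrow> fin (f d n) \<and> ple (f d n) d" "\<And>d. pm d \<Longrightarrow> sconv (\<lambda>n. \<Sum>i<n. f d i) d"
    by metis
  show ?thesis
  proof (rule that[of "\<Union>d\<in>D. range (f d)"])
    show "countable (\<Union>d\<in>D. range (f d))" using D(1) by blast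
    show "fin e \<and> ple e P" if "e \<in> (\<Union>d\<in>D. range (f d))" for e
      using that f(1) D(2) ple_trans by blast
    fix N x assume N: "vna N" "P \<in> N" "(\<Union>d\<in>D. range (f d)) \<subseteq> N" and x: "x \<in> M"
    have "D \<subseteq> N"
    proof
      fix d assume d: "d \<in> D"
      show "d \<in> N"
        by (rule salgD(5)[OF vna_salg[OF N(1)] _ f(2)], rule salg_sum[OF vna_salg[OF N(1)]])
          (use N(3) d D(2) in auto)
    qed
    then show "P * x * P \<in> N" using D(3) N x by blast
  qed
qed

end

section \<open>Storing a sequence of operators in one conjugate of \<open>P\<close>\<close>

context factor_with_masa begin

text \<open>All \<open>t i\<close> are superposed with geometric weights into one operator
  \<open>T\<close>; their ranges lie in orthogonal \<open>e i\<close>, which are available as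
  elements of \<open>A (1 - P)\<close>, so multiplication by \<open>e i\<close> reads off
  \<open>t i\<close> again.\<close>

lemma assemble:
  assumes P: "pa P" and t: "\<And>i::nat. t i \<in> M" "\<And>i. norm (t i) \<le> 1" "\<And>i. t i * P = t i" "\<And>i. e i * t i = t i"
    and e: "\<And>i. pa (e i)" "\<And>i. ple (e i) (1 - P)" "\<And>i j. i \<noteq> j \<Longrightarrow> e i * e j = 0"
  obtains U where "U \<in> M" "star U * U = 1" "U * star U = 1"
    "\<And>N. vna N \<Longrightarrow> star U * P * U \<in> N \<Longrightarrow> (\<And>a. a \<in> A \<Longrightarrow> a * (1 - P) \<in> N) \<Longrightarrow>
      P \<in> N \<and> (\<forall>i. e i \<in> N \<and> t i \<in> N)"
proof -
  have PP: "P * P = P" using P by (simp add: paD)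
  define s where "s = (\<lambda>i. (1/2::real) ^ i *\<^sub>R t i)"
  have ns: "norm (s i) \<le> (1/2) ^ i" for i using t(2)[of i] by (simp add: s_def mult_left_le)
  have sg: "summable (\<lambda>i. (1/2::real) ^ i)" by (rule summable_geometric) simp
  have sn: "summable (\<lambda>i. norm (s i))" by (rule summable_comparison_test'[OF sg, of 0]) (simp add: ns)
  have sm: "summable s" by (rule summable_norm_cancel[OF sn])
  \<comment> \<open>The series has norm at most 2, and \<open>unitary_graph\<close> requires
    1/8.\<close>
  define T where "T = (1/16) *\<^sub>R (\<Sum>i. s i)"
  have "norm (\<Sum>i. s i) \<le> (\<Sum>i. norm (s i))" by (rule summable_norm[OF sn])
  also have "\<dots> \<le> (\<Sum>i. (1/2::real) ^ i)" by (rule suminf_le[OF ns sn sg])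
  also have "\<dots> = 2" by (subst suminf_geometric) auto
  finally have nT: "norm T \<le> 1/8" by (simp add: T_def)
  have sM: "s i \<in> M" for i using t(1) by (simp add: s_def M_closed)
  have "(\<Sum>i<n. s i) \<in> M" for n by (rule salg_sum[OF M_salg sM])
  then have "(\<Sum>i. s i) \<in> M" using salg_limit[OF M_salg _ summable_LIMSEQ[OF sm]] by blast
  then have TM: "T \<in> M" by (simp add: T_def M_closed)
  have "P * e i = 0" for i
  proof -
    have "(1 - P) * e i = e i" using e(2)[of i] by (simp add: ple_def)
    then have "P * ((1 - P) * e i) = P * e i" by simp
    then show ?thesis by (simp add: mult.assoc[symmetric] right_diff_distrib PP)
  qed
  then have "P * t i = 0" for i using t(4)[of i] by (metis mult.assoc mult_zero_left)
  then have "P * s i = 0" for i by (simp add: s_def)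
  then have PT: "P * T = 0" using suminf_mult[OF sm, of P] by (simp add: T_def)
  have "s i * P = s i" for i by (simp add: s_def t(3))
  then have TP: "T * P = T" using suminf_mult2[OF sm, of P] by (simp add: T_def)
  have eT: "e i * T = ((1/16) * (1/2) ^ i) *\<^sub>R t i" for i
  proof -
    have "e i * s j = (if j = i then s i else 0)" for j
    proof (cases "j = i")
      case False
      have "e i * s j = (1/2) ^ j *\<^sub>R (e i * e j * t j)" by (simp add: s_def mult.assoc t(4))
      then show ?thesis using e(3)[of i j] False by simp
    qed (simp add: s_def t(4))
    then have "(\<Sum>j. e i * s j) = s i" using suminf_finite[of "{i}" "\<lambda>j. e i * s j"] by simp
    then have "e i * (\<Sum>j. s j) = s i" using suminf_mult[OF sm, of "e i"] by simp
    then show ?thesis by (simp add: T_def s_def)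
  qed
  obtain U where U: "U \<in> M" "star U * U = 1" "U * star U = 1"
    "\<And>N. vna N \<Longrightarrow> P \<in> N \<Longrightarrow> star U * P * U \<in> N \<Longrightarrow> T \<in> N"
    using unitary_graph[OF paD(2)[OF P] PT TP nT vna pmD(1)[OF pa_pm[OF P]] TM] by blast
  show ?thesis
  proof (rule that[OF U(1-3)])
    fix N assume N: "vna N" "star U * P * U \<in> N" "\<And>a. a \<in> A \<Longrightarrow> a * (1 - P) \<in> N"
    note Nsa = vna_salg[OF N(1)]
    have "1 - P \<in> N" using N(3)[of 1] A_closed(1) by simp
    then have "1 - (1 - P) \<in> N" using salg_closed(2)[OF Nsa salgD(1)[OF Nsa]] by blast
    then have PN: "P \<in> N" by simp
    have TN: "T \<in> N" by (rule U(4)[OF N(1) PN N(2)])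
    have eN: "e i \<in> N" for i
    proof -
      have "proj (1 - P)" by (rule proj_complement[OF paD(2)[OF P]])
      then have "e i * (1 - P) = e i" using ple_right[OF paD(2)[OF e(1)] _ e(2)] by blast
      then show ?thesis using N(3)[OF paD(1)[OF e(1)], of i] by simp
    qed
    have "t i \<in> N" for i
    proof -
      have "(16 * 2 ^ i) *\<^sub>R (e i * T) \<in> N" by (intro salgD(4)[OF Nsa] salgD(3)[OF Nsa] eN TN)
      then show ?thesis by (simp add: eT power_one_over)
    qed
    then show "P \<in> N \<and> (\<forall>i. e i \<in> N \<and> t i \<in> N)" using PN eN by blast
  qed
qed

end

lemma norm_pis: assumes "pis v" shows "norm v \<le> 1"
proof (rule norm_cop_bound)
  fix x
  have e: "proj (star v * v)" using assms by (simp add: pis_def)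
  have "(norm (v \<cdot> x))\<^sup>2 = (norm ((star v * v) \<cdot> x))\<^sup>2"
    unfolding norm_ap_square[of v] by (rule proj_cinner[OF e])
  then have "norm (v \<cdot> x) = norm ((star v * v) \<cdot> x)" by simp
  then show "norm (v \<cdot> x) \<le> 1 * norm x" using norm_proj_ap[OF e, of x] by simp
qed simp

context factor_with_masa begin

text \<open>\<open>N\<close> ranges over all von Neumann algebras, not only over subalgebras of
  \<open>M\<close>; \<open>W_star_eqI\<close> turns this into a statement about
  \<open>W_star\<close>.\<close>

definition conjugate_generates :: "'h cop \<Rightarrow> bool" where
  "conjugate_generates P \<longleftrightarrow> (\<exists>U\<in>M. star U * U = 1 \<and> U * star U = 1 \<and>
     (\<forall>N. vna N \<longrightarrow> star U * P * U \<in> N \<longrightarrow> (\<forall>a\<in>A. a * (1 - P) \<in> N) \<longrightarrow> M \<subseteq> N))"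

text \<open>The partial isometries \<open>v k\<close> carry the generating projections \<open>f k\<close> below \<open>P\<close> onto pieces of the
  masa; the remainder of \<open>1 - P\<close> is connected to \<open>P\<close> through \<open>pieces\<close>.\<close>

lemma construct_from_projections:
  assumes sm: small_pieces and P: "pa P" "P \<noteq> 0"
    and f: "\<And>k::nat. pm (f k)" "\<And>k. ple (f k) P"
    and gen: "\<And>N x. vna N \<Longrightarrow> P \<in> N \<Longrightarrow> (\<And>k. f k \<in> N) \<Longrightarrow> x \<in> M \<Longrightarrow> P * x * P \<in> N"
    and e: "\<And>k. pa (e k)" "\<And>k. ple (e k) (1 - P)" "\<And>m n. m \<noteq> n \<Longrightarrow> e m * e n = 0" "\<And>k. meq (f k) (e k)"
  shows "conjugate_generates P"
proof -
  have pP: "pm P" by (rule pa_pm[OF P(1)])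
  have p1: "pa (1 - P)" using pa_diff[OF P(1) pa_1] by simp
  obtain F where F: "pm F" "sconv (\<lambda>n. \<Sum>i<n. e i) F" "\<And>n. ple (e n) F" "\<And>q. (\<And>n. ple (e n) q) \<Longrightarrow> ple F q"
    using pm_sum_seq[of e, OF pa_pm[OF e(1)] e(3)] by metis
  have "(\<Sum>i<n. e i) \<in> A" for n using e(1) by (intro salg_sum[OF A_salg]) (simp add: paD)
  then have "F \<in> A" using salgD(5)[OF A_salg _ F(2)] by blast
  then have F': "pa F" "ple F (1 - P)" using F(1) F(4)[OF e(2)] by (auto simp: pa_def pm_def)
  define E where "E = 1 - P - F"
  have E: "pa E" "ple E (1 - P)" unfolding E_def
    using pa_diff[OF F'(1) p1 F'(2)] ple_diff[OF _ _ F'(2)] F'(1) p1 by (auto simp: pa_def)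
  obtain w where w: "\<And>n. w n \<in> M \<and> pis (w n)" "\<And>n. pa (w n * star (w n))" "\<And>n. ple (star (w n) * w n) P"
    "\<And>m n. m \<noteq> n \<Longrightarrow> (w m * star (w m)) * (w n * star (w n)) = 0" "\<And>n. ple (w n * star (w n)) E"
    "\<And>R. pm R \<Longrightarrow> (\<And>n::nat. ple (w n * star (w n)) R) \<Longrightarrow> ple E R"
    using pieces[OF sm E(1) pP P(2)] by metis
  have "\<exists>v\<in>M. star v * v = f k \<and> v * star v = e k" for k using e(4)[of k] unfolding meq_def .
  then obtain v where v: "\<And>k. v k \<in> M" "\<And>k. star (v k) * v k = f k" "\<And>k. v k * star (v k) = e k" by metis
  have pv: "pis (v k)" for k using pis_of_initial[OF f(1) v(2)] .
  have eE: "e k * E = 0" for k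
  proof -
    have "e k * (1 - P) = e k" using ple_right[OF paD(2)[OF e(1)] paD(2)[OF p1] e(2)] .
    moreover have "e k * F = e k" using ple_right[OF paD(2)[OF e(1)] pmD(2)[OF F(1)] F(3)] .
    ultimately show ?thesis unfolding E_def by (simp add: right_diff_distrib)
  qed
  have ew: "e k * (w n * star (w n)) = 0" for k n
  proof -
    have "e k * (E * (w n * star (w n))) = 0" by (simp add: mult.assoc[symmetric] eE)
    then show ?thesis using w(5)[of n] by (simp add: ple_def)
  qed
  have we: "w n * star (w n) * e k = 0" for k n
    using orth_sym[OF paD(2)[OF e(1)] paD(2)[OF w(2)] ew] .
  \<comment> \<open>Even places carry the copies of the generating projections, odd places the
    pieces of the remainder of \<open>1 - P\<close>.\<close>
  define t where "t = (\<lambda>i. if even i then v (i div 2) else w (i div 2))"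
  define g where "g = (\<lambda>i. t i * star (t i))"
  have g: "g i = (if even i then e (i div 2) else w (i div 2) * star (w (i div 2)))" for i
    by (simp add: g_def t_def v(3))
  have t: "t i \<in> M" "pis (t i)" "ple (star (t i) * t i) P" for i
    using v w pv f by (auto simp: t_def)
  have gp: "pa (g i)" for i using e(1) w(2) by (simp add: g)
  have g1: "ple (g i) (1 - P)" for i using e(2) ple_trans[OF w(5) E(2)] by (simp add: g)
  have go: "g i * g j = 0" if "i \<noteq> j" for i j
  proof -
    have "i div 2 \<noteq> j div 2" if "even i = even j" using that \<open>i \<noteq> j\<close> by (metis div_mult_mod_eq parity_cases)
    then show ?thesis using e(3) w(4) ew we by (auto simp: g)
  qed
  have tP: "t i * P = t i" for i using pis_right[OF t(2) _ t(3)] pP by (simp add: pm_def)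
  have gt: "g i * t i = t i" for i using pisD(1)[OF t(2)[of i]] by (simp add: g_def mult.assoc)
  obtain U where U: "U \<in> M" "star U * U = 1" "U * star U = 1"
    "\<And>N. vna N \<Longrightarrow> star U * P * U \<in> N \<Longrightarrow> (\<And>a. a \<in> A \<Longrightarrow> a * (1 - P) \<in> N) \<Longrightarrow>
      P \<in> N \<and> (\<forall>i. g i \<in> N \<and> t i \<in> N)"
    using assemble[of P t g, OF P(1) t(1) norm_pis[OF t(2)] tP gt gp g1 go] by blast
  have "M \<subseteq> N" if N: "vna N" "star U * P * U \<in> N" "\<And>a. a \<in> A \<Longrightarrow> a * (1 - P) \<in> N" for N
  proof -
    have PN: "P \<in> N" and tN: "\<And>i. t i \<in> N" using U(4)[OF N] by blast+
    have fN: "f k \<in> N" for k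
    proof -
      have "star (t (2 * k)) * t (2 * k) \<in> N" by (intro vnaD(3)[OF N(1)] vnaD(5)[OF N(1)] tN)
      then show ?thesis by (simp add: t_def v(2))
    qed
    show ?thesis
    proof (rule generate_from_corner[OF N(1) pP PN gen[OF N(1) PN fN] t(1) tN tP])
      show "pm (t i * star (t i))" "ple (t i * star (t i)) (1 - P)" for i
        using pa_pm[OF gp[of i]] g1[of i] by (simp_all add: g_def)
      show "t i * star (t i) * (t j * star (t j)) = 0" if "i \<noteq> j" for i j using go[OF that] by (simp add: g_def)
      fix R assume R: "pm R" "\<And>n. ple (t n * star (t n)) R"
      have "ple (e k) R" for k using R(2)[of "2 * k"] by (simp add: t_def v(3))
      then have "ple F R" by (rule F(4))
      moreover have "ple (w k * star (w k)) R" for k using R(2)[of "2 * k + 1"] by (simp add: t_def)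
      then have "ple E R" by (rule w(6)[OF R(1)])
      ultimately have "ple (F + E) R" by (rule ple_add)
      then show "ple (1 - P) R" by (simp add: E_def)
    qed
  qed
  then show ?thesis unfolding conjugate_generates_def using U(1-3) by blast
qed

text \<open>Atoms are finite, so the masa has none and \<open>1 - P\<close> contains an infinite
  orthogonal sequence of its projections; any two nonzero projections are equivalent.\<close>

lemma construct_III:
  assumes III: "\<And>p. fin p \<Longrightarrow> p = 0" and P: "pa P" "P \<noteq> 0" "mle P (1 - P)"
  shows "conjugate_generates P"
proof -
  have pP: "pm P" by (rule pa_pm[OF P(1)])
  have p1: "pa (1 - P)" using pa_diff[OF P(1) pa_1] by simp
  have n1: "1 - P \<noteq> 0"
  proof
    assume 0: "1 - P = 0"
    obtain v where "star v * v = P" "ple (v * star v) 0" using P(3) unfolding mle_def 0 by blast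
    then have "v * star v = 0" by (simp add: ple_def)
    then have "v = 0" by (metis star_self_eq_0 star_star star_eq_0)
    then show False using P(2) \<open>star v * v = P\<close> by simp
  qed
  have no: "False" if "atom e" for e using III[OF atom_fin[OF that]] that by (simp add: atom_def)
  obtain e :: "nat \<Rightarrow> 'h cop" where e: "\<And>n. pa (e n)" "\<And>n. e n \<noteq> 0" "\<And>n. ple (e n) (1 - P)" "\<And>m n. m \<noteq> n \<Longrightarrow> e m * e n = 0"
    using diffuse_orth_seq[OF p1 n1] no by metis
  obtain D where D: "countable D" "\<And>d. d \<in> D \<Longrightarrow> pm d \<and> ple d P"
    "\<And>N x. vna N \<Longrightarrow> P \<in> N \<Longrightarrow> D \<subseteq> N \<Longrightarrow> x \<in> M \<Longrightarrow> P * x * P \<in> N"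
    using corner_generated_by_projections[OF pP] by blast
  \<comment> \<open>Zero is dropped because each \<open>f k\<close> has to be equivalent to the
    nonzero \<open>e k\<close>; \<open>P\<close> keeps the set nonempty.\<close>
  define D' where "D' = insert P (D - {0})"
  define f where "f = from_nat_into D'"
  have rf: "range f = D'" unfolding f_def by (rule range_from_nat_into) (use D(1) in \<open>auto simp: D'_def\<close>)
  have fD: "f k \<in> D'" for k using rf by blast
  have f: "pm (f k)" "ple (f k) P" "f k \<noteq> 0" for k
    using fD[of k] D(2) pP P(2) ple_refl[of P] by (auto simp: D'_def pm_def)
  show ?thesis
  proof (rule construct_from_projections[OF small_pieces_III[OF III] P(1,2) f(1,2) _ e(1,3,4)])
    fix N x assume N: "vna N" "P \<in> N" "\<And>k. f k \<in> N" and x: "x \<in> M"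
    have "D \<subseteq> insert 0 D'" by (auto simp: D'_def)
    moreover have "D' \<subseteq> N" using N(3) rf by blast
    moreover have "0 \<in> N" using salg_closed(3)[OF vna_salg[OF N(1)]] .
    ultimately show "P * x * P \<in> N" using D(3)[OF N(1,2) _ x] by blast
  next
    show "meq (f k) (e k)" for k by (rule type_III_meq[OF III f(1,3) pa_pm[OF e(1)] e(2)])
  qed
qed

text \<open>\<open>1 - P\<close> is infinite, since otherwise \<open>P\<close> and with it 1 would
  be finite by \<open>fin_add\<close>. An infinite projection of the masa has room for a copy of any
  finite one, and \<open>fin_add\<close> again keeps the rest infinite.\<close>

lemma construct_semifinite:
  assumes sm: small_pieces and g: "fin g" "g \<noteq> 0" and inf: "\<not> fin 1" and P: "pa P" "P \<noteq> 0" "mle P (1 - P)"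
  shows "conjugate_generates P"
proof -
  have pP: "pm P" by (rule pa_pm[OF P(1)])
  have p1: "pa (1 - P)" using pa_diff[OF P(1) pa_1] by simp
  have inf1: "\<not> fin (1 - P)"
  proof
    assume f: "fin (1 - P)"
    have "fin P" by (rule fin_mle[OF f pP P(3)])
    then have "fin (P + (1 - P))" by (rule fin_add[OF _ f]) (simp add: right_diff_distrib pmD[OF pP])
    then show False using inf by simp
  qed
  obtain D where D: "countable D" "\<And>d. d \<in> D \<Longrightarrow> fin d \<and> ple d P"
    "\<And>N x. vna N \<Longrightarrow> P \<in> N \<Longrightarrow> D \<subseteq> N \<Longrightarrow> x \<in> M \<Longrightarrow> P * x * P \<in> N"
    using corner_generated_by_finite_projections[OF pP g] by blast
  \<comment> \<open>The inserted 0 makes the enumeration meaningful when \<open>D\<close> is empty,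
    and it is matched with a zero copy.\<close>
  define f where "f = from_nat_into (insert 0 D)"
  have rf: "range f = insert 0 D" unfolding f_def by (rule range_from_nat_into) (use D(1) in auto)
  have fD: "f k \<in> insert 0 D" for k using rf by blast
  have f: "fin (f k)" "ple (f k) P" for k using fD[of k] D(2) fin_0 by auto
  define ok where "ok = (\<lambda>R. pa R \<and> ple R (1 - P) \<and> \<not> fin R)"
  have "\<exists>e. pa e \<and> ple e R \<and> meq (f k) e" if "ok R" for k R
  proof -
    have R: "pa R" "\<not> fin R" using that by (auto simp: ok_def)
    have "\<not> mle R (f k)" using fin_mle[OF f(1) pa_pm[OF R(1)]] R(2) by blast
    then have "mle (f k) R" using comparison[OF fin_pm[OF f(1)] pa_pm[OF R(1)]] by blast
    then show ?thesis using fit[OF sm R(1) f(1)] by metis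
  qed
  then have "\<forall>k R. \<exists>e. ok R \<longrightarrow> pa e \<and> ple e R \<and> meq (f k) e" by blast
  then obtain c where "\<forall>k R. ok R \<longrightarrow> pa (c k R) \<and> ple (c k R) R \<and> meq (f k) (c k R)"
    unfolding choice_iff by blast
  then have c: "\<And>k R. ok R \<Longrightarrow> pa (c k R) \<and> ple (c k R) R \<and> meq (f k) (c k R)" by blast
  \<comment> \<open>\<open>R k\<close> is what is left of \<open>1 - P\<close> after the copies of
    \<open>f 0\<close>, ..., \<open>f (k - 1)\<close> have been removed.\<close>
  define R where "R = rec_nat (1 - P) (\<lambda>k R. R - c k R)"
  have R0: "R 0 = 1 - P" and RS: "\<And>k. R (Suc k) = R k - c k (R k)" by (simp_all add: R_def)
  define e where "e = (\<lambda>k. c k (R k))"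
  have okR: "ok (R k)" for k
  proof (induct k)
    case 0 then show ?case using p1 inf1 ple_refl[of "1 - P"] by (simp add: ok_def R0 pa_def)
  next
    case (Suc k)
    have k: "pa (R k)" "ple (R k) (1 - P)" "\<not> fin (R k)" using Suc by (auto simp: ok_def)
    have ck: "pa (e k)" "ple (e k) (R k)" "meq (f k) (e k)" using c[OF Suc, of k] by (auto simp: e_def)
    have "fin (e k)" using fin_meq[OF f(1) ck(3)] .
    have le: "ple (R k - e k) (R k)" using ple_diff[OF _ _ ck(2)] ck(1) k(1) by (simp add: pa_def)
    have "\<not> fin (R k - e k)"
    proof
      assume "fin (R k - e k)"
      moreover have "(R k - e k) * e k = 0" using ck by (simp add: ple_def left_diff_distrib paD)
      ultimately have "fin (R k - e k + e k)" using fin_add \<open>fin (e k)\<close> by blast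
      then show False using k(3) by simp
    qed
    then show ?case using pa_diff[OF ck(1) k(1) ck(2)] ple_trans[OF le k(2)] by (simp add: ok_def RS e_def)
  qed
  have e: "pa (e k)" "ple (e k) (R k)" "meq (f k) (e k)" for k using c[OF okR, of k] by (auto simp: e_def)
  have Rdec: "ple (R (m + k)) (R m)" for m k
  proof (induct k)
    case 0 then show ?case using okR[of m] ple_refl[of "R m"] by (simp add: ok_def pa_def)
  next
    case (Suc k)
    have "ple (R (Suc (m + k))) (R (m + k))" unfolding RS
      using ple_diff[OF _ _ e(2)[of "m + k"]] e(1) okR[of "m + k"] by (simp add: ok_def pa_def e_def)
    then show ?case using ple_trans Suc by fastforce
  qed
  have lt: "e m * e n = 0" if "m < n" for m n
  proof -
    have "ple (R n) (R (Suc m))" using Rdec[of "Suc m" "n - Suc m"] that by simp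
    then have "R (Suc m) * e n = e n" using ple_trans[OF e(2)] by (simp add: ple_def)
    then have "e m * e n = e m * R (Suc m) * e n" by (simp add: mult.assoc)
    have "e m * R m = e m" using ple_right[OF paD(2)[OF e(1)] _ e(2)] okR[of m] by (simp add: ok_def pa_def)
    moreover have "R (Suc m) = R m - e m" by (simp add: RS e_def)
    ultimately have "e m * R (Suc m) = 0" by (simp add: right_diff_distrib paD(4)[OF e(1)])
    with \<open>e m * e n = e m * R (Suc m) * e n\<close> show ?thesis by simp
  qed
  show ?thesis
  proof (rule construct_from_projections[of P f e])
    show small_pieces "pa P" "P \<noteq> 0" by (fact sm P(1,2))+
    show "pm (f k)" "ple (f k) P" "pa (e k)" "meq (f k) (e k)" for k
      by (rule fin_pm[OF f(1)], rule f(2), rule e(1), rule e(3))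
  next
    fix N x assume N: "vna N" "P \<in> N" "\<And>k. f k \<in> N" and x: "x \<in> M"
    have "range f \<subseteq> N" by (rule image_subsetI) (rule N(3))
    then have "D \<subseteq> N" unfolding rf by simp
    then show "P * x * P \<in> N" using D(3)[OF N(1,2) _ x] by blast
  next
    show "ple (e k) (1 - P)" for k
    proof (rule ple_trans[OF e(2)])
      show "ple (R k) (1 - P)" using okR[of k] by (simp add: ok_def)
    qed
    show "e m * e n = 0" if "m \<noteq> n" for m n
    proof (cases "m < n")
      case False
      then have "e n * e m = 0" using lt that by simp
      then show ?thesis by (rule orth_sym[OF paD(2)[OF e(1)] paD(2)[OF e(1)]])
    qed (rule lt)
  qed
qed

end

section \<open>The finite types: one copy of \<open>P\<close> carrying a matrix generator\<close>

context factor_with_masa begin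

text \<open>The generator is \<open>K = G + star G\<close>, where \<open>G\<close> is a strictly upper triangular matrix over the
  blocks \<open>v i * star (v i)\<close>.  Its first row consists of the matrix units, and the entries between the
  remaining full blocks hold the elements of \<open>Y\<close>.\<close>

lemma block_generator:
  fixes v :: "nat \<Rightarrow> 'h cop" and k :: nat
  assumes b: "pa b" and v0: "v 0 = b" and v: "\<And>i. i \<le> Suc k \<Longrightarrow> v i \<in> M \<and> pis (v i)"
    and full: "\<And>i. i \<le> k \<Longrightarrow> star (v i) * v i = b" and vb: "v (Suc k) * b = v (Suc k)"
    and q: "\<And>i. i \<le> Suc k \<Longrightarrow> v i * star (v i) \<in> A"
    and o: "\<And>i j. i \<le> Suc k \<Longrightarrow> j \<le> Suc k \<Longrightarrow> i \<noteq> j \<Longrightarrow> star (v i) * v j = 0"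
    and E: "(\<Sum>i\<le>Suc k. v i * star (v i)) = E"
    and Y: "finite Y" "Y \<subseteq> M" "\<And>y. y \<in> Y \<Longrightarrow> b * y * b = y" "2 * card Y \<le> k * (k - 1)"
    and gen: "\<And>N x. vna N \<Longrightarrow> b \<in> N \<Longrightarrow> Y \<subseteq> N \<Longrightarrow> x \<in> M \<Longrightarrow> b * x * b \<in> N"
  obtains K where "K \<in> M" "star K = K" "E * K = K"
    "\<And>N x. vna N \<Longrightarrow> K \<in> N \<Longrightarrow> (\<And>a. a \<in> A \<Longrightarrow> a * E \<in> N) \<Longrightarrow> x \<in> M \<Longrightarrow> E * x * E \<in> N"
proof -
  define I where "I = {..Suc k}"
  have I: "finite I" "\<And>i. i \<in> I \<longleftrightarrow> i \<le> Suc k" by (simp_all add: I_def)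
  have EI: "(\<Sum>i\<in>I. v i * star (v i)) = E" unfolding I_def by (rule E)
  define q where "q = (\<lambda>i. v i * star (v i))"
  have bM: "b \<in> M" "b * b = b" "star b = b" using b pa_pm[OF b] by (simp_all add: pmD paD)
  have vib: "v i * b = v i" if "i \<le> Suc k" for i
  proof (cases "i \<le> k")
    case True
    then show ?thesis using pisD(1)[of "v i"] v[OF that] full by simp
  next
    case False
    then have "i = Suc k" using that by simp
    then show ?thesis using vb by simp
  qed
  have bv: "b * star (v i) = star (v i)" if "i \<le> Suc k" for i using vib[OF that] bM(3) by (metis star_mult)
  have qv: "q i * v j = (if i = j then v j else 0)" if "i \<le> Suc k" "j \<le> Suc k" for i j
    using that pisD(1)[of "v j"] v o by (auto simp: q_def mult.assoc)
  have sq: "star (q i) = q i" for i by (simp add: q_def star_mult)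
  have vq: "star (v j) * q i = (if i = j then star (v j) else 0)" if "i \<le> Suc k" "j \<le> Suc k" for i j
    using arg_cong[OF qv[OF that], of star] by (simp add: star_mult sq split: if_splits)
  have qE: "q i * E = q i" if "i \<le> Suc k" for i
  proof -
    have "q i * E = (\<Sum>j\<in>I. (q i * v j) * star (v j))"
      unfolding EI[symmetric] by (simp only: sum_distrib_left mult.assoc)
    also have "\<dots> = (\<Sum>j\<in>I. if i = j then v j * star (v j) else 0)"
      by (intro sum.cong refl) (use that qv I in auto)
    also have "\<dots> = q i" using that I by (simp add: q_def)
    finally show ?thesis .
  qed
  \<comment> \<open>Row 0 is reserved for the matrix units, and column \<open>Suc k\<close> belongs
    to a block that may be smaller than \<open>b\<close>; the places that remain number
    \<open>k * (k - 1) / 2\<close>.\<close>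
  define Pr where "Pr = {(i, j). 1 \<le> i \<and> i < j \<and> j \<le> k}"
  have fPr: "finite Pr"
  proof -
    have "Pr \<subseteq> {..k} \<times> {..k}" by (auto simp: Pr_def)
    then show ?thesis by (rule finite_subset) simp
  qed
  have "2 * card Pr = k * (k - 1)"
  proof -
    have "2 * card {(i, j). 1 \<le> i \<and> i < j \<and> j \<le> n} = n * (n - 1)" for n :: nat
    proof (induct n)
      case 0
      have "{(i, j). 1 \<le> i \<and> i < j \<and> j \<le> (0::nat)} = {}" by auto
      then show ?case by (simp only: card.empty)
    next
      case (Suc n)
      have eq: "{(i, j). 1 \<le> i \<and> i < j \<and> j \<le> Suc n} = {(i, j). 1 \<le> i \<and> i < j \<and> j \<le> n} \<union> (\<lambda>i. (i, Suc n)) ` {1..n}"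
        by (auto simp: le_Suc_eq)
      have "finite {(i, j). 1 \<le> i \<and> i < j \<and> j \<le> n}"
        by (rule finite_subset[of _ "{..n} \<times> {..n}"]) auto
      then have "card {(i, j). 1 \<le> i \<and> i < j \<and> j \<le> Suc n} = card {(i, j). 1 \<le> i \<and> i < j \<and> j \<le> n} + card ((\<lambda>i. (i, Suc n)) ` {1..n})"
        unfolding eq by (intro card_Un_disjoint) auto
      also have "card ((\<lambda>i. (i, Suc n)) ` {1..n}) = n" by (subst card_image) (auto simp: inj_on_def)
      finally show ?case using Suc by (cases n) auto
    qed
    then show ?thesis unfolding Pr_def .
  qed
  then have "card Y \<le> card Pr" using Y(4) by linarith
  then obtain h where h: "inj_on h Y" "h ` Y \<subseteq> Pr" using card_le_inj[OF Y(1) fPr] by blast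
  \<comment> \<open>In row 0, for \<open>j > 0\<close>, the block
    \<open>v 0 * y 0 j * star (v j)\<close> reduces to \<open>star (v j)\<close>. The other entries
    hold the members of \<open>Y\<close> at the places chosen by \<open>h\<close>, and 0
    elsewhere.\<close>
  define y where "y = (\<lambda>i j. if i = 0 then (if j = 0 then 0 else star (v j) * v j)
    else if (i, j) \<in> h ` Y then the_inv_into Y h (i, j) else 0)"
  have yh: "y i j = z" if "z \<in> Y" "h z = (i, j)" for z i j
  proof -
    have "(i, j) \<in> Pr" using h(2) that by (metis image_subset_iff)
    moreover have "(i, j) \<in> h ` Y" using that by (metis imageI)
    moreover have "the_inv_into Y h (i, j) = z" using the_inv_into_f_f[OF h(1) that(1)] that(2) by simp
    ultimately show ?thesis by (auto simp: y_def Pr_def)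
  qed
  have ylow: "y i j = 0" if "j \<le> i" for i j
  proof -
    have "(i, j) \<notin> Pr" using that by (auto simp: Pr_def)
    then show ?thesis using h(2) that by (auto simp: y_def)
  qed
  have yM: "y i j \<in> M" if "j \<le> Suc k" for i j
  proof -
    have "the_inv_into Y h (i, j) \<in> Y" if "(i, j) \<in> h ` Y"
      using the_inv_into_into[OF h(1) that] by simp
    then show ?thesis using v[OF that] Y(2) by (auto simp: y_def M_closed)
  qed
  define G where "G = (\<Sum>i\<in>I. \<Sum>j\<in>I. v i * y i j * star (v j))"
  define K where "K = G + star G"
  have GM: "G \<in> M" unfolding G_def
    using v yM I by (intro M_closed(11) M_closed(3) M_closed(5)) auto
  have qGq: "q a * G * q c = v a * y a c * star (v c)" if "a \<le> Suc k" "c \<le> Suc k" for a c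
  proof -
    have "q a * G * q c = (\<Sum>i\<in>I. \<Sum>j\<in>I. (q a * v i) * y i j * (star (v j) * q c))"
      by (simp add: G_def sum_distrib_left sum_distrib_right mult.assoc)
    also have "\<dots> = (\<Sum>i\<in>I. \<Sum>j\<in>I. if a = i then (if c = j then v i * y i j * star (v j) else 0) else 0)"
      by (intro sum.cong refl) (use that qv vq I in auto)
    also have "\<dots> = (\<Sum>i\<in>I. if a = i then v i * y i c * star (v c) else 0)"
      by (intro sum.cong refl) (use that I in auto)
    also have "\<dots> = v a * y a c * star (v c)" using that I by simp
    finally show ?thesis .
  qed
  \<comment> \<open>\<open>G\<close> is strictly upper triangular, so its adjoint contributes
    nothing above the diagonal.\<close>
  have qKq: "q a * K * q c = v a * y a c * star (v c)" if "a < c" "c \<le> Suc k" for a c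
  proof -
    have "q a * star G * q c = star (q c * G * q a)" by (simp add: star_mult sq mult.assoc)
    also have "q c * G * q a = 0" using that by (subst qGq) (simp_all add: ylow)
    finally show ?thesis using that by (simp add: K_def distrib_left distrib_right qGq)
  qed
  show ?thesis
  proof (rule that[of K])
    show "K \<in> M" using GM by (simp add: K_def M_closed)
    show "star K = K" by (simp add: K_def add.commute)
    have Ev: "E * v i = v i" if "i \<le> Suc k" for i
    proof -
      have "E * q i = q i" using arg_cong[OF qE[OF that], of star] sq E by (simp add: star_mult star_sum EI[symmetric])
      then have "E * (q i * v i) = q i * v i" by (simp only: mult.assoc[symmetric])
      then show ?thesis using qv[OF that that] by simp
    qed
    have "E * G = G" unfolding G_def sum_distrib_left
      by (intro sum.cong refl) (simp add: mult.assoc[symmetric] Ev I)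
    moreover have "E * star G = star G" unfolding G_def star_sum sum_distrib_left
      by (intro sum.cong refl) (simp add: star_mult mult.assoc[symmetric] Ev I)
    ultimately show "E * K = K" by (simp add: K_def distrib_left)
    fix N x assume N: "vna N" "K \<in> N" "\<And>a. a \<in> A \<Longrightarrow> a * E \<in> N" and x: "x \<in> M"
    note Nsa = vna_salg[OF N(1)]
    have qN: "q i \<in> N" if "i \<le> Suc k" for i
      using N(3)[OF \<open>i \<le> Suc k \<Longrightarrow> v i * star (v i) \<in> A\<close>[OF that]] qE[OF that] by (simp add: q_def)
    have bq: "b = q 0" using v0 bM by (simp add: q_def)
    have bN: "b \<in> N" using qN[of 0] bq by simp
    have ent: "v a * y a c * star (v c) \<in> N" if "a < c" "c \<le> Suc k" for a c
      unfolding qKq[OF that, symmetric] using that by (intro salgD(3)[OF Nsa] qN N(2)) auto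
    have vN: "v j \<in> N" if "j \<le> Suc k" for j
    proof (cases "j = 0")
      case False
      have "v 0 * y 0 j * star (v j) = b * (star (v j) * (v j * star (v j)))"
        using False by (simp add: v0 y_def mult.assoc)
      also have "star (v j) * (v j * star (v j)) = star (v j)" using pisD(5) v[OF that] by blast
      finally have "star (v j) \<in> N" using ent[of 0 j] False that bv by simp
      then have "star (star (v j)) \<in> N" by (rule vnaD(5)[OF N(1)])
      then show ?thesis by simp
    qed (simp add: v0 bN)
    have "Y \<subseteq> N"
    proof
      fix z assume z: "z \<in> Y"
      obtain i j where ij: "h z = (i, j)" by (cases "h z")
      then have P: "1 \<le> i" "i < j" "j \<le> k" using h(2) z by (force simp: Pr_def)+
      have "v i * z * star (v j) \<in> N" using ent[of i j] P yh[OF z ij] by simp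
      moreover have "star (v i) \<in> N" "v j \<in> N" using vnaD(5)[OF N(1) vN[of i]] vN[of j] P by auto
      ultimately have "star (v i) * (v i * z * star (v j)) * v j \<in> N"
        using salgD(3)[OF Nsa salgD(3)[OF Nsa]] by blast
      moreover have "star (v i) * (v i * z * star (v j)) * v j = b * z * b"
      proof -
        have "star (v i) * (v i * z * star (v j)) * v j = (star (v i) * v i) * z * (star (v j) * v j)"
          by (simp only: mult.assoc)
        then show ?thesis using P by (simp add: full)
      qed
      ultimately show "z \<in> N" using Y(3)[OF z] by simp
    qed
    have bxb: "b * z * b \<in> N" if "z \<in> M" for z by (rule gen[OF N(1) bN \<open>Y \<subseteq> N\<close> that])
    have "E * x * E = (\<Sum>i\<in>I. \<Sum>j\<in>I. v i * (star (v i) * x * v j) * star (v j))"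
      unfolding EI[symmetric] sum_distrib_left sum_distrib_right
      by (subst sum.swap) (simp only: mult.assoc)
    moreover have "v i * (star (v i) * x * v j) * star (v j) \<in> N" if "i \<le> Suc k" "j \<le> Suc k" for i j
    proof -
      have "b * (star (v i) * x * v j) * b \<in> N" using v that x by (intro bxb) (simp add: M_closed)
      moreover have "b * (star (v i) * x * v j) * b = star (v i) * x * v j"
        using bv[OF that(1)] vib[OF that(2)] by (metis mult.assoc)
      ultimately have "star (v i) * x * v j \<in> N" by simp
      then show ?thesis by (rule salgD(3)[OF Nsa salgD(3)[OF Nsa vN[OF that(1)]] vnaD(5)[OF N(1) vN[OF that(2)]]])
    qed
    ultimately show "E * x * E \<in> N" by (auto intro!: salg_sum[OF Nsa] simp: I)
  qed
qed

text \<open>One operator \<open>t0\<close> from \<open>P\<close> to \<open>E\<close> stores both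
  \<open>K\<close> and the partial isometry \<open>V\<close>: it is half of \<open>V\<close>
  multiplied by the root of \<open>1 + c K\<close>. Then \<open>t0 * star t0\<close> reveals
  \<open>K\<close>, and dividing by the root returns \<open>V\<close>.\<close>

lemma construct_from_generator:
  assumes sm: small_pieces and P: "pa P" "P \<noteq> 0" and E: "pa E" "ple E (1 - P)" "meq P E"
    and K: "K \<in> M" "star K = K" "E * K = K"
    and gen: "\<And>N x. vna N \<Longrightarrow> K \<in> N \<Longrightarrow> (\<And>a. a \<in> A \<Longrightarrow> a * E \<in> N) \<Longrightarrow> x \<in> M \<Longrightarrow> E * x * E \<in> N"
  shows "conjugate_generates P"
proof -
  have pP: "pm P" by (rule pa_pm[OF P(1)])
  have PP: "P * P = P" "star P = P" and EE: "E * E = E" "star E = E" using P(1) E(1) by (simp_all add: paD)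
  have p1: "pa (1 - P)" using pa_diff[OF P(1) pa_1] by simp
  obtain V where V: "V \<in> M" "star V * V = P" "V * star V = E" using E(3) unfolding meq_def by blast
  have pV: "pis V" using pis_of_initial[OF pP V(2)] .
  have EV: "E * V = V" using pis_left[OF pV, of E] V(3) ple_refl[of E] E(1) by (simp add: pa_def)
  have VP: "V * P = V" using pisD(1)[OF pV] V(2) by simp
  have KE: "K * E = K" using arg_cong[OF K(3), of star] by (simp add: star_mult K(2) EE)
  \<comment> \<open>This makes \<open>x = - c K\<close> of norm at most 1/4, so that
    \<open>1 - x\<close> has a square root and an inverse in every algebra containing
    \<open>K\<close>.\<close>
  define c where "c = 1 / (4 * (norm K + 1))"
  have n1: "norm K + 1 > 0" by (simp add: add_nonneg_pos)
  then have c: "c > 0" by (simp add: c_def)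
  define x where "x = - (c *\<^sub>R K)"
  have nx: "norm x \<le> 1/4"
  proof -
    have "norm x = norm K / (4 * (norm K + 1))" using c by (simp add: x_def c_def)
    also have "\<dots> \<le> 1/4" using n1 by (simp add: divide_le_eq)
    finally show ?thesis .
  qed
  obtain r where r: "gens x r" "norm r \<le> 1" "(1 - r) * (1 - r) = 1 - x" "star r = r"
    using sqrt_one_minus[of x] nx by (auto simp: x_def K(2))
  obtain h where h: "gens (1 - x) h" "h * (1 - x) = 1" using neumann_inverse[of "1 - x"] nx by auto
  have xM: "x \<in> M" using K(1) by (simp add: x_def M_closed)
  have rM: "r \<in> M" using gensD[OF r(1) M_salg xM] .
  have Er: "E * r = r * E" by (rule gens_commute[OF r(1)]) (simp add: x_def K(3) KE)
  \<comment> \<open>\<open>1 - r\<close> has norm at most 2, so the factor 1/2 meets the norm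
    condition of \<open>assemble\<close>.\<close>
  define t0 where "t0 = (1/2) *\<^sub>R ((1 - r) * V)"
  have t0M: "t0 \<in> M" using rM V(1) by (simp add: t0_def M_closed)
  have nt0: "norm t0 \<le> 1"
  proof -
    have "norm (1 - r) \<le> 2" using norm_triangle_ineq4[of 1 r] norm_one_le[where 'h='h] r(2) by linarith
    then have "norm ((1 - r) * V) \<le> 2 * 1"
      by (intro order_trans[OF norm_mult_ineq mult_mono] norm_pis[OF pV]) auto
    then show ?thesis by (simp add: t0_def)
  qed
  have t0P: "t0 * P = t0" by (simp add: t0_def mult.assoc VP)
  have E1r: "E * (1 - r) = (1 - r) * E" by (simp add: right_diff_distrib left_diff_distrib Er)
  have Et0: "E * t0 = t0"
  proof -
    have "E * ((1 - r) * V) = (1 - r) * (E * V)" by (simp only: mult.assoc[symmetric] E1r)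
    then show ?thesis by (simp add: t0_def EV)
  qed
  have t0t0: "t0 * star t0 = (1/4) *\<^sub>R (E + c *\<^sub>R K)"
  proof -
    have "(1 - r) * V * star ((1 - r) * V) = (1 - r) * (V * star V) * (1 - r)" by (simp add: star_mult r(4) mult.assoc)
    also have "\<dots> = E * ((1 - r) * (1 - r))" unfolding V(3) E1r[symmetric] by (simp only: mult.assoc)
    also have "\<dots> = E + c *\<^sub>R K" unfolding r(3) by (simp add: x_def distrib_left K(3))
    finally show ?thesis by (simp add: t0_def)
  qed
  define E' where "E' = 1 - P - E"
  have E': "pa E'" unfolding E'_def by (rule pa_diff[OF E(1) p1 E(2)])
  have E'1: "ple E' (1 - P)" unfolding E'_def using ple_diff[OF _ _ E(2)] E(1) p1 by (simp add: pa_def)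
  obtain w where w: "\<And>n. w n \<in> M \<and> pis (w n)" "\<And>n. pa (w n * star (w n))" "\<And>n. ple (star (w n) * w n) P"
    "\<And>m n. m \<noteq> n \<Longrightarrow> (w m * star (w m)) * (w n * star (w n)) = 0" "\<And>n. ple (w n * star (w n)) E'"
    "\<And>R. pm R \<Longrightarrow> (\<And>n::nat. ple (w n * star (w n)) R) \<Longrightarrow> ple E' R"
    using pieces[OF sm E' pP P(2)] by metis
  have EE': "E * E' = 0"
    using ple_right[OF paD(2)[OF E(1)] paD(2)[OF p1] E(2)] by (simp add: E'_def right_diff_distrib EE)
  have Ew: "E * (w n * star (w n)) = 0" for n
  proof -
    have "E * (E' * (w n * star (w n))) = 0" by (simp add: mult.assoc[symmetric] EE')
    then show ?thesis using w(5)[of n] by (simp add: ple_def)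
  qed
  have wE: "w n * star (w n) * E = 0" for n using orth_sym[OF paD(2)[OF E(1)] paD(2)[OF w(2)] Ew] .
  define t where "t = (\<lambda>i. case i of 0 \<Rightarrow> t0 | Suc n \<Rightarrow> w n)"
  \<comment> \<open>The stored operator in slot 0 is \<open>t0\<close>, but
    \<open>generate_from_corner\<close> needs \<open>s i * star (s i)\<close> to be a projection,
    hence \<open>V\<close> in its place.\<close>
  define s where "s = (\<lambda>i. case i of 0 \<Rightarrow> V | Suc n \<Rightarrow> w n)"
  define g where "g = (\<lambda>i. s i * star (s i))"
  have g: "g i = (case i of 0 \<Rightarrow> E | Suc n \<Rightarrow> w n * star (w n))" for i
    by (simp add: g_def s_def V(3) split: nat.split)
  have wP: "w n * P = w n" for n using pis_right[of "w n" P] w(1,3) pP by (simp add: pm_def)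
  have ww: "w n * star (w n) * w n = w n" for n using pisD(1)[of "w n"] w(1) by (simp add: mult.assoc)
  have tM: "t i \<in> M" "norm (t i) \<le> 1" "t i * P = t i" "g i * t i = t i" for i
    using t0M nt0 t0P Et0 w(1) norm_pis wP ww by (auto simp: t_def g split: nat.split)
  have gp: "pa (g i)" "ple (g i) (1 - P)" for i
    using E w(2) ple_trans[OF w(5) E'1] by (auto simp: g split: nat.split)
  have go: "g i * g j = 0" if "i \<noteq> j" for i j
    using that w(4) Ew wE by (auto simp: g split: nat.split)
  obtain U where U: "U \<in> M" "star U * U = 1" "U * star U = 1"
    "\<And>N. vna N \<Longrightarrow> star U * P * U \<in> N \<Longrightarrow> (\<And>a. a \<in> A \<Longrightarrow> a * (1 - P) \<in> N) \<Longrightarrow>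
      P \<in> N \<and> (\<forall>i. g i \<in> N \<and> t i \<in> N)"
    using assemble[of P t g, OF P(1) tM gp go] by blast
  have "M \<subseteq> N" if N: "vna N" "star U * P * U \<in> N" "\<And>a. a \<in> A \<Longrightarrow> a * (1 - P) \<in> N" for N
  proof -
    note Nsa = vna_salg[OF N(1)]
    have PN: "P \<in> N" and tN: "\<And>i. t i \<in> N" and gN: "\<And>i. g i \<in> N" using U(4)[OF N] by blast+
    have EN: "E \<in> N" using gN[of 0] by (simp add: g)
    have t0N: "t0 \<in> N" using tN[of 0] by (simp add: t_def)
    have "(1 / c) *\<^sub>R (4 *\<^sub>R (t0 * star t0) - E) \<in> N"
      by (intro salgD(4)[OF Nsa] salg_closed(2)[OF Nsa] salgD(3)[OF Nsa] vnaD(5)[OF N(1)] t0N EN)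
    then have KN: "K \<in> N" using c by (simp add: t0t0)
    have aE: "a * E \<in> N" if "a \<in> A" for a
    proof -
      have "a * (1 - P) * E \<in> N" by (intro salgD(3)[OF Nsa] N(3) that EN)
      moreover have "(1 - P) * E = E" using E(2) by (simp add: ple_def)
      ultimately show ?thesis by (simp add: mult.assoc)
    qed
    have xN: "x \<in> N" unfolding x_def by (intro salg_closed(1)[OF Nsa] salgD(4)[OF Nsa] KN)
    have rN: "r \<in> N" using gensD[OF r(1) Nsa xN] .
    have hN: "h \<in> N" by (rule gensD[OF h(1) Nsa]) (intro salg_closed(2)[OF Nsa] salgD(1)[OF Nsa] xN)
    have "2 *\<^sub>R (h * ((1 - r) * t0)) \<in> N"
      by (intro salgD(4)[OF Nsa] salgD(3)[OF Nsa] hN salg_closed(2)[OF Nsa] salgD(1)[OF Nsa] rN t0N)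
    \<comment> \<open>A second factor \<open>1 - r\<close> completes the root inside
      \<open>t0\<close> to \<open>1 - x\<close>, which \<open>h\<close> cancels.\<close>
    moreover have "2 *\<^sub>R (h * ((1 - r) * t0)) = V"
    proof -
      have "2 *\<^sub>R (h * ((1 - r) * t0)) = h * ((1 - r) * (1 - r)) * V" by (simp add: t0_def mult.assoc)
      then show ?thesis unfolding r(3) by (simp add: h(2))
    qed
    ultimately have VN: "V \<in> N" by simp
    have PMP: "P * y * P \<in> N" if y: "y \<in> M" for y
    proof -
      have "E * (V * y * star V) * E \<in> N" by (rule gen[OF N(1) KN aE]) (use V(1) y in \<open>simp_all add: M_closed\<close>)
      moreover have "star V * E = star V" using arg_cong[OF EV, of star] by (simp add: star_mult EE)
      then have "E * (V * y * star V) * E = V * y * star V" by (simp add: mult.assoc[symmetric] EV) (simp add: mult.assoc)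
      ultimately have "V * y * star V \<in> N" by simp
      then have "star V * (V * y * star V) * V \<in> N" by (rule salgD(3)[OF Nsa salgD(3)[OF Nsa vnaD(5)[OF N(1) VN]] VN])
      moreover have "star V * (V * y * star V) * V = (star V * V) * y * (star V * V)" by (simp only: mult.assoc)
      ultimately show ?thesis by (simp add: V(2))
    qed
    have sM: "s i \<in> M" "s i \<in> N" "s i * P = s i" for i
      using V(1) VN VP w(1) wP tN[of i] by (auto simp: s_def t_def split: nat.splits)
    show ?thesis
    proof (rule generate_from_corner[OF N(1) pP PN PMP sM])
      show "pm (s i * star (s i))" "ple (s i * star (s i)) (1 - P)" for i
        using pa_pm[OF gp(1)[of i]] gp(2)[of i] by (simp_all add: g_def)
      show "s i * star (s i) * (s j * star (s j)) = 0" if "i \<noteq> j" for i j using go[OF that] by (simp add: g_def)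
      fix R assume R: "pm R" "\<And>n. ple (s n * star (s n)) R"
      have "ple E R" using R(2)[of 0] by (simp add: s_def V(3))
      moreover have "ple (w k * star (w k)) R" for k using R(2)[of "Suc k"] by (simp add: s_def)
      then have "ple E' R" by (rule w(6)[OF R(1)])
      ultimately have "ple (E + E') R" by (rule ple_add)
      then show "ple (1 - P) R" by (simp add: E'_def)
    qed
  qed
  then show ?thesis unfolding conjugate_generates_def using U(1-3) by blast
qed

text \<open>The number of full blocks of \<open>E\<close> is bounded below through the traces of \<open>E\<close> and \<open>b\<close>.\<close>

lemma construct_finite:
  assumes sm: small_pieces and f1: "fin 1" and P: "pa P" "P \<noteq> 0" and E: "pa E" "ple E (1 - P)" "meq P E"
    and b: "pa b" "b \<noteq> 0" "ple b E"
    and Y: "finite Y" "Y \<subseteq> M" "\<And>y. y \<in> Y \<Longrightarrow> b * y * b = y"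
    and gen: "\<And>N x. vna N \<Longrightarrow> b \<in> N \<Longrightarrow> Y \<subseteq> N \<Longrightarrow> x \<in> M \<Longrightarrow> b * x * b \<in> N"
    and count: "\<And>k. (\<And>\<tau>. tracial \<tau> \<Longrightarrow> Re (\<tau> E) \<le> (real k + 2) * Re (\<tau> b)) \<Longrightarrow> 2 * card Y \<le> k * (k - 1)"
  shows "conjugate_generates P"
proof -
  have pb: "pm b" by (rule pa_pm[OF b(1)])
  have bb: "b * b = b" "star b = b" using b by (simp_all add: paD)
  \<comment> \<open>\<open>b\<close> itself is block 0, so only the rest of \<open>E\<close> is
    divided into copies of \<open>b\<close>.\<close>
  define E0 where "E0 = E - b"
  have E0: "pa E0" unfolding E0_def by (rule pa_diff[OF b(1) E(1) b(3)])
  have fE0: "fin E0" by (rule fin_sub[OF f1 pa_pm[OF E0]]) simp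
  have fb: "fin b" by (rule fin_sub[OF f1 pb]) simp
  have bE0: "b * E0 = 0" using ple_right[OF paD(2)[OF b(1)] paD(2)[OF E(1)] b(3)] by (simp add: E0_def right_diff_distrib bb)
  have fitA: "\<exists>f\<in>A. pm f \<and> meq b f \<and> ple f r" if r: "pm r" "r \<in> A" "mle b r" for r
  proof -
    have "pa r" using r by (simp add: pa_def pm_def)
    then obtain e where "pa e" "ple e r" "meq b e" using fit[OF sm _ fb r(3)] by blast
    then show ?thesis using pa_pm by (auto simp: pa_def)
  qed
  have "\<exists>k v. (\<forall>i. v i \<in> M \<and> pis (v i)) \<and> (\<forall>i<k. star (v i) * v i = b) \<and> ple (star (v k) * v k) b \<and>
    (\<forall>i\<le>k. \<forall>j\<le>k. i \<noteq> j \<longrightarrow> star (v i) * v j = 0) \<and> (\<Sum>i<Suc k. v i * star (v i)) = E0 \<and>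
    (\<forall>i\<le>k. v i * star (v i) \<in> A)"
    by (rule finite_cover_in[OF fE0 pb b(2) A_salg paD(1)[OF E0]]) (rule fitA)
  then obtain k u where u: "\<And>i. u i \<in> M \<and> pis (u i)" "\<And>i. i < k \<Longrightarrow> star (u i) * u i = b" "ple (star (u k) * u k) b"
    "\<And>i j. i \<le> k \<Longrightarrow> j \<le> k \<Longrightarrow> i \<noteq> j \<Longrightarrow> star (u i) * u j = 0" "(\<Sum>i<Suc k. u i * star (u i)) = E0"
    "\<And>i. i \<le> k \<Longrightarrow> u i * star (u i) \<in> A" by blast
  define v where "v = (\<lambda>i. case i of 0 \<Rightarrow> b | Suc j \<Rightarrow> u j)"
  have sumv: "(\<Sum>i\<le>Suc k. f (v i)) = f b + (\<Sum>i<Suc k. f (u i))" for f :: "'h cop \<Rightarrow> 'h cop"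
    unfolding lessThan_Suc_atMost[symmetric] by (subst sum.lessThan_Suc_shift) (simp add: v_def)
  have bu: "b * u j = 0" if "j \<le> k" for j
  proof -
    have "E0 * u j = (\<Sum>i<Suc k. u i * (star (u i) * u j))"
      unfolding u(5)[symmetric] by (simp only: sum_distrib_right mult.assoc)
    also have "\<dots> = (\<Sum>i\<in>{j}. u i * (star (u i) * u j))"
      by (rule sum.mono_neutral_right) (use that u(4) in auto)
    also have "\<dots> = u j" using pisD(1)[of "u j"] u(1) by simp
    finally have "b * u j = b * E0 * u j" by (simp add: mult.assoc)
    then show ?thesis by (simp add: bE0)
  qed
  then have ub: "star (u j) * b = 0" if "j \<le> k" for j using that bb(2) by (metis star_mult star_simps(1))
  \<comment> \<open>\<open>E\<close> consists of \<open>b\<close>, of \<open>k\<close> full copies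
    of \<open>b\<close> and of a remainder below one copy; this is the 2 in
    \<open>count\<close>.\<close>
  have count': "2 * card Y \<le> k * (k - 1)"
  proof (rule count)
    fix \<tau> assume t: "tracial \<tau>"
    have pu: "pm (star (u i) * u i)" for i using pis_pm u(1) by blast
    have "\<tau> E0 = (\<Sum>i<Suc k. \<tau> (u i * star (u i)))"
      unfolding u(5)[symmetric] using u(1) by (intro tracial_sum[OF t]) (simp add: M_closed)
    also have "\<dots> = (\<Sum>i<Suc k. \<tau> (star (u i) * u i))"
      using u(1) by (intro sum.cong refl tracialD(5)[OF t]) (simp_all add: M_closed)
    also have "\<dots> = of_nat k * \<tau> b + \<tau> (star (u k) * u k)" using u(2) by simp
    finally have "Re (\<tau> E0) = real k * Re (\<tau> b) + Re (\<tau> (star (u k) * u k))" by simp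
    moreover have "Re (\<tau> (star (u k) * u k)) \<le> Re (\<tau> b)" by (rule tracial_ple[OF t pu pb u(3)])
    moreover have "\<tau> E = \<tau> b + \<tau> E0" using tracialD(1)[OF t, of b E0] pmD(1)[OF pb] pmD(1)[OF pa_pm[OF E0]] by (simp add: E0_def)
    ultimately show "Re (\<tau> E) \<le> (real k + 2) * Re (\<tau> b)" by (simp add: algebra_simps)
  qed
  have "\<exists>K. K \<in> M \<and> star K = K \<and> E * K = K \<and>
    (\<forall>N x. vna N \<longrightarrow> K \<in> N \<longrightarrow> (\<forall>a\<in>A. a * E \<in> N) \<longrightarrow> x \<in> M \<longrightarrow> E * x * E \<in> N)"
  proof (rule block_generator[of b v k E Y])
    show "pa b" "v 0 = b" by (simp_all add: b v_def)
    show "v i \<in> M \<and> pis (v i)" for i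
      using u(1) pmD(1)[OF pb] proj_pis(1)[OF pmD(2)[OF pb]] by (auto simp: v_def split: nat.split)
    show "star (v i) * v i = b" if "i \<le> k" for i using that u(2) bb by (auto simp: v_def split: nat.split)
    show "v (Suc k) * b = v (Suc k)" using pis_right[of "u k" b] u(1,3) pb by (simp add: v_def pm_def)
    show "v i * star (v i) \<in> A" if "i \<le> Suc k" for i
      using that u(6) b(1) bb by (auto simp: v_def pa_def split: nat.split)
    show "star (v i) * v j = 0" if "i \<le> Suc k" "j \<le> Suc k" "i \<noteq> j" for i j
      using that u(4) bu ub bb by (auto simp: v_def split: nat.split)
    show "(\<Sum>i\<le>Suc k. v i * star (v i)) = E"
      using sumv[of "\<lambda>x. x * star x"] u(5) by (simp add: bb E0_def)
  next
    fix K assume "K \<in> M" "star K = K" "E * K = K"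
      "\<And>N x. vna N \<Longrightarrow> K \<in> N \<Longrightarrow> (\<And>a. a \<in> A \<Longrightarrow> a * E \<in> N) \<Longrightarrow> x \<in> M \<Longrightarrow> E * x * E \<in> N"
    then show ?thesis by blast
  qed (use Y gen count' in auto)
  then obtain K where K: "K \<in> M" "star K = K" "E * K = K"
    "\<And>N x. vna N \<Longrightarrow> K \<in> N \<Longrightarrow> (\<And>a. a \<in> A \<Longrightarrow> a * E \<in> N) \<Longrightarrow> x \<in> M \<Longrightarrow> E * x * E \<in> N" by blast
  show ?thesis by (rule construct_from_generator[OF sm P E K])
qed

end

lemma vna_Int:
  assumes M: "vna M" and N: "vna N"
  shows "vna (M \<inter> N)"
  unfolding vna_def
proof (intro conjI ballI allI impI)
  fix x assume x: "\<forall>F e. finite F \<longrightarrow> 0 < e \<longrightarrow> (\<exists>y\<in>M \<inter> N. \<forall>v\<in>F. norm (x \<cdot> v - y \<cdot> v) < e)"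
  have "x \<in> M" by (rule vnaD(6)[OF M]) (use x in blast)
  moreover have "x \<in> N" by (rule vnaD(6)[OF N]) (use x in blast)
  ultimately show "x \<in> M \<inter> N" by simp
qed (use vnaD(1-5)[OF M] vnaD(1-5)[OF N] in auto)

text \<open>Inserting 1 as the sum of the \<open>u l * star (u l)\<close> between two factors gives
  the rule for matrix products, so having all entries in \<open>N\<close> is stable. This exchanges
  generators of \<open>M\<close> for generators of a corner.\<close>

lemma vna_matrix:
  fixes u :: "nat \<Rightarrow> 'h::complex_hilbert cop"
  assumes N: "vna N" and u: "\<And>i. i < k \<Longrightarrow> norm (u i) \<le> 1" "\<And>i j. i < k \<Longrightarrow> j < k \<Longrightarrow> star (u i) * u j \<in> N"
    "(\<Sum>i<k. u i * star (u i)) = 1"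
  shows "vna {z. \<forall>i<k. \<forall>j<k. star (u i) * z * u j \<in> N}" (is "vna ?N1")
  unfolding vna_def
proof (intro conjI ballI allI impI)
  show "1 \<in> ?N1" using u(2) by simp
next
  fix z w assume z: "z \<in> ?N1" and w: "w \<in> ?N1"
  show "z + w \<in> ?N1" using z w vnaD(2)[OF N] by (simp add: distrib_left distrib_right)
  have "star (u i) * (z * w) * u j \<in> N" if "i < k" "j < k" for i j
  proof -
    have "star (u i) * (z * w) * u j = star (u i) * z * (\<Sum>l<k. u l * star (u l)) * w * u j"
      by (simp add: u(3) mult.assoc)
    also have "\<dots> = (\<Sum>l<k. (star (u i) * z * u l) * (star (u l) * w * u j))"
      by (simp only: sum_distrib_left sum_distrib_right mult.assoc)
    also have "\<dots> \<in> N" by (rule salg_sum[OF vna_salg[OF N]], rule vnaD(3)[OF N]) (use that z w in auto)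
    finally show ?thesis .
  qed
  then show "z * w \<in> ?N1" by simp
next
  fix c z assume z: "z \<in> ?N1"
  have "star (u i) * (sc c * z) * u j = sc c * (star (u i) * z * u j)" for i j
    by (metis mult.assoc sc_commute)
  then show "sc c * z \<in> ?N1" using z vnaD(4)[OF N] by simp
next
  fix z assume z: "z \<in> ?N1"
  have "star (u i) * star z * u j \<in> N" if "i < k" "j < k" for i j
  proof -
    have "star (star (u j) * z * u i) \<in> N" using z that by (intro vnaD(5)[OF N]) simp
    then show ?thesis by (simp add: star_mult mult.assoc)
  qed
  then show "star z \<in> ?N1" by simp
next
  fix z assume z: "\<forall>F e. finite F \<longrightarrow> 0 < e \<longrightarrow> (\<exists>y\<in>?N1. \<forall>v\<in>F. norm (z \<cdot> v - y \<cdot> v) < e)"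
  have "star (u i) * z * u j \<in> N" if ij: "i < k" "j < k" for i j
  proof (rule vnaD(6)[OF N])
    fix F :: "'h set" and e :: real assume F: "finite F" "e > 0"
    obtain y where y: "y \<in> ?N1" "\<forall>v\<in>(\<lambda>v. u j \<cdot> v) ` F. norm (z \<cdot> v - y \<cdot> v) < e"
      using z[rule_format, of "(\<lambda>v. u j \<cdot> v) ` F" e] F by auto
    have "norm ((star (u i) * z * u j) \<cdot> v - (star (u i) * y * u j) \<cdot> v) < e" if "v \<in> F" for v
    proof -
      have "(star (u i) * z * u j) \<cdot> v - (star (u i) * y * u j) \<cdot> v = star (u i) \<cdot> (z \<cdot> u j \<cdot> v - y \<cdot> u j \<cdot> v)" by simp
      also have "norm \<dots> \<le> norm (u i) * norm (z \<cdot> u j \<cdot> v - y \<cdot> u j \<cdot> v)" using norm_ap[of "star (u i)" "z \<cdot> u j \<cdot> v - y \<cdot> u j \<cdot> v"] by (simp only: norm_star)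
      also have "\<dots> \<le> norm (z \<cdot> u j \<cdot> v - y \<cdot> u j \<cdot> v)" using u(1)[OF ij(1)] by (intro mult_left_le_one_le) auto
      also have "\<dots> < e" using y(2) that by blast
      finally show ?thesis .
    qed
    then show "\<exists>y\<in>N. \<forall>v\<in>F. norm ((star (u i) * z * u j) \<cdot> v - y \<cdot> v) < e" using y(1) ij by blast
  qed
  then show "z \<in> ?N1" by simp
qed

context separable_factor begin

definition abn :: "'h cop \<Rightarrow> bool" where
  "abn p \<longleftrightarrow> pm p \<and> (\<forall>x\<in>M. \<forall>y\<in>M. (p * x * p) * (p * y * p) = (p * y * p) * (p * x * p))"

text \<open>For a proper \<open>q\<close> the element \<open>q * x * (p - q)\<close> is nonzero for
  some \<open>x\<close> by \<open>full_corner\<close>; but in the commutative corner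
  \<open>q\<close> commutes with \<open>p * x * p\<close>, which makes it vanish.\<close>

lemma abn_minimal:
  assumes p: "abn p" and q: "pm q" "ple q p" "q \<noteq> 0"
  shows "q = p"
proof (rule ccontr)
  assume ne: "q \<noteq> p"
  have pp: "pm p" using p by (simp add: abn_def)
  have r: "pm (p - q)" by (rule pm_diff[OF q(1) pp q(2)])
  have pq: "p * q = q" "q * p = q" using q(2) ple_right[OF pmD(2)[OF q(1)] pmD(2)[OF pp] q(2)] by (simp_all add: ple_def)
  obtain x where x: "x \<in> M" "q * x * (p - q) \<noteq> 0" using full_corner[OF r _ q(1,3)] ne by auto
  have "(p * q * p) * (p * x * p) = (p * x * p) * (p * q * p)" using p x(1) pmD(1)[OF q(1)] by (simp add: abn_def)
  then have c: "q * (p * x * p) = (p * x * p) * q" by (simp add: pq)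
  have "q * x * (p - q) = q * (p * x * p) * (p - q)"
  proof -
    have "q * (p * x * p) * (p - q) = (q * p) * x * (p * (p - q))" by (simp only: mult.assoc)
    also have "\<dots> = q * x * (p - q)" by (simp add: pq right_diff_distrib pmD(4)[OF pp])
    finally show ?thesis by simp
  qed
  also have "\<dots> = (p * x * p) * (q * (p - q))" unfolding c by (simp only: mult.assoc)
  also have "q * (p - q) = 0" by (simp add: pq right_diff_distrib pmD(4)[OF q(1)])
  finally show False using x(2) by simp
qed

lemma abn_mle:
  assumes p: "abn p" "p \<noteq> 0" and g: "pm g" "g \<noteq> 0"
  shows "mle p g"
proof -
  have pp: "pm p" using p by (simp add: abn_def)
  obtain v where v: "v \<in> M" "pis v" "v \<noteq> 0" "ple (star v * v) p" "ple (v * star v) g"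
    using comparison_nonzero[OF pp p(2) g] by blast
  have "star v * v = p"
    by (rule abn_minimal[OF p(1)]) (use v pis_pm star_self_eq_0 in auto)
  then show ?thesis unfolding mle_def using v by blast
qed

lemma abn_fin:
  assumes p: "abn p"
  shows "fin p"
  unfolding fin_def
proof (intro conjI allI impI)
  show "pm p" using p by (simp add: abn_def)
  fix q assume q: "pm q" "meq p q" "ple q p"
  show "q = p"
  proof (cases "q = 0")
    case True
    obtain v where v: "star v * v = p" "v * star v = q" using q(2) by (auto simp: meq_def)
    then have "v = 0" using True star_self_eq_0[of "star v"] by simp
    then show ?thesis using v by simp
  qed (use abn_minimal[OF p q(1,3)] in auto)
qed

end

context factor_with_masa begin

lemma small_pieces_finite: assumes f1: "fin 1" shows small_pieces
proof (rule small_pieces_semifinite)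
  fix E assume "pa E" "E \<noteq> 0"
  moreover have "fin E" by (rule fin_sub[OF f1 pa_pm]) (use \<open>pa E\<close> in simp_all)
  ultimately show "\<exists>E0. pa E0 \<and> E0 \<noteq> 0 \<and> ple E0 E \<and> fin E0" using ple_refl paD(2) by blast
qed

lemma finite_copy:
  assumes f1: "fin 1" and P: "pa P" "P \<noteq> 0" "mle P (1 - P)"
  obtains E where "pa E" "ple E (1 - P)" "meq P E" "E \<noteq> 0"
proof -
  have "fin P" by (rule fin_sub[OF f1 pa_pm[OF P(1)]]) simp
  have "pa (1 - P)" using pa_diff[OF P(1) pa_1] by simp
  then obtain E where E: "pa E" "ple E (1 - P)" "meq P E"
    using fit[OF small_pieces_finite[OF f1] _ \<open>fin P\<close> P(3)] by blast
  obtain v where v: "star v * v = P" "v * star v = E" using E(3) by (auto simp: meq_def)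
  have "E \<noteq> 0"
  proof
    assume "E = 0"
    then have "v = 0" using v(2) star_self_eq_0[of "star v"] by simp
    then show False using v(1) P(2) by simp
  qed
  then show ?thesis using E that by blast
qed

text \<open>1 is a finite sum of finite projections. The minimal \<open>p 0\<close> embeds into
  every nonzero projection, so infinitely many orthogonal projections of the masa are impossible and
  there is an atom \<open>b\<close> below \<open>E\<close>. Its corner is scalar, so no further
  generators have to be stored.\<close>

lemma construct_I:
  fixes p :: "nat \<Rightarrow> 'h cop"
  assumes p: "\<And>i. i < n \<Longrightarrow> abn (p i)" "n \<ge> 1" "\<And>i. i < n \<Longrightarrow> p i \<noteq> 0"
    "\<And>i j. i < n \<Longrightarrow> j < n \<Longrightarrow> i \<noteq> j \<Longrightarrow> p i * p j = 0" "(\<Sum>i<n. p i) = 1"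
    and P: "pa P" "P \<noteq> 0" "mle P (1 - P)"
  shows "conjugate_generates P"
proof -
  have "fin (\<Sum>i<m. p i)" if "m \<le> n" for m
    using that
  proof (induct m)
    case (Suc m)
    have "(\<Sum>i<m. p i) * p m = 0" unfolding sum_distrib_right
      by (rule sum.neutral) (use Suc.prems p(4) in auto)
    then show ?case using fin_add[of "\<Sum>i<m. p i" "p m"] Suc abn_fin[OF p(1)] by simp
  qed (simp add: fin_0)
  then have f1: "fin 1" using p(5) by (metis order_refl)
  have p0: "abn (p 0)" "p 0 \<noteq> 0" using p(1-3) by auto
  obtain E where E: "pa E" "ple E (1 - P)" "meq P E" "E \<noteq> 0" using finite_copy[OF f1 P] by blast
  have "\<exists>b. atom b \<and> ple b E"
  proof (rule ccontr)
    assume no: "\<nexists>b. atom b \<and> ple b E"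
    obtain e :: "nat \<Rightarrow> 'h cop" where e: "\<And>n. pa (e n)" "\<And>n. e n \<noteq> 0" "\<And>m n. m \<noteq> n \<Longrightarrow> e m * e n = 0"
      using diffuse_orth_seq[OF E(1,4)] no by metis
    show False
      by (rule fin_no_infinite_copies[OF f1 _ p0(2), of e])
        (use e p0 pa_pm abn_mle[OF p0] in \<open>auto simp: abn_def\<close>)
  qed
  then obtain b where b: "atom b" "ple b E" by blast
  then have pb: "pa b" "b \<noteq> 0" by (simp_all add: atom_def)
  show ?thesis
  proof (rule construct_finite[OF small_pieces_finite[OF f1] f1 P(1,2) E(1-3) pb b(2), of "{}"])
    fix N x assume N: "vna N" "b \<in> N" and x: "x \<in> M"
    obtain c where "b * x * b = sc c * b" using atom_scalar[OF b(1) x] by blast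
    then show "b * x * b \<in> N" using vnaD(4)[OF N] by simp
  qed simp_all
qed

text \<open>The hypothesis on \<open>X\<close>, \<open>k\<close>, \<open>p\<close> is Shen's condition \<open>\<G>(M) = 0\<close>.  The nonzero blocks of the
  elements of \<open>X\<close>, carried to one projection \<open>b\<close> of trace \<open>1/k\<close> in the masa, generate \<open>bMb\<close>; as
  there are few of them compared to \<open>k\<^sup>2\<close>, they fit above the diagonal of a matrix over a copy of \<open>P\<close>.\<close>

lemma construct_II_1:
  fixes \<tau> :: "'h cop \<Rightarrow> complex"
  assumes f1: "fin 1" and t: "tracial \<tau>"
    and shen: "\<And>\<epsilon>. \<epsilon> > 0 \<Longrightarrow> \<exists>X (k::nat) p. k \<ge> 1 \<and> (\<forall>i<k. pm (p i) \<and> \<tau> (p i) = 1 / of_nat k) \<and>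
      (\<forall>i<k. \<forall>j<k. i \<noteq> j \<longrightarrow> p i * p j = 0) \<and> (\<Sum>i<k. p i) = 1 \<and> finite X \<and> X \<subseteq> M \<and>
      (\<forall>N. vna N \<longrightarrow> N \<subseteq> M \<longrightarrow> X \<subseteq> N \<longrightarrow> N = M) \<and>
      (\<Sum>x\<in>X. real (card {(i, j). i < k \<and> j < k \<and> p i * x * p j \<noteq> 0})) \<le> \<epsilon> * (real k)\<^sup>2"
    and P: "pa P" "P \<noteq> 0" "mle P (1 - P)"
  shows "conjugate_generates P"
proof -
  note sm = small_pieces_finite[OF f1]
  obtain E where E: "pa E" "ple E (1 - P)" "meq P E" "E \<noteq> 0" using finite_copy[OF f1 P] by blast
  note pE = pa_pm[OF E(1)]
  define \<theta> where "\<theta> = Re (\<tau> E)"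
  have \<theta>: "\<theta> > 0" unfolding \<theta>_def by (rule tracial_faithful[OF f1 t pE E(4)])
  \<comment> \<open>With \<open>s = \<theta> * real k\<close>, the 100 serves twice: a single
    nonzero block already forces \<open>s \<ge> 10\<close>, and from there on twice
    \<open>s^2 / 100\<close> is at most \<open>(s - 2) (s - 3)\<close>.\<close>
  have "\<theta>\<^sup>2 / 100 > 0" using \<theta> by simp
  from shen[OF this] obtain X and k :: nat and p where k: "k \<ge> 1" and p: "\<forall>i<k. pm (p i) \<and> \<tau> (p i) = 1 / of_nat k"
    "\<forall>i<k. \<forall>j<k. i \<noteq> j \<longrightarrow> p i * p j = 0" "(\<Sum>i<k. p i) = 1" and X: "finite X" "X \<subseteq> M"
    "\<forall>N. vna N \<longrightarrow> N \<subseteq> M \<longrightarrow> X \<subseteq> N \<longrightarrow> N = M"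
    and few: "(\<Sum>x\<in>X. real (card {(i, j). i < k \<and> j < k \<and> p i * x * p j \<noteq> 0})) \<le> \<theta>\<^sup>2 / 100 * (real k)\<^sup>2"
    by blast
  define S where "S = (\<lambda>x. {(i, j). i < k \<and> j < k \<and> p i * x * p j \<noteq> 0})"
  have fS: "finite (S x)" for x by (rule finite_subset[of _ "{..<k} \<times> {..<k}"]) (auto simp: S_def)
  define T where "T = (SIGMA x:X. S x)"
  have fT: "finite T" using X(1) fS by (auto simp: T_def)
  have cT: "real (card T) \<le> \<theta>\<^sup>2 / 100 * (real k)\<^sup>2"
    using few X(1) fS by (simp add: T_def S_def card_SigmaI)
  \<comment> \<open>Without a nonzero block \<open>X\<close> contains at most 0, so
    \<open>M = A\<close> would be abelian, and a nonzero \<open>P\<close> could not be equivalent to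
    a part of \<open>1 - P\<close>.\<close>
  have "T \<noteq> {}"
  proof
    assume T: "T = {}"
    have "x = 0" if x: "x \<in> X" for x
    proof -
      have "p i * x * p j = 0" if "i < k" "j < k" for i j using T x that by (auto simp: T_def S_def)
      then have "(\<Sum>i<k. \<Sum>j<k. p i * x * p j) = 0" by simp
      also have "(\<Sum>i<k. \<Sum>j<k. p i * x * p j) = (\<Sum>i<k. p i) * x * (\<Sum>j<k. p j)"
        by (simp only: sum_distrib_left sum_distrib_right) (rule sum.swap)
      finally show ?thesis by (simp add: p(3))
    qed
    then have "X \<subseteq> A" using A_closed(7) by auto
    then have AM: "A = M" using X(3) A_vna A_sub by blast
    obtain v where v: "v \<in> M" "star v * v = P" "ple (v * star v) (1 - P)" using P(3) by (auto simp: mle_def)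
    have "v * star v = P" using A_comm[of v "star v"] v(1,2) A_star AM by auto
    then have "(1 - P) * P = P" using v(3) by (simp add: ple_def)
    then show False using P(1,2) by (simp add: left_diff_distrib paD)
  qed
  then have "card T \<ge> 1" using fT by (simp add: Suc_le_eq card_gt_0_iff)
  then have "1 \<le> \<theta>\<^sup>2 / 100 * (real k)\<^sup>2" using cT by linarith
  then have "10\<^sup>2 \<le> (\<theta> * real k)\<^sup>2" by (simp add: power_mult_distrib)
  then have tk: "10 \<le> \<theta> * real k" by (rule power2_le_imp_le) (use \<theta> in simp)
  have k0: "0 < real k" using k by simp
  have p0: "pm (p 0)" "\<tau> (p 0) = 1 / of_nat k" using p(1) k by auto
  have rp0: "Re (\<tau> (p 0)) = 1 / real k" by (simp add: p0(2) Re_divide_of_nat)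
  \<comment> \<open>The partition is now finer than \<open>E\<close>, so a copy \<open>b\<close> of
    \<open>p 0\<close> can be found in the masa below \<open>E\<close>.\<close>
  have "1 / real k < \<theta>" using tk k0 by (simp add: divide_less_eq)
  then have "\<not> mle E (p 0)" using tracial_mle[OF t pE p0(1)] rp0 by (auto simp: \<theta>_def)
  then have "mle (p 0) E" using comparison[OF p0(1) pE] by blast
  moreover have "fin (p 0)" by (rule fin_sub[OF f1 p0(1)]) simp
  ultimately obtain b where b: "pa b" "ple b E" "meq (p 0) b" using fit[OF sm E(1)] by blast
  note pb = pa_pm[OF b(1)]
  have tb: "\<tau> b = 1 / of_nat k" using tracial_meq[OF t b(3)] p0(2) by simp
  have b0: "b \<noteq> 0" using tb tracialD(8)[OF t] k by auto
  have "\<exists>u\<in>M. star u * u = b \<and> u * star u = p i" if "i < k" for i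
    using tracial_eq_meq[OF f1 t pb, of "p i"] p(1) that tb by (simp add: meq_def)
  then obtain u where u: "\<And>i. i < k \<Longrightarrow> u i \<in> M" "\<And>i. i < k \<Longrightarrow> star (u i) * u i = b" "\<And>i. i < k \<Longrightarrow> u i * star (u i) = p i"
    by metis
  have pu: "pis (u i)" if "i < k" for i by (rule pis_of_initial[OF pb u(2)[OF that]])
  have ub: "u i * b = u i" "b * star (u i) = star (u i)" if "i < k" for i
  proof -
    show "u i * b = u i" using pisD(1)[OF pu[OF that]] u(2)[OF that] by simp
    then have "star (u i * b) = star (u i)" by simp
    then show "b * star (u i) = star (u i)" by (simp add: star_mult pmD(3)[OF pb])
  qed
  have up: "p i * u i = u i" "star (u i) * p i = star (u i)" if "i < k" for i
  proof -
    show "p i * u i = u i" unfolding u(3)[OF that, symmetric] by (simp add: mult.assoc u(2)[OF that] ub[OF that])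
    show "star (u i) * p i = star (u i)"
      unfolding u(3)[OF that, symmetric] by (simp add: mult.assoc[symmetric] u(2)[OF that] ub[OF that])
  qed
  define Y where "Y = (\<lambda>(x, i, j). star (u i) * x * u j) ` T"
  have cY: "card Y \<le> card T" unfolding Y_def by (rule card_image_le[OF fT])
  show ?thesis
  proof (rule construct_finite[OF sm f1 P(1,2) E(1-3) b(1) b0 b(2), of Y])
    show "finite Y" unfolding Y_def using fT by simp
    show "Y \<subseteq> M" using X(2) u(1) by (auto simp: Y_def T_def S_def intro!: M_closed(3) M_closed(5))
    show "b * y * b = y" if yY: "y \<in> Y" for y
    proof -
      obtain d where d: "d \<in> T" "y = (case d of (x, i, j) \<Rightarrow> star (u i) * x * u j)" using yY unfolding Y_def by blast
      obtain x i j where "d = (x, i, j)" by (cases d)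
      then have y: "i < k" "j < k" "y = star (u i) * x * u j" using d by (simp_all add: T_def S_def)
      have "b * y * b = (b * star (u i)) * x * (u j * b)" unfolding y(3) by (simp only: mult.assoc)
      then show ?thesis using ub y by simp
    qed
  next
    fix N x assume N: "vna N" "b \<in> N" "Y \<subseteq> N" and x: "x \<in> M"
    have N0: "0 \<in> N" using salg_closed(3)[OF vna_salg[OF N(1)]] .
    have zero: "star (u i) * z * u j \<in> N" if "i < k" "j < k" "p i * z * p j = 0" for z i j
    proof -
      have "star (u i) * z * u j = (star (u i) * p i) * z * (p j * u j)" using up that by simp
      also have "\<dots> = star (u i) * (p i * z * p j) * u j" by (simp only: mult.assoc)
      finally show ?thesis using that N0 by simp
    qed
    \<comment> \<open>This algebra contains \<open>X\<close>, whose nonzero entries form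
      \<open>Y\<close>; hence it is \<open>M\<close>, and its entries at place (0, 0) recover the
      whole corner of \<open>b\<close>.\<close>
    have "vna (M \<inter> {z. \<forall>i<k. \<forall>j<k. star (u i) * z * u j \<in> N})"
    proof (rule vna_Int[OF vna vna_matrix[OF N(1)]])
      show "norm (u i) \<le> 1" if "i < k" for i using norm_pis[OF pu[OF that]] .
      show "star (u i) * u j \<in> N" if "i < k" "j < k" for i j
      proof (cases "i = j")
        case False
        then show ?thesis using zero[OF that, of 1] p(2) that by simp
      qed (use that u N in simp)
      show "(\<Sum>i<k. u i * star (u i)) = 1" unfolding p(3)[symmetric] by (intro sum.cong refl) (simp add: u(3))
    qed
    moreover have "X \<subseteq> M \<inter> {z. \<forall>i<k. \<forall>j<k. star (u i) * z * u j \<in> N}"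
    proof
      fix z assume z: "z \<in> X"
      have "star (u i) * z * u j \<in> N" if ij: "i < k" "j < k" for i j
      proof (cases "p i * z * p j = 0")
        case False
        then have "(z, i, j) \<in> T" using z ij by (simp add: T_def S_def)
        then have "star (u i) * z * u j \<in> Y" unfolding Y_def by (force simp: image_iff)
        then show ?thesis using N(3) by blast
      qed (rule zero[OF ij])
      then show "z \<in> M \<inter> {z. \<forall>i<k. \<forall>j<k. star (u i) * z * u j \<in> N}" using z X(2) by blast
    qed
    ultimately have eq: "M \<inter> {z. \<forall>i<k. \<forall>j<k. star (u i) * z * u j \<in> N} = M" using X(3) by blast
    have k0: "0 < k" using k by simp
    define z where "z = u 0 * (b * x * b) * star (u 0)"
    have "z \<in> M" unfolding z_def using u(1)[OF k0] pmD(1)[OF pb] x by (simp add: M_closed)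
    then have "star (u 0) * z * u 0 \<in> N" using eq k0 by blast
    also have "star (u 0) * z * u 0 = (star (u 0) * u 0) * b * x * b * (star (u 0) * u 0)" unfolding z_def by (simp only: mult.assoc)
    also have "\<dots> = b * x * b" using u(2)[OF k0] pmD(4)[OF pb] by (simp add: mult.assoc)
    finally show "b * x * b \<in> N" .
  next
    fix m :: nat assume m: "\<And>\<tau>. tracial \<tau> \<Longrightarrow> Re (\<tau> E) \<le> (real m + 2) * Re (\<tau> b)"
    define s where "s = \<theta> * real k"
    have "\<theta> \<le> (real m + 2) * (1 / real k)" using m[OF t] tb by (simp add: \<theta>_def Re_divide_of_nat)
    then have ms: "s - 2 \<le> real m" using k0 by (simp add: s_def field_simps)
    have s10: "10 \<le> s" using tk by (simp add: s_def)
    have "2 * real (card Y) \<le> 2 * (s\<^sup>2 / 100)" using cY cT by (simp add: s_def power_mult_distrib)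
    also have "\<dots> \<le> (s - 2) * (s - 3)"
    proof -
      have "0 \<le> (s - 10) * (s - 10)" by simp
      moreover have "10 * 10 \<le> s * s" using s10 by (intro mult_mono) auto
      moreover have "10 * s \<le> s * s" using s10 by (intro mult_right_mono) auto
      ultimately show ?thesis by (simp add: power2_eq_square algebra_simps)
    qed
    also have "\<dots> \<le> real m * (real m - 1)" using ms s10 by (intro mult_mono) auto
    also have "\<dots> = real (m * (m - 1))" using ms s10 by (cases m) (auto simp: algebra_simps)
    finally show "2 * card Y \<le> m * (m - 1)" by linarith
  qed
qed

end

section \<open>Concrete von Neumann algebras\<close>

text \<open>A basic open set of the product topology restricts finitely many coordinates, so a
  finite set of vectors and one common radius describe the neighbourhoods.\<close>

lemma closedin_strong_iff:
  fixes N :: "('h::complex_hilbert \<Rightarrow>\<^sub>L 'h) set"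
  shows "closedin strong_operator_topology N \<longleftrightarrow>
    (\<forall>T. (\<forall>F e. finite F \<longrightarrow> e > 0 \<longrightarrow> (\<exists>S\<in>N. \<forall>v\<in>F. norm (blinfun_apply T v - blinfun_apply S v) < e)) \<longrightarrow> T \<in> N)"
    (is "_ \<longleftrightarrow> ?R")
proof
  assume "closedin strong_operator_topology N"
  then have "openin strong_operator_topology (- N)"
    by (simp add: closedin_def strong_operator_topology_topspace Compl_eq_Diff_UNIV)
  then obtain U where U: "open U" "- N = blinfun_apply -` U"
    unfolding strong_operator_topology_def openin_pullback_topology by auto
  show ?R
  proof (intro allI impI, rule ccontr)
    fix T assume T: "\<forall>F e. finite F \<longrightarrow> e > 0 \<longrightarrow> (\<exists>S\<in>N. \<forall>v\<in>F. norm (blinfun_apply T v - blinfun_apply S v) < e)"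
      and "T \<notin> N"
    then have TU: "blinfun_apply T \<in> U" using U(2) by blast
    have "openin (product_topology (\<lambda>i. euclidean) UNIV) U" using U(1) by (simp add: open_fun_def)
    from product_topology_open_contains_basis[OF this TU]
    obtain X where X: "blinfun_apply T \<in> (\<Pi>\<^sub>E i\<in>UNIV. X i)" "\<And>i. open (X i)" "finite {i. X i \<noteq> UNIV}" "(\<Pi>\<^sub>E i\<in>UNIV. X i) \<subseteq> U"
      by auto
    define F where "F = {i. X i \<noteq> UNIV}"
    have "\<exists>e>0. ball (blinfun_apply T i) e \<subseteq> X i" for i
      using X(1,2) by (auto simp: open_contains_ball PiE_iff)
    then obtain e where e: "\<And>i. e i > 0" "\<And>i. ball (blinfun_apply T i) (e i) \<subseteq> X i" by metis
    have fF: "finite (insert 1 (e ` F))" using X(3) by (simp add: F_def)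
    \<comment> \<open>The inserted 1 keeps the minimum defined when \<open>F\<close> is
      empty.\<close>
    define e0 where "e0 = Min (insert 1 (e ` F))"
    have "e0 > 0" unfolding e0_def using fF e(1) by (subst Min_gr_iff) auto
    then obtain S where S: "S \<in> N" "\<forall>v\<in>F. norm (blinfun_apply T v - blinfun_apply S v) < e0"
      using T X(3) F_def by blast
    have "blinfun_apply S i \<in> X i" for i
    proof (cases "i \<in> F")
      case True
      then have "e0 \<le> e i" unfolding e0_def using fF by (intro Min_le) auto
      then have "blinfun_apply S i \<in> ball (blinfun_apply T i) (e i)" using S(2) True by (auto simp: dist_norm)
      then show ?thesis using e(2) by blast
    qed (simp add: F_def)
    then have "blinfun_apply S \<in> U" using X(4) by (auto simp: PiE_iff)
    then show False using S(1) U(2) by blast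
  qed
next
  assume R: ?R
  have "openin strong_operator_topology (- N)"
  proof (subst openin_subopen, intro ballI)
    fix T assume "T \<in> - N"
    then have "\<not> (\<forall>F e. finite F \<longrightarrow> e > 0 \<longrightarrow> (\<exists>S\<in>N. \<forall>v\<in>F. norm (blinfun_apply T v - blinfun_apply S v) < e))"
      using R by (metis ComplD)
    then obtain F e where F: "finite F" "e > 0" "\<And>S. S \<in> N \<Longrightarrow> \<not> (\<forall>v\<in>F. norm (blinfun_apply T v - blinfun_apply S v) < e)"
      by blast
    show "\<exists>W. openin strong_operator_topology W \<and> T \<in> W \<and> W \<subseteq> - N"
    proof (intro exI conjI)
      show "openin strong_operator_topology {S. \<forall>v\<in>F. blinfun_apply S v \<in> ball (blinfun_apply T v) e}"
        by (rule strong_operator_topology_basis[OF F(1)]) simp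
      show "T \<in> {S. \<forall>v\<in>F. blinfun_apply S v \<in> ball (blinfun_apply T v) e}" using F(2) by simp
      show "{S. \<forall>v\<in>F. blinfun_apply S v \<in> ball (blinfun_apply T v) e} \<subseteq> - N"
      proof
        fix S assume "S \<in> {S. \<forall>v\<in>F. blinfun_apply S v \<in> ball (blinfun_apply T v) e}"
        then have "\<forall>v\<in>F. norm (blinfun_apply T v - blinfun_apply S v) < e" by (simp add: dist_norm)
        then show "S \<in> - N" using F(3)[of S] by blast
      qed
    qed
  qed
  then show "closedin strong_operator_topology N"
    by (simp add: closedin_def strong_operator_topology_topspace Compl_eq_Diff_UNIV)
qed

definition cops :: "('h::complex_hilbert \<Rightarrow>\<^sub>L 'h) set \<Rightarrow> 'h cop set" where
  "cops N = {x. Rep_cop x \<in> N}"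

lemmas Rep_simps = zero_cop.rep_eq plus_cop.rep_eq minus_cop.rep_eq times_cop.rep_eq one_cop.rep_eq
  star.rep_eq sc.rep_eq norm_cop.rep_eq ap.rep_eq

lemma cops_iff: "x \<in> cops N \<longleftrightarrow> Rep_cop x \<in> N"
  by (simp add: cops_def)

lemma Rep_image_cops: "N \<subseteq> bounded_operators \<Longrightarrow> Rep_cop ` cops N = N"
proof (intro equalityI subsetI)
  fix T assume N: "N \<subseteq> bounded_operators" and T: "T \<in> N"
  then have "Rep_cop (Abs_cop T) = T" by (intro Abs_cop_inverse) auto
  then show "T \<in> Rep_cop ` cops N" using T by (metis cops_iff imageI)
qed (auto simp: cops_iff)

lemma Rep_cases:
  assumes "N \<subseteq> bounded_operators" "T \<in> N"
  obtains x where "T = Rep_cop x" "x \<in> cops N"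
  using Rep_image_cops[OF assms(1)] assms(2) by auto

lemma Rep_sum: "Rep_cop (\<Sum>i\<in>I. f i) = (\<Sum>i\<in>I. Rep_cop (f i))"
  by (induct I rule: infinite_finite_induct) (simp_all add: Rep_simps)

lemma cops_mono_iff:
  assumes M: "M \<subseteq> bounded_operators"
  shows "cops M \<subseteq> cops N \<longleftrightarrow> M \<subseteq> N"
proof
  assume "cops M \<subseteq> cops N"
  then show "M \<subseteq> N" using Rep_cases[OF M] by (metis cops_iff subset_iff)
qed (auto simp: cops_iff)

lemma cops_image: "cops (Rep_cop ` B) = B"
  by (auto simp: cops_iff Rep_cop_inject)

lemma star_subalgebra_image_iff:
  "star_subalgebra (Rep_cop ` B) \<longleftrightarrow> 0 \<in> B \<and> (\<forall>x\<in>B. \<forall>y\<in>B. x + y \<in> B \<and> x * y \<in> B) \<and>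
     (\<forall>c. \<forall>x\<in>B. sc c * x \<in> B) \<and> (\<forall>x\<in>B. star x \<in> B)"
proof -
  have m: "Rep_cop x \<in> Rep_cop ` B \<longleftrightarrow> x \<in> B" for x by (auto simp: Rep_cop_inject)
  have "Rep_cop ` B \<subseteq> bounded_operators" using Rep_cop by blast
  then show ?thesis unfolding star_subalgebra_def ball_simps by (simp only: Rep_simps[symmetric] m simp_thms)
qed

lemma von_neumann_algebra_vna:
  assumes "von_neumann_algebra N"
  shows "vna (cops N)" "N \<subseteq> bounded_operators"
proof -
  have N: "star_subalgebra N" "id_blinfun \<in> N" "closedin strong_operator_topology N"
    using assms by (simp_all add: von_neumann_algebra_def)
  then show sub: "N \<subseteq> bounded_operators" by (simp add: star_subalgebra_def)
  have "star_subalgebra (Rep_cop ` cops N)" using N(1) Rep_image_cops[OF sub] by simp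
  note N1 = this[unfolded star_subalgebra_image_iff]
  show "vna (cops N)" unfolding vna_def
  proof (intro conjI allI impI)
    fix x assume x: "\<forall>F e. finite F \<longrightarrow> 0 < e \<longrightarrow> (\<exists>y\<in>cops N. \<forall>v\<in>F. norm (x \<cdot> v - y \<cdot> v) < e)"
    have "Rep_cop x \<in> N"
    proof (rule mp[OF spec[OF N(3)[unfolded closedin_strong_iff], of "Rep_cop x"]])
      show "\<forall>F e. finite F \<longrightarrow> 0 < e \<longrightarrow> (\<exists>S\<in>N. \<forall>v\<in>F. norm (blinfun_apply (Rep_cop x) v - blinfun_apply S v) < e)"
        using x by (metis cops_iff ap.rep_eq)
    qed
    then show "x \<in> cops N" by (simp add: cops_iff)
  qed (use N1 N(2) in \<open>auto simp: cops_iff Rep_simps\<close>)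
qed

text \<open>Closure is taken among all bounded real-linear operators, so complex linearity of a
  limit has to be proved along with its membership.\<close>

lemma vna_von_neumann_algebra:
  assumes B: "vna B"
  shows "von_neumann_algebra (Rep_cop ` B)"
  unfolding von_neumann_algebra_def
proof (intro conjI)
  show "star_subalgebra (Rep_cop ` B)"
    unfolding star_subalgebra_image_iff using vnaD(2-5)[OF B] salg_closed(3)[OF vna_salg[OF B]] by simp
  show "id_blinfun \<in> Rep_cop ` B" using vnaD(1)[OF B] by (metis imageI one_cop.rep_eq)
  show "closedin strong_operator_topology (Rep_cop ` B)"
    unfolding closedin_strong_iff
  proof (intro allI impI)
    fix T assume T: "\<forall>F e. finite F \<longrightarrow> e > 0 \<longrightarrow>
      (\<exists>S\<in>Rep_cop ` B. \<forall>v\<in>F. norm (blinfun_apply T v - blinfun_apply S v) < e)"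
    have "blinfun_apply T (c *\<^sub>C v) = c *\<^sub>C blinfun_apply T v" for c v
    proof (rule ccontr)
      assume ne: "blinfun_apply T (c *\<^sub>C v) \<noteq> c *\<^sub>C blinfun_apply T v"
      define d where "d = norm (blinfun_apply T (c *\<^sub>C v) - c *\<^sub>C blinfun_apply T v)"
      define e where "e = d / (cmod c + 1)"
      have n1: "cmod c + 1 > 0" by (simp add: add_nonneg_pos)
      have e: "e > 0" using ne n1 by (simp add: d_def e_def)
      obtain y where y: "norm (blinfun_apply T v - y \<cdot> v) < e" "norm (blinfun_apply T (c *\<^sub>C v) - y \<cdot> (c *\<^sub>C v)) < e"
        using T[rule_format, of "{v, c *\<^sub>C v}" e] e by (auto simp: ap.rep_eq)
      have "d = norm ((blinfun_apply T (c *\<^sub>C v) - y \<cdot> (c *\<^sub>C v)) - c *\<^sub>C (blinfun_apply T v - y \<cdot> v))"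
        by (simp add: d_def scaleC_diff_right)
      also have "\<dots> \<le> norm (blinfun_apply T (c *\<^sub>C v) - y \<cdot> (c *\<^sub>C v)) + cmod c * norm (blinfun_apply T v - y \<cdot> v)"
        by (rule order_trans[OF norm_triangle_ineq4]) (simp add: norm_scaleC)
      also have "\<dots> < e + cmod c * e"
        using y by (intro add_less_le_mono mult_left_mono) auto
      also have "\<dots> = (cmod c + 1) * e" by (simp add: algebra_simps)
      also have "\<dots> = d" using n1 by (simp add: e_def)
      finally show False by simp
    qed
    then have "T \<in> bounded_operators" by (simp add: bounded_operators_def)
    then obtain x where x: "T = Rep_cop x" by (metis Rep_cop_cases)
    have "x \<in> B" by (rule vnaD(6)[OF B]) (use T x in \<open>simp add: ap.rep_eq\<close>)
    then show "T \<in> Rep_cop ` B" using x by simp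
  qed
qed

lemma W_star_eqI:
  assumes M: "von_neumann_algebra M" and S: "S \<subseteq> M"
    and gen: "\<And>N. vna N \<Longrightarrow> (\<And>x. Rep_cop x \<in> S \<Longrightarrow> x \<in> N) \<Longrightarrow> cops M \<subseteq> N"
  shows "M = W_star M S"
  unfolding W_star_def
proof (rule hull_unique[symmetric])
  fix N assume N: "S \<subseteq> N" "von_neumann_algebra N \<and> N \<subseteq> M"
  have "cops M \<subseteq> cops N" by (rule gen) (use N von_neumann_algebra_vna in \<open>auto simp: cops_iff\<close>)
  then show "M \<subseteq> N" using cops_mono_iff von_neumann_algebra_vna(2)[OF M] by blast
qed (use M S in auto)

lemma W_star_minimal:
  assumes W: "W_star M X = M" and N: "vna N" "N \<subseteq> cops M" and X: "X \<subseteq> Rep_cop ` N" and M: "M \<subseteq> bounded_operators"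
  shows "N = cops M"
proof -
  have "W_star M X \<subseteq> Rep_cop ` N"
    unfolding W_star_def by (rule hull_minimal) (use X N vna_von_neumann_algebra in \<open>auto simp: cops_iff\<close>)
  then have "cops M \<subseteq> N" using W by (auto simp: cops_iff Rep_cop_inject)
  then show ?thesis using N by blast
qed

text \<open>For self-adjoint \<open>x\<close> commuting with \<open>A\<close>, the relative bicommutant of \<open>A\<close> and \<open>x\<close> is abelian.\<close>

lemma masa_max:
  assumes M: "von_neumann_algebra M" and A: "masa M A" and x: "x \<in> cops M" "\<And>a. a \<in> cops A \<Longrightarrow> x * a = a * x"
  shows "x \<in> cops A"
proof -
  have bM: "M \<subseteq> bounded_operators" using von_neumann_algebra_vna[OF M] by blast
  have AM: "A \<subseteq> M" and Ab: "abelian A" and As: "star_subalgebra A"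
    and Am: "\<And>B. B \<subseteq> M \<Longrightarrow> star_subalgebra B \<Longrightarrow> abelian B \<Longrightarrow> A \<subseteq> B \<Longrightarrow> B = A" using A unfolding masa_def by blast+
  have bA: "A \<subseteq> bounded_operators" using AM bM by simp
  have "star_subalgebra (Rep_cop ` cops A)" using As Rep_image_cops[OF bA] by simp
  note A1 = this[unfolded star_subalgebra_image_iff]
  note Mc = vnaD(1-5)[OF von_neumann_algebra_vna(1)[OF M]] salg_closed(2,3)[OF vna_salg[OF von_neumann_algebra_vna(1)[OF M]]]
  have Ac: "a * b = b * a" if "a \<in> cops A" "b \<in> cops A" for a b
    using Ab that by (simp add: abelian_def cops_iff Rep_simps flip: Rep_cop_inject)
  have sa: "z \<in> cops A" if z: "z \<in> cops M" "star z = z" "\<And>a. a \<in> cops A \<Longrightarrow> z * a = a * z" for z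
  proof -
    define B where "B = {w \<in> cops M. \<forall>y\<in>cops M. (\<forall>a\<in>insert z (cops A). y * a = a * y) \<longrightarrow> w * y = y * w}"
    have comm: "a * b = b * a" if "a \<in> insert z (cops A)" "b \<in> insert z (cops A)" for a b
      using that z(3) Ac by auto
    have sub: "insert z (cops A) \<subseteq> B"
      using z(1) AM by (auto simp: B_def cops_iff)
    have starB: "star w \<in> B" if w: "w \<in> B" for w
      unfolding B_def
    proof (intro CollectI conjI ballI impI)
      show "star w \<in> cops M" using w Mc(5) by (auto simp: B_def)
      fix y assume y: "y \<in> cops M" "\<forall>a\<in>insert z (cops A). y * a = a * y"
      have "star y * a = a * star y" if a: "a \<in> insert z (cops A)" for a
      proof -
        have "star a \<in> insert z (cops A)" using a z(2) A1 by auto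
        then have "y * star a = star a * y" using y(2) by blast
        then have "star (y * star a) = star (star a * y)" by simp
        then show ?thesis by (simp add: star_mult)
      qed
      then have "w * star y = star y * w" using w Mc(5)[OF y(1)] by (simp add: B_def)
      then have "star (w * star y) = star (star y * w)" by simp
      then show "star w * y = y * star w" by (simp add: star_mult)
    qed
    have "star_subalgebra (Rep_cop ` B)" unfolding star_subalgebra_image_iff
    proof (intro conjI ballI allI)
      show "0 \<in> B" using Mc(7) by (simp add: B_def)
      fix v w assume v: "v \<in> B" and w: "w \<in> B"
      show "v + w \<in> B" using v w Mc(2) by (auto simp: B_def distrib_left distrib_right)
      show "v * w \<in> B" using v w Mc(3) by (auto simp: B_def) (metis mult.assoc)
    next
      fix c w assume w: "w \<in> B"
      then show "sc c * w \<in> B" using Mc(4) by (auto simp: B_def) (metis mult.assoc sc_commute)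
    qed (rule starB)
    moreover have "abelian (Rep_cop ` B)" unfolding abelian_def
    proof (intro ballI)
      fix S T assume "S \<in> Rep_cop ` B" "T \<in> Rep_cop ` B"
      then obtain v w where v: "S = Rep_cop v" "v \<in> B" and w: "T = Rep_cop w" "w \<in> B" by blast
      \<comment> \<open>\<open>v\<close> commutes with \<open>z\<close> and with the masa, which
        makes it an admissible test element for \<open>w\<close>.\<close>
      have "a * v = v * a" if "a \<in> insert z (cops A)" for a
      proof -
        have "a \<in> cops M" using that z(1) AM by (auto simp: cops_iff)
        then show ?thesis using v(2) comm that by (simp add: B_def)
      qed
      then have "w * v = v * w" using w(2) v(2) by (auto simp: B_def)
      then show "S o\<^sub>L T = T o\<^sub>L S" unfolding v w by (simp flip: times_cop.rep_eq)
    qed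
    moreover have "Rep_cop ` B \<subseteq> M" by (auto simp: B_def cops_iff)
    moreover have "A \<subseteq> Rep_cop ` B" using sub Rep_image_cops[OF bA] by blast
    ultimately have "Rep_cop ` B = A" using Am by blast
    then have "B = cops A" using cops_image by blast
    then show ?thesis using sub by blast
  qed
  have sx: "star x * a = a * star x" if "a \<in> cops A" for a
    using x(2)[of "star a"] A1 that arg_cong[of _ _ star] by (metis star_mult star_star)
  have h1: "x + star x \<in> cops A"
    by (rule sa) (use x sx Mc in \<open>auto simp: algebra_simps\<close>)
  have h2: "sc \<i> * (x - star x) \<in> cops A"
  proof (rule sa)
    show "sc \<i> * (x - star x) \<in> cops M" using x Mc by auto
    have "sc (-\<i>) = - (sc \<i> :: 'a cop)" using sc_mult[of "of_real (-1)" \<i>, unfolded sc_of_real, where 'a='a] by simp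
    then show "star (sc \<i> * (x - star x)) = sc \<i> * (x - star x)"
      by (simp add: star_mult sc_commute right_diff_distrib)
    fix a assume "a \<in> cops A"
    then have "(x - star x) * a = a * (x - star x)" using x(2) sx by (simp add: left_diff_distrib right_diff_distrib)
    then show "sc \<i> * (x - star x) * a = a * (sc \<i> * (x - star x))" by (metis mult.assoc sc_commute)
  qed
  have "sc (1/2) * ((x + star x) + sc (-\<i>) * (sc \<i> * (x - star x))) \<in> cops A" using h1 h2 A1 by blast
  also have "sc (-\<i>) * (sc \<i> * (x - star x)) = x - star x" by (simp add: mult.assoc[symmetric] sc_mult)
  also have "sc (1/2) * ((x + star x) + (x - star x)) = (sc (1/2) + sc (1/2)) * x" by (simp add: distrib_left distrib_right)
  also have "\<dots> = x" by (simp add: sc_add)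
  finally show ?thesis .
qed

section \<open>Consequences of a separable predual\<close>

lemma vector_functional_predual:
  fixes xs us :: "nat \<Rightarrow> 'h::complex_hilbert"
  assumes M: "von_neumann_algebra M"
  shows "(\<lambda>T\<in>M. \<Sum>i<n. cinner (blinfun_apply T (xs i)) (us i)) \<in> predual M" (is "?\<phi> \<in> _")
  unfolding predual_def
proof (intro CollectI conjI)
  have sM: "star_subalgebra M" using M by (simp add: von_neumann_algebra_def)
  show "linear_functional M ?\<phi>"
    unfolding linear_functional_def
    using sM by (auto simp: star_subalgebra_def blinfun.add_left cinner_add_left sum.distrib
        scalar_op.rep_eq cinner_scaleC_left sum_distrib_left)
  \<comment> \<open>The ultraweak topology is given by square summable sequences; padding with 0
    turns the finite sum into such a series.\<close>
  define pad where "pad = (\<lambda>(ys :: nat \<Rightarrow> 'h) i. if i < n then ys i else 0)"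
  have ss: "square_summable (pad ys)" for ys
    unfolding square_summable_def by (rule summable_finite[of "{..<n}"]) (auto simp: pad_def)
  define I where "I = {(xs, ys). square_summable (xs :: nat \<Rightarrow> 'h) \<and> square_summable (ys :: nat \<Rightarrow> 'h)}"
  define f where "f = (\<lambda>T :: 'h \<Rightarrow>\<^sub>L 'h. \<lambda>(xs, ys)\<in>I. \<Sum>n. cinner (blinfun_apply T (xs n)) (ys n))"
  have uw: "ultraweak_topology = pullback_topology UNIV f (product_topology (\<lambda>_. euclidean) I)"
    unfolding ultraweak_topology_def Let_def I_def f_def by (rule refl)
  have pI: "(pad xs, pad us) \<in> I" using ss by (simp add: I_def)
  have "continuous_map ultraweak_topology euclidean ((\<lambda>g. g (pad xs, pad us)) \<circ> f)"
    unfolding uw by (intro continuous_map_pullback continuous_map_product_coordinates pI)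
  moreover have "((\<lambda>g. g (pad xs, pad us)) \<circ> f) T = (\<Sum>i<n. cinner (blinfun_apply T (xs i)) (us i))" for T
  proof -
    have "((\<lambda>g. g (pad xs, pad us)) \<circ> f) T = (\<Sum>m. cinner (blinfun_apply T (pad xs m)) (pad us m))"
      using pI by (simp add: f_def)
    also have "\<dots> = (\<Sum>i<n. cinner (blinfun_apply T (pad xs i)) (pad us i))"
      by (rule suminf_finite) (auto simp: pad_def)
    also have "\<dots> = (\<Sum>i<n. cinner (blinfun_apply T (xs i)) (us i))" by (intro sum.cong) (auto simp: pad_def)
    finally show ?thesis .
  qed
  ultimately have "continuous_map ultraweak_topology euclidean (\<lambda>T. \<Sum>i<n. cinner (blinfun_apply T (xs i)) (us i))"
    by (metis (no_types, lifting) ext)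
  then have "continuous_map (subtopology ultraweak_topology M) euclidean (\<lambda>T. \<Sum>i<n. cinner (blinfun_apply T (xs i)) (us i))"
    by (rule continuous_map_from_subtopology)
  then show "continuous_map (subtopology ultraweak_topology M) euclidean ?\<phi>"
    by (rule continuous_map_eq) (simp add: topspace_subtopology)
qed

lemma separable_predual_approx:
  assumes M: "von_neumann_algebra M" and sp: "separable_predual M"
  obtains D :: "(('h::complex_hilbert \<Rightarrow>\<^sub>L 'h) \<Rightarrow> complex) set" where "countable D"
    "\<And>(n::nat) xs us \<epsilon>. \<epsilon> > 0 \<Longrightarrow> \<exists>\<psi>\<in>D. \<forall>x\<in>cops M. cmod ((\<Sum>i<n. cinner (x \<cdot> xs i) (us i)) - \<psi> (Rep_cop x)) \<le> \<epsilon> * norm x"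
proof -
  obtain D where D: "countable D" "\<forall>\<phi>\<in>predual M. \<forall>\<epsilon>>0. \<exists>\<psi>\<in>D. \<forall>T\<in>M. cmod (\<phi> T - \<psi> T) \<le> \<epsilon> * norm T"
    using sp unfolding separable_predual_def by blast
  have "\<exists>\<psi>\<in>D. \<forall>x\<in>cops M. cmod ((\<Sum>i<n. cinner (x \<cdot> xs i) (us i)) - \<psi> (Rep_cop x)) \<le> \<epsilon> * norm x"
    if e0: "\<epsilon> > 0" for n :: nat and xs us :: "nat \<Rightarrow> 'h" and \<epsilon> :: real
  proof -
    obtain \<psi> where \<psi>: "\<psi> \<in> D" "\<forall>T\<in>M. cmod ((\<lambda>T\<in>M. \<Sum>i<n. cinner (blinfun_apply T (xs i)) (us i)) T - \<psi> T) \<le> \<epsilon> * norm T"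
      using D(2)[rule_format, OF vector_functional_predual[OF M, where n=n and xs=xs and us=us] e0] by blast
    show ?thesis
    proof (intro bexI[of _ \<psi>] ballI)
      fix x assume "x \<in> cops M"
      then have "Rep_cop x \<in> M" by (simp add: cops_iff)
      then show "cmod ((\<Sum>i<n. cinner (x \<cdot> xs i) (us i)) - \<psi> (Rep_cop x)) \<le> \<epsilon> * norm x"
        using \<psi>(2)[rule_format, of "Rep_cop x"] by (simp add: ap.rep_eq norm_cop.rep_eq)
    qed (rule \<psi>(1))
  qed
  then show ?thesis using D(1) that by blast
qed

text \<open>A unit vector in the range of each projection gives vector functionals that take the
  values 1 and 0 on two orthogonal projections. Approximations within 1/3 from a countable set still
  differ, so the family injects into that set.\<close>

lemma separable_predual_sigma_finite:
  fixes M :: "('h::complex_hilbert \<Rightarrow>\<^sub>L 'h) set"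
  assumes M: "von_neumann_algebra M" and sp: "separable_predual M"
    and F: "F \<subseteq> cops M" "\<And>e. e \<in> F \<Longrightarrow> proj e \<and> e \<noteq> 0" "\<And>e f. e \<in> F \<Longrightarrow> f \<in> F \<Longrightarrow> e \<noteq> f \<Longrightarrow> e * f = 0"
  shows "countable F"
proof -
  obtain D :: "(('h \<Rightarrow>\<^sub>L 'h) \<Rightarrow> complex) set" where D: "countable D"
    "\<And>(n::nat) xs us \<epsilon>. \<epsilon> > 0 \<Longrightarrow> \<exists>\<psi>\<in>D. \<forall>x\<in>cops M. cmod ((\<Sum>i<n. cinner (x \<cdot> xs i) (us i)) - \<psi> (Rep_cop x)) \<le> \<epsilon> * norm x"
    using separable_predual_approx[OF M sp] by blast
  have "\<exists>w. e \<cdot> w = w \<and> norm w = 1" if "e \<in> F" for e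
  proof -
    have pe: "proj e" "e \<noteq> 0" using F(2)[OF that] by simp_all
    then have "\<not> (\<forall>v. e \<cdot> v = 0)" using cop_eqI[of e 0] by auto
    then obtain v where v: "e \<cdot> v \<noteq> 0" by blast
    have "e \<cdot> e \<cdot> v = e \<cdot> v" using pe by (metis ap_simps(6) projD(2))
    then show ?thesis using v by (intro exI[of _ "(1 / norm (e \<cdot> v)) *\<^sub>R (e \<cdot> v)"]) simp
  qed
  then obtain w where w: "\<And>e. e \<in> F \<Longrightarrow> e \<cdot> w e = w e" "\<And>e. e \<in> F \<Longrightarrow> norm (w e) = 1" by metis
  have "\<exists>\<psi>\<in>D. \<forall>x\<in>cops M. cmod (cinner (x \<cdot> w e) (w e) - \<psi> (Rep_cop x)) \<le> 1/3 * norm x" for e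
    using D(2)[of "1/3" "\<lambda>_. w e" "\<lambda>_. w e" 1] by simp
  then obtain \<psi> where \<psi>: "\<And>e. \<psi> e \<in> D" "\<And>e x. x \<in> cops M \<Longrightarrow> cmod (cinner (x \<cdot> w e) (w e) - \<psi> e (Rep_cop x)) \<le> 1/3 * norm x"
    by metis
  have "inj_on \<psi> F"
  proof (rule inj_onI, rule ccontr)
    fix e f assume e: "e \<in> F" and f: "f \<in> F" and eq: "\<psi> e = \<psi> f" and ne: "e \<noteq> f"
    have eM: "e \<in> cops M" using e F(1) by blast
    have ne1: "norm e \<le> 1" by (rule norm_cop_bound) (use F(2)[OF e] norm_proj_ap in auto)
    have "e \<cdot> w f = (e * f) \<cdot> w f" using w(1)[OF f] by simp
    then have 0: "e \<cdot> w f = 0" using F(3)[OF e f ne] by simp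
    have 1: "cinner (e \<cdot> w e) (w e) = 1" using w[OF e] by (simp add: cinner_self)
    have "cmod (1 - \<psi> e (Rep_cop e)) \<le> 1/3" using \<psi>(2)[OF eM, of e] ne1 1 by simp
    moreover have "cmod (\<psi> e (Rep_cop e)) \<le> 1/3" using \<psi>(2)[OF eM, of f] ne1 0 eq by simp
    ultimately have "cmod 1 \<le> 2/3" using norm_triangle_ineq[of "1 - \<psi> e (Rep_cop e)" "\<psi> e (Rep_cop e)"] by simp
    then show False by simp
  qed
  moreover have "countable (\<psi> ` F)" by (rule countable_subset[OF _ D(1)]) (use \<psi>(1) in blast)
  ultimately show ?thesis by (rule countable_image_inj_on[rotated])
qed

text \<open>For each functional in \<open>D\<close> and each basic open set of complex numbers, one
  element of the unit ball with value in that set is chosen, if there is any. Approximating a given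
  functional by one in \<open>D\<close> then makes these countably many choices dense.\<close>

lemma separable_predual_countably_dense:
  fixes M :: "('h::complex_hilbert \<Rightarrow>\<^sub>L 'h) set"
  assumes M: "von_neumann_algebra M" and sp: "separable_predual M"
  shows "\<exists>S. countable S \<and> S \<subseteq> cops M \<and>
      (\<forall>x\<in>cops M. norm x \<le> 1 \<longrightarrow> (\<forall>(n::nat) xs us. \<forall>\<epsilon>>0. \<exists>s\<in>S.
        cmod ((\<Sum>i<n. cinner (s \<cdot> xs i) (us i)) - (\<Sum>i<n. cinner (x \<cdot> xs i) (us i))) < \<epsilon>))"
proof -
  obtain D :: "(('h \<Rightarrow>\<^sub>L 'h) \<Rightarrow> complex) set" where D: "countable D"
    "\<And>(n::nat) xs us \<epsilon>. \<epsilon> > 0 \<Longrightarrow> \<exists>\<psi>\<in>D. \<forall>x\<in>cops M. cmod ((\<Sum>i<n. cinner (x \<cdot> xs i) (us i)) - \<psi> (Rep_cop x)) \<le> \<epsilon> * norm x"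
    using separable_predual_approx[OF M sp] by blast
  obtain B :: "complex set set" where B: "countable B" "topological_basis B" using ex_countable_basis by blast
  define ok where "ok = (\<lambda>(\<psi>, b) s. s \<in> cops M \<and> norm s \<le> 1 \<and> \<psi> (Rep_cop s) \<in> (b :: complex set))"
  define S where "S = (\<lambda>d. SOME s. ok d s) ` {d \<in> D \<times> B. \<exists>s. ok d s}"
  have okS: "ok d (SOME s. ok d s)" if "\<exists>s. ok d s" for d using someI_ex[OF that] .
  show ?thesis
  proof (intro exI[of _ S] conjI ballI allI impI)
    show "countable S" unfolding S_def
      by (intro countable_image countable_subset[OF _ countable_SIGMA[OF D(1) B(1)]]) auto
    show "S \<subseteq> cops M" using okS by (auto simp: S_def ok_def split: prod.splits)
    fix x and n :: nat and xs us :: "nat \<Rightarrow> 'h" and \<epsilon> :: real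
    assume x: "x \<in> cops M" "norm x \<le> 1" and \<epsilon>: "\<epsilon> > 0"
    define \<phi> where "\<phi> = (\<lambda>x. \<Sum>i<n. cinner (x \<cdot> xs i) (us i))"
    obtain \<psi> where \<psi>: "\<psi> \<in> D" "\<And>x. x \<in> cops M \<Longrightarrow> cmod (\<phi> x - \<psi> (Rep_cop x)) \<le> \<epsilon>/4 * norm x"
      using D(2)[of "\<epsilon>/4" xs us n] \<epsilon> by (auto simp: \<phi>_def)
    have near: "cmod (\<phi> y - \<psi> (Rep_cop y)) \<le> \<epsilon>/4" if "y \<in> cops M" "norm y \<le> 1" for y
      by (rule order_trans[OF \<psi>(2)[OF that(1)]]) (use \<epsilon> mult_left_mono[OF that(2), of "\<epsilon>/4"] in simp)
    obtain b where b: "b \<in> B" "\<psi> (Rep_cop x) \<in> b" "b \<subseteq> ball (\<psi> (Rep_cop x)) (\<epsilon>/4)"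
      using topological_basisE[OF B(2), of "ball (\<psi> (Rep_cop x)) (\<epsilon>/4)" "\<psi> (Rep_cop x)"] \<epsilon> by auto
    have ex: "\<exists>s. ok (\<psi>, b) s" using x b by (auto simp: ok_def)
    define s where "s = (SOME s. ok (\<psi>, b) s)"
    have "s \<in> S" unfolding S_def s_def using ex \<psi>(1) b(1) by blast
    have s: "s \<in> cops M" "norm s \<le> 1" "\<psi> (Rep_cop s) \<in> b" using okS[OF ex] by (simp_all add: s_def ok_def)
    have d: "cmod (\<psi> (Rep_cop s) - \<psi> (Rep_cop x)) < \<epsilon>/4" using s(3) b(3) by (auto simp: dist_norm norm_minus_commute)
    have "\<phi> s - \<phi> x = (\<phi> s - \<psi> (Rep_cop s)) + (\<psi> (Rep_cop s) - \<psi> (Rep_cop x)) - (\<phi> x - \<psi> (Rep_cop x))" by simp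
    also have "cmod \<dots> \<le> cmod (\<phi> s - \<psi> (Rep_cop s)) + cmod (\<psi> (Rep_cop s) - \<psi> (Rep_cop x)) + cmod (\<phi> x - \<psi> (Rep_cop x))"
      by (meson norm_triangle_ineq norm_triangle_ineq4 add_right_mono order_trans)
    also have "\<dots> < \<epsilon>" using near[OF s(1,2)] near[OF x] d \<epsilon> by linarith
    finally show "\<exists>s\<in>S. cmod ((\<Sum>i<n. cinner (s \<cdot> xs i) (us i)) - (\<Sum>i<n. cinner (x \<cdot> xs i) (us i))) < \<epsilon>"
      using \<open>s \<in> S\<close> by (auto simp: \<phi>_def)
  qed
qed

lemma separable_factor_cops:
  assumes fM: "factor M" and sp: "separable_predual M"
  shows "separable_factor (cops M)"
proof -
  have M: "von_neumann_algebra M" and c: "center M = range scalar_op" using fM by (simp_all add: factor_def)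
  show ?thesis
  proof
    show "vna (cops M)" by (rule von_neumann_algebra_vna(1)[OF M])
    fix x assume x: "x \<in> cops M" "\<And>y. y \<in> cops M \<Longrightarrow> x * y = y * x"
    have "Rep_cop x o\<^sub>L T = T o\<^sub>L Rep_cop x" if T: "T \<in> M" for T
    proof -
      obtain y where "T = Rep_cop y" "y \<in> cops M" using Rep_cases[OF von_neumann_algebra_vna(2)[OF M] T] by blast
      then show ?thesis using x(2) by (metis times_cop.rep_eq)
    qed
    then have "Rep_cop x \<in> center M" using x(1) by (simp add: center_def cops_iff)
    then show "\<exists>c. x = sc c" unfolding c by (metis Rep_cop_inject imageE sc.rep_eq)
  next
    show "countable F" if "F \<subseteq> cops M" "\<And>e. e \<in> F \<Longrightarrow> proj e \<and> e \<noteq> 0"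
      "\<And>e f. e \<in> F \<Longrightarrow> f \<in> F \<Longrightarrow> e \<noteq> f \<Longrightarrow> e * f = 0" for F
      using separable_predual_sigma_finite[OF M sp that] .
  qed (rule separable_predual_countably_dense[OF M sp])
qed

lemma factor_with_masa_cops:
  assumes fM: "factor M" and sp: "separable_predual M" and A: "masa M A"
  shows "factor_with_masa (cops M) (cops A)"
proof -
  have M: "von_neumann_algebra M" using fM by (simp_all add: factor_def)
  have AM: "A \<subseteq> M" and Ab: "abelian A" and As: "star_subalgebra A" using A by (auto simp: masa_def)
  interpret separable_factor "cops M" by (rule separable_factor_cops[OF fM sp])
  show ?thesis
  proof unfold_locales
    show "cops A \<subseteq> cops M" using AM by (auto simp: cops_iff)
    show "a * b = b * a" if "a \<in> cops A" "b \<in> cops A" for a b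
      using Ab that by (simp add: abelian_def cops_iff Rep_simps flip: Rep_cop_inject)
    show "star a \<in> cops A" if "a \<in> cops A" for a
      using As that by (simp add: star_subalgebra_def cops_iff Rep_simps)
    show "x \<in> cops A" if "x \<in> cops M" "\<And>a. a \<in> cops A \<Longrightarrow> x * a = a * x" for x
      by (rule masa_max[OF M A that])
  qed
qed

section \<open>Translation of the concrete notions and of the hypotheses on the type\<close>

locale operator_factor = separable_factor "cops M" for M :: "('h::complex_hilbert \<Rightarrow>\<^sub>L 'h) set" +
  assumes M_bounded: "M \<subseteq> bounded_operators"
begin

lemma proj_le_iff:
  assumes "proj f"
  shows "proj_le (Rep_cop e) (Rep_cop f) \<longleftrightarrow> ple e f"
proof
  assume le: "proj_le (Rep_cop e) (Rep_cop f)"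
  show "ple e f" unfolding ple_def
  proof (rule cop_eqI)
    fix v
    obtain w where "e \<cdot> v = f \<cdot> w" using le by (auto simp: proj_le_def ap.rep_eq)
    then show "(f * e) \<cdot> v = e \<cdot> v" using projD(2)[OF assms] by (metis ap_simps(6))
  qed
next
  assume "ple e f"
  then have "e \<cdot> v = f \<cdot> (e \<cdot> v)" for v by (metis ap_simps(6) ple_def)
  then show "proj_le (Rep_cop e) (Rep_cop f)" unfolding proj_le_def ap.rep_eq by (metis image_subsetI rangeI)
qed

lemma pm_iff: "Rep_cop e \<in> projections M \<longleftrightarrow> pm e"
  by (simp add: projections_def pm_def proj_def cops_iff Rep_simps flip: Rep_cop_inject)

lemma projections_cases:
  assumes "P \<in> projections M"
  obtains e where "P = Rep_cop e" "pm e"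
  using assms Rep_cases[OF M_bounded, of P] pm_iff unfolding projections_def by blast

lemma mvn_equiv_iff:
  assumes "pm p"
  shows "mvn_equiv M (Rep_cop p) (Rep_cop q) \<longleftrightarrow> meq p q"
proof
  assume "mvn_equiv M (Rep_cop p) (Rep_cop q)"
  then obtain V where V: "V \<in> M" "adj V o\<^sub>L V = Rep_cop p" "V o\<^sub>L adj V = Rep_cop q"
    unfolding mvn_equiv_def by blast
  obtain v where "V = Rep_cop v" "v \<in> cops M" using Rep_cases[OF M_bounded V(1)] by blast
  then show "meq p q" unfolding meq_def using V by (metis Rep_cop_inject star.rep_eq times_cop.rep_eq)
next
  assume "meq p q"
  then obtain v where v: "v \<in> cops M" "star v * v = p" "v * star v = q" by (auto simp: meq_def)
  have "v * star v * v = v" using pisD(1)[OF pis_of_initial[OF assms v(2)]] by (simp add: mult.assoc)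
  then have "partial_isometry (Rep_cop v)" unfolding partial_isometry_def by (simp flip: star.rep_eq times_cop.rep_eq)
  then show "mvn_equiv M (Rep_cop p) (Rep_cop q)" unfolding mvn_equiv_def
    using v by (intro bexI[of _ "Rep_cop v"]) (auto simp: cops_iff simp flip: star.rep_eq times_cop.rep_eq)
qed

lemma finite_projection_iff: "finite_projection M (Rep_cop p) \<longleftrightarrow> fin p"
proof
  assume f: "finite_projection M (Rep_cop p)"
  then have p: "pm p" by (simp add: finite_projection_def pm_iff)
  show "fin p" unfolding fin_def
  proof (intro conjI allI impI)
    fix q assume q: "pm q" "meq p q" "ple q p"
    then have "Rep_cop q = Rep_cop p"
      using f p by (simp add: finite_projection_def pm_iff mvn_equiv_iff proj_le_iff pmD(2))
    then show "q = p" by (simp add: Rep_cop_inject)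
  qed (rule p)
next
  assume f: "fin p"
  note p = fin_pm[OF f]
  show "finite_projection M (Rep_cop p)" unfolding finite_projection_def
  proof (intro conjI ballI impI)
    fix Q assume Q: "Q \<in> projections M" "mvn_equiv M (Rep_cop p) Q \<and> proj_le Q (Rep_cop p)"
    obtain q where "Q = Rep_cop q" "pm q" using projections_cases[OF Q(1)] by blast
    then have "q = p" using Q(2) f p by (auto simp: fin_def mvn_equiv_iff proj_le_iff pmD(2))
    then show "Q = Rep_cop p" using \<open>Q = Rep_cop q\<close> by simp
  qed (simp add: pm_iff p)
qed

lemma mvn_le_mle:
  assumes p: "pm p" and q: "pm q" and le: "mvn_le M (Rep_cop p) (Rep_cop q)"
  shows "mle p q"
proof -
  obtain Q0 where Q0: "Q0 \<in> projections M" "mvn_equiv M (Rep_cop p) Q0" "proj_le Q0 (Rep_cop q)"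
    using le unfolding mvn_le_def by blast
  obtain r where "Q0 = Rep_cop r" "pm r" using projections_cases[OF Q0(1)] by blast
  then have "meq p r" "ple r q" using Q0 p q by (simp_all add: mvn_equiv_iff proj_le_iff pmD(2))
  then show ?thesis by (auto simp: mle_def meq_def)
qed

lemma abelian_projection_iff: "abelian_projection M (Rep_cop p) \<longleftrightarrow> abn p"
proof -
  have "abelian ((\<lambda>T. Rep_cop p o\<^sub>L T o\<^sub>L Rep_cop p) ` (Rep_cop ` cops M)) \<longleftrightarrow>
    (\<forall>x\<in>cops M. \<forall>y\<in>cops M. (p * x * p) * (p * y * p) = (p * y * p) * (p * x * p))"
    unfolding abelian_def ball_simps by (simp only: times_cop.rep_eq[symmetric] Rep_cop_inject)
  then show ?thesis by (simp add: abelian_projection_def abn_def pm_iff Rep_image_cops[OF M_bounded])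
qed

lemma Rep_eq_0 [simp]: "Rep_cop p = 0 \<longleftrightarrow> p = 0"
  by (metis Rep_cop_inject zero_cop.rep_eq)

lemma tracial_state_iff: "tracial_state M \<tau> \<longleftrightarrow> \<tau> \<in> extensional M \<and> tracial (\<lambda>x. \<tau> (Rep_cop x))"
proof -
  have *: "(\<forall>T\<in>M. Q T) \<longleftrightarrow> (\<forall>x\<in>cops M. Q (Rep_cop x))" for Q
    using Rep_cases[OF M_bounded] by (metis cops_iff)
  show ?thesis unfolding tracial_state_def linear_functional_def tracial_def * by (auto simp: Rep_simps)
qed

text \<open>\<open>trace_of\<close> is a definite description, so it denotes a trace only once
  uniqueness is known; the infinite orthogonal sequence is what \<open>tracial_unique\<close> asks
  for.\<close>

lemma trace_of_tracial:
  fixes e :: "nat \<Rightarrow> 'h cop"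
  assumes f1: "fin 1" and ne: "(1 :: 'h cop) \<noteq> 0"
    and e: "\<And>n. pm (e n)" "\<And>n. e n \<noteq> 0" "\<And>m n. m \<noteq> n \<Longrightarrow> e m * e n = 0"
  shows "tracial (\<lambda>x. trace_of M (Rep_cop x))"
proof -
  obtain \<tau> where t: "tracial \<tau>" using tracial_exists[OF f1 ne] by blast
  \<comment> \<open>Tracial states are extensional, so the trace found on \<open>cop\<close> is cut
    off outside \<open>M\<close>.\<close>
  define \<sigma> where "\<sigma> = restrict (\<lambda>T. \<tau> (Abs_cop T)) M"
  have eq: "\<sigma> (Rep_cop x) = \<tau> x" if "x \<in> cops M" for x
    using that by (simp add: \<sigma>_def cops_iff Rep_cop_inverse)
  then have "tracial (\<lambda>x. \<sigma> (Rep_cop x))"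
    unfolding tracial_def
  proof (intro conjI ballI allI)
    fix c x y assume x: "x \<in> cops M"
    show "\<sigma> (Rep_cop (sc c * x)) = c * \<sigma> (Rep_cop x)"
      unfolding eq[OF M_closed(4)[OF x]] eq[OF x] by (rule tracialD(2)[OF t x])
    show "\<sigma> (Rep_cop (star x * x)) \<in> \<real>\<^sub>\<ge>\<^sub>0"
      unfolding eq[OF M_closed(3)[OF M_closed(5)[OF x] x]] using t x by (simp add: tracial_def)
    assume y: "y \<in> cops M"
    show "\<sigma> (Rep_cop (x + y)) = \<sigma> (Rep_cop x) + \<sigma> (Rep_cop y)"
      unfolding eq[OF M_closed(2)[OF x y]] eq[OF x] eq[OF y] by (rule tracialD(1)[OF t x y])
    show "\<sigma> (Rep_cop (x * y)) = \<sigma> (Rep_cop (y * x))"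
      unfolding eq[OF M_closed(3)[OF x y]] eq[OF M_closed(3)[OF y x]] by (rule tracialD(5)[OF t x y])
  next
    show "\<sigma> (Rep_cop 1) = 1" unfolding eq[OF M_closed(1)] by (rule tracialD(4)[OF t])
  qed
  moreover have "\<sigma> \<in> extensional M" by (simp add: \<sigma>_def)
  ultimately have s: "tracial_state M \<sigma>" by (simp add: tracial_state_iff)
  have "trace_of M = \<sigma>" unfolding trace_of_def
  proof (rule the_equality)
    show "tracial_state M \<sigma>" by (rule s)
    fix \<rho> assume r: "tracial_state M \<rho>"
    show "\<rho> = \<sigma>"
    proof (rule extensionalityI[of _ M])
      show "\<rho> \<in> extensional M" "\<sigma> \<in> extensional M" using r s by (simp_all add: tracial_state_iff)
      fix T assume "T \<in> M"
      then obtain x where x: "T = Rep_cop x" "x \<in> cops M" using Rep_cases[OF M_bounded] by blast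
      show "\<rho> T = \<sigma> T" unfolding x(1)
        by (rule tracial_unique[OF f1 _ _ x(2) e]) (use r s in \<open>simp_all add: tracial_state_iff\<close>)
    qed
  qed
  then show ?thesis using s by (simp add: tracial_state_iff)
qed

end

locale operator_masa = factor_with_masa "cops M" "cops A" + operator_factor M
  for M A :: "('h::complex_hilbert \<Rightarrow>\<^sub>L 'h) set" +
  assumes A_le: "A \<subseteq> M"
begin

lemma type_I_fin_conjugate:
  assumes I: "type_I_fin M n" and P: "pa P" "P \<noteq> 0" "mle P (1 - P)"
  shows "conjugate_generates P"
proof -
  obtain f where n: "n \<ge> 1" and f: "\<forall>i<n. abelian_projection M (f i) \<and> f i \<noteq> 0"
    "\<forall>i<n. \<forall>j<n. i \<noteq> j \<longrightarrow> f i o\<^sub>L f j = 0" "(\<Sum>i<n. f i) = id_blinfun"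
    using I unfolding type_I_fin_def by blast
  define e where "e = (\<lambda>i. Abs_cop (f i))"
  have Re: "Rep_cop (e i) = f i" if "i < n" for i
  proof -
    have "f i \<in> M" using f(1) that by (simp add: abelian_projection_def projections_def)
    then show ?thesis unfolding e_def using M_bounded by (intro Abs_cop_inverse) auto
  qed
  show ?thesis
  proof (rule construct_I[of n e, OF _ n _ _ _ P])
    show "abn (e i)" "e i \<noteq> 0" if "i < n" for i
      using f(1) that abelian_projection_iff[of "e i"] Rep_eq_0[of "e i"] by (simp_all add: Re)
    show "e i * e j = 0" if "i < n" "j < n" "i \<noteq> j" for i j
      using f(2) that by (simp add: Re times_cop.rep_eq flip: Rep_eq_0)
    have "Rep_cop (\<Sum>i<n. e i) = Rep_cop 1" using f(3) by (simp add: Rep_sum Re one_cop.rep_eq)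
    then show "(\<Sum>i<n. e i) = 1" by (simp add: Rep_cop_inject)
  qed
qed

lemma type_II_1_conjugate:
  assumes II: "type_II_1 M" "shen_G M = 0" and P: "pa P" "P \<noteq> 0" "mle P (1 - P)"
  shows "conjugate_generates P"
proof -
  have ne: "(1 :: 'h cop) \<noteq> 0" using P(2) by (metis mult_1 mult_zero_left)
  have f1: "fin 1" using II(1) finite_projection_iff[of 1] by (simp add: type_II_1_def one_cop.rep_eq)
  have no: "p = 0" if "abn p" for p
    using II(1) that abelian_projection_iff[of p] Rep_eq_0[of p] by (auto simp: type_II_1_def type_II_def)
  \<comment> \<open>An atom of the masa has a scalar corner and would be a nonzero abelian
    projection, which type II excludes; the masa is therefore diffuse.\<close>
  have "False" if a: "atom e" for e
  proof -
    have pe: "pm e" "e \<noteq> 0" using a pa_pm by (simp_all add: atom_def)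
    have "(e * x * e) * (e * y * e) = (e * y * e) * (e * x * e)" if xy: "x \<in> cops M" "y \<in> cops M" for x y
    proof -
      obtain c d where cd: "e * x * e = sc c * e" "e * y * e = sc d * e" using atom_scalar[OF a] xy by metis
      have "sc a * e * (sc b * e) = sc (a * b) * (e * e)" for a b by (rule cop_eqI) (simp add: scaleC_scaleC mult.commute)
      then show ?thesis unfolding cd by (simp add: mult.commute[of c d])
    qed
    then have "abn e" using pe by (simp add: abn_def)
    then show False using no pe by blast
  qed
  then obtain e :: "nat \<Rightarrow> 'h cop" where e: "\<And>n. pa (e n)" "\<And>n. e n \<noteq> 0" "\<And>m n. m \<noteq> n \<Longrightarrow> e m * e n = 0"
    using diffuse_orth_seq[OF pa_1 ne] by metis
  have t: "tracial (\<lambda>x. trace_of M (Rep_cop x))"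
    by (rule trace_of_tracial[OF f1 ne pa_pm[OF e(1)] e(2,3)])
  show ?thesis
  proof (rule construct_II_1[OF f1 t _ P])
    fix \<epsilon> :: real assume \<epsilon>: "\<epsilon> > 0"
    then have "shen_G M < ereal \<epsilon>" using II(2) by (simp add: zero_ereal_def)
    then obtain X k f where X: "shen_I X k f < \<epsilon>" "k \<ge> 1" "equal_trace_partition M k f" "finite X" "X \<subseteq> M" "W_star M X = M"
      unfolding shen_G_def Inf_less_iff by auto
    have XX: "Rep_cop ` cops X = X" using X(5) M_bounded by (intro Rep_image_cops) simp
    have fX: "finite (cops X)" using X(4) XX by (metis Rep_cop_inject finite_imageD inj_onI)
    define p where "p = (\<lambda>i. Abs_cop (f i))"
    have f: "\<forall>i<k. f i \<in> projections M \<and> trace_of M (f i) = 1 / of_nat k"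
      "\<forall>i<k. \<forall>j<k. i \<noteq> j \<longrightarrow> f i o\<^sub>L f j = 0" "(\<Sum>i<k. f i) = id_blinfun"
      using X(3) by (simp_all add: equal_trace_partition_def)
    have Rp: "Rep_cop (p i) = f i" if "i < k" for i
    proof -
      have "f i \<in> M" using f(1) that by (simp add: projections_def)
      then show ?thesis unfolding p_def using M_bounded by (intro Abs_cop_inverse) auto
    qed
    show "\<exists>X (k::nat) p. k \<ge> 1 \<and> (\<forall>i<k. pm (p i) \<and> trace_of M (Rep_cop (p i)) = 1 / of_nat k) \<and>
      (\<forall>i<k. \<forall>j<k. i \<noteq> j \<longrightarrow> p i * p j = 0) \<and> (\<Sum>i<k. p i) = 1 \<and> finite X \<and> X \<subseteq> cops M \<and>
      (\<forall>N. vna N \<longrightarrow> N \<subseteq> cops M \<longrightarrow> X \<subseteq> N \<longrightarrow> N = cops M) \<and>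
      (\<Sum>x\<in>X. real (card {(i, j). i < k \<and> j < k \<and> p i * x * p j \<noteq> 0})) \<le> \<epsilon> * (real k)\<^sup>2"
    proof (intro exI conjI)
      show "1 \<le> k" by (rule X(2))
      show "\<forall>i<k. pm (p i) \<and> trace_of M (Rep_cop (p i)) = 1 / of_nat k"
        using f(1) Rp pm_iff by metis
      show "\<forall>i<k. \<forall>j<k. i \<noteq> j \<longrightarrow> p i * p j = 0"
        using f(2) by (simp add: Rp times_cop.rep_eq flip: Rep_eq_0)
      have "Rep_cop (\<Sum>i<k. p i) = Rep_cop 1" using f(3) by (simp add: Rep_sum Rp one_cop.rep_eq)
      then show "(\<Sum>i<k. p i) = 1" by (simp add: Rep_cop_inject)
      show "finite (cops X)" by (rule fX)
      show "cops X \<subseteq> cops M" using X(5) by (auto simp: cops_iff)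
      show "\<forall>N. vna N \<longrightarrow> N \<subseteq> cops M \<longrightarrow> cops X \<subseteq> N \<longrightarrow> N = cops M"
      proof (intro allI impI)
        fix N assume N: "vna N" "N \<subseteq> cops M" "cops X \<subseteq> N"
        have "X \<subseteq> Rep_cop ` N" using N(3) XX by blast
        then show "N = cops M" by (rule W_star_minimal[OF X(6) N(1,2) _ M_bounded])
      qed
      have "inj_on Rep_cop (cops X)" by (simp add: inj_on_def Rep_cop_inject)
      then have "shen_I (Rep_cop ` cops X) k f =
        (\<Sum>x\<in>cops X. real (card {(i, j). i < k \<and> j < k \<and> f i o\<^sub>L Rep_cop x o\<^sub>L f j \<noteq> 0}) / (real k)\<^sup>2)"
        unfolding shen_I_def by (rule sum.reindex[THEN trans]) simp
      also have "\<dots> = (\<Sum>x\<in>cops X. real (card {(i, j). i < k \<and> j < k \<and> p i * x * p j \<noteq> 0})) / (real k)\<^sup>2"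
      proof -
        have "{(i, j). i < k \<and> j < k \<and> f i o\<^sub>L Rep_cop x o\<^sub>L f j \<noteq> 0} =
          {(i, j). i < k \<and> j < k \<and> p i * x * p j \<noteq> 0}" for x
          by (auto simp: Rp[symmetric] simp flip: times_cop.rep_eq)
        then show ?thesis by (simp add: sum_divide_distrib)
      qed
      finally have "(\<Sum>x\<in>cops X. real (card {(i, j). i < k \<and> j < k \<and> p i * x * p j \<noteq> 0})) / (real k)\<^sup>2 < \<epsilon>"
        using X(1) XX by simp
      then show "(\<Sum>x\<in>cops X. real (card {(i, j). i < k \<and> j < k \<and> p i * x * p j \<noteq> 0})) \<le> \<epsilon> * (real k)\<^sup>2"
        using X(2) by (simp add: divide_less_eq)
    qed
  qed
qed

text \<open>If no nonzero finite projection of the masa lay below \<open>E\<close>, every finite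
  \<open>Q\<close> in \<open>A\<close> would be orthogonal to \<open>E\<close>, because their
  product is a subprojection of \<open>Q\<close>. Then \<open>1 - E\<close> would bound all of them,
  and the join would not be 1.\<close>

lemma semifinite_conjugate:
  assumes inf: "type_I_inf M \<or> type_II_inf M"
    and join: "is_proj_join M {Q\<in>A. finite_projection M Q} id_blinfun"
    and P: "pa P" "P \<noteq> 0" "mle P (1 - P)"
  shows "conjugate_generates P"
proof -
  have f1: "\<not> fin 1" using inf finite_projection_iff[of 1] by (auto simp: type_I_inf_def type_II_inf_def one_cop.rep_eq)
  have "\<exists>g. fin g \<and> g \<noteq> 0"
  proof -
    have "\<exists>P. (abelian_projection M P \<or> finite_projection M P) \<and> P \<noteq> 0"
      using inf by (auto simp: type_I_inf_def type_II_inf_def type_II_def)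
    then obtain Q where Q: "abelian_projection M Q \<or> finite_projection M Q" "Q \<noteq> 0" by blast
    then have "Q \<in> projections M" by (auto simp: abelian_projection_def finite_projection_def)
    then obtain g where "Q = Rep_cop g" using projections_cases by blast
    then show ?thesis using Q abn_fin by (auto simp: abelian_projection_iff finite_projection_iff)
  qed
  then obtain g where g: "fin g" "g \<noteq> 0" by blast
  have small_pieces
  proof (rule small_pieces_semifinite, rule ccontr)
    fix E assume E: "pa E" "E \<noteq> 0" and none: "\<nexists>E0. pa E0 \<and> E0 \<noteq> 0 \<and> ple E0 E \<and> fin E0"
    have pE: "pa (1 - E)" using pa_diff[OF E(1) pa_1] by simp
    have "proj_le Q (Rep_cop (1 - E))" if Q: "Q \<in> A" "finite_projection M Q" for Q
    proof -
      obtain q where q: "Q = Rep_cop q" "pm q" using projections_cases Q(2) unfolding finite_projection_def by blast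
      have fq: "fin q" using Q(2) q(1) finite_projection_iff by simp
      have pq: "pa q" using Q(1) q by (simp add: pa_def cops_iff pmD(2))
      have c: "E * q = q * E" by (rule A_comm[OF paD(1)[OF E(1)] paD(1)[OF pq]])
      have pqE: "pa (q * E)" by (rule pa_mult[OF pq E(1)])
      have "ple (q * E) q" by (simp add: ple_def mult.assoc[symmetric] paD(4)[OF pq])
      then have "fin (q * E)" by (rule fin_sub[OF fq pa_pm[OF pqE]])
      moreover have "ple (q * E) E" unfolding c[symmetric] by (simp add: ple_def mult.assoc[symmetric] paD(4)[OF E(1)])
      ultimately have "q * E = 0" using none pqE by blast
      then have "ple q (1 - E)" by (simp add: ple_def left_diff_distrib c)
      then show ?thesis using q(1) proj_le_iff[OF paD(2)[OF pE]] by simp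
    qed
    then have "proj_le (Rep_cop 1) (Rep_cop (1 - E))"
      using join pm_iff[of "1 - E"] pa_pm[OF pE] unfolding is_proj_join_def by (simp add: one_cop.rep_eq)
    then have "ple 1 (1 - E)" using proj_le_iff[OF paD(2)[OF pE]] by simp
    then show False using E(2) by (simp add: ple_def)
  qed
  then show ?thesis by (rule construct_semifinite[OF _ g f1 P])
qed

end

theorem theorem1p1:
  fixes M A :: "('h::complex_hilbert \<Rightarrow>\<^sub>L 'h) set" and P :: "'h \<Rightarrow>\<^sub>L 'h"
  assumes "factor M" and "separable_predual M"
    and "masa M A"
    and "(\<exists>n. type_I_fin M n) \<or> type_III M
       \<or> type_II_1 M \<and> shen_G M = 0
       \<or> (type_I_inf M \<or> type_II_inf M) \<and>
           is_proj_join M {Q\<in>A. finite_projection M Q} id_blinfun"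
    and "P \<in> projections A" and "P \<noteq> 0"
    and "mvn_le M P (id_blinfun - P)"
  shows "\<exists>U\<in>M. unitary U \<and>
           M = W_star M ({adj U o\<^sub>L P o\<^sub>L U} \<union> {T o\<^sub>L (id_blinfun - P) | T. T \<in> A})"
proof -
  have M: "von_neumann_algebra M" using assms(1) by (simp add: factor_def)
  have AM: "A \<subseteq> M" using assms(3) by (simp add: masa_def)
  interpret factor_with_masa "cops M" "cops A" by (rule factor_with_masa_cops[OF assms(1-3)])
  interpret operator_masa M A
    by unfold_locales (rule von_neumann_algebra_vna(2)[OF M], rule AM)
  have PA: "P \<in> A" and PM: "P \<in> projections M" using assms(5) AM by (auto simp: projections_def)
  obtain p where Pp: "P = Rep_cop p" and pm: "pm p" using projections_cases[OF PM] by blast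
  have p: "pa p" "p \<noteq> 0" using PA Pp pmD(2)[OF pm] assms(6) by (auto simp: pa_def cops_iff)
  have P1: "id_blinfun - P = Rep_cop (1 - p)" by (simp add: Pp Rep_simps)
  have "pm (1 - p)" using pm_diff[OF pm pm_1] by simp
  then have le: "mle p (1 - p)" using mvn_le_mle[OF pm] assms(7) P1 Pp by simp
  have "conjugate_generates p"
    using assms(4)
  proof (elim disjE exE conjE)
    show "conjugate_generates p" if "type_III M"
    proof (rule construct_III[OF _ p le])
      show "q = 0" if "fin q" for q
        using \<open>type_III M\<close> that finite_projection_iff[of q] by (auto simp: type_III_def)
    qed
  qed (use type_I_fin_conjugate type_II_1_conjugate semifinite_conjugate p le in blast)+
  then obtain U where U: "U \<in> cops M" "star U * U = 1" "U * star U = 1"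
    "\<And>N. vna N \<Longrightarrow> star U * p * U \<in> N \<Longrightarrow> \<forall>a\<in>cops A. a * (1 - p) \<in> N \<Longrightarrow> cops M \<subseteq> N"
    unfolding conjugate_generates_def by blast
  let ?S = "{adj (Rep_cop U) o\<^sub>L P o\<^sub>L Rep_cop U} \<union> {T o\<^sub>L (id_blinfun - P) | T. T \<in> A}"
  have bA: "A \<subseteq> bounded_operators" using AM M_bounded by simp
  have S1: "adj (Rep_cop U) o\<^sub>L P o\<^sub>L Rep_cop U = Rep_cop (star U * p * U)" by (simp add: Pp Rep_simps)
  have S2: "Rep_cop a o\<^sub>L (id_blinfun - P) = Rep_cop (a * (1 - p))" for a by (simp add: P1 Rep_simps)
  have "M = W_star M ?S"
  proof (rule W_star_eqI[OF M])
    show "?S \<subseteq> M"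
    proof
      fix T assume "T \<in> ?S"
      then consider "T = Rep_cop (star U * p * U)" | a where "a \<in> cops A" "T = Rep_cop (a * (1 - p))"
        using S1 S2 Rep_cases[OF bA] by (smt (verit) Un_iff mem_Collect_eq singletonD)
      then show "T \<in> M"
        using U(1) pmD(1)[OF pm] A_sub M_closed by cases (auto simp flip: cops_iff)
    qed
    fix N assume N: "vna N" "\<And>x. Rep_cop x \<in> ?S \<Longrightarrow> x \<in> N"
    show "cops M \<subseteq> N"
    proof (rule U(4)[OF N(1)])
      show "star U * p * U \<in> N" by (rule N(2)) (simp add: S1)
      show "\<forall>a\<in>cops A. a * (1 - p) \<in> N"
      proof
        fix a assume "a \<in> cops A"
        then have "Rep_cop a \<in> A" by (simp add: cops_iff)
        then show "a * (1 - p) \<in> N" by (intro N(2)) (auto simp: S2[symmetric])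
      qed
    qed
  qed
  moreover have "unitary (Rep_cop U)" unfolding unitary_def
    using arg_cong[OF U(2), of Rep_cop] arg_cong[OF U(3), of Rep_cop] by (simp add: Rep_simps)
  moreover have "Rep_cop U \<in> M" using U(1) by (simp add: cops_iff)
  ultimately show ?thesis by blast
qed

end
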